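(* There is a sequence of CS-4 surfaces which, suitably scaled, converges to the Costa surface.
   Context: Minimal pentagons of type CS. A minimal pentagon is a minimal surface patch in $\mathbb{R}^3$ conformally parametrized by the upper half plane, extending continuously to the boundary $\mathbb{R}\cup\{\infty\}$, with five marked boundary points whose images are called vertices; the images of the five boundary arcs between consecutive vertices are called edges. It is of type CS if it is contained in a box $[0,1]\times[0,1]\times[0,h]$ (for some $h>0$) such that: two edges are diagonals of the top and of the bottom face of the box, respectively, and these are orthogonal; the remaining three edges lie in the vertical faces of the box; all vertices lie on box edges or are box vertices; and along each edge lying in a vertical face, the normal vector of the surface lies in the plane of that face. CS-4 surfaces. For $a<0<b<1$ and $\rho>0$ consider on the upper half plane the Weierstrass map $$f(z)=\operatorname{Re}\int^z\left(\tfrac12\left(\tfrac1G-G\right)dh,\ \tfrac i2\left(\tfrac1G+G\right)dh,\ dh\right)$$ (defined up to translation), with $$G\,dh=\rho(z-a)^{1/2}z^{-3/4}(z-b)^{-3/4}(1-z)^{-3/4}dz,\qquad \tfrac1G\,dh=\tfrac1\rho(z-a)^{-1/2}z^{-1/4}(z-b)^{-1/4}(1-z)^{-1/4}dz,$$ $dh=z^{-1/2}(z-b)^{-1/2}(1-z)^{-1/2}dz$, the forms being positive on $(b,1)$ and extended analytically. When $f$ parametrizes, up to translation and scaling, a minimal pentagon of type CS, the triply periodic minimal surface of genus 4 obtained from this pentagon by repeated $180^\circ$ rotations about its horizontal straight edges and reflections at the vertical planes containing its other edges is called a CS-4 surface. The Costa surface is Costa's complete embedded minimal surface of finite total curvature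 in $\mathbb{R}^3$ of genus 1 with three ends. Convergence: after suitable scalings and translations of $\mathbb{R}^3$, the Weierstrass maps $f_i$ of the sequence converge, locally uniformly on the upper half plane, to a conformal parametrization of a minimal piece whose extension by reflections and rotations across its boundary curves is the Costa surface. *)

theory Defs
  imports "HOL-Complex_Analysis.Complex_Analysis" "HOL-Analysis.Cross3" "HOL-Library.Extended_Real"
begin

unbundle cross3_syntax

section \<open>Conformally parametrized minimal surfaces\<close>

definition upper_half_plane :: "complex set" where
  "upper_half_plane = {z. 0 < Im z}"

definition closed_half_plane :: "complex set" where
  "closed_half_plane = {z. 0 \<le> Im z}"

definition partial_u :: "(complex \<Rightarrow> real^3) \<Rightarrow> complex \<Rightarrow> real^3" where
  "partial_u X z = frechet_derivative X (at z) 1"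

definition partial_v :: "(complex \<Rightarrow> real^3) \<Rightarrow> complex \<Rightarrow> real^3" where
  "partial_v X z = frechet_derivative X (at z) \<i>"

definition C2_on :: "(complex \<Rightarrow> real^3) \<Rightarrow> complex set \<Rightarrow> bool" where
  "C2_on X U \<longleftrightarrow>
     (\<forall>z\<in>U. X differentiable at z \<and> partial_u X differentiable at z \<and> partial_v X differentiable at z) \<and>
     continuous_on U (partial_u (partial_u X)) \<and> continuous_on U (partial_v (partial_u X)) \<and>
     continuous_on U (partial_u (partial_v X)) \<and> continuous_on U (partial_v (partial_v X))"

definition unit_normal :: "(complex \<Rightarrow> real^3) \<Rightarrow> complex \<Rightarrow> real^3" where
  "unit_normal X z = sgn (partial_u X z \<times> partial_v X z)"

text \<open>Mean curvature in terms of the coefficients of the first and second fundamental form.\<close>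

definition mean_curvature :: "(complex \<Rightarrow> real^3) \<Rightarrow> complex \<Rightarrow> real" where
  "mean_curvature X z =
    (let E = partial_u X z \<bullet> partial_u X z;
         F = partial_u X z \<bullet> partial_v X z;
         G = partial_v X z \<bullet> partial_v X z;
         e = partial_u (partial_u X) z \<bullet> unit_normal X z;
         f = partial_v (partial_u X) z \<bullet> unit_normal X z;
         g = partial_v (partial_v X) z \<bullet> unit_normal X z
     in (e * G - 2 * f * F + g * E) / (2 * (E * G - F\<^sup>2)))"

definition conformal_minimal_immersion :: "(complex \<Rightarrow> real^3) \<Rightarrow> complex set \<Rightarrow> bool" where
  "conformal_minimal_immersion X U \<longleftrightarrow>
     C2_on X U \<and>
     (\<forall>z\<in>U. partial_u X z \<noteq> 0 \<and> norm (partial_u X z) = norm (partial_v X z) \<and>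
            partial_u X z \<bullet> partial_v X z = 0 \<and> mean_curvature X z = 0)"


section \<open>Minimal pentagons\<close>

text \<open>The half plane together with its boundary circle (real line and infinity) is modelled
  inside \<^typ>\<open>complex option\<close>, with \<^term>\<open>None\<close> the point at infinity. Points of the boundary circle
  are labelled by extended reals; both infinite labels denote the point at infinity.\<close>

definition boundary_point :: "ereal \<Rightarrow> complex option" where
  "boundary_point \<xi> = (if \<bar>\<xi>\<bar> = \<infinity> then None else Some (of_real (real_of_ereal \<xi>)))"

definition approach :: "complex option \<Rightarrow> complex set \<Rightarrow> complex filter" where
  "approach \<zeta> S = (case \<zeta> of None \<Rightarrow> inf at_infinity (principal S) | Some z \<Rightarrow> at z within S)"

definition compact_half_plane :: "complex option set" where
  "compact_half_plane = insert None (Some ` closed_half_plane)"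

text \<open>The boundary arc from the \<open>k\<close>-th marked point to the next one; the last arc passes through
  infinity, possibly only as its initial point.\<close>

definition boundary_arc :: "(nat \<Rightarrow> ereal) \<Rightarrow> nat \<Rightarrow> complex option set" where
  "boundary_arc p k = boundary_point ` (if k < 4 then {p k .. p (Suc k)} else {p 4 ..} \<union> {.. p 0})"

definition open_boundary_arc :: "(nat \<Rightarrow> ereal) \<Rightarrow> nat \<Rightarrow> complex option set" where
  "open_boundary_arc p k = boundary_arc p k - (boundary_point \<circ> p) ` {..<5}"

definition vertex :: "(complex option \<Rightarrow> real^3) \<Rightarrow> (nat \<Rightarrow> ereal) \<Rightarrow> nat \<Rightarrow> real^3" where
  "vertex F p k = F (boundary_point (p k))"

definition edge :: "(complex option \<Rightarrow> real^3) \<Rightarrow> (nat \<Rightarrow> ereal) \<Rightarrow> nat \<Rightarrow> (real^3) set" where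
  "edge F p k = F ` boundary_arc p k"

text \<open>Five distinct points of the boundary circle can always be listed in their cyclic order such
  that only the last one may be infinity.\<close>

definition minimal_pentagon :: "(complex option \<Rightarrow> real^3) \<Rightarrow> (nat \<Rightarrow> ereal) \<Rightarrow> bool" where
  "minimal_pentagon F p \<longleftrightarrow>
     conformal_minimal_immersion (F \<circ> Some) upper_half_plane \<and>
     continuous_on closed_half_plane (F \<circ> Some) \<and>
     ((F \<circ> Some) \<longlongrightarrow> F None) (approach None closed_half_plane) \<and>
     -\<infinity> < p 0 \<and> (\<forall>k<4. p k < p (Suc k))"


section \<open>Pentagons of type CS\<close>

definition box_of_height :: "real \<Rightarrow> (real^3) set" where
  "box_of_height h = cbox (vector [0, 0, 0]) (vector [1, 1, h])"

definition box_edges :: "real \<Rightarrow> (real^3) set" where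
  "box_edges h = {x \<in> box_of_height h.
     (x$1 \<in> {0, 1} \<and> x$2 \<in> {0, 1}) \<or>
     (x$1 \<in> {0, 1} \<and> x$3 \<in> {0, h}) \<or>
     (x$2 \<in> {0, 1} \<and> x$3 \<in> {0, h})}"

definition vertical_face :: "real \<Rightarrow> 3 \<Rightarrow> real \<Rightarrow> (real^3) set" where
  "vertical_face h j c = {x \<in> box_of_height h. x$j = c}"

text \<open>\<open>P\<close> and \<open>Q\<close> are the end points of a diagonal of the horizontal unit square at height \<open>t\<close>.\<close>

definition square_diagonal :: "real \<Rightarrow> real^3 \<Rightarrow> real^3 \<Rightarrow> bool" where
  "square_diagonal t P Q \<longleftrightarrow>
     (P = vector [0, 0, t] \<and> Q = vector [1, 1, t]) \<or> (P = vector [1, 0, t] \<and> Q = vector [0, 1, t])"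

definition normal_along :: "(complex option \<Rightarrow> real^3) \<Rightarrow> complex option \<Rightarrow> real^3 \<Rightarrow> bool" where
  "normal_along F \<zeta> n \<longleftrightarrow> (unit_normal (F \<circ> Some) \<longlongrightarrow> n) (approach \<zeta> upper_half_plane)"

definition type_CS :: "(complex option \<Rightarrow> real^3) \<Rightarrow> (nat \<Rightarrow> ereal) \<Rightarrow> bool" where
  "type_CS F p \<longleftrightarrow> minimal_pentagon F p \<and>
     (\<exists>h>0.
        F ` compact_half_plane \<subseteq> box_of_height h \<and>
        (\<exists>k<5. \<exists>l<5. \<exists>P Q P' Q'.
           k \<noteq> l \<and>
           square_diagonal h P Q \<and> edge F p k = closed_segment P Q \<and>
           square_diagonal 0 P' Q' \<and> edge F p l = closed_segment P' Q' \<and>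
           orthogonal (Q - P) (Q' - P') \<and>
           (\<forall>m<5. m \<noteq> k \<and> m \<noteq> l \<longrightarrow>
              (\<exists>j\<in>{1, 2}. \<exists>c\<in>{0, 1}. edge F p m \<subseteq> vertical_face h j c))) \<and>
        (\<forall>k<5. vertex F p k \<in> box_edges h) \<and>
        (\<forall>k<5. \<forall>j\<in>{1, 2}. \<forall>c\<in>{0, 1}. edge F p k \<subseteq> vertical_face h j c \<longrightarrow>
           (\<forall>\<zeta>\<in>open_boundary_arc p k. \<exists>n. normal_along F \<zeta> n \<and> n $ j = 0)))"


section \<open>Extension by rotations and reflections\<close>

text \<open>Rotation by \<open>180\<close> degrees about the line through \<open>q\<close> in direction \<open>d\<close>, and reflection at the
  plane through \<open>q\<close> with normal vector \<open>n\<close>.\<close>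

definition half_turn :: "real^3 \<Rightarrow> real^3 \<Rightarrow> real^3 \<Rightarrow> real^3" where
  "half_turn q d x = 2 *\<^sub>R (q + ((x - q) \<bullet> d / (d \<bullet> d)) *\<^sub>R d) - x"

definition plane_reflection :: "real^3 \<Rightarrow> real^3 \<Rightarrow> real^3 \<Rightarrow> real^3" where
  "plane_reflection q n x = x - (2 * ((x - q) \<bullet> n) / (n \<bullet> n)) *\<^sub>R n"

text \<open>For a set of involutions this is the generated group.\<close>

inductive_set generated_maps :: "('a \<Rightarrow> 'a) set \<Rightarrow> ('a \<Rightarrow> 'a) set" for A where
  id: "id \<in> generated_maps A"
| comp: "\<sigma> \<in> A \<Longrightarrow> \<tau> \<in> generated_maps A \<Longrightarrow> \<sigma> \<circ> \<tau> \<in> generated_maps A"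

definition extension_by :: "('a \<Rightarrow> 'a) set \<Rightarrow> 'a set \<Rightarrow> 'a set" where
  "extension_by A M = (\<Union>\<tau>\<in>generated_maps A. \<tau> ` M)"


section \<open>CS-4 surfaces\<close>

text \<open>The Weierstrass integrand, in terms of the forms \<open>G dh\<close>, \<open>(1/G) dh\<close> and \<open>dh\<close>.\<close>

definition weierstrass_form :: "complex \<Rightarrow> complex \<Rightarrow> complex \<Rightarrow> complex^3" where
  "weierstrass_form Gdh Gdh' dh = vector [(Gdh' - Gdh) / 2, (\<i> / 2) * (Gdh' + Gdh), dh]"

text \<open>The principal branches of all powers involved are analytic on the upper half plane, and
  positive on the interval from \<open>b\<close> to \<open>1\<close>.\<close>

definition CS4_form :: "real \<Rightarrow> real \<Rightarrow> real \<Rightarrow> complex \<Rightarrow> complex^3" where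
  "CS4_form a b \<rho> z = weierstrass_form
     (of_real \<rho> * (z - of_real a) powr (1/2) * z powr (-3/4) * (z - of_real b) powr (-3/4) * (1 - z) powr (-3/4))
     (1 / of_real \<rho> * (z - of_real a) powr (-1/2) * z powr (-1/4) * (z - of_real b) powr (-1/4) * (1 - z) powr (-1/4))
     (z powr (-1/2) * (z - of_real b) powr (-1/2) * (1 - z) powr (-1/2))"

text \<open>The base point \<open>\<i>\<close> of the integration fixes the translation.\<close>

definition CS4_map :: "real \<Rightarrow> real \<Rightarrow> real \<Rightarrow> complex \<Rightarrow> real^3" where
  "CS4_map a b \<rho> z = (\<chi> k. Re (contour_integral (linepath \<i> z) (\<lambda>\<zeta>. CS4_form a b \<rho> \<zeta> $ k)))"

definition CS4_marked_points :: "real \<Rightarrow> real \<Rightarrow> nat \<Rightarrow> ereal" where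
  "CS4_marked_points a b k = [ereal a, 0, ereal b, 1, \<infinity>] ! k"

text \<open>The rotations about the horizontal straight edges of a pentagon of type CS, and the
  reflections at the vertical planes (through faces of the box) that contain its other edges.\<close>

definition CS_symmetries ::
    "(complex option \<Rightarrow> real^3) \<Rightarrow> (nat \<Rightarrow> ereal) \<Rightarrow> (real^3 \<Rightarrow> real^3) set" where
  "CS_symmetries F p =
     {half_turn q d | q d. d \<noteq> 0 \<and> d $ 3 = 0 \<and> (\<exists>k<5. edge F p k = closed_segment q (q + d))} \<union>
     {plane_reflection q (axis j 1) | q j. j \<in> {1, 2} \<and> q $ j \<in> {0, 1} \<and>
        (\<exists>k<5. edge F p k \<subseteq> {x. x $ j = q $ j})}"

definition CS4_surface :: "real \<Rightarrow> real \<Rightarrow> real \<Rightarrow> (real^3) set \<Rightarrow> bool" where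
  "CS4_surface a b \<rho> S \<longleftrightarrow>
     a < 0 \<and> 0 < b \<and> b < 1 \<and> 0 < \<rho> \<and>
     (\<exists>F r t. 0 < r \<and>
        (\<forall>z\<in>upper_half_plane. F (Some z) = r *\<^sub>R CS4_map a b \<rho> z + t) \<and>
        type_CS F (CS4_marked_points a b) \<and>
        S = extension_by (CS_symmetries F (CS4_marked_points a b)) (F ` compact_half_plane))"


section \<open>The Costa surface\<close>

text \<open>The square torus minus three points: the affine curve \<open>w\<^sup>2 = u (1 - u\<^sup>2)\<close> without its two
  branch points over \<open>u = 1\<close> and \<open>u = -1\<close>. The third puncture is the point at infinity.\<close>

definition costa_curve :: "(complex \<times> complex) set" where
  "costa_curve = {(u, w). w\<^sup>2 = u * (1 - u\<^sup>2)} - {(1, 0), (-1, 0)}"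

text \<open>The classical Weierstrass data \<open>G = c/w\<close>, \<open>dh = du/(u\<^sup>2 - 1)\<close>. In terms of the Weierstrass
  function \<open>\<wp>\<close> of the square lattice, \<open>u\<close> and \<open>w\<close> are constant multiples of \<open>\<wp>\<close> and \<open>\<wp>'\<close>. The
  existence of a single-valued map \<open>X\<close> on the curve is the period condition, which holds for exactly
  one \<open>c > 0\<close>. Away from the branch point \<open>(0, 0)\<close>, \<open>u\<close> is a local coordinate on the curve, and
  \<open>X\<close> is determined up to translation.\<close>

definition costa_immersion :: "real \<Rightarrow> (complex \<times> complex \<Rightarrow> real^3) \<Rightarrow> bool" where
  "costa_immersion c X \<longleftrightarrow>
     0 < c \<and> continuous_on costa_curve X \<and>
     (\<forall>U s. open U \<and> s holomorphic_on U \<and> (\<forall>u\<in>U. s u \<noteq> 0 \<and> (s u)\<^sup>2 = u * (1 - u\<^sup>2)) \<longrightarrow>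
        (\<forall>u\<in>U. ((\<lambda>u. X (u, s u)) has_derivative
           (\<lambda>\<delta>. \<chi> k. Re (weierstrass_form
              (of_real c / s u * (1 / (u\<^sup>2 - 1)))
              (s u / of_real c * (1 / (u\<^sup>2 - 1)))
              (1 / (u\<^sup>2 - 1)) $ k * \<delta>))) (at u)))"

text \<open>The Costa surface, up to similarity of Euclidean space.\<close>

definition costa_surface :: "(real^3) set \<Rightarrow> bool" where
  "costa_surface S \<longleftrightarrow>
     (\<exists>c X r Q t. costa_immersion c X \<and> 0 < r \<and> orthogonal_transformation Q \<and>
        S = (\<lambda>x. r *\<^sub>R Q x + t) ` X ` costa_curve)"


section \<open>Convergence\<close>

text \<open>The map \<open>X\<close> is defined on the closed half plane without a finite set \<open>E\<close> of real points
  (the real ends; infinity is always omitted). The boundary arcs are the components of the real line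
  without the finite set \<open>V\<close>, consisting of \<open>E\<close> and the real vertices.\<close>

definition boundary_arcs :: "real set \<Rightarrow> complex set set" where
  "boundary_arcs V = components (of_real ` (- V))"

definition arc_symmetry :: "(complex \<Rightarrow> real^3) \<Rightarrow> complex set \<Rightarrow> (real^3 \<Rightarrow> real^3) \<Rightarrow> bool" where
  "arc_symmetry X A \<sigma> \<longleftrightarrow>
     (\<exists>q d. d \<noteq> 0 \<and> X ` A \<subseteq> range (\<lambda>t. q + t *\<^sub>R d) \<and> \<sigma> = half_turn q d) \<or>
     (\<exists>q n. n \<noteq> 0 \<and> X ` A \<subseteq> {x. (x - q) \<bullet> n = 0} \<and>
        (\<forall>z\<in>A. \<exists>m. (unit_normal X \<longlongrightarrow> m) (at z within upper_half_plane) \<and> m \<bullet> n = 0) \<and>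
        \<sigma> = plane_reflection q n)"

definition minimal_piece :: "(complex \<Rightarrow> real^3) \<Rightarrow> real set \<Rightarrow> real set \<Rightarrow> bool" where
  "minimal_piece X E V \<longleftrightarrow>
     conformal_minimal_immersion X upper_half_plane \<and>
     E \<subseteq> V \<and> finite V \<and>
     continuous_on (closed_half_plane - of_real ` E) X \<and>
     (\<forall>A\<in>boundary_arcs V. \<exists>\<sigma>. arc_symmetry X A \<sigma>)"

definition symmetric_extension :: "(complex \<Rightarrow> real^3) \<Rightarrow> real set \<Rightarrow> real set \<Rightarrow> (real^3) set" where
  "symmetric_extension X E V =
     extension_by {\<sigma>. \<exists>A\<in>boundary_arcs V. arc_symmetry X A \<sigma>} (X ` (closed_half_plane - of_real ` E))"

definition converges_to_costa :: "(nat \<Rightarrow> complex \<Rightarrow> real^3) \<Rightarrow> bool" where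
  "converges_to_costa f \<longleftrightarrow>
     (\<exists>r t X E V.
        (\<forall>n. 0 < r n) \<and>
        (\<forall>K. compact K \<and> K \<subseteq> upper_half_plane \<longrightarrow>
           uniform_limit K (\<lambda>n z. r n *\<^sub>R f n z + t n) X sequentially) \<and>
        minimal_piece X E V \<and> costa_surface (symmetric_extension X E V))"

end

theory Submission
  imports Defs
begin

text \<open>
  The data of the pentagon are products of real powers of \<open>z - x\<close> with real \<open>x\<close>, so the
  primitives of \<open>G dh\<close> and \<open>dh / G\<close> are Schwarz--Christoffel maps: an interval between two
  marked points goes to a straight segment, whose direction is read off the exponents and
  whose length is the integral of the modulus. Hence for all parameters two of the boundary
  curves are horizontal and straight, and the other three lie in vertical planes parallel to
  the coordinate planes. That these lines and planes are those of a box amounts to two real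
  equations between side lengths, linear in \<open>\<rho>\<^sup>2\<close> (\<open>CS4_period\<close>). Eliminating \<open>\<rho>\<close> leaves the
  equation \<open>period_gap a b = 0\<close>. The gap is negative for \<open>b\<close> close to \<open>0\<close>, where one side
  length blows up, and positive at any given \<open>b\<close> once \<open>-a\<close> is large; the intermediate value
  theorem therefore gives solutions with \<open>a\<close> arbitrarily negative and \<open>b\<close> arbitrarily small
  (\<open>period_gap_zero\<close>). The pentagon stays in its box because the coordinates are harmonic, so
  it is enough to look at the boundary; there the coordinates are constant or their
  monotonicity is decided by comparing \<open>\<bar>G\<bar>\<close> with \<open>1\<close>.

  Now let \<open>a\<close> tend to \<open>-\<infinity>\<close> and \<open>b\<close> to \<open>0\<close> along solutions. By dominated convergence the
  side lengths converge after multiplication with powers of \<open>-a\<close>, and the period equations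
  force \<open>\<rho> \<surd>(-a)\<close> to converge to a positive number \<open>c\<close> (\<open>CS4_parameters\<close>). Since
  \<open>\<rho> (z - a)\<^sup>1\<^sup>/\<^sup>2\<close> is \<open>\<rho> \<surd>(-a)\<close> times the square root of \<open>1 + z / (-a)\<close>, the forms
  converge locally uniformly, and so do the maps (\<open>CS4_converges\<close>); only a translation is
  needed. The boundary of the limit piece consists of an arc in a horizontal line and two arcs
  in vertical planes, and what is left of the period equations says that the line and the two
  planes have a point in common (\<open>Y_plane1\<close>).

  It remains to recognize the extension of the limit piece. The substitution
  \<open>z = 1 - u\<^sup>2\<close> turns the limit forms into the data \<open>G = c / w\<close>,
  \<open>dh = du / (u\<^sup>2 - 1)\<close> on the curve \<open>w\<^sup>2 = u (1 - u\<^sup>2)\<close>. The group generated by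
  \<open>(u, w) \<mapsto> (cnj u, cnj w)\<close> and \<open>(u, w) \<mapsto> (- u, \<i> w)\<close> has order eight and cuts the
  curve into eight copies of the half plane. The immersion of the curve is obtained by folding
  a point into one of these copies and applying to the image of the limit piece the isometry
  that belongs to the group element. This is continuous because the arcs are fixed by the
  respective symmetries, and it has the right derivative: inside the copies by symmetry, and
  across the seams because its difference to a local primitive is continuous and locally
  constant off a line. Its image is invariant under the symmetries of the three arcs, and
  hence it is the extension (\<open>symmetric_extension_eq\<close>).
\<close>

section \<open>Powers on the closed half plane\<close>

lemma open_upper_half_plane: "open upper_half_plane"
  unfolding upper_half_plane_def by (simp add: open_halfspace_Im_gt)

lemma convex_upper_half_plane: "convex upper_half_plane"
  unfolding upper_half_plane_def by (simp add: convex_halfspace_Im_gt)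

lemma upper_subset_closed_half_plane: "upper_half_plane \<subseteq> closed_half_plane"
  by (auto simp: upper_half_plane_def closed_half_plane_def)

lemma closed_half_plane_cases:
  assumes "z \<in> closed_half_plane"
  obtains "z \<in> upper_half_plane" | x where "z = of_real x"
proof (cases "Im z > 0")
  case True then show ?thesis using that(1) by (simp add: upper_half_plane_def)
next
  case False
  then have "Im z = 0" using assms by (simp add: closed_half_plane_def)
  then have "z = of_real (Re z)" by (simp add: complex_eq_iff)
  then show ?thesis using that(2) by blast
qed

lemma at_within_upper_half_plane_nontrivial:
  assumes "z \<in> closed_half_plane" shows "at z within upper_half_plane \<noteq> bot"
proof -
  have "z islimpt upper_half_plane"
    unfolding islimpt_approachable
  proof (intro allI impI)
    fix e :: real assume "e > 0"
    then show "\<exists>x'\<in>upper_half_plane. x' \<noteq> z \<and> dist x' z < e"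
      using assms
      by (intro bexI[of _ "z + \<i> * of_real (e/2)"])
         (auto simp: upper_half_plane_def closed_half_plane_def dist_norm norm_mult complex_eq_iff)
  qed
  then show ?thesis by (simp add: trivial_limit_within)
qed

lemma upper_at_infinity_nontrivial: "inf at_infinity (principal upper_half_plane) \<noteq> bot"
proof
  assume "inf at_infinity (principal upper_half_plane) = bot"
  then have "eventually (\<lambda>z. z \<notin> upper_half_plane) (at_infinity :: complex filter)"
    by (simp add: trivial_limit_def eventually_inf_principal)
  then obtain R where R: "\<And>z. norm z \<ge> R \<Longrightarrow> z \<notin> upper_half_plane"
    by (auto simp: eventually_at_infinity)
  show False using R[of "\<i> * of_real (max R 1)"]
    by (auto simp: upper_half_plane_def norm_mult)
qed

text \<open>On the closed half plane the principal logarithm agrees with a branch that is cut along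
  the negative imaginary axis; hence it is continuous up to the negative real axis.\<close>

lemma Ln_closed_half_plane:
  assumes "z \<in> closed_half_plane" "z \<noteq> 0"
  shows "Ln z = Ln (-(\<i> * z)) + \<i> * of_real (pi/2)"
proof -
  have "Re (-(\<i> * z)) \<ge> 0" "-(\<i> * z) \<noteq> 0" using assms by (auto simp: closed_half_plane_def)
  then have "Ln (\<i> * (-(\<i> * z))) = Ln (-(\<i> * z)) + \<i> * of_real pi / 2"
    using Ln_times_ii[of "-(\<i> * z)"] by presburger
  moreover have "\<i> * (-(\<i> * z)) = z" by simp
  ultimately show ?thesis by simp
qed

lemma continuous_on_Ln_closed_half_plane: "continuous_on (closed_half_plane - {0}) Ln"
proof -
  have "continuous_on (closed_half_plane - {0}) (\<lambda>z. Ln (-(\<i> * z)) + \<i> * of_real (pi/2))"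
    by (intro continuous_intros)
       (auto simp: closed_half_plane_def complex_nonpos_Reals_iff complex_eq_iff)
  then show ?thesis
    by (rule continuous_on_eq) (metis Diff_iff Ln_closed_half_plane insert_iff)
qed

lemma continuous_on_powr_closed_half_plane:
  assumes "continuous_on S f" "\<And>z. z \<in> S \<Longrightarrow> f z \<in> closed_half_plane - {0}"
  shows "continuous_on S (\<lambda>z. f z powr (w::complex))"
proof -
  have "continuous_on (closed_half_plane - {0}) (\<lambda>z. exp (w * Ln z))"
    by (intro continuous_intros continuous_on_Ln_closed_half_plane)
  then have "continuous_on (closed_half_plane - {0}) (\<lambda>z. z powr w)"
    by (rule continuous_on_eq) (auto simp: powr_def)
  moreover have "f ` S \<subseteq> closed_half_plane - {0}" using assms(2) by (rule image_subsetI)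
  ultimately show ?thesis
    by (rule continuous_on_compose2[where t = "closed_half_plane - {0}", OF _ assms(1)])
qed

text \<open>The argument of a power on the negative axis; it produces the angles of all polygons
  below.\<close>

lemma of_real_powr_cis:
  assumes "x \<noteq> 0"
  shows "complex_of_real x powr of_real e = cis (if x < 0 then pi * e else 0) * of_real (\<bar>x\<bar> powr e)"
proof (cases "x < 0")
  case True
  have "Ln (of_real x) = of_real (ln \<bar>x\<bar>) + \<i> * of_real pi"
    using True Ln_of_real'[of x] by simp
  then show ?thesis using True
    by (simp add: powr_def exp_add exp_of_real cis_conv_exp algebra_simps flip: of_real_mult)
next
  case False
  then show ?thesis using assms by (simp add: powr_of_real)
qed


section \<open>Schwarz--Christoffel integrands\<close>

text \<open>A list of pairs \<open>(x, e)\<close> encodes the product of the powers \<open>(z - x)\<^sup>e\<close>, the integrand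
  of a Schwarz--Christoffel map up to a constant.\<close>

definition sc_form :: "(real \<times> real) list \<Rightarrow> complex \<Rightarrow> complex" where
  "sc_form xs z = (\<Prod>(x, e)\<leftarrow>xs. (z - of_real x) powr of_real e)"

definition sc_abs :: "(real \<times> real) list \<Rightarrow> real \<Rightarrow> real" where
  "sc_abs xs t = (\<Prod>(x, e)\<leftarrow>xs. \<bar>t - x\<bar> powr e)"

definition sc_points :: "(real \<times> real) list \<Rightarrow> real set" where
  "sc_points xs = fst ` set xs"

definition sc_order :: "(real \<times> real) list \<Rightarrow> real \<Rightarrow> real" where
  "sc_order xs p = (\<Sum>(x, e)\<leftarrow>xs. if x = p then e else 0)"

text \<open>The principal powers of negative numbers have the argument \<open>pi\<close> times the exponent, so
  \<open>pi * sc_turn xs t\<close> is the argument of the integrand at a real point \<open>t\<close>; its jumps are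
  the exterior angles of the image polygon.\<close>

definition sc_turn :: "(real \<times> real) list \<Rightarrow> real \<Rightarrow> real" where
  "sc_turn xs t = (\<Sum>(x, e)\<leftarrow>xs. if t < x then e else 0)"

definition sc_degree :: "(real \<times> real) list \<Rightarrow> real" where
  "sc_degree xs = (\<Sum>(x, e)\<leftarrow>xs. e)"

lemmas sc_defs = sc_form_def sc_abs_def sc_points_def sc_order_def sc_turn_def sc_degree_def

lemma sc_form_Cons: "sc_form ((x, e) # xs) z = (z - of_real x) powr of_real e * sc_form xs z"
  by (simp add: sc_form_def)

lemma sc_form_holomorphic: "sc_form xs holomorphic_on upper_half_plane"
  unfolding sc_form_def
proof (induction xs)
  case (Cons a xs)
  have "(\<lambda>z. (z - of_real (fst a)) powr of_real (snd a)) holomorphic_on upper_half_plane"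
    by (intro holomorphic_intros) (auto simp: upper_half_plane_def complex_nonpos_Reals_iff)
  then show ?case using Cons by (auto simp: case_prod_beta intro!: holomorphic_intros)
qed auto

lemma sc_form_continuous:
  "continuous_on (closed_half_plane - of_real ` sc_points xs) (sc_form xs)"
proof (induction xs)
  case (Cons a xs)
  obtain x e where a: "a = (x, e)" by (cases a)
  let ?S = "closed_half_plane - of_real ` sc_points (a # xs)"
  have "continuous_on ?S (\<lambda>z. (z - of_real x) powr of_real e)"
    by (intro continuous_on_powr_closed_half_plane continuous_intros)
       (auto simp: closed_half_plane_def a sc_points_def)
  moreover have "continuous_on ?S (sc_form xs)"
    by (rule continuous_on_subset[OF Cons]) (auto simp: sc_points_def)
  ultimately show ?case unfolding a sc_form_Cons by (rule continuous_on_mult)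
qed (simp add: sc_form_def)

lemma sc_form_nonzero: "z \<notin> of_real ` sc_points xs \<Longrightarrow> sc_form xs z \<noteq> 0"
proof (induction xs)
  case (Cons a xs)
  then show ?case by (cases a) (auto simp: sc_form_Cons sc_points_def)
qed (simp add: sc_form_def)

lemma sc_abs_Cons: "sc_abs ((x, e) # xs) t = \<bar>t - x\<bar> powr e * sc_abs xs t"
  by (simp add: sc_abs_def)

lemma sc_abs_pos: "t \<notin> sc_points xs \<Longrightarrow> sc_abs xs t > 0"
proof (induction xs)
  case (Cons a xs)
  then show ?case by (cases a) (simp add: sc_abs_Cons sc_points_def)
qed (simp add: sc_abs_def)

lemma sc_abs_continuous: "t \<notin> sc_points xs \<Longrightarrow> isCont (sc_abs xs) t"
proof (induction xs)
  case (Cons a xs)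
  obtain x e where a: "a = (x, e)" by (cases a)
  have "isCont (\<lambda>t. \<bar>t - x\<bar> powr e) t"
    using Cons(2) by (intro continuous_intros) (auto simp: a sc_points_def)
  moreover have "isCont (sc_abs xs) t" using Cons by (auto simp: sc_points_def)
  ultimately show ?case unfolding a sc_abs_Cons by (intro continuous_mult)
qed (simp add: sc_abs_def[abs_def])

lemma sc_abs_nonneg: "sc_abs xs t \<ge> 0"
proof (induction xs)
  case (Cons a xs)
  then show ?case by (cases a) (simp add: sc_abs_Cons)
qed (simp add: sc_abs_def)

lemma sc_form_of_real:
  assumes "t \<notin> sc_points xs"
  shows "sc_form xs (of_real t) = cis (pi * sc_turn xs t) * of_real (sc_abs xs t)"
  using assms
proof (induction xs)
  case (Cons a xs)
  have "sc_form xs (of_real t) = cis (pi * sc_turn xs t) * of_real (sc_abs xs t)" and "t \<noteq> fst a"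
    using Cons by (auto simp: sc_points_def)
  moreover have "(of_real t - of_real (fst a) :: complex) powr of_real (snd a)
      = cis (if t < fst a then pi * snd a else 0) * of_real (\<bar>t - fst a\<bar> powr snd a)"
    using of_real_powr_cis[of "t - fst a" "snd a"] \<open>t \<noteq> fst a\<close> by simp
  ultimately show ?case
    by (auto simp: sc_form_def sc_abs_def sc_turn_def case_prod_beta algebra_simps
        simp flip: cis_mult)
qed (auto simp: sc_defs)

lemma sc_form_bigo_at:
  "sc_form xs \<in> O[at (of_real p) within S](\<lambda>z. of_real (norm (z - of_real p) powr sc_order xs p))"
proof (induction xs)
  case Nil
  have "(\<lambda>z. 1::complex) \<in> O[at (of_real p) within S](\<lambda>z. of_real (norm (z - of_real p) powr 0))"
    by (rule bigoI[of _ 1], rule eventually_mono[OF eventually_neq_at_within[of "of_real p"]]) auto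
  then show ?case by (simp add: sc_form_def[abs_def] sc_order_def)
next
  case (Cons a xs)
  obtain x e where a: "a = (x, e)" by (cases a)
  have 1: "(\<lambda>z. (z - of_real x) powr of_real e)
      \<in> O[at (of_real p) within S](\<lambda>z. of_real (norm (z - of_real p) powr (if x = p then e else 0)))"
  proof (cases "x = p")
    case True
    then show ?thesis by (intro bigoI[of _ 1]) (auto simp: norm_powr_real_powr')
  next
    case False
    have "((\<lambda>z. norm (z - of_real x) powr e) \<longlongrightarrow> norm (of_real p - of_real x :: complex) powr e)
        (at (of_real p) within S)"
      using False by (intro tendsto_intros) auto
    then have "\<forall>\<^sub>F z in at (of_real p) within S.
        norm (z - of_real x) powr e < norm (of_real p - of_real x :: complex) powr e + 1"
      by (rule order_tendstoD) simp
    with eventually_neq_at_within[of "of_real p" "of_real p" S]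
    have "\<forall>\<^sub>F z in at (of_real p) within S. norm ((z - of_real x) powr of_real e)
        \<le> (norm (of_real p - of_real x :: complex) powr e + 1) *
          norm (complex_of_real (norm (z - of_real p) powr (if x = p then e else 0)))"
      by eventually_elim (use False in \<open>auto simp: norm_powr_real_powr'\<close>)
    then show ?thesis by (rule bigoI)
  qed
  have 2: "sc_form (a # xs) = (\<lambda>z. (z - of_real x) powr of_real e * sc_form xs z)"
    by (auto simp: sc_form_def a)
  have 3: "(\<lambda>z. complex_of_real (norm (z - of_real p) powr sc_order (a # xs) p))
     = (\<lambda>z. of_real (norm (z - of_real p) powr (if x = p then e else 0)) *
            of_real (norm (z - of_real p) powr sc_order xs p))"
    by (auto simp: sc_order_def a powr_add)
  show ?case unfolding 2 3 by (intro landau_o.big.mult 1 Cons)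
qed

lemma sc_form_bigo_infinity:
  "sc_form xs \<in> O[inf at_infinity (principal S)](\<lambda>z. of_real (norm z powr sc_degree xs))"
proof (induction xs)
  case Nil
  have "\<forall>\<^sub>F z::complex in inf at_infinity (principal S). norm z \<ge> 1"
    by (rule filter_leD[OF inf_le1]) (auto simp: eventually_at_infinity)
  then have "(\<lambda>z. 1::complex) \<in> O[inf at_infinity (principal S)](\<lambda>z. of_real (norm z powr 0))"
    by (intro bigoI[of _ 1]) (auto elim!: eventually_mono)
  then show ?case by (simp add: sc_form_def[abs_def] sc_degree_def)
next
  case (Cons a xs)
  obtain x e where a: "a = (x, e)" by (cases a)
  have 1: "(\<lambda>z. (z - of_real x) powr of_real e)
      \<in> O[inf at_infinity (principal S)](\<lambda>z. of_real (norm z powr e))"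
  proof (rule bigoI)
    have "\<forall>\<^sub>F z::complex in inf at_infinity (principal S). norm z \<ge> 2 * \<bar>x\<bar> + 1"
      by (rule filter_leD[OF inf_le1]) (auto simp: eventually_at_infinity)
    then show "\<forall>\<^sub>F z in inf at_infinity (principal S). norm ((z - complex_of_real x) powr of_real e)
        \<le> 2 powr \<bar>e\<bar> * norm (complex_of_real (norm z powr e))"
    proof eventually_elim
      case (elim z)
      have "norm (z - of_real x) \<le> norm z + \<bar>x\<bar>" "norm z \<le> norm (z - of_real x) + \<bar>x\<bar>"
        using norm_triangle_ineq4[of z "of_real x"] norm_triangle_ineq2[of z "of_real x"]
        by (auto simp: norm_minus_commute)
      then have *: "norm (z - of_real x) \<le> 2 * norm z" "norm z \<le> 2 * norm (z - of_real x)"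
          "norm z > 0"
        using elim by auto
      have "norm (z - of_real x) powr e \<le> 2 powr \<bar>e\<bar> * norm z powr e"
      proof (cases "e \<ge> 0")
        case True
        have "norm (z - of_real x) powr e \<le> (2 * norm z) powr e"
          using * True by (intro powr_mono2) auto
        then show ?thesis using True * by (simp add: powr_mult)
      next
        case False
        have "norm (z - of_real x) powr e \<le> (norm z / 2) powr e"
          using * False by (intro powr_mono2') auto
        then show ?thesis using False * by (simp add: powr_divide powr_minus field_simps)
      qed
      then show ?case by (simp add: norm_powr_real_powr')
    qed
  qed
  have 2: "sc_form (a # xs) = (\<lambda>z. (z - of_real x) powr of_real e * sc_form xs z)"
    by (auto simp: sc_form_def a)
  have 3: "(\<lambda>z::complex. complex_of_real (norm z powr sc_degree (a # xs)))
     = (\<lambda>z. of_real (norm z powr e) * of_real (norm z powr sc_degree xs))"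
    by (auto simp: sc_degree_def a powr_add)
  show ?case unfolding 2 3 by (intro landau_o.big.mult 1 Cons)
qed


section \<open>Boundary values of primitives\<close>

lemma primitive_lipschitz:
  fixes f :: "complex \<Rightarrow> complex"
  assumes "convex S" "\<And>z. z \<in> S \<Longrightarrow> (f has_field_derivative h z) (at z)"
    "\<And>z. z \<in> S \<Longrightarrow> norm (h z) \<le> B" "x \<in> S" "y \<in> S"
  shows "norm (f x - f y) \<le> B * norm (x - y)"
proof (rule field_differentiable_bound[OF assms(1)])
  show "(f has_field_derivative h z) (at z within S)" if "z \<in> S" for z
    using assms(2)[OF that] by (rule has_field_derivative_at_within)
qed (fact assms)+

text \<open>After the substitution \<open>z = p + \<zeta>\<^sup>4\<close> the derivative of the primitive is bounded on a
  convex sector, so that the primitive is Lipschitz continuous there. This is why exponents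
  down to \<open>-3/4\<close> are harmless.\<close>

lemma primitive_limit_at:
  assumes der: "\<And>z. z \<in> upper_half_plane \<Longrightarrow> (f has_field_derivative h z) (at z)"
    and h: "h \<in> O[at (of_real p) within upper_half_plane](\<lambda>z. of_real (norm (z - of_real p) powr m))"
    and m: "m \<ge> -3/4"
  shows "\<exists>l. (f \<longlongrightarrow> l) (at (of_real p) within upper_half_plane)"
proof -
  obtain C where C: "C > 0" "\<forall>\<^sub>F z in at (of_real p) within upper_half_plane.
      norm (h z) \<le> C * norm (complex_of_real (norm (z - of_real p) powr m))"
    using h by (auto elim: landau_o.bigE)
  then obtain d0 where d0: "d0 > 0" "\<And>z. z \<in> upper_half_plane \<Longrightarrow> z \<noteq> of_real p \<Longrightarrow>
      dist z (of_real p) < d0 \<Longrightarrow> norm (h z) \<le> C * norm (z - of_real p) powr m"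
    by (auto simp: eventually_at)
  define d where "d = min d0 1"
  have d: "d > 0" "d \<le> 1" "d \<le> d0" using d0 by (auto simp: d_def)
  \<comment> \<open>The fourth power maps this sector of opening \<open>pi / 4\<close> into the upper half plane.\<close>
  define S where "S = {\<zeta>. 0 < Im \<zeta>} \<inter> {\<zeta>. Im \<zeta> < Re \<zeta>} \<inter> ball 0 d"
  have conv: "convex S"
  proof -
    have "{\<zeta>::complex. Im \<zeta> < Re \<zeta>} = {\<zeta>. (\<i> - 1) \<bullet> \<zeta> < 0}"
      by (auto simp: inner_complex_def)
    then have "convex {\<zeta>::complex. Im \<zeta> < Re \<zeta>}" by (metis convex_halfspace_lt)
    then show ?thesis unfolding S_def by (intro convex_Int) (auto simp: convex_halfspace_Im_gt)
  qed
  define g where "g \<zeta> = f (of_real p + \<zeta>^4)" for \<zeta>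
  have pos: "Im (\<zeta>^4) > 0" if "\<zeta> \<in> S" for \<zeta>
  proof -
    have 2: "Im (\<zeta>^4) = 4 * Re \<zeta> * Im \<zeta> * ((Re \<zeta>)\<^sup>2 - (Im \<zeta>)\<^sup>2)"
      by (simp add: power4_eq_xxxx power2_eq_square algebra_simps)
    have "(Im \<zeta>)\<^sup>2 < (Re \<zeta>)\<^sup>2" using that by (intro power_strict_mono) (auto simp: S_def)
    then show ?thesis unfolding 2 using that by (auto simp: S_def)
  qed
  have lip: "norm (g x - g y) \<le> (4 * C) * norm (x - y)" if "x \<in> S" "y \<in> S" for x y
  proof (rule primitive_lipschitz[OF conv _ _ that])
    fix \<zeta> assume S: "\<zeta> \<in> S"
    have up: "of_real p + \<zeta>^4 \<in> upper_half_plane" using pos[OF S] by (simp add: upper_half_plane_def)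
    show "(g has_field_derivative (h (of_real p + \<zeta>^4) * (4 * \<zeta>^3))) (at \<zeta>)"
      unfolding g_def
      by (rule DERIV_chain2[of f _ "\<lambda>\<zeta>. of_real p + \<zeta>^4", OF der[OF up]])
         (auto intro!: derivative_eq_intros)
    have z: "\<zeta> \<noteq> 0" and nz: "norm \<zeta> < d" using S by (auto simp: S_def)
    have n4: "norm (\<zeta>^4) = norm \<zeta> ^ 4" by (simp add: norm_power)
    have "norm \<zeta> ^ 4 \<le> norm \<zeta> ^ 1" using nz d by (intro power_decreasing) auto
    then have "norm (h (of_real p + \<zeta>^4)) \<le> C * norm (\<zeta>^4) powr m"
      using d0(2)[OF up] z nz d pos[OF S] n4 by (auto simp: dist_norm)
    also have "norm (\<zeta>^4) powr m \<le> norm (\<zeta>^4) powr (-3/4)"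
      using m z nz d by (intro powr_mono') (auto simp: n4 power_le_one)
    also have "norm (\<zeta>^4) powr (-3/4) = 1 / norm \<zeta> ^ 3"
    proof -
      have "norm (\<zeta>^4) powr (-3/4) = (norm \<zeta> powr 4) powr (-3/4)"
        using z by (simp add: n4 powr_numeral)
      also have "\<dots> = norm \<zeta> powr (-3)" by (subst powr_powr) simp
      also have "\<dots> = 1 / norm \<zeta> ^ 3" using z by (simp add: powr_minus powr_numeral divide_inverse)
      finally show ?thesis .
    qed
    finally have "norm (h (of_real p + \<zeta>^4)) \<le> C * (1 / norm \<zeta> ^ 3)" using C by simp
    then have "norm (h (of_real p + \<zeta>^4)) * (4 * norm \<zeta> ^ 3) \<le> C * (1 / norm \<zeta> ^ 3) * (4 * norm \<zeta> ^ 3)"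
      by (intro mult_right_mono) auto
    also have "\<dots> = 4 * C" using z by simp
    finally show "norm (h (of_real p + \<zeta>^4) * (4 * \<zeta>^3)) \<le> 4 * C"
      by (simp add: norm_mult norm_power)
  qed
  have "uniformly_continuous_on S g"
    unfolding uniformly_continuous_on_def
  proof (intro allI impI)
    fix e :: real assume e: "e > 0"
    show "\<exists>d>0. \<forall>x\<in>S. \<forall>x'\<in>S. dist x' x < d \<longrightarrow> dist (g x') (g x) < e"
    proof (intro exI[of _ "e / (4 * C)"] conjI ballI impI)
      show "e / (4 * C) > 0" using e C by simp
      fix x x' assume "x \<in> S" "x' \<in> S" and n: "dist x' x < e / (4 * C)"
      then have "dist (g x') (g x) \<le> (4 * C) * dist x' x" using lip by (auto simp: dist_norm)
      also have "\<dots> < e" using n C by (simp add: field_simps)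
      finally show "dist (g x') (g x) < e" .
    qed
  qed
  moreover have "0 \<in> closure S"
    unfolding closure_approachable
  proof (intro allI impI)
    fix e :: real assume e: "e > 0"
    define r where "r = min e d / 4"
    have r: "r > 0" using e d by (auto simp: r_def)
    have "norm (Complex (2*r) r) \<le> 2*r + r" using r by (intro order_trans[OF cmod_le]) auto
    also have "\<dots> < min e d" using e d by (auto simp: r_def)
    finally show "\<exists>y\<in>S. dist y 0 < e"
      using r by (intro bexI[of _ "Complex (2*r) r"]) (auto simp: S_def)
  qed
  ultimately obtain l where l: "(g \<longlongrightarrow> l) (at 0 within S)"
    by (rule uniformly_continuous_on_extension_at_closure)
  \<comment> \<open>A right inverse of the fourth power, with values in the sector.\<close>
  define q where "q z = csqrt (csqrt (z - of_real p))" for z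
  have q4: "q z ^ 4 = z - of_real p" for z
    using power_mult[of "q z" 2 2] by (simp add: q_def)
  have nq: "norm (q z) = sqrt (sqrt (norm (z - of_real p)))" for z
    by (simp add: q_def)
  have qlim: "(q \<longlongrightarrow> 0) (at (of_real p) within upper_half_plane)"
  proof (rule tendsto_norm_zero_cancel)
    have "((\<lambda>z. sqrt (sqrt (norm (z - of_real p)))) \<longlongrightarrow>
        sqrt (sqrt (norm (of_real p - of_real p :: complex)))) (at (of_real p) within upper_half_plane)"
      by (intro tendsto_intros)
    then show "((\<lambda>z. norm (q z)) \<longlongrightarrow> 0) (at (of_real p) within upper_half_plane)" by (simp add: nq)
  qed
  have qS: "q z \<in> S" if z: "z \<in> upper_half_plane" "dist z (of_real p) < d^4" for z
  proof -
    define s where "s = csqrt (z - of_real p)"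
    have s2: "s^2 = z - of_real p" by (simp add: s_def)
    have im: "Im (s^2) > 0" using z by (simp add: s2 upper_half_plane_def)
    have "Re s \<ge> 0" using csqrt_principal[of "z - of_real p"] by (auto simp: s_def)
    then have s: "Re s > 0" "Im s > 0"
      using im by (auto simp: power2_eq_square zero_less_mult_iff)
    have t2: "(q z)^2 = s" by (simp add: q_def s_def)
    have "Re (q z) \<ge> 0" using csqrt_principal[of s] by (auto simp: q_def s_def)
    have "Im ((q z)^2) > 0" "Re ((q z)^2) > 0" using s unfolding t2 by auto
    then have t: "Re (q z) > 0" "Im (q z) > 0" "(Re (q z))\<^sup>2 > (Im (q z))\<^sup>2"
      using \<open>Re (q z) \<ge> 0\<close> by (auto simp: power2_eq_square zero_less_mult_iff)
    have "Im (q z) < Re (q z)" using t by (meson power_less_imp_less_base less_imp_le)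
    moreover have "norm (q z) < d"
    proof -
      have "norm (q z) ^ 4 < d ^ 4" using z by (simp add: q4 dist_norm flip: norm_power)
      then show ?thesis using d by (meson power_less_imp_less_base less_imp_le)
    qed
    ultimately show ?thesis using t by (auto simp: S_def)
  qed
  have near: "\<forall>\<^sub>F z in at (of_real p) within upper_half_plane. z \<in> upper_half_plane \<and> dist z (of_real p) < d^4"
    using d unfolding eventually_at by (intro exI[of _ "d^4"]) auto
  have "filterlim q (at 0 within S) (at (of_real p) within upper_half_plane)"
    unfolding filterlim_at
  proof
    show "\<forall>\<^sub>F z in at (of_real p) within upper_half_plane. q z \<in> S \<and> q z \<noteq> 0"
      using near by eventually_elim (use qS in \<open>force simp: S_def\<close>)
  qed (rule qlim)
  from filterlim_compose[OF l this] have "((\<lambda>z. g (q z)) \<longlongrightarrow> l) (at (of_real p) within upper_half_plane)" .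
  then show ?thesis by (auto simp: g_def q4)
qed

lemma neg_inverse_upper_half_plane: "z \<in> upper_half_plane \<Longrightarrow> -1/z \<in> upper_half_plane"
  by (auto simp: upper_half_plane_def Im_divide divide_pos_pos add_nonneg_pos power2_eq_square
      zero_less_mult_iff intro!: divide_pos_pos add_nonneg_pos)

lemma filterlim_neg_inverse_at_infinity:
  "filterlim (\<lambda>z::complex. -1/z) (at 0 within upper_half_plane) (inf at_infinity (principal upper_half_plane))"
  unfolding filterlim_at
proof
  show "\<forall>\<^sub>F z::complex in inf at_infinity (principal upper_half_plane). -1/z \<in> upper_half_plane \<and> -1/z \<noteq> 0"
    unfolding eventually_inf_principal
    using neg_inverse_upper_half_plane by (intro always_eventually) (auto simp: upper_half_plane_def)
  show "((\<lambda>z::complex. -1/z) \<longlongrightarrow> 0) (inf at_infinity (principal upper_half_plane))"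
    by (rule tendsto_mono[OF inf_le1]) (rule tendsto_divide_0[OF tendsto_const filterlim_ident])
qed

lemma filterlim_neg_inverse_at_0:
  "filterlim (\<lambda>z::complex. -1/z) (inf at_infinity (principal upper_half_plane)) (at 0 within upper_half_plane)"
  unfolding filterlim_inf filterlim_principal
proof
  have "filterlim (\<lambda>z::complex. inverse z) at_infinity (at 0)" by (rule filterlim_inverse_at_infinity)
  then have "filterlim (\<lambda>z::complex. - inverse z) at_infinity (at 0)"
    by (simp add: filterlim_at_infinity_conv_norm_at_top)
  then show "filterlim (\<lambda>z::complex. -1/z) at_infinity (at 0 within upper_half_plane)"
    by (auto simp: divide_inverse intro: filterlim_mono at_le)
  show "\<forall>\<^sub>F z::complex in at 0 within upper_half_plane. -1/z \<in> upper_half_plane"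
    unfolding eventually_at using neg_inverse_upper_half_plane by (auto intro!: exI[of _ 1])
qed

text \<open>The inversion \<open>z \<mapsto> -1/z\<close> maps the half plane to itself and infinity to \<open>0\<close>, where the
  transformed integrand has order \<open>-m - 2 \<ge> -3/4\<close>.\<close>

lemma primitive_limit_at_infinity:
  assumes der: "\<And>z. z \<in> upper_half_plane \<Longrightarrow> (f has_field_derivative h z) (at z)"
    and h: "h \<in> O[inf at_infinity (principal upper_half_plane)](\<lambda>z. of_real (norm z powr m))"
    and m: "m \<le> -5/4"
  shows "\<exists>l. (f \<longlongrightarrow> l) (inf at_infinity (principal upper_half_plane))"
proof -
  define g where "g z = f (-1/z)" for z
  have "\<exists>l. (g \<longlongrightarrow> l) (at (of_real 0) within upper_half_plane)"
  proof (rule primitive_limit_at)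
    fix z assume z: "z \<in> upper_half_plane"
    then have "z \<noteq> 0" by (auto simp: upper_half_plane_def)
    then show "(g has_field_derivative (h (-1/z) * (1/z^2))) (at z)"
      unfolding g_def
      by (intro DERIV_chain2[of f _ "\<lambda>z. -1/z", OF der[OF neg_inverse_upper_half_plane[OF z]]])
         (auto intro!: derivative_eq_intros simp: power2_eq_square)
  next
    have "(\<lambda>z. h (-1/z)) \<in> O[at 0 within upper_half_plane](\<lambda>z. of_real (norm (-1/z) powr m))"
      by (rule landau_o.big.compose[OF h filterlim_neg_inverse_at_0])
    then have "(\<lambda>z. h (-1/z) * (1/z^2)) \<in> O[at 0 within upper_half_plane](\<lambda>z. of_real (norm (-1/z) powr m) * (1/z^2))"
      by (intro landau_o.big.mult) auto
    also have "(\<lambda>z. of_real (norm (-1/z) powr m) * (1/z^2)) \<in> O[at 0 within upper_half_plane](\<lambda>z. of_real (norm (z - of_real 0) powr (-m-2)))"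
    proof (rule bigoI[of _ 1])
      show "\<forall>\<^sub>F z in at 0 within upper_half_plane. norm (complex_of_real (norm (-1/z) powr m) * (1/z^2))
          \<le> 1 * norm (complex_of_real (norm (z - of_real 0) powr (-m-2)))"
        using eventually_neq_at_within[of 0]
      proof eventually_elim
        case (elim z)
        then show ?case
          by (simp add: norm_divide norm_mult norm_power powr_divide powr_diff powr_minus
              field_simps powr_realpow[of "norm z" 2, simplified])
      qed
    qed
    finally show "(\<lambda>z. h (-1/z) * (1/z^2)) \<in> O[at (of_real 0) within upper_half_plane](\<lambda>z. of_real (norm (z - of_real 0) powr (-m-2)))" by simp
  qed (use m in auto)
  then obtain l where "(g \<longlongrightarrow> l) (at 0 within upper_half_plane)" by auto
  from filterlim_compose[OF this filterlim_neg_inverse_at_infinity]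
  show ?thesis by (auto simp: g_def)
qed

lemma closed_closed_half_plane: "closed closed_half_plane"
  unfolding closed_half_plane_def by (simp add: closed_halfspace_Im_ge)

lemma limit_extension_bound:
  fixes f :: "complex \<Rightarrow> complex"
  assumes "(f \<longlongrightarrow> l) (at z within U)" "at z within U \<noteq> bot" "open N" "z \<in> N"
    "\<And>y. y \<in> N \<inter> U \<Longrightarrow> dist (f y) L \<le> e"
  shows "dist l L \<le> e"
proof (rule tendsto_upperbound[OF tendsto_dist[OF assms(1) tendsto_const] _ assms(2)])
  show "\<forall>\<^sub>F y in at z within U. dist (f y) L \<le> e"
    unfolding eventually_at_topological using assms(3-5) by (intro exI[of _ N]) auto
qed

text \<open>The limits of a function at boundary points always form a continuous function, since
  values of the extension near \<open>x\<close> are limits of values of \<open>f\<close> near \<open>x\<close>.\<close>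

lemma limit_extension_continuous_on:
  fixes f :: "complex \<Rightarrow> complex"
  assumes lim: "\<And>z. z \<in> T \<Longrightarrow> (f \<longlongrightarrow> F z) (at z within U)" and nt: "\<And>z. z \<in> T \<Longrightarrow> at z within U \<noteq> bot"
  shows "continuous_on T F"
  unfolding continuous_on_iff
proof (intro ballI allI impI)
  fix x and e :: real assume x: "x \<in> T" and e: "e > 0"
  have "\<forall>\<^sub>F y in at x within U. dist (f y) (F x) < e/2" by (rule tendstoD[OF lim[OF x]]) (use e in simp)
  then obtain d where d: "d > 0" "\<And>y. y \<in> U \<Longrightarrow> y \<noteq> x \<Longrightarrow> dist y x < d \<Longrightarrow> dist (f y) (F x) < e/2"
    by (auto simp: eventually_at)
  have "dist (F z) (F x) < e" if z: "z \<in> T" "dist z x < d" for z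
  proof (cases "z = x")
    case False
    have "dist (F z) (F x) \<le> e/2"
    proof (rule limit_extension_bound[OF lim[OF z(1)] nt[OF z(1)], of "ball x d - {x}"])
      show "open (ball x d - {x})" by (simp add: open_delete)
      show "z \<in> ball x d - {x}" using False z by (auto simp: dist_commute)
      show "dist (f y) (F x) \<le> e/2" if "y \<in> (ball x d - {x}) \<inter> U" for y
        using d(2)[of y] that by (force simp: dist_commute)
    qed
    then show ?thesis using e by simp
  qed (use e in simp)
  then show "\<exists>d>0. \<forall>x'\<in>T. dist x' x < d \<longrightarrow> dist (F x') (F x) < e" using d(1) by blast
qed

lemma limit_extension_at_infinity:
  fixes f :: "complex \<Rightarrow> complex"
  assumes lim: "\<And>z. z \<in> T \<Longrightarrow> (f \<longlongrightarrow> F z) (at z within U)" and nt: "\<And>z. z \<in> T \<Longrightarrow> at z within U \<noteq> bot"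
    and inf: "(f \<longlongrightarrow> L) (inf at_infinity (principal U))"
  shows "(F \<longlongrightarrow> L) (inf at_infinity (principal T))"
proof (rule tendstoI)
  fix e :: real assume e: "e > 0"
  have "\<forall>\<^sub>F y in inf at_infinity (principal U). dist (f y) L < e/2" by (rule tendstoD[OF inf]) (use e in simp)
  then obtain R where R: "\<And>y. norm y \<ge> R \<Longrightarrow> y \<in> U \<Longrightarrow> dist (f y) L < e/2"
    by (auto simp: eventually_inf_principal eventually_at_infinity)
  have "dist (F z) L < e" if z: "z \<in> T" "norm z \<ge> R + 1" for z
  proof -
    have "dist (F z) L \<le> e/2"
    proof (rule limit_extension_bound[OF lim[OF z(1)] nt[OF z(1)], of "- cball 0 R"])
      show "dist (f y) L \<le> e/2" if "y \<in> - cball 0 R \<inter> U" for y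
        using R[of y] that by force
    qed (use z in auto)
    then show ?thesis using e by simp
  qed
  then show "\<forall>\<^sub>F z in inf at_infinity (principal T). dist (F z) L < e"
    by (auto simp: eventually_inf_principal eventually_at_infinity)
qed

definition half_plane_extension :: "(complex \<Rightarrow> complex) \<Rightarrow> complex option \<Rightarrow> complex" where
  "half_plane_extension f \<zeta> = Lim (approach \<zeta> upper_half_plane) f"

lemma approach_nontrivial:
  assumes "\<zeta> \<in> compact_half_plane" shows "approach \<zeta> upper_half_plane \<noteq> bot"
proof (cases \<zeta>)
  case None
  then show ?thesis by (simp add: approach_def upper_at_infinity_nontrivial)
next
  case (Some z)
  then have "z \<in> closed_half_plane" using assms by (auto simp: compact_half_plane_def)
  then show ?thesis by (simp add: approach_def Some at_within_upper_half_plane_nontrivial)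
qed

lemma half_plane_extension_eq:
  "(f \<longlongrightarrow> l) (approach \<zeta> upper_half_plane) \<Longrightarrow> \<zeta> \<in> compact_half_plane \<Longrightarrow> half_plane_extension f \<zeta> = l"
  unfolding half_plane_extension_def by (rule tendsto_Lim[OF approach_nontrivial])

text \<open>The mean value inequality for \<open>f - d z\<close> on half discs passes to the boundary.\<close>

lemma primitive_boundary_derivative:
  assumes der: "\<And>z. z \<in> upper_half_plane \<Longrightarrow> (f has_field_derivative h z) (at z)"
    and h: "(h \<longlongrightarrow> d) (at p within upper_half_plane)" and p: "Im p = 0"
    and N: "open N" "p \<in> N" and F: "\<And>z. z \<in> N \<inter> closed_half_plane \<Longrightarrow> (f \<longlongrightarrow> F z) (at z within upper_half_plane)"
  shows "(F has_field_derivative d) (at p within closed_half_plane)"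
  unfolding has_field_derivative_def has_derivative_within_alt
proof (intro conjI allI impI)
  fix e :: real assume e: "e > 0"
  have "\<forall>\<^sub>F y in at p within upper_half_plane. dist (h y) d < e" using tendstoD[OF h] e by simp
  then obtain r1 where r1': "r1 > 0" "\<forall>y\<in>upper_half_plane. y \<noteq> p \<and> dist y p < r1 \<longrightarrow> dist (h y) d < e"
    unfolding eventually_at by blast
  have "p \<notin> upper_half_plane" using p by (simp add: upper_half_plane_def)
  then have r1: "r1 > 0" "\<And>y. y \<in> upper_half_plane \<Longrightarrow> dist y p < r1 \<Longrightarrow> dist (h y) d < e"
    using r1' by metis+
  obtain r2 where r2: "r2 > 0" "ball p r2 \<subseteq> N" using N openE by blast
  define r where "r = min r1 r2"
  have r: "r > 0" using r1 r2 by (simp add: r_def)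
  let ?S = "upper_half_plane \<inter> ball p r"
  have lip: "norm ((f x - d * x) - (f y - d * y)) \<le> e * norm (x - y)" if "x \<in> ?S" "y \<in> ?S" for x y
  proof (rule primitive_lipschitz[OF _ _ _ that])
    show "convex ?S" by (intro convex_Int convex_upper_half_plane convex_ball)
    fix z assume z: "z \<in> ?S"
    show "((\<lambda>z. f z - d * z) has_field_derivative (h z - d)) (at z)"
      using der z by (auto intro!: derivative_eq_intros)
    show "norm (h z - d) \<le> e" using r1(2)[of z] z by (simp add: r_def dist_commute less_imp_le flip: dist_norm)
  qed
  have pc: "p \<in> closed_half_plane" using p by (simp add: closed_half_plane_def)
  have near: "\<forall>\<^sub>F x in at z within upper_half_plane. x \<in> ?S" if "z \<in> ball p r" for z
    unfolding eventually_at_topological using that by (intro exI[of _ "ball p r"]) auto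
  have 1: "norm ((F z - d * z) - (f y - d * y)) \<le> e * norm (z - y)"
    if z: "z \<in> closed_half_plane \<inter> ball p r" and y: "y \<in> ?S" for z y
  proof (rule tendsto_le)
    have "z \<in> N \<inter> closed_half_plane" using z r2 by (auto simp: r_def)
    note F = F[OF this]
    show "((\<lambda>x. norm ((f x - d * x) - (f y - d * y))) \<longlongrightarrow> norm ((F z - d * z) - (f y - d * y)))
        (at z within upper_half_plane)"
      by (intro tendsto_intros F)
    show "((\<lambda>x. e * norm (x - y)) \<longlongrightarrow> e * norm (z - y)) (at z within upper_half_plane)"
      by (intro tendsto_intros)
    show "at z within upper_half_plane \<noteq> bot" using z at_within_upper_half_plane_nontrivial by auto
    show "\<forall>\<^sub>F x in at z within upper_half_plane. norm ((f x - d * x) - (f y - d * y)) \<le> e * norm (x - y)"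
      using near[of z] z y lip by (auto elim!: eventually_mono)
  qed
  have 2: "norm ((F z - d * z) - (F p - d * p)) \<le> e * norm (z - p)"
    if z: "z \<in> closed_half_plane \<inter> ball p r" for z
  proof (rule tendsto_le)
    have "p \<in> N \<inter> closed_half_plane" using N pc by auto
    note F = F[OF this]
    show "((\<lambda>y. norm ((F z - d * z) - (f y - d * y))) \<longlongrightarrow> norm ((F z - d * z) - (F p - d * p)))
        (at p within upper_half_plane)"
      by (intro tendsto_intros F)
    show "((\<lambda>y. e * norm (z - y)) \<longlongrightarrow> e * norm (z - p)) (at p within upper_half_plane)"
      by (intro tendsto_intros)
    show "at p within upper_half_plane \<noteq> bot" using pc at_within_upper_half_plane_nontrivial by auto
    show "\<forall>\<^sub>F y in at p within upper_half_plane. norm ((F z - d * z) - (f y - d * y)) \<le> e * norm (z - y)"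
      using near[of p] r z 1 by (auto elim!: eventually_mono)
  qed
  show "\<exists>r>0. \<forall>y\<in>closed_half_plane. norm (y - p) < r \<longrightarrow> norm (F y - F p - d * (y - p)) \<le> e * norm (y - p)"
    using r 2 by (intro exI[of _ r]) (auto simp: dist_norm norm_minus_commute algebra_simps)
qed (simp add: bounded_linear_mult_right)


section \<open>Schwarz--Christoffel maps\<close>

lemma half_plane_primitive:
  assumes "h holomorphic_on upper_half_plane" "z \<in> upper_half_plane"
  shows "((\<lambda>z. contour_integral (linepath \<i> z) h) has_field_derivative h z) (at z)"
    and "(\<And>z. z \<in> upper_half_plane \<Longrightarrow> (P has_field_derivative h z) (at z)) \<Longrightarrow>
      contour_integral (linepath \<i> z) h = P z - P \<i>"
proof -
  have i: "\<i> \<in> upper_half_plane" by (simp add: upper_half_plane_def)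
  have eq: "contour_integral (linepath \<i> z) h = P z - P \<i>"
    if "z \<in> upper_half_plane" "\<And>z. z \<in> upper_half_plane \<Longrightarrow> (P has_field_derivative h z) (at z)" for P z
  proof -
    have "closed_segment \<i> z \<subseteq> upper_half_plane"
      using that(1) i by (intro closed_segment_subset convex_upper_half_plane)
    then have "(h has_contour_integral (P (pathfinish (linepath \<i> z)) - P (pathstart (linepath \<i> z)))) (linepath \<i> z)"
      by (intro contour_integral_primitive[of upper_half_plane])
         (auto intro: that(2) has_field_derivative_at_within)
    then show ?thesis by (simp add: contour_integral_unique)
  qed
  then show "(\<And>z. z \<in> upper_half_plane \<Longrightarrow> (P has_field_derivative h z) (at z)) \<Longrightarrow>
      contour_integral (linepath \<i> z) h = P z - P \<i>"
    using assms by blast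
  have "\<exists>g. \<forall>x\<in>upper_half_plane. (g has_field_derivative h x) (at x within upper_half_plane)"
    by (rule holomorphic_convex_primitive'[OF convex_upper_half_plane open_upper_half_plane assms(1)]) blast
  then obtain g where "\<And>x. x \<in> upper_half_plane \<Longrightarrow> (g has_field_derivative h x) (at x within upper_half_plane)"
    by metis
  then have g: "(g has_field_derivative h x) (at x)" if "x \<in> upper_half_plane" for x
    using at_within_open[OF that open_upper_half_plane] that by metis
  have "((\<lambda>z. g z - g \<i>) has_field_derivative h z) (at z)"
    using g[OF assms(2)] by (auto intro!: derivative_eq_intros)
  moreover have "\<forall>\<^sub>F z in nhds z. contour_integral (linepath \<i> z) h = g z - g \<i>"
    using eventually_nhds_in_open[OF open_upper_half_plane assms(2)] by eventually_elim (use eq g in blast)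
  ultimately show "((\<lambda>z. contour_integral (linepath \<i> z) h) has_field_derivative h z) (at z)"
    by (subst DERIV_cong_ev[OF refl _ refl])
qed

definition sc_map :: "(real \<times> real) list \<Rightarrow> complex \<Rightarrow> complex" where
  "sc_map xs z = contour_integral (linepath \<i> z) (sc_form xs)"

definition sc_ext :: "(real \<times> real) list \<Rightarrow> complex option \<Rightarrow> complex" where
  "sc_ext xs = half_plane_extension (sc_map xs)"

text \<open>The points at which \<open>primitive_limit_at\<close> provides a value of the extended map.\<close>

definition sc_domain :: "(real \<times> real) list \<Rightarrow> complex set" where
  "sc_domain xs = closed_half_plane - of_real ` {x. sc_order xs x < -3/4}"

lemma sc_map_derivative:
  "z \<in> upper_half_plane \<Longrightarrow> (sc_map xs has_field_derivative sc_form xs z) (at z)"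
  unfolding sc_map_def[abs_def] by (rule half_plane_primitive(1)[OF sc_form_holomorphic])

lemma sc_order_zero: "p \<notin> sc_points xs \<Longrightarrow> sc_order xs p = 0"
proof (induction xs)
  case (Cons a xs)
  then show ?case by (cases a) (auto simp: sc_order_def sc_points_def)
qed (simp add: sc_order_def)

lemma finite_sc_points: "finite (sc_points xs)" by (simp add: sc_points_def)

lemma sc_map_tendsto:
  assumes "z \<in> sc_domain xs"
  shows "(sc_map xs \<longlongrightarrow> sc_ext xs (Some z)) (at z within upper_half_plane)"
proof -
  have c: "z \<in> closed_half_plane" using assms by (simp add: sc_domain_def)
  have "\<exists>l. (sc_map xs \<longlongrightarrow> l) (at z within upper_half_plane)"
    using c
  proof (cases rule: closed_half_plane_cases)
    case 1
    then have "isCont (sc_map xs) z" using DERIV_isCont sc_map_derivative by blast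
    then show ?thesis using at_within_open[OF 1 open_upper_half_plane] by (auto simp: isCont_def)
  next
    case (2 x)
    then have "sc_order xs x \<ge> -3/4" using assms by (auto simp: sc_domain_def)
    then show ?thesis unfolding 2
      by (intro primitive_limit_at[OF sc_map_derivative sc_form_bigo_at])
  qed
  then obtain l where l: "(sc_map xs \<longlongrightarrow> l) (at z within upper_half_plane)" ..
  moreover have "sc_ext xs (Some z) = l"
    unfolding sc_ext_def using l c
    by (intro half_plane_extension_eq) (auto simp: approach_def compact_half_plane_def)
  ultimately show ?thesis by simp
qed

lemma sc_ext_upper: "z \<in> upper_half_plane \<Longrightarrow> sc_ext xs (Some z) = sc_map xs z"
  unfolding sc_ext_def
proof (intro half_plane_extension_eq)
  assume z: "z \<in> upper_half_plane"
  then have "isCont (sc_map xs) z" using DERIV_isCont sc_map_derivative by blast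
  then show "(sc_map xs \<longlongrightarrow> sc_map xs z) (approach (Some z) upper_half_plane)"
    using at_within_open[OF z open_upper_half_plane] by (simp add: isCont_def approach_def)
qed (use upper_subset_closed_half_plane in \<open>auto simp: compact_half_plane_def\<close>)

lemma sc_map_tendsto_infinity:
  assumes "sc_degree xs \<le> -5/4"
  shows "(sc_map xs \<longlongrightarrow> sc_ext xs None) (inf at_infinity (principal upper_half_plane))"
proof -
  obtain l where l: "(sc_map xs \<longlongrightarrow> l) (inf at_infinity (principal upper_half_plane))"
    using primitive_limit_at_infinity[OF sc_map_derivative sc_form_bigo_infinity assms] by blast
  moreover have "sc_ext xs None = l"
    unfolding sc_ext_def using l
    by (intro half_plane_extension_eq) (auto simp: approach_def compact_half_plane_def)
  ultimately show ?thesis by simp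
qed

lemma sc_ext_continuous: "continuous_on (sc_domain xs) (\<lambda>z. sc_ext xs (Some z))"
  by (rule limit_extension_continuous_on[OF sc_map_tendsto])
     (auto simp: sc_domain_def intro!: at_within_upper_half_plane_nontrivial)

lemma sc_ext_tendsto_infinity:
  assumes "sc_degree xs \<le> -5/4"
  shows "((\<lambda>z. sc_ext xs (Some z)) \<longlongrightarrow> sc_ext xs None) (inf at_infinity (principal (sc_domain xs)))"
  by (rule limit_extension_at_infinity[OF sc_map_tendsto _ sc_map_tendsto_infinity[OF assms]])
     (auto simp: sc_domain_def intro!: at_within_upper_half_plane_nontrivial)

lemma sc_form_tendsto:
  assumes "p \<notin> sc_points xs"
  shows "(sc_form xs \<longlongrightarrow> sc_form xs (of_real p)) (at (of_real p) within upper_half_plane)"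
proof -
  have "of_real p \<in> closed_half_plane - of_real ` sc_points xs"
    using assms by (auto simp: closed_half_plane_def)
  then have "(sc_form xs \<longlongrightarrow> sc_form xs (of_real p)) (at (of_real p) within (closed_half_plane - of_real ` sc_points xs))"
    using sc_form_continuous unfolding continuous_on_def by blast
  then show ?thesis
    by (rule tendsto_within_subset) (auto simp: upper_half_plane_def closed_half_plane_def)
qed

lemma finite_sc_singular: "finite {x. sc_order xs x < -3/4}"
proof (rule finite_subset[OF _ finite_sc_points[of xs]])
  show "{x. sc_order xs x < -3/4} \<subseteq> sc_points xs"
  proof
    fix x assume "x \<in> {x. sc_order xs x < -3/4}"
    then show "x \<in> sc_points xs" using sc_order_zero[of x xs] by fastforce
  qed
qed

lemma sc_domain_I:
  assumes "z \<in> closed_half_plane" "z \<notin> of_real ` sc_points xs"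
  shows "z \<in> sc_domain xs"
proof -
  have "z \<noteq> of_real x" if "sc_order xs x < -3/4" for x
  proof -
    have "x \<in> sc_points xs" using that sc_order_zero[of x xs] by fastforce
    then show ?thesis using assms by blast
  qed
  then show ?thesis using assms by (auto simp: sc_domain_def)
qed

lemma sc_ext_derivative:
  assumes "p \<notin> sc_points xs"
  shows "((\<lambda>z. sc_ext xs (Some z)) has_field_derivative sc_form xs (of_real p)) (at (of_real p) within closed_half_plane)"
proof (rule primitive_boundary_derivative[OF sc_map_derivative sc_form_tendsto[OF assms]])
  show "open (- (of_real ` sc_points xs) :: complex set)"
    by (intro open_Compl finite_imp_closed finite_imageI finite_sc_points)
  fix z :: complex assume z: "z \<in> - of_real ` sc_points xs \<inter> closed_half_plane"
  then have "z \<in> sc_domain xs" by (intro sc_domain_I) auto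
  then show "(sc_map xs \<longlongrightarrow> sc_ext xs (Some z)) (at z within upper_half_plane)" by (rule sc_map_tendsto)
qed (use assms in auto)

lemma sc_ext_vector_derivative:
  assumes "t \<notin> sc_points xs"
  shows "((\<lambda>t. sc_ext xs (Some (of_real t))) has_vector_derivative
    cis (pi * sc_turn xs t) * of_real (sc_abs xs t)) (at t)"
proof -
  have "((\<lambda>z. sc_ext xs (Some z)) has_field_derivative sc_form xs (of_real t)) (at (of_real t) within range of_real)"
    by (rule DERIV_subset[OF sc_ext_derivative[OF assms]]) (auto simp: closed_half_plane_def)
  then have "((\<lambda>z. sc_ext xs (Some z)) \<circ> of_real has_vector_derivative 1 * sc_form xs (of_real t)) (at t)"
    by (intro field_vector_diff_chain_within)
       (auto simp: has_vector_derivative_def fun_eq_iff scaleR_conv_of_real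
          intro!: bounded_linear_imp_has_derivative[OF bounded_linear_of_real, THEN has_derivative_eq_rhs])
  then show ?thesis by (simp add: o_def sc_form_of_real[OF assms])
qed

text \<open>The points of the boundary circle at which the map extends continuously.\<close>

definition sc_regular :: "(real \<times> real) list \<Rightarrow> ereal \<Rightarrow> bool" where
  "sc_regular xs \<xi> \<longleftrightarrow> (if \<bar>\<xi>\<bar> = \<infinity> then sc_degree xs \<le> -5/4 else sc_order xs (real_of_ereal \<xi>) \<ge> -3/4)"

lemma sc_ext_real_tendsto:
  "sc_order xs p \<ge> -3/4 \<Longrightarrow> ((\<lambda>t. sc_ext xs (Some (of_real t))) \<longlongrightarrow> sc_ext xs (Some (of_real p))) (at p)"
  "sc_degree xs \<le> -5/4 \<Longrightarrow> ((\<lambda>t. sc_ext xs (Some (of_real t))) \<longlongrightarrow> sc_ext xs None) at_top"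
  "sc_degree xs \<le> -5/4 \<Longrightarrow> ((\<lambda>t. sc_ext xs (Some (of_real t))) \<longlongrightarrow> sc_ext xs None) at_bot"
proof -
  let ?B = "{x. sc_order xs x < -3/4}"
  assume p: "sc_order xs p \<ge> -3/4"
  then have "of_real p \<in> sc_domain xs" by (auto simp: sc_domain_def closed_half_plane_def)
  then have 1: "((\<lambda>z. sc_ext xs (Some z)) \<longlongrightarrow> sc_ext xs (Some (of_real p))) (at (of_real p) within sc_domain xs)"
    using sc_ext_continuous unfolding continuous_on_def by blast
  have "open (- ?B)" using finite_sc_singular by (intro open_Compl finite_imp_closed)
  moreover have "p \<in> - ?B" using p by auto
  ultimately have "\<forall>\<^sub>F t in at p. t \<in> - ?B" by (rule eventually_at_in_open')
  then have 2: "\<forall>\<^sub>F t in at p. of_real t \<in> sc_domain xs \<and> (of_real t::complex) \<noteq> of_real p"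
    using eventually_neq_at_within[of p p UNIV]
    by eventually_elim (auto simp: sc_domain_def closed_half_plane_def)
  have "filterlim (of_real :: real \<Rightarrow> complex) (at (of_real p) within sc_domain xs) (at p)"
    unfolding filterlim_at using 2 by (auto intro!: tendsto_intros)
  from filterlim_compose[OF 1 this]
  show "((\<lambda>t. sc_ext xs (Some (of_real t))) \<longlongrightarrow> sc_ext xs (Some (of_real p))) (at p)" .
next
  let ?B = "{x. sc_order xs x < -3/4}"
  assume d: "sc_degree xs \<le> -5/4"
  note 1 = sc_ext_tendsto_infinity[OF d]
  obtain R where R: "\<And>x. x \<in> ?B \<Longrightarrow> norm x \<le> R" using finite_imp_bounded[OF finite_sc_singular] by (auto simp: bounded_iff)
  have ev: "\<forall>\<^sub>F t in at_infinity. (of_real t :: complex) \<in> sc_domain xs"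
    using R unfolding eventually_at_infinity by (intro exI[of _ "R + 1"]) (force simp: sc_domain_def closed_half_plane_def)
  have lim: "filterlim (of_real :: real \<Rightarrow> complex) (inf at_infinity (principal (sc_domain xs))) at_infinity"
    unfolding filterlim_inf filterlim_principal
    using ev filterlim_norm_at_top[where 'a = real] by (auto simp: filterlim_at_infinity_conv_norm_at_top real_norm_def[abs_def])
  show "((\<lambda>t. sc_ext xs (Some (of_real t))) \<longlongrightarrow> sc_ext xs None) at_top"
    using filterlim_compose[OF 1 lim] by (rule tendsto_mono[OF at_top_le_at_infinity])
  show "((\<lambda>t. sc_ext xs (Some (of_real t))) \<longlongrightarrow> sc_ext xs None) at_bot"
    using filterlim_compose[OF 1 lim] by (rule tendsto_mono[OF at_bot_le_at_infinity])
qed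

lemma sc_ext_one_sided:
  assumes "sc_regular xs \<xi>"
  shows "\<xi> \<noteq> \<infinity> \<Longrightarrow> ((\<lambda>x. sc_ext xs (Some (of_real (real_of_ereal x)))) \<longlongrightarrow> sc_ext xs (boundary_point \<xi>)) (at_right \<xi>)"
    and "\<xi> \<noteq> -\<infinity> \<Longrightarrow> ((\<lambda>x. sc_ext xs (Some (of_real (real_of_ereal x)))) \<longlongrightarrow> sc_ext xs (boundary_point \<xi>)) (at_left \<xi>)"
proof -
  let ?F = "\<lambda>t. sc_ext xs (Some (of_real t))"
  have r: "(?F \<longlongrightarrow> sc_ext xs (boundary_point (ereal p))) (at p within S)" if "\<xi> = ereal p" for p S
    using sc_ext_real_tendsto(1)[of xs p] assms that
    by (auto simp: sc_regular_def boundary_point_def intro: tendsto_within_subset)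
  have "((?F \<circ> real_of_ereal) \<longlongrightarrow> sc_ext xs (boundary_point \<xi>)) (at_right \<xi>)" if "\<xi> \<noteq> \<infinity>"
  proof (cases \<xi>)
    case (real p)
    then show ?thesis using r[OF real, of "{p<..}"] by (simp only: ereal_tendsto_simps)
  next
    case MInf
    then show ?thesis using sc_ext_real_tendsto(3)[of xs] assms
      by (simp add: ereal_tendsto_simps sc_regular_def boundary_point_def del: o_apply)
  qed (use that in simp)
  then show "((\<lambda>x. ?F (real_of_ereal x)) \<longlongrightarrow> sc_ext xs (boundary_point \<xi>)) (at_right \<xi>)" if "\<xi> \<noteq> \<infinity>"
    using that by (simp add: o_def)
  have "((?F \<circ> real_of_ereal) \<longlongrightarrow> sc_ext xs (boundary_point \<xi>)) (at_left \<xi>)" if "\<xi> \<noteq> -\<infinity>"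
  proof (cases \<xi>)
    case (real p)
    then show ?thesis using r[OF real, of "{..<p}"] by (simp only: ereal_tendsto_simps)
  next
    case PInf
    then show ?thesis using sc_ext_real_tendsto(2)[of xs] assms
      by (simp add: ereal_tendsto_simps sc_regular_def boundary_point_def del: o_apply)
  qed (use that in simp)
  then show "((\<lambda>x. ?F (real_of_ereal x)) \<longlongrightarrow> sc_ext xs (boundary_point \<xi>)) (at_left \<xi>)" if "\<xi> \<noteq> -\<infinity>"
    using that by (simp add: o_def)
qed

definition sc_side :: "(real \<times> real) list \<Rightarrow> ereal \<Rightarrow> ereal \<Rightarrow> real" where
  "sc_side xs p q = (LBINT t=p..q. sc_abs xs t)"

text \<open>Along an arc without singular points the integrand has constant argument. After a
  rotation the real part of the map is therefore a primitive of the modulus, and the imaginary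
  part is constant.\<close>

lemma sc_side:
  assumes "p < q" and reg: "sc_regular xs p" "sc_regular xs q"
    and arc: "\<And>t. p < ereal t \<Longrightarrow> ereal t < q \<Longrightarrow> t \<notin> sc_points xs \<and> sc_turn xs t = \<tau>"
  shows "set_integrable lborel (einterval p q) (sc_abs xs)"
    and "sc_ext xs (boundary_point q) - sc_ext xs (boundary_point p) = cis (pi * \<tau>) * of_real (sc_side xs p q)"
proof -
  define c where "c = cis (- (pi * \<tau>))"
  define F where "F t = c * sc_ext xs (Some (of_real t))" for t
  have F: "(F has_vector_derivative of_real (sc_abs xs t)) (at t)" if "p < ereal t" "ereal t < q" for t
  proof -
    have "(F has_vector_derivative c * (cis (pi * sc_turn xs t) * of_real (sc_abs xs t))) (at t)"
      unfolding F_def using arc[OF that]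
      by (intro has_vector_derivative_mult_right sc_ext_vector_derivative) simp
    moreover have "c * (cis (pi * sc_turn xs t) * of_real (sc_abs xs t)) = of_real (sc_abs xs t)"
      using arc[OF that] by (simp add: c_def cis_mult flip: mult.assoc)
    ultimately show ?thesis by simp
  qed
  have re: "DERIV (\<lambda>t. Re (F t)) t :> sc_abs xs t" and im: "DERIV (\<lambda>t. Im (F t)) t :> 0"
    if "p < ereal t" "ereal t < q" for t
    using F[OF that] has_vector_derivative_complex_iff
    by (auto simp: has_real_derivative_iff_has_vector_derivative bounded_linear.has_vector_derivative[OF bounded_linear_Re]
        dest: bounded_linear.has_vector_derivative[OF bounded_linear_Re] bounded_linear.has_vector_derivative[OF bounded_linear_Im])
  have pq: "p \<noteq> \<infinity>" "q \<noteq> -\<infinity>" using assms(1) by auto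
  have lp: "((\<lambda>x. F (real_of_ereal x)) \<longlongrightarrow> c * sc_ext xs (boundary_point p)) (at_right p)"
    unfolding F_def by (intro tendsto_intros sc_ext_one_sided reg pq)
  have lq: "((\<lambda>x. F (real_of_ereal x)) \<longlongrightarrow> c * sc_ext xs (boundary_point q)) (at_left q)"
    unfolding F_def by (intro tendsto_intros sc_ext_one_sided reg pq)
  note lim = tendsto_Re[OF lp] tendsto_Re[OF lq] tendsto_Im[OF lp] tendsto_Im[OF lq]
  have ftc: "set_integrable lborel (einterval p q) (sc_abs xs)"
    "(LBINT t=p..q. sc_abs xs t) = Re (c * sc_ext xs (boundary_point q)) - Re (c * sc_ext xs (boundary_point p))"
    using arc lim
    by (intro interval_integral_FTC_nonneg[OF assms(1), where F = "\<lambda>t. Re (F t)", OF re];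
        auto simp: o_def sc_abs_nonneg intro!: sc_abs_continuous simp del: Re_complex_div_eq_0 times_complex.sel)+
  have "(LBINT t=p..q. 0) = Im (c * sc_ext xs (boundary_point q)) - Im (c * sc_ext xs (boundary_point p))"
    using lim
    by (intro interval_integral_FTC_nonneg[OF assms(1), where F = "\<lambda>t. Im (F t)", OF im];
        auto simp: o_def simp del: times_complex.sel)
  then have "c * (sc_ext xs (boundary_point q) - sc_ext xs (boundary_point p)) = of_real (sc_side xs p q)"
    using ftc(2) by (simp add: complex_eq_iff sc_side_def algebra_simps)
  then have "cis (pi * \<tau>) * c * (sc_ext xs (boundary_point q) - sc_ext xs (boundary_point p))
      = cis (pi * \<tau>) * of_real (sc_side xs p q)" by (simp add: mult.assoc)
  moreover have "cis (pi * \<tau>) * c = 1" by (simp add: c_def cis_mult)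
  ultimately show "sc_ext xs (boundary_point q) - sc_ext xs (boundary_point p) = cis (pi * \<tau>) * of_real (sc_side xs p q)"
    by simp
  show "set_integrable lborel (einterval p q) (sc_abs xs)" by (rule ftc(1))
qed


section \<open>A maximum principle\<close>

text \<open>The maximum modulus principle for \<open>exp F\<close> on a half disc outside which \<open>F\<close> is close to
  \<open>L\<close>; that \<open>Re L \<le> M\<close> follows from the bound on the real axis.\<close>

lemma half_plane_maximum_principle:
  assumes hol: "F holomorphic_on upper_half_plane" and cont: "continuous_on closed_half_plane F"
    and inf: "(F \<longlongrightarrow> L) (inf at_infinity (principal closed_half_plane))"
    and bd: "\<And>x. Re (F (of_real x)) \<le> M" and z: "z \<in> closed_half_plane"
  shows "Re (F z) \<le> M"
proof (rule field_le_epsilon)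
  fix e :: real assume e: "e > 0"
  have "\<forall>\<^sub>F z in inf at_infinity (principal closed_half_plane). dist (F z) L < e/2"
    by (rule tendstoD[OF inf]) (use e in simp)
  then obtain R where R: "\<And>z. z \<in> closed_half_plane \<Longrightarrow> norm z \<ge> R \<Longrightarrow> dist (F z) L < e/2"
    by (auto simp: eventually_inf_principal eventually_at_infinity)
  have out: "Re (F w) \<le> M + e" if w: "w \<in> closed_half_plane" "norm w \<ge> R" for w
  proof -
    have "dist (F w) L < e/2" "dist (F (of_real (max R 0))) L < e/2"
      using R w by (auto simp: closed_half_plane_def)
    then have "dist (F w) (F (of_real (max R 0))) < e"
      by (metis dist_commute dist_triangle_half_l)
    then have "Re (F w) - Re (F (of_real (max R 0))) < e"
      using abs_Re_le_cmod[of "F w - F (of_real (max R 0))"] by (simp add: dist_norm)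
    then show ?thesis using bd[of "max R 0"] by simp
  qed
  show "Re (F z) \<le> M + e"
  proof (cases "z \<in> upper_half_plane \<and> norm z < R")
    case False
    then show ?thesis
    proof (cases "norm z < R")
      case True
      then obtain x where "z = of_real x" using False z by (auto elim: closed_half_plane_cases)
      then show ?thesis using bd[of x] e by simp
    qed (use out z in auto)
  next
    case True
    let ?D = "upper_half_plane \<inter> ball 0 R"
    have op: "open ?D" by (intro open_Int open_upper_half_plane open_ball)
    have cl: "closure ?D \<subseteq> closed_half_plane \<inter> cball 0 R"
      using upper_subset_closed_half_plane
      by (intro closure_minimal closed_Int closed_closed_half_plane closed_cball) auto
    have "norm (exp (F z)) \<le> exp (M + e)"
    proof (rule maximum_modulus_frontier[where f = "\<lambda>z. exp (F z)" and S = ?D])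
      show "(\<lambda>z. exp (F z)) holomorphic_on interior ?D"
        unfolding interior_open[OF op]
        by (intro holomorphic_on_exp' holomorphic_on_subset[OF hol]) auto
      show "continuous_on (closure ?D) (\<lambda>z. exp (F z))"
        using cl by (auto intro!: continuous_intros continuous_on_subset[OF cont])
      show "bounded ?D" by (rule bounded_subset[OF bounded_ball]) auto
      fix w assume "w \<in> frontier ?D"
      then have w: "w \<in> closure ?D" "w \<notin> ?D" unfolding frontier_def interior_open[OF op] by auto
      have "Re (F w) \<le> M + e"
      proof (cases "norm w \<ge> R")
        case False
        then have "w \<notin> upper_half_plane" "w \<in> closed_half_plane" using w cl by auto
        then obtain x where "w = of_real x" by (auto elim: closed_half_plane_cases)
        then show ?thesis using bd[of x] e by simp
      qed (use out w cl in auto)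
      then show "norm (exp (F w)) \<le> exp (M + e)" by simp
    qed (use True in auto)
    then show ?thesis by simp
  qed
qed

(* In this theory $ is the component of a vector, not a coefficient of a power series. *)
no_notation fps_nth (infixl "$" 75)

section \<open>Weierstrass representation\<close>

text \<open>The map \<open>X\<close> is locally the real part of a primitive of \<open>\<omega>\<close>.\<close>

definition weierstrass_rep :: "(complex \<Rightarrow> real^3) \<Rightarrow> (complex \<Rightarrow> complex^3) \<Rightarrow> complex set \<Rightarrow> bool" where
  "weierstrass_rep X \<omega> U \<longleftrightarrow> open U \<and> (\<forall>k. (\<lambda>z. \<omega> z $ k) holomorphic_on U) \<and>
     (\<forall>z\<in>U. (X has_derivative (\<lambda>\<delta>. \<chi> k. Re (\<omega> z $ k * \<delta>))) (at z))"

lemma has_derivative_vec_lambda: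
  fixes f :: "'a::real_normed_vector \<Rightarrow> 'n::finite \<Rightarrow> real"
  assumes "\<And>k. ((\<lambda>x. f x k) has_derivative (\<lambda>h. f' h k)) (at x)"
  shows "((\<lambda>x. \<chi> k. f x k) has_derivative (\<lambda>h. \<chi> k. f' h k)) (at x)"
proof (subst has_derivative_componentwise_within, intro ballI)
  fix i :: "real^'n" assume "i \<in> Basis"
  then obtain k where "i = axis k 1" by (auto simp: Basis_vec_def)
  then show "((\<lambda>x. (\<chi> k. f x k) \<bullet> i) has_derivative (\<lambda>x. (\<chi> k. f' x k) \<bullet> i)) (at x)"
    using assms by (simp add: inner_axis)
qed

lemma has_derivative_Re_mult:
  assumes "(f has_field_derivative D) (at z)"
  shows "((\<lambda>z. Re (f z)) has_derivative (\<lambda>\<delta>. Re (D * \<delta>))) (at z)"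
  using has_derivative_Re[OF assms[unfolded has_field_derivative_def]] .

lemma weierstrass_rep_partials:
  assumes "weierstrass_rep X \<omega> U" "z \<in> U"
  shows "partial_u X z = (\<chi> k. Re (\<omega> z $ k))" "partial_v X z = (\<chi> k. - Im (\<omega> z $ k))"
    "X differentiable at z"
proof -
  have d: "(X has_derivative (\<lambda>\<delta>. \<chi> k. Re (\<omega> z $ k * \<delta>))) (at z)"
    using assms by (auto simp: weierstrass_rep_def)
  from frechet_derivative_at[OF d] have "frechet_derivative X (at z) = (\<lambda>\<delta>. \<chi> k. Re (\<omega> z $ k * \<delta>))" by simp
  then show "partial_u X z = (\<chi> k. Re (\<omega> z $ k))" "partial_v X z = (\<chi> k. - Im (\<omega> z $ k))"
    by (auto simp: partial_u_def partial_v_def)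
  show "X differentiable at z" using d by (auto simp: differentiable_def)
qed

lemma weierstrass_rep_transform:
  fixes F :: "complex \<Rightarrow> complex^3"
  assumes "open U" "\<And>k. (\<lambda>z. F z $ k) holomorphic_on U" "\<And>z. z \<in> U \<Longrightarrow> Y z = (\<chi> k. Re (F z $ k))"
  shows "weierstrass_rep Y (\<lambda>z. \<chi> k. deriv (\<lambda>z. F z $ k) z) U"
  unfolding weierstrass_rep_def
proof (intro conjI allI ballI)
  fix k show "(\<lambda>z. (\<chi> k. deriv (\<lambda>z. F z $ k) z) $ k) holomorphic_on U"
    using assms by (auto intro!: holomorphic_deriv)
next
  fix z assume z: "z \<in> U"
  have "((\<lambda>z. \<chi> k. Re (F z $ k)) has_derivative (\<lambda>\<delta>. \<chi> k. Re (deriv (\<lambda>z. F z $ k) z * \<delta>))) (at z)"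
    using assms z by (intro has_derivative_vec_lambda has_derivative_Re_mult holomorphic_derivI)
  then have "(Y has_derivative (\<lambda>\<delta>. \<chi> k. Re (deriv (\<lambda>z. F z $ k) z * \<delta>))) (at z)"
    by (rule has_derivative_transform_within_open[OF _ assms(1) z]) (simp add: assms(3))
  then show "(Y has_derivative (\<lambda>\<delta>. \<chi> k. Re ((\<chi> k. deriv (\<lambda>z. F z $ k) z) $ k * \<delta>))) (at z)" by simp
qed (rule assms)

text \<open>The partial derivatives are again real parts of holomorphic maps; thus the formulas for
  first derivatives also give the second ones.\<close>

lemma weierstrass_rep_partial:
  assumes "weierstrass_rep X \<omega> U"
  shows "weierstrass_rep (partial_u X) (\<lambda>z. \<chi> k. deriv (\<lambda>z. \<omega> z $ k) z) U"
    "weierstrass_rep (partial_v X) (\<lambda>z. \<chi> k. \<i> * deriv (\<lambda>z. \<omega> z $ k) z) U"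
proof -
  have o: "open U" and h: "\<And>k. (\<lambda>z. \<omega> z $ k) holomorphic_on U"
    using assms by (auto simp: weierstrass_rep_def)
  show "weierstrass_rep (partial_u X) (\<lambda>z. \<chi> k. deriv (\<lambda>z. \<omega> z $ k) z) U"
    by (rule weierstrass_rep_transform[OF o h weierstrass_rep_partials(1)[OF assms]])
  have "weierstrass_rep (partial_v X) (\<lambda>z. \<chi> k. deriv (\<lambda>z. (\<chi> k. \<i> * \<omega> z $ k) $ k) z) U"
    by (rule weierstrass_rep_transform[OF o])
       (auto intro!: holomorphic_intros h simp: weierstrass_rep_partials(2)[OF assms])
  moreover have "deriv (\<lambda>z. (\<chi> k. \<i> * \<omega> z $ k) $ k) z = \<i> * deriv (\<lambda>z. \<omega> z $ k) z" if "z \<in> U" for z k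
    using holomorphic_derivI[OF h o that, of k] by (auto intro!: DERIV_imp_deriv derivative_eq_intros)
  ultimately show "weierstrass_rep (partial_v X) (\<lambda>z. \<chi> k. \<i> * deriv (\<lambda>z. \<omega> z $ k) z) U"
    using h o by (auto simp: weierstrass_rep_def intro!: holomorphic_intros holomorphic_deriv)
qed

text \<open>The real and the imaginary part of the null equation are the two conditions of
  conformality.\<close>

lemma null_vector_conformal:
  fixes w :: "complex^3"
  assumes "(w$1)\<^sup>2 + (w$2)\<^sup>2 + (w$3)\<^sup>2 = 0"
  defines "u \<equiv> (\<chi> k. Re (w $ k)) :: real^3" and "v \<equiv> (\<chi> k. - Im (w $ k)) :: real^3"
  shows "u \<bullet> u = v \<bullet> v" "u \<bullet> v = 0" "w \<noteq> 0 \<Longrightarrow> u \<noteq> 0" "w \<noteq> 0 \<Longrightarrow> u \<times> v \<noteq> 0"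
proof -
  have "Re ((w$1)\<^sup>2 + (w$2)\<^sup>2 + (w$3)\<^sup>2) = 0" "Im ((w$1)\<^sup>2 + (w$2)\<^sup>2 + (w$3)\<^sup>2) = 0" using assms(1) by simp_all
  then show 1: "u \<bullet> u = v \<bullet> v" and 2: "u \<bullet> v = 0"
    by (simp_all add: u_def v_def inner_vec_def sum_3 power2_eq_square algebra_simps)
  show 3: "u \<noteq> 0" if "w \<noteq> 0"
  proof
    assume u: "u = 0"
    then have v: "v = 0" using 1 by simp
    have "w $ k = 0" for k
      using arg_cong[OF u, of "\<lambda>x. x $ k"] arg_cong[OF v, of "\<lambda>x. x $ k"]
      by (simp add: u_def v_def complex_eq_iff)
    then show False using that by (simp add: vec_eq_iff)
  qed
  show "u \<times> v \<noteq> 0" if "w \<noteq> 0"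
  proof
    assume "u \<times> v = 0"
    then have "(norm u)\<^sup>2 * (norm v)\<^sup>2 = 0" using norm_cross[of u v] 2 by simp
    then show False using 1 3[OF that] by (auto simp: inner_eq_zero_iff)
  qed
qed

text \<open>The map is conformal because \<open>\<omega>\<close> is a null vector, and harmonic because it is the real
  part of a holomorphic map; a conformal harmonic map has mean curvature zero.\<close>

lemma weierstrass_conformal_minimal:
  assumes rep: "weierstrass_rep X \<omega> U"
    and null: "\<And>z. z \<in> U \<Longrightarrow> (\<omega> z $ 1)\<^sup>2 + (\<omega> z $ 2)\<^sup>2 + (\<omega> z $ 3)\<^sup>2 = 0"
    and nz: "\<And>z. z \<in> U \<Longrightarrow> \<omega> z \<noteq> 0"
  shows "conformal_minimal_immersion X U"
proof -
  let ?d = "\<lambda>z k. deriv (\<lambda>z. \<omega> z $ k) z"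
  note repu = weierstrass_rep_partial(1)[OF rep] and repv = weierstrass_rep_partial(2)[OF rep]
  note p = weierstrass_rep_partials[OF rep]
  note pu = weierstrass_rep_partials[OF repu] and pv = weierstrass_rep_partials[OF repv]
  have cont: "continuous_on U (\<lambda>z. ?d z k)" for k
    using rep by (auto simp: weierstrass_rep_def intro!: holomorphic_on_imp_continuous_on holomorphic_deriv)
  have "continuous_on U (partial_u (partial_u X))"
    by (rule continuous_on_eq[OF _ pu(1)[symmetric]]) (auto intro!: continuous_intros cont)
  moreover have "continuous_on U (partial_v (partial_u X))"
    by (rule continuous_on_eq[OF _ pu(2)[symmetric]]) (auto intro!: continuous_intros cont)
  moreover have "continuous_on U (partial_u (partial_v X))"
    by (rule continuous_on_eq[OF _ pv(1)[symmetric]]) (auto intro!: continuous_intros cont)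
  moreover have "continuous_on U (partial_v (partial_v X))"
    by (rule continuous_on_eq[OF _ pv(2)[symmetric]]) (auto intro!: continuous_intros cont)
  ultimately have C2: "C2_on X U" using p(3) pu(3) pv(3) by (auto simp: C2_on_def)
  show ?thesis
    unfolding conformal_minimal_immersion_def
  proof (intro conjI ballI C2)
    fix z assume z: "z \<in> U"
    note n = null_vector_conformal[OF null[OF z], folded p(1)[OF z] p(2)[OF z]]
    show "partial_u X z \<noteq> 0" using n(3) nz[OF z] by blast
    show "norm (partial_u X z) = norm (partial_v X z)" using n(1) by (simp add: norm_eq_sqrt_inner)
    show "partial_u X z \<bullet> partial_v X z = 0" by (rule n(2))
    have "partial_v (partial_v X) z = - partial_u (partial_u X) z"
      by (simp add: pu[OF z] pv[OF z] vec_eq_iff)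
    then show "mean_curvature X z = 0"
      unfolding mean_curvature_def Let_def n(2) n(1) by simp
  qed
qed

text \<open>A nonzero null vector has linearly independent real and imaginary parts; so the normal
  vector extends continuously to every boundary point at which the form has a nonzero limit.\<close>

lemma weierstrass_normal_limit:
  fixes w :: "complex^3"
  assumes rep: "weierstrass_rep X \<omega> U"
    and lim: "\<And>k. ((\<lambda>z. \<omega> z $ k) \<longlongrightarrow> w $ k) (at p within U)"
    and null: "(w$1)\<^sup>2 + (w$2)\<^sup>2 + (w$3)\<^sup>2 = 0" and nz: "w \<noteq> 0"
  shows "(unit_normal X \<longlongrightarrow> sgn ((\<chi> k. Re (w $ k)) \<times> (\<chi> k. - Im (w $ k)))) (at p within U)"
proof -
  let ?u = "\<lambda>w. (\<chi> k. Re (w $ k)) :: real^3" and ?v = "\<lambda>w. (\<chi> k. - Im (w $ k)) :: real^3"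
  have "(\<omega> \<longlongrightarrow> w) (at p within U)" by (rule vec_tendstoI) (rule lim)
  then have "((\<lambda>z. ?u (\<omega> z) \<times> ?v (\<omega> z)) \<longlongrightarrow> ?u w \<times> ?v w) (at p within U)"
    by (intro vec_tendstoI) (auto simp: cross3_def vector_def forall_3 intro!: tendsto_eq_intros)
  then have "((\<lambda>z. sgn (?u (\<omega> z) \<times> ?v (\<omega> z))) \<longlongrightarrow> sgn (?u w \<times> ?v w)) (at p within U)"
    using null_vector_conformal(4)[OF null nz] by (intro tendsto_sgn)
  moreover have "\<forall>\<^sub>F z in at p within U. sgn (?u (\<omega> z) \<times> ?v (\<omega> z)) = unit_normal X z"
    unfolding eventually_at_topological
    by (intro exI[of _ UNIV]) (simp add: unit_normal_def weierstrass_rep_partials[OF rep])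
  ultimately show ?thesis by (rule Lim_transform_eventually)
qed

lemma weierstrass_form_components [simp]:
  "weierstrass_form \<alpha> \<beta> \<gamma> $ 1 = (\<beta> - \<alpha>) / 2" "weierstrass_form \<alpha> \<beta> \<gamma> $ 2 = (\<i> / 2) * (\<beta> + \<alpha>)"
  "weierstrass_form \<alpha> \<beta> \<gamma> $ 3 = \<gamma>"
  by (simp_all add: weierstrass_form_def)

lemma weierstrass_form_null:
  assumes "\<alpha> * \<beta> = \<gamma>\<^sup>2"
  shows "(weierstrass_form \<alpha> \<beta> \<gamma> $ 1)\<^sup>2 + (weierstrass_form \<alpha> \<beta> \<gamma> $ 2)\<^sup>2 + (weierstrass_form \<alpha> \<beta> \<gamma> $ 3)\<^sup>2 = 0"
  using assms by (simp add: power2_eq_square field_simps)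

lemma weierstrass_form_nonzero: "\<gamma> \<noteq> 0 \<Longrightarrow> weierstrass_form \<alpha> \<beta> \<gamma> \<noteq> 0"
  using weierstrass_form_components(3)[of \<alpha> \<beta> \<gamma>] by (metis zero_index)

section \<open>The period problem\<close>

lemma sc_turn_const:
  assumes "\<And>x. x \<in> sc_points xs \<Longrightarrow> ereal x \<le> p \<or> q \<le> ereal x"
    and "p < ereal t" "ereal t < q" "p < ereal t'" "ereal t' < q"
  shows "sc_turn xs t = sc_turn xs t'"
  using assms(1)
proof (induction xs)
  case (Cons y xs)
  obtain x e where y: "y = (x, e)" by (cases y)
  have "ereal x \<le> p \<or> q \<le> ereal x" using Cons(2)[of x] by (simp add: y sc_points_def)
  then have "t < x \<longleftrightarrow> t' < x"
  proof
    assume "ereal x \<le> p"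
    then have "ereal x < ereal t" "ereal x < ereal t'" by (rule le_less_trans[OF _ assms(2)], rule le_less_trans[OF _ assms(4)])
    then show ?thesis by simp
  next
    assume "q \<le> ereal x"
    then have "ereal t < ereal x" "ereal t' < ereal x" by (rule less_le_trans[OF assms(3)], rule less_le_trans[OF assms(5)])
    then show ?thesis by simp
  qed
  moreover have "sc_turn xs t = sc_turn xs t'" using Cons by (auto simp: sc_points_def)
  ultimately show ?case by (simp add: y sc_turn_def)
qed (simp add: sc_turn_def)

lemma sc_side_at:
  assumes t: "p < ereal t" "ereal t < q" and reg: "sc_regular xs p" "sc_regular xs q"
    and pts: "\<forall>x\<in>sc_points xs. ereal x \<le> p \<or> q \<le> ereal x"
  shows "set_integrable lborel (einterval p q) (sc_abs xs)"
    and "sc_ext xs (boundary_point q) - sc_ext xs (boundary_point p)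
      = cis (pi * sc_turn xs t) * of_real (LBINT x:einterval p q. sc_abs xs x)"
proof -
  have pq: "p < q" using t by (rule less_trans)
  have *: "s \<notin> sc_points xs \<and> sc_turn xs s = sc_turn xs t" if s: "p < ereal s" "ereal s < q" for s
  proof
    show "s \<notin> sc_points xs" using pts s by (meson not_less)
    show "sc_turn xs s = sc_turn xs t" using sc_turn_const[of xs p q s t] pts s t by blast
  qed
  show "set_integrable lborel (einterval p q) (sc_abs xs)" by (rule sc_side(1)[OF pq reg *])
  show "sc_ext xs (boundary_point q) - sc_ext xs (boundary_point p)
      = cis (pi * sc_turn xs t) * of_real (LBINT x:einterval p q. sc_abs xs x)"
    using sc_side(2)[OF pq reg *] pq by (simp add: sc_side_def interval_lebesgue_integral_le_eq)
qed

lemmas sc_integrable = sc_side_at(1)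

lemma sc_abs_measurable [measurable]: "sc_abs xs \<in> borel_measurable borel"
proof (induction xs)
  case (Cons y xs)
  obtain x e where y: "y = (x, e)" by (cases y)
  have "(\<lambda>t. \<bar>t - x\<bar> powr e * sc_abs xs t) \<in> borel_measurable borel" using Cons by measurable
  then show ?case by (simp add: y sc_abs_Cons[abs_def])
qed (simp add: sc_abs_def[abs_def])

lemma set_integral_ge_const:
  fixes f :: "real \<Rightarrow> real"
  assumes int: "set_integrable lborel S f" and "{p<..<q} \<subseteq> S" "p \<le> q"
    and "\<And>x. x \<in> S \<Longrightarrow> 0 \<le> f x" "\<And>x. x \<in> {p<..<q} \<Longrightarrow> m \<le> f x"
  shows "m * (q - p) \<le> (LBINT x:S. f x)"
proof -
  have i: "set_integrable lborel {p<..<q} f" by (rule set_integrable_subset[OF int _ assms(2)]) simp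
  have "m * (q - p) = (LBINT x:{p<..<q}. m)"
    using assms(3) by (simp add: set_lebesgue_integral_def)
  also have "\<dots> \<le> (LBINT x:{p<..<q}. f x)"
    by (rule set_integral_mono) (use i assms in \<open>auto simp: set_integrable_def\<close>)
  also have "\<dots> \<le> (LBINT x:S. f x)"
    unfolding set_lebesgue_integral_def using i int assms
    by (intro integral_mono) (auto simp: set_integrable_def indicator_def)
  finally show ?thesis .
qed

lemma set_integral_dominated_convergence:
  fixes f :: "nat \<Rightarrow> real \<Rightarrow> real"
  assumes g: "set_integrable lborel S g" and S: "S \<in> sets borel"
    and bd: "\<And>n x. x \<in> S \<Longrightarrow> \<bar>f n x\<bar> \<le> g x"
    and m: "\<And>n. f n \<in> borel_measurable borel" "f' \<in> borel_measurable borel"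
    and lim: "\<And>x. x \<in> S \<Longrightarrow> (\<lambda>n. f n x) \<longlonglongrightarrow> f' x"
  shows "(\<lambda>n. LBINT x:S. f n x) \<longlonglongrightarrow> (LBINT x:S. f' x)"
  unfolding set_lebesgue_integral_def
proof (rule integral_dominated_convergence[where w = "\<lambda>x. indicator S x *\<^sub>R g x"])
  show "integrable lborel (\<lambda>x. indicator S x *\<^sub>R g x)" using g by (simp add: set_integrable_def)
  show "(\<lambda>x. indicat_real S x *\<^sub>R f' x) \<in> borel_measurable lborel" using m S by measurable
  show "(\<lambda>x. indicat_real S x *\<^sub>R f n x) \<in> borel_measurable lborel" for n using m S by measurable
  show "AE x in lborel. norm (indicator S x *\<^sub>R f n x) \<le> indicator S x *\<^sub>R g x" for n
    using bd by (auto simp: indicator_def)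
  show "AE x in lborel. (\<lambda>n. indicat_real S x *\<^sub>R f n x) \<longlonglongrightarrow> indicator S x *\<^sub>R f' x"
    using lim by (auto simp: indicator_def)
qed

lemma continuous_on_set_integral:
  fixes f :: "real \<Rightarrow> real \<Rightarrow> real"
  assumes g: "set_integrable lborel S g"
    and bd: "\<And>b x. b \<in> B \<Longrightarrow> x \<in> S \<Longrightarrow> \<bar>f b x\<bar> \<le> g x"
    and m: "\<And>b. f b \<in> borel_measurable borel" and S: "S \<in> sets borel"
    and cont: "\<And>x. x \<in> S \<Longrightarrow> continuous_on B (\<lambda>b. f b x)"
  shows "continuous_on B (\<lambda>b. LBINT x:S. f b x)"
  unfolding continuous_on_sequentially
proof (intro allI ballI impI, elim conjE)
  fix \<beta> b assume b: "b \<in> B" "\<forall>n. \<beta> n \<in> B" "\<beta> \<longlonglongrightarrow> b"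
  have "(\<lambda>n. f (\<beta> n) x) \<longlonglongrightarrow> f b x" if "x \<in> S" for x
    using cont[OF that] b unfolding continuous_on_sequentially o_def by blast
  then show "((\<lambda>b. LBINT x:S. f b x) \<circ> \<beta>) \<longlonglongrightarrow> (LBINT x:S. f b x)"
    unfolding o_def using b by (intro set_integral_dominated_convergence[OF g S bd m m]) auto
qed

text \<open>The exponents of \<open>G dh\<close>, \<open>dh / G\<close> and \<open>dh\<close>, and those of their limits for \<open>a \<rightarrow> -\<infinity>\<close>
  and \<open>b \<rightarrow> 0\<close>: the exponents at \<open>0\<close> and \<open>b\<close> add up, and the factor at \<open>a\<close> tends to a
  constant after multiplication with a power of \<open>-a\<close>.\<close>

definition G_list :: "real \<Rightarrow> real \<Rightarrow> (real \<times> real) list" where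
  "G_list a b = [(a, 1/2), (0, -3/4), (b, -3/4), (1, -3/4)]"

definition K_list :: "real \<Rightarrow> real \<Rightarrow> (real \<times> real) list" where
  "K_list a b = [(a, -1/2), (0, -1/4), (b, -1/4), (1, -1/4)]"

definition H_list :: "real \<Rightarrow> (real \<times> real) list" where
  "H_list b = [(0, -1/2), (b, -1/2), (1, -1/2)]"

definition G_lim :: "(real \<times> real) list" where "G_lim = [(0, -3/2), (1, -3/4)]"

definition K_lim :: "(real \<times> real) list" where "K_lim = [(0, -1/2), (1, -1/4)]"

definition H_lim :: "(real \<times> real) list" where "H_lim = [(0, -1), (1, -1/2)]"

lemmas sc_list_defs = G_list_def K_list_def H_list_def G_lim_def K_lim_def H_lim_def

lemma CS4_regular:
  assumes "a < 0" "0 < b" "b < 1"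
  shows "sc_regular (G_list a b) \<xi>" "sc_regular (K_list a b) \<xi>" "sc_regular (H_list b) \<xi>"
  using assms by (auto simp: sc_regular_def sc_order_def sc_degree_def sc_list_defs)

lemma CS4_points:
  "sc_points (G_list a b) = {a, 0, b, 1}" "sc_points (K_list a b) = {a, 0, b, 1}" "sc_points (H_list b) = {0, b, 1}"
  by (auto simp: sc_points_def sc_list_defs)

lemma einterval_ereal [simp]: "einterval (ereal p) (ereal q) = {p<..<q}"
  "einterval (ereal p) \<infinity> = {p<..}" "einterval (-\<infinity>) (ereal q) = {..<q}"
  by (auto simp: einterval_def)

lemma CS4_integrable:
  assumes "a < 0" "0 < b" "b < 1"
  shows "set_integrable lborel {a<..<0} (sc_abs (G_list a b))" "set_integrable lborel {a<..<0} (sc_abs (K_list a b))"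
    "set_integrable lborel {0<..<b} (sc_abs (G_list a b))" "set_integrable lborel {0<..<b} (sc_abs (K_list a b))"
    "set_integrable lborel {b<..<1} (sc_abs (G_list a b))" "set_integrable lborel {b<..<1} (sc_abs (K_list a b))"
    "set_integrable lborel {1<..} (sc_abs (G_list a b))" "set_integrable lborel {1<..} (sc_abs (K_list a b))"
    "set_integrable lborel {..<a} (sc_abs (G_list a b))" "set_integrable lborel {..<a} (sc_abs (K_list a b))"
proof -
  note r = CS4_regular[OF assms]
  note I = sc_integrable[of _ _ _ "G_list a b", OF _ _ r(1) r(1)] sc_integrable[of _ _ _ "K_list a b", OF _ _ r(2) r(2)]
  show "set_integrable lborel {a<..<0} (sc_abs (G_list a b))" "set_integrable lborel {a<..<0} (sc_abs (K_list a b))"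
    using I[of "ereal a" "a/2" "ereal 0"] assms by (auto simp: CS4_points)
  show "set_integrable lborel {0<..<b} (sc_abs (G_list a b))" "set_integrable lborel {0<..<b} (sc_abs (K_list a b))"
    using I[of "ereal 0" "b/2" "ereal b"] assms by (auto simp: CS4_points)
  show "set_integrable lborel {b<..<1} (sc_abs (G_list a b))" "set_integrable lborel {b<..<1} (sc_abs (K_list a b))"
    using I[of "ereal b" "(b+1)/2" "ereal 1"] assms by (auto simp: CS4_points)
  show "set_integrable lborel {1<..} (sc_abs (G_list a b))" "set_integrable lborel {1<..} (sc_abs (K_list a b))"
    using I[of "ereal 1" 2 "\<infinity>"] assms by (auto simp: CS4_points)
  show "set_integrable lborel {..<a} (sc_abs (G_list a b))" "set_integrable lborel {..<a} (sc_abs (K_list a b))"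
    using I[of "-\<infinity>" "a-1" "ereal a"] assms by (auto simp: CS4_points)
qed

text \<open>The arcs are numbered from the marked point \<open>0\<close> on: \<open>(0, b)\<close>, \<open>(b, 1)\<close>, \<open>(1, \<infinity>)\<close>,
  \<open>(-\<infinity>, a)\<close>, \<open>(a, 0)\<close>.\<close>

definition side5 where "side5 xs a = (LBINT x:{a<..<0}. sc_abs xs x)"
definition side1 where "side1 xs b = (LBINT x:{0<..<b}. sc_abs xs x)"
definition side2 where "side2 xs b = (LBINT x:{b<..<1}. sc_abs xs x)"
definition side3 where "side3 xs = (LBINT x:{1<..}. sc_abs xs x)"
definition side4 where "side4 xs a = (LBINT x:{..<a}. sc_abs xs x)"

lemmas side_defs = side1_def side2_def side3_def side4_def side5_def

lemma cis_eighths: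
  "cis (pi * (-3/4)) = - Complex (sqrt 2 / 2) (sqrt 2 / 2)"
  "cis (pi * (-3/2)) = \<i>"
  "cis (pi * (-9/4)) = Complex (sqrt 2 / 2) (- (sqrt 2 / 2))"
  "cis (pi * (-7/4)) = Complex (sqrt 2 / 2) (sqrt 2 / 2)"
  "cis (pi * (-1/4)) = Complex (sqrt 2 / 2) (- (sqrt 2 / 2))"
  "cis (pi * (-1/2)) = -\<i>"
  "cis (pi * (-5/4)) = - Complex (sqrt 2 / 2) (- (sqrt 2 / 2))"
proof -
  have e: "cis (pi/4) = Complex (sqrt 2 / 2) (sqrt 2 / 2)" "cis (-(pi/4)) = Complex (sqrt 2 / 2) (- (sqrt 2 / 2))"
    by (simp_all add: complex_eq_iff cos_45 sin_45)
  have "cis (pi * (-3/4)) = cis (pi/4) * cis (-pi)" by (simp only: cis_mult) (simp add: algebra_simps)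
  then show "cis (pi * (-3/4)) = - Complex (sqrt 2 / 2) (sqrt 2 / 2)" by (simp add: e complex_eq_iff)
  have "cis (pi * (-3/2)) = cis (pi/2) * cis (-(2*pi))" by (simp only: cis_mult) (simp add: algebra_simps)
  then show "cis (pi * (-3/2)) = \<i>" by (simp add: complex_eq_iff)
  have "cis (pi * (-9/4)) = cis (-(pi/4)) * cis (-(2*pi))" by (simp only: cis_mult) (simp add: algebra_simps)
  then show "cis (pi * (-9/4)) = Complex (sqrt 2 / 2) (- (sqrt 2 / 2))" by (simp add: e complex_eq_iff)
  have "cis (pi * (-7/4)) = cis (pi/4) * cis (-(2*pi))" by (simp only: cis_mult) (simp add: algebra_simps)
  then show "cis (pi * (-7/4)) = Complex (sqrt 2 / 2) (sqrt 2 / 2)" by (simp add: e complex_eq_iff)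
  show "cis (pi * (-1/4)) = Complex (sqrt 2 / 2) (- (sqrt 2 / 2))" using e(2) by simp
  show "cis (pi * (-1/2)) = -\<i>" by (simp add: complex_eq_iff)
  have "cis (pi * (-5/4)) = cis (-(pi/4)) * cis (-pi)" by (simp only: cis_mult) (simp add: algebra_simps)
  then show "cis (pi * (-5/4)) = - Complex (sqrt 2 / 2) (- (sqrt 2 / 2))" by (simp add: e complex_eq_iff)
qed

text \<open>The primitives of \<open>G dh\<close> and \<open>dh / G\<close> map the half plane to pentagons all of whose
  angles are multiples of \<open>pi / 4\<close>, as are the directions of the sides.\<close>

lemma CS4_sides:
  assumes "a < 0" "0 < b" "b < 1"
  defines "P \<equiv> \<lambda>\<xi>. sc_ext (G_list a b) (boundary_point \<xi>)" and "Q \<equiv> \<lambda>\<xi>. sc_ext (K_list a b) (boundary_point \<xi>)"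
  shows "P \<infinity> - P 1 = of_real (side3 (G_list a b))"
    "P 1 - P (ereal b) = - Complex (sqrt 2 / 2) (sqrt 2 / 2) * of_real (side2 (G_list a b) b)"
    "P (ereal b) - P 0 = \<i> * of_real (side1 (G_list a b) b)"
    "P 0 - P (ereal a) = Complex (sqrt 2 / 2) (- (sqrt 2 / 2)) * of_real (side5 (G_list a b) a)"
    "P (ereal a) - P (-\<infinity>) = Complex (sqrt 2 / 2) (sqrt 2 / 2) * of_real (side4 (G_list a b) a)"
    "Q \<infinity> - Q 1 = of_real (side3 (K_list a b))"
    "Q 1 - Q (ereal b) = Complex (sqrt 2 / 2) (- (sqrt 2 / 2)) * of_real (side2 (K_list a b) b)"
    "Q (ereal b) - Q 0 = - \<i> * of_real (side1 (K_list a b) b)"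
    "Q 0 - Q (ereal a) = - Complex (sqrt 2 / 2) (sqrt 2 / 2) * of_real (side5 (K_list a b) a)"
    "Q (ereal a) - Q (-\<infinity>) = - Complex (sqrt 2 / 2) (- (sqrt 2 / 2)) * of_real (side4 (K_list a b) a)"
proof -
  note r = CS4_regular[OF assms(1-3)]
  note G = sc_side_at(2)[of _ _ _ "G_list a b", OF _ _ r(1) r(1)]
    and K = sc_side_at(2)[of _ _ _ "K_list a b", OF _ _ r(2) r(2)]
  have turn: "sc_turn (G_list a b) 2 = 0" "sc_turn (G_list a b) ((b+1)/2) = -3/4"
    "sc_turn (G_list a b) (b/2) = -3/2" "sc_turn (G_list a b) (a/2) = -9/4" "sc_turn (G_list a b) (a-1) = -7/4"
    "sc_turn (K_list a b) 2 = 0" "sc_turn (K_list a b) ((b+1)/2) = -1/4"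
    "sc_turn (K_list a b) (b/2) = -1/2" "sc_turn (K_list a b) (a/2) = -3/4" "sc_turn (K_list a b) (a-1) = -5/4"
    using assms(1-3) by (auto simp: sc_turn_def G_list_def K_list_def)
  show "P \<infinity> - P 1 = of_real (side3 (G_list a b))"
    using G[of "ereal 1" 2 "\<infinity>"] assms(1-3) unfolding turn cis_eighths P_def
    by (simp add: CS4_points side_defs one_ereal_def zero_ereal_def)
  show "P 1 - P (ereal b) = - Complex (sqrt 2 / 2) (sqrt 2 / 2) * of_real (side2 (G_list a b) b)"
    using G[of "ereal b" "(b+1)/2" "ereal 1"] assms(1-3) unfolding turn cis_eighths P_def
    by (simp add: CS4_points side_defs one_ereal_def zero_ereal_def)
  show "P (ereal b) - P 0 = \<i> * of_real (side1 (G_list a b) b)"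
    using G[of "ereal 0" "b/2" "ereal b"] assms(1-3) unfolding turn cis_eighths P_def
    by (simp add: CS4_points side_defs one_ereal_def zero_ereal_def)
  show "P 0 - P (ereal a) = Complex (sqrt 2 / 2) (- (sqrt 2 / 2)) * of_real (side5 (G_list a b) a)"
    using G[of "ereal a" "a/2" "ereal 0"] assms(1-3) unfolding turn cis_eighths P_def
    by (simp add: CS4_points side_defs one_ereal_def zero_ereal_def)
  show "P (ereal a) - P (-\<infinity>) = Complex (sqrt 2 / 2) (sqrt 2 / 2) * of_real (side4 (G_list a b) a)"
    using G[of "-\<infinity>" "a-1" "ereal a"] assms(1-3) unfolding turn cis_eighths P_def
    by (simp add: CS4_points side_defs one_ereal_def zero_ereal_def)
  show "Q \<infinity> - Q 1 = of_real (side3 (K_list a b))"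
    using K[of "ereal 1" 2 "\<infinity>"] assms(1-3) unfolding turn cis_eighths Q_def
    by (simp add: CS4_points side_defs one_ereal_def zero_ereal_def)
  show "Q 1 - Q (ereal b) = Complex (sqrt 2 / 2) (- (sqrt 2 / 2)) * of_real (side2 (K_list a b) b)"
    using K[of "ereal b" "(b+1)/2" "ereal 1"] assms(1-3) unfolding turn cis_eighths Q_def
    by (simp add: CS4_points side_defs one_ereal_def zero_ereal_def)
  show "Q (ereal b) - Q 0 = - \<i> * of_real (side1 (K_list a b) b)"
    using K[of "ereal 0" "b/2" "ereal b"] assms(1-3) unfolding turn cis_eighths Q_def
    by (simp add: CS4_points side_defs one_ereal_def zero_ereal_def)
  show "Q 0 - Q (ereal a) = - Complex (sqrt 2 / 2) (sqrt 2 / 2) * of_real (side5 (K_list a b) a)"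
    using K[of "ereal a" "a/2" "ereal 0"] assms(1-3) unfolding turn cis_eighths Q_def
    by (simp add: CS4_points side_defs one_ereal_def zero_ereal_def)
  show "Q (ereal a) - Q (-\<infinity>) = - Complex (sqrt 2 / 2) (- (sqrt 2 / 2)) * of_real (side4 (K_list a b) a)"
    using K[of "-\<infinity>" "a-1" "ereal a"] assms(1-3) unfolding turn cis_eighths Q_def
    by (simp add: CS4_points side_defs one_ereal_def zero_ereal_def)
qed

text \<open>The sides of a closed pentagon add up to zero; the real and the imaginary part of this
  equation are two relations between the five lengths.\<close>

lemma CS4_closing:
  assumes "a < 0" "0 < b" "b < 1"
  shows "side1 (G_list a b) b = side3 (G_list a b) + sqrt 2 * side5 (G_list a b) a"
    "side2 (G_list a b) b = sqrt 2 * side3 (G_list a b) + side5 (G_list a b) a + side4 (G_list a b) a"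
    "side3 (K_list a b) = side1 (K_list a b) b + sqrt 2 * side5 (K_list a b) a"
    "side4 (K_list a b) a = side2 (K_list a b) b + side5 (K_list a b) a + sqrt 2 * side1 (K_list a b) b"
proof -
  note s = CS4_sides[OF assms]
  have inf: "boundary_point (-\<infinity>) = boundary_point \<infinity>" by (simp add: boundary_point_def)
  let ?e = "Complex (sqrt 2 / 2) (sqrt 2 / 2)" and ?f = "Complex (sqrt 2 / 2) (- (sqrt 2 / 2))"
  define P where "P = (\<lambda>\<xi>. sc_ext (G_list a b) (boundary_point \<xi>))"
  define Q where "Q = (\<lambda>\<xi>. sc_ext (K_list a b) (boundary_point \<xi>))"
  define G where "G = of_real (side3 (G_list a b)) - ?e * of_real (side2 (G_list a b) b)
     + \<i> * of_real (side1 (G_list a b) b) + ?f * of_real (side5 (G_list a b) a) + ?e * of_real (side4 (G_list a b) a)"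
  define K where "K = of_real (side3 (K_list a b)) + ?f * of_real (side2 (K_list a b) b)
     - \<i> * of_real (side1 (K_list a b) b) - ?e * of_real (side5 (K_list a b) a) - ?f * of_real (side4 (K_list a b) a)"
  have "G = (P \<infinity> - P 1) + (P 1 - P (ereal b)) + (P (ereal b) - P 0) + (P 0 - P (ereal a)) + (P (ereal a) - P (-\<infinity>))"
    unfolding G_def P_def s by simp
  then have "G = 0" by (simp add: P_def inf)
  then have G: "Re G = 0" "Im G = 0" by simp_all
  have "K = (Q \<infinity> - Q 1) + (Q 1 - Q (ereal b)) + (Q (ereal b) - Q 0) + (Q 0 - Q (ereal a)) + (Q (ereal a) - Q (-\<infinity>))"
    unfolding K_def Q_def s by simp
  then have "K = 0" by (simp add: Q_def inf)
  then have K: "Re K = 0" "Im K = 0" by simp_all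
  have q: "sqrt 2 * (sqrt 2 * x) = 2 * x" for x by (simp flip: mult.assoc)
  have g: "2 * side3 (G_list a b) + sqrt 2 * (side5 (G_list a b) a + side4 (G_list a b) a - side2 (G_list a b) b) = 0"
      "2 * side1 (G_list a b) b + sqrt 2 * (side4 (G_list a b) a - side5 (G_list a b) a - side2 (G_list a b) b) = 0"
    using G by (simp_all add: G_def algebra_simps)
  have k: "2 * side3 (K_list a b) + sqrt 2 * (side2 (K_list a b) b - side5 (K_list a b) a - side4 (K_list a b) a) = 0"
      "2 * side1 (K_list a b) b + sqrt 2 * (side2 (K_list a b) b + side5 (K_list a b) a - side4 (K_list a b) a) = 0"
    subgoal using K(1) unfolding K_def right_diff_distrib distrib_left by simp
    subgoal using K(2) unfolding K_def right_diff_distrib distrib_left by simp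
    done
  have "sqrt 2 * (2 * side3 (G_list a b) + sqrt 2 * (side5 (G_list a b) a + side4 (G_list a b) a - side2 (G_list a b) b)) = 0"
    unfolding g by simp
  then show "side2 (G_list a b) b = sqrt 2 * side3 (G_list a b) + side5 (G_list a b) a + side4 (G_list a b) a"
    by (simp add: distrib_left q)
  show "side1 (G_list a b) b = side3 (G_list a b) + sqrt 2 * side5 (G_list a b) a"
    using g by (simp add: algebra_simps)
  have "sqrt 2 * (2 * side1 (K_list a b) b + sqrt 2 * (side2 (K_list a b) b + side5 (K_list a b) a - side4 (K_list a b) a)) = 0"
    unfolding k by simp
  then show "side4 (K_list a b) a = side2 (K_list a b) b + side5 (K_list a b) a + sqrt 2 * side1 (K_list a b) b"
    by (simp add: distrib_left q)
  show "side3 (K_list a b) = side1 (K_list a b) b + sqrt 2 * side5 (K_list a b) a"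
    using k unfolding right_diff_distrib distrib_left by linarith
qed

text \<open>The determinant of the two linear equations for \<open>\<rho>\<^sup>2\<close> in \<open>CS4_period\<close> below.\<close>

definition period_gap :: "real \<Rightarrow> real \<Rightarrow> real" where
  "period_gap a b = side5 (K_list a b) a * (sqrt 2 * side4 (G_list a b) a + side3 (G_list a b))
     - side5 (G_list a b) a * (sqrt 2 * side2 (K_list a b) b + side1 (K_list a b) b)"

lemma powr_abs_between:
  fixes x :: real
  assumes "b0 \<le> b" "b \<le> b1" "x \<notin> {b0..b1}" "e \<le> 0"
  shows "\<bar>x - b\<bar> powr e \<le> \<bar>x - b0\<bar> powr e + \<bar>x - b1\<bar> powr e"
proof (cases "x < b0")
  case True
  then have "\<bar>x - b\<bar> powr e \<le> \<bar>x - b0\<bar> powr e" using assms by (intro powr_mono2') auto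
  then show ?thesis by (simp add: add_increasing2)
next
  case False
  then have "\<bar>x - b\<bar> powr e \<le> \<bar>x - b1\<bar> powr e" using assms by (intro powr_mono2') auto
  then show ?thesis by (simp add: add_increasing)
qed

text \<open>The exponent \<open>g\<close> is not positive, so outside the interval the power \<open>\<bar>x - b\<bar> powr g\<close>
  is bounded by the sum of its values for the two end points of the interval, and dominated
  convergence applies.\<close>

lemma side_continuous_in_point:
  assumes L: "L = (\<lambda>b. (p, e) # (q, f) # (b, g) # xs)" and g: "g \<le> 0"
    and int: "set_integrable lborel S (sc_abs (L b0))" "set_integrable lborel S (sc_abs (L b1))"
    and S: "S \<in> sets borel" "S \<inter> {b0..b1} = {}"
  shows "continuous_on {b0..b1} (\<lambda>b. LBINT x:S. sc_abs (L b) x)"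
proof (rule continuous_on_set_integral[where g = "\<lambda>x. sc_abs (L b0) x + sc_abs (L b1) x"])
  define w where "w x = \<bar>x - p\<bar> powr e * (\<bar>x - q\<bar> powr f * sc_abs xs x)" for x
  have eq: "sc_abs (L b) x = w x * \<bar>x - b\<bar> powr g" for b x
    by (simp add: L sc_abs_Cons w_def)
  have w: "w x \<ge> 0" for x by (simp add: w_def sc_abs_nonneg)
  show "set_integrable lborel S (\<lambda>x. sc_abs (L b0) x + sc_abs (L b1) x)" using int by (rule set_integral_add)
  show "\<bar>sc_abs (L b) x\<bar> \<le> sc_abs (L b0) x + sc_abs (L b1) x" if "b \<in> {b0..b1}" "x \<in> S" for b x
  proof -
    have "\<bar>x - b\<bar> powr g \<le> \<bar>x - b0\<bar> powr g + \<bar>x - b1\<bar> powr g"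
      using that S g by (intro powr_abs_between) auto
    then have "w x * \<bar>x - b\<bar> powr g \<le> w x * (\<bar>x - b0\<bar> powr g + \<bar>x - b1\<bar> powr g)"
      by (intro mult_left_mono w)
    then show ?thesis unfolding eq distrib_left by (simp add: w)
  qed
  show "continuous_on {b0..b1} (\<lambda>b. sc_abs (L b) x)" if "x \<in> S" for x
    unfolding eq using that S by (intro continuous_intros) auto
qed (use S in auto)

text \<open>The sides over \<open>(0, b)\<close> and \<open>(b, 1)\<close> are integrals with moving end points. The closing
  relations express the combination of them that occurs by sides over arcs that do not depend
  on \<open>b\<close>.\<close>

lemma period_gap_continuous:
  assumes "a < 0" "0 < b0" "b0 \<le> b1" "b1 < 1"
  shows "continuous_on {b0..b1} (period_gap a)"
proof -
  have I: "continuous_on {b0..b1} (\<lambda>b. LBINT x:S. sc_abs (G_list a b) x)"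
      "continuous_on {b0..b1} (\<lambda>b. LBINT x:S. sc_abs (K_list a b) x)"
    if "S \<in> {{a<..<0}, {1<..}, {..<a}}" for S
  proof -
    have S: "S \<in> sets borel" "S \<inter> {b0..b1} = {}" using that assms by auto
    have b: "0 < b0" "b0 < 1" "0 < b1" "b1 < 1" using assms by auto
    show "continuous_on {b0..b1} (\<lambda>b. LBINT x:S. sc_abs (G_list a b) x)"
      using that CS4_integrable[OF assms(1) b(1,2)] CS4_integrable[OF assms(1) b(3,4)]
      by (intro side_continuous_in_point[where L = "G_list a" and p = a and e = "1/2" and q = 0 and f = "-3/4"
          and g = "-3/4" and xs = "[(1,-3/4)]", OF _ _ _ _ S]) (auto simp: fun_eq_iff G_list_def[of a])
    show "continuous_on {b0..b1} (\<lambda>b. LBINT x:S. sc_abs (K_list a b) x)"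
      using that CS4_integrable[OF assms(1) b(1,2)] CS4_integrable[OF assms(1) b(3,4)]
      by (intro side_continuous_in_point[where L = "K_list a" and p = a and e = "-1/2" and q = 0 and f = "-1/4"
          and g = "-1/4" and xs = "[(1,-1/4)]", OF _ _ _ _ S]) (auto simp: fun_eq_iff K_list_def[of a])
  qed
  have 1: "continuous_on {b0..b1} (\<lambda>b. side5 (K_list a b) a * (sqrt 2 * side4 (G_list a b) a + side3 (G_list a b))
     - side5 (G_list a b) a * (sqrt 2 * side4 (K_list a b) a - side3 (K_list a b)))"
    unfolding side_defs by (intro continuous_intros I) auto
  have 2: "period_gap a b = side5 (K_list a b) a * (sqrt 2 * side4 (G_list a b) a + side3 (G_list a b))
     - side5 (G_list a b) a * (sqrt 2 * side4 (K_list a b) a - side3 (K_list a b))" if "b \<in> {b0..b1}" for b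
  proof -
    have "a < 0" "0 < b" "b < 1" using that assms by auto
    note c = CS4_closing[OF this]
    have "sqrt 2 * (sqrt 2 * x) = 2 * x" for x by (simp flip: mult.assoc)
    then have "sqrt 2 * side4 (K_list a b) a - side3 (K_list a b) = sqrt 2 * side2 (K_list a b) b + side1 (K_list a b) b"
      unfolding c(3,4) by (simp add: distrib_left)
    then show ?thesis by (simp add: period_gap_def)
  qed
  show ?thesis by (rule continuous_on_eq[OF 1]) (simp add: 2)
qed

lemma side_nonneg: "side1 xs b \<ge> 0" "side2 xs b \<ge> 0" "side3 xs \<ge> 0" "side4 xs a \<ge> 0" "side5 xs a \<ge> 0"
  unfolding side_defs set_lebesgue_integral_def by (auto intro!: Bochner_Integration.integral_nonneg simp: sc_abs_nonneg)

lemma powr_minus_three_quarters_two: "(2::real) powr (-3/4) * (2 powr (-3/4)) * (1/2) powr (1/2) = 1/4"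
proof -
  have "(1/2::real) powr (1/2) = 2 powr (-1/2)" by (simp add: powr_divide powr_minus_divide)
  then have "(2::real) powr (-3/4) * (2 powr (-3/4)) * (1/2) powr (1/2) = 2 powr (-2)"
    by (simp flip: powr_add)
  also have "\<dots> = 1/4" by (simp add: powr_minus_divide)
  finally show ?thesis .
qed

text \<open>Between \<open>-b\<close> and \<open>0\<close> the integrand is at least \<open>b powr (-3/2) / 4\<close>.\<close>

lemma side5_G_ge:
  assumes "a \<le> -1" "0 < b" "b \<le> 1/2"
  shows "side5 (G_list a b) a \<ge> b powr (-1/2) / 4"
proof -
  let ?m = "(1/2) powr (1/2) * (b powr (-3/4) * ((2*b) powr (-3/4) * 2 powr (-3/4)))"
  have "?m * (0 - (-b)) \<le> side5 (G_list a b) a"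
    unfolding side5_def
  proof (rule set_integral_ge_const)
    show "set_integrable lborel {a<..<0} (sc_abs (G_list a b))" using assms by (intro CS4_integrable) auto
    fix x assume x: "x \<in> {-b<..<0}"
    show "?m \<le> sc_abs (G_list a b) x"
    proof -
      have "(1/2) powr (1/2) \<le> \<bar>x - a\<bar> powr (1/2)" using x assms by (intro powr_mono2) auto
      moreover have "b powr (-3/4) \<le> \<bar>x\<bar> powr (-3/4)" "(2*b) powr (-3/4) \<le> \<bar>x - b\<bar> powr (-3/4)"
          "2 powr (-3/4) \<le> \<bar>x - 1\<bar> powr (-3/4)"
        using x assms by (intro powr_mono2'; auto)+
      ultimately have "?m \<le> \<bar>x - a\<bar> powr (1/2) * (\<bar>x\<bar> powr (-3/4) * (\<bar>x - b\<bar> powr (-3/4) * \<bar>x - 1\<bar> powr (-3/4)))"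
        by (intro mult_mono) auto
      then show ?thesis by (simp add: G_list_def sc_abs_def)
    qed
  qed (use assms in \<open>auto simp: sc_abs_nonneg\<close>)
  moreover have "?m * (0 - (-b)) = b powr (-1/2) / 4"
  proof -
    have "?m * (0 - (-b)) = (2 powr (-3/4) * (2 powr (-3/4)) * (1/2) powr (1/2)) * (b powr (-3/4) * b powr (-3/4) * b powr 1)"
      using assms by (simp add: powr_mult)
    also have "b powr (-3/4) * b powr (-3/4) * b powr 1 = b powr (-1/2)" by (simp only: powr_add[symmetric]) simp
    finally show ?thesis unfolding powr_minus_three_quarters_two by simp
  qed
  ultimately show ?thesis by simp
qed

text \<open>As \<open>b\<close> tends to \<open>0\<close>, the fifth side of the first pentagon blows up like \<open>b\<^sup>-\<^sup>1\<^sup>/\<^sup>2\<close>; its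
  factor is bounded below, and the first product in the gap is bounded above.\<close>

lemma period_gap_neg:
  assumes "a \<le> -1" "\<delta> > 0"
  shows "\<exists>b. 0 < b \<and> b < \<delta> \<and> b \<le> 1/2 \<and> period_gap a b < 0"
proof -
  \<comment> \<open>The bounds do not depend on \<open>b\<close>.\<close>
  define M5 where "M5 = (LBINT x:{a<..<0}. sc_abs [(a,-1/2),(0,-1/2),(1,-1/4)] x)"
  define M4 where "M4 = (LBINT x:{..<a}. sc_abs [(a,1/2),(0,-3/2),(1,-3/4)] x)"
  define M3 where "M3 = side3 (G_list a (1/2))"
  define m2 where "m2 = (1 - a) powr (-1/2) * (1/2)"
  have i5: "set_integrable lborel {a<..<0} (sc_abs [(a,-1/2),(0,-1/2),(1,-1/4)])"
    using sc_integrable[of "ereal a" "a/2" "ereal 0"] assms by (simp add: sc_regular_def sc_order_def sc_points_def)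
  have i4: "set_integrable lborel {..<a} (sc_abs [(a,1/2),(0,-3/2),(1,-3/4)])"
    using sc_integrable[of "-\<infinity>" "a-1" "ereal a"] assms by (simp add: sc_regular_def sc_order_def sc_points_def sc_degree_def)
  have gap: "period_gap a b \<le> M5 * (sqrt 2 * M4 + M3) - b powr (-1/2) / 4 * (sqrt 2 * m2)"
    if b: "0 < b" "b \<le> 1/2" for b
  proof -
    have ab: "a < 0" "0 < b" "b < 1" using assms b by auto
    have "side5 (K_list a b) a \<le> M5"
      unfolding side5_def M5_def
    proof (rule set_integral_mono)
      fix x assume x: "x \<in> {a<..<0}"
      have "\<bar>x\<bar> powr (-1/4) * \<bar>x - b\<bar> powr (-1/4) \<le> \<bar>x\<bar> powr (-1/4) * \<bar>x\<bar> powr (-1/4)"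
        using x b by (intro mult_left_mono powr_mono2') auto
      also have "\<dots> = \<bar>x\<bar> powr (-1/2)" by (simp flip: powr_add)
      finally have "\<bar>x - a\<bar> powr (-1/2) * (\<bar>x\<bar> powr (-1/4) * \<bar>x - b\<bar> powr (-1/4)) * \<bar>x - 1\<bar> powr (-1/4)
          \<le> \<bar>x - a\<bar> powr (-1/2) * \<bar>x\<bar> powr (-1/2) * \<bar>x - 1\<bar> powr (-1/4)"
        by (intro mult_right_mono mult_left_mono) auto
      then show "sc_abs (K_list a b) x \<le> sc_abs [(a,-1/2),(0,-1/2),(1,-1/4)] x"
        by (simp add: K_list_def sc_abs_def mult.assoc)
    qed (use CS4_integrable[OF ab] i5 in auto)
    moreover have "side4 (G_list a b) a \<le> M4"
      unfolding side4_def M4_def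
    proof (rule set_integral_mono)
      fix x assume x: "x \<in> {..<a}"
      have "\<bar>x\<bar> powr (-3/4) * \<bar>x - b\<bar> powr (-3/4) \<le> \<bar>x\<bar> powr (-3/4) * \<bar>x\<bar> powr (-3/4)"
        using x b assms by (intro mult_left_mono powr_mono2') auto
      also have "\<dots> = \<bar>x\<bar> powr (-3/2)" by (simp flip: powr_add)
      finally have "\<bar>x - a\<bar> powr (1/2) * (\<bar>x\<bar> powr (-3/4) * \<bar>x - b\<bar> powr (-3/4)) * \<bar>x - 1\<bar> powr (-3/4)
          \<le> \<bar>x - a\<bar> powr (1/2) * \<bar>x\<bar> powr (-3/2) * \<bar>x - 1\<bar> powr (-3/4)"
        by (intro mult_right_mono mult_left_mono) auto
      then show "sc_abs (G_list a b) x \<le> sc_abs [(a,1/2),(0,-3/2),(1,-3/4)] x"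
        by (simp add: G_list_def sc_abs_def mult.assoc)
    qed (use CS4_integrable[OF ab] i4 in auto)
    moreover have "side3 (G_list a b) \<le> M3"
      unfolding side3_def M3_def
    proof (rule set_integral_mono)
      fix x :: real assume x: "x \<in> {1<..}"
      show "sc_abs (G_list a b) x \<le> sc_abs (G_list a (1/2)) x"
        unfolding G_list_def sc_abs_def using x b by (auto intro!: mult_left_mono mult_right_mono powr_mono2')
    qed (use CS4_integrable[OF ab] CS4_integrable[of a "1/2"] ab in auto)
    ultimately have 1: "side5 (K_list a b) a * (sqrt 2 * side4 (G_list a b) a + side3 (G_list a b)) \<le> M5 * (sqrt 2 * M4 + M3)"
      using side_nonneg by (intro mult_mono add_mono) (auto intro!: add_nonneg_nonneg order_trans[OF side_nonneg(5)])
    have "(1 - a) powr (-1/2) * (1 - 1/2) \<le> side2 (K_list a b) b"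
      unfolding side2_def
    proof (rule set_integral_ge_const)
      fix x :: real assume x: "x \<in> {1/2<..<1}"
      have "1 powr (-1/4) \<le> \<bar>x\<bar> powr (-1/4)" "1 powr (-1/4) \<le> \<bar>x-b\<bar> powr (-1/4)" "1 powr (-1/4) \<le> \<bar>x-1\<bar> powr (-1/4)"
        "(1 - a) powr (-1/2) \<le> \<bar>x - a\<bar> powr (-1/2)"
        using x b assms by (intro powr_mono2'; auto)+
      then have "(1 - a) powr (-1/2) * (1 * (1 * 1)) \<le> \<bar>x - a\<bar> powr (-1/2) * (\<bar>x\<bar> powr (-1/4) * (\<bar>x-b\<bar> powr (-1/4) * \<bar>x-1\<bar> powr (-1/4)))"
        by (intro mult_mono) auto
      then show "(1 - a) powr (-1/2) \<le> sc_abs (K_list a b) x" by (simp add: sc_abs_def K_list_def)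
    qed (use CS4_integrable[OF ab] b in \<open>auto simp: sc_abs_nonneg\<close>)
    then have "sqrt 2 * m2 \<le> sqrt 2 * side2 (K_list a b) b + side1 (K_list a b) b"
      using side_nonneg(1)[of "K_list a b" b] by (simp add: m2_def add_increasing2)
    then have "b powr (-1/2) / 4 * (sqrt 2 * m2) \<le> side5 (G_list a b) a * (sqrt 2 * side2 (K_list a b) b + side1 (K_list a b) b)"
      using side5_G_ge[OF assms(1) b] side_nonneg by (intro mult_mono) (auto simp: m2_def)
    with 1 show ?thesis by (simp add: period_gap_def)
  qed
  have m2: "m2 > 0" using assms by (simp add: m2_def)
  define Z where "Z = M5 * (sqrt 2 * M4 + M3)"
  define T where "T = max (max 2 (1/\<delta> + 1)) (4 * Z / (sqrt 2 * m2) + 1)"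
  have T: "T \<ge> 2" "T > 1/\<delta>" "T > 4 * Z / (sqrt 2 * m2)" by (auto simp: T_def)
  \<comment> \<open>With this choice \<open>b powr (-1/2) = T\<close>.\<close>
  define b where "b = 1 / T^2"
  have "b \<le> 1/2^2" unfolding b_def using T by (intro divide_left_mono power_mono) auto
  moreover have "b > 0" using T by (simp add: b_def)
  moreover have "b < \<delta>"
  proof -
    have "1 / T^2 \<le> 1 / T" using T by (intro divide_left_mono) (auto simp: power2_eq_square)
    also have "1 / T < \<delta>" using T assms by (simp add: field_simps)
    finally show ?thesis by (simp add: b_def)
  qed
  moreover have "b powr (-1/2) = T"
  proof -
    have "b = T powr (-2)" using T by (simp add: b_def powr_minus_divide)
    then show ?thesis using T by (simp add: powr_powr)
  qed
  moreover have "Z < T / 4 * (sqrt 2 * m2)" using T(3) m2 by (simp add: field_simps)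
  ultimately show ?thesis using gap[of b] by (intro exI[of _ b]) (auto simp: Z_def)
qed

text \<open>For fixed \<open>b = \<delta>\<close> and \<open>a \<rightarrow> -\<infinity>\<close> the second product in the gap stays bounded, since
  the factor \<open>(-a)\<^sup>1\<^sup>/\<^sup>2\<close> from \<open>G dh\<close> cancels the factor \<open>(-a)\<^sup>-\<^sup>1\<^sup>/\<^sup>2\<close> from \<open>dh / G\<close>. In
  the first product the side over \<open>(a, 0)\<close> has length at least a multiple of \<open>(-a)\<^sup>-\<^sup>1\<^sup>/\<^sup>4\<close>,
  and the other factor is at least a multiple of \<open>(-a)\<^sup>1\<^sup>/\<^sup>2\<close>.\<close>

lemma period_gap_pos:
  assumes "0 < \<delta>" "\<delta> < 1"
  shows "\<exists>A\<ge>1. \<forall>a\<le>-A. period_gap a \<delta> > 0"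
proof -
  define C where "C = (LBINT x:{..<0}. sc_abs [(0,-3/4),(\<delta>,-3/4),(1,-3/4)] x)"
  define D2 where "D2 = (LBINT x:{\<delta><..<1}. sc_abs [(0,-1/4),(\<delta>,-1/4),(1,-1/4)] x)"
  define D1 where "D1 = (LBINT x:{0<..<\<delta>}. sc_abs [(0,-1/4),(\<delta>,-1/4),(1,-1/4)] x)"
  define D where "D = sqrt 2 * D2 + D1"
  have iC: "set_integrable lborel {..<0} (sc_abs [(0,-3/4),(\<delta>,-3/4),(1,-3/4)])"
    using sc_integrable[of "-\<infinity>" "-1" "ereal 0"] assms by (simp add: sc_regular_def sc_order_def sc_points_def sc_degree_def)
  have iD2: "set_integrable lborel {\<delta><..<1} (sc_abs [(0,-1/4),(\<delta>,-1/4),(1,-1/4)])"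
    using sc_integrable[of "ereal \<delta>" "(\<delta>+1)/2" "ereal 1"] assms by (simp add: sc_regular_def sc_order_def sc_points_def)
  have iD1: "set_integrable lborel {0<..<\<delta>} (sc_abs [(0,-1/4),(\<delta>,-1/4),(1,-1/4)])"
    using sc_integrable[of "ereal 0" "\<delta>/2" "ereal \<delta>"] assms by (simp add: sc_regular_def sc_order_def sc_points_def)
  have C0: "C \<ge> 0" "D \<ge> 0"
    unfolding C_def D_def D1_def D2_def set_lebesgue_integral_def
    by (auto intro!: Bochner_Integration.integral_nonneg add_nonneg_nonneg simp: sc_abs_nonneg)
  have "period_gap a \<delta> > 0" if a: "a \<le> - ((8 * (C * D) + 1) ^ 4)" for a
  proof -
    let ?A = "-a"
    have "8 * (C * D) + 1 \<ge> 1" using C0 by simp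
    then have "(8 * (C * D) + 1) ^ 4 \<ge> 1" by (rule one_le_power)
    then have A: "?A \<ge> 1" using a by simp
    have ad: "a < 0" "0 < \<delta>" "\<delta> < 1" using A assms by auto
    have "side5 (G_list a \<delta>) a \<le> ?A powr (1/2) * C"
    proof -
      have iA: "set_integrable lborel {a<..<0} (sc_abs [(0,-3/4),(\<delta>,-3/4),(1,-3/4)])"
        by (rule set_integrable_subset[OF iC]) auto
      have "side5 (G_list a \<delta>) a \<le> (LBINT x:{a<..<0}. ?A powr (1/2) * sc_abs [(0,-3/4),(\<delta>,-3/4),(1,-3/4)] x)"
        unfolding side5_def
      proof (rule set_integral_mono)
        show "set_integrable lborel {a<..<0} (\<lambda>x. ?A powr (1/2) * sc_abs [(0,-3/4),(\<delta>,-3/4),(1,-3/4)] x)"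
          by (intro set_integrable_mult_right set_integrable_subset[OF iC]) auto
        fix x assume x: "x \<in> {a<..<0}"
        then show "sc_abs (G_list a \<delta>) x \<le> ?A powr (1/2) * sc_abs [(0,-3/4),(\<delta>,-3/4),(1,-3/4)] x"
          unfolding G_list_def sc_abs_Cons[of a] by (intro mult_right_mono powr_mono2 sc_abs_nonneg) auto
      qed (use CS4_integrable[OF ad] in auto)
      also have "\<dots> = ?A powr (1/2) * (LBINT x:{a<..<0}. sc_abs [(0,-3/4),(\<delta>,-3/4),(1,-3/4)] x)" by simp
      also have "(LBINT x:{a<..<0}. sc_abs [(0,-3/4),(\<delta>,-3/4),(1,-3/4)] x) \<le> C"
        unfolding C_def set_lebesgue_integral_def using iC iA
        by (intro integral_mono) (auto simp: set_integrable_def indicator_def sc_abs_nonneg)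
      finally show ?thesis by (simp add: mult_left_mono)
    qed
    moreover have "side2 (K_list a \<delta>) \<delta> \<le> ?A powr (-1/2) * D2"
    proof -
      have "side2 (K_list a \<delta>) \<delta> \<le> (LBINT x:{\<delta><..<1}. ?A powr (-1/2) * sc_abs [(0,-1/4),(\<delta>,-1/4),(1,-1/4)] x)"
        unfolding side2_def
      proof (rule set_integral_mono)
        fix x assume x: "x \<in> {\<delta><..<1}"
        then show "sc_abs (K_list a \<delta>) x \<le> ?A powr (-1/2) * sc_abs [(0,-1/4),(\<delta>,-1/4),(1,-1/4)] x"
          unfolding K_list_def sc_abs_Cons[of a] using ad by (intro mult_right_mono powr_mono2' sc_abs_nonneg) auto
      qed (use CS4_integrable[OF ad] iD2 in auto)
      then show ?thesis by (simp add: D2_def)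
    qed
    moreover have "side1 (K_list a \<delta>) \<delta> \<le> ?A powr (-1/2) * D1"
    proof -
      have "side1 (K_list a \<delta>) \<delta> \<le> (LBINT x:{0<..<\<delta>}. ?A powr (-1/2) * sc_abs [(0,-1/4),(\<delta>,-1/4),(1,-1/4)] x)"
        unfolding side1_def
      proof (rule set_integral_mono)
        fix x assume x: "x \<in> {0<..<\<delta>}"
        then show "sc_abs (K_list a \<delta>) x \<le> ?A powr (-1/2) * sc_abs [(0,-1/4),(\<delta>,-1/4),(1,-1/4)] x"
          unfolding K_list_def sc_abs_Cons[of a] using ad by (intro mult_right_mono powr_mono2' sc_abs_nonneg) auto
      qed (use CS4_integrable[OF ad] iD1 in auto)
      then show ?thesis by (simp add: D1_def)
    qed
    ultimately have "side5 (G_list a \<delta>) a * (sqrt 2 * side2 (K_list a \<delta>) \<delta> + side1 (K_list a \<delta>) \<delta>)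
        \<le> (?A powr (1/2) * C) * (sqrt 2 * (?A powr (-1/2) * D2) + ?A powr (-1/2) * D1)"
      using side_nonneg C0 by (intro mult_mono add_mono mult_left_mono) (auto intro!: add_nonneg_nonneg)
    also have "\<dots> = (?A powr (1/2) * ?A powr (-1/2)) * (C * D)" by (simp add: D_def algebra_simps)
    also have "?A powr (1/2) * ?A powr (-1/2) = 1" using ad by (simp flip: powr_add)
    finally have up: "side5 (G_list a \<delta>) a * (sqrt 2 * side2 (K_list a \<delta>) \<delta> + side1 (K_list a \<delta>) \<delta>) \<le> C * D" by simp
    have k5: "?A powr (-1/2) * ((2 * ?A) powr (-1/4) * ((2 * ?A) powr (-1/4) * (2 * ?A) powr (-1/4))) * (0 - a)
        \<le> side5 (K_list a \<delta>) a"
      unfolding side5_def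
    proof (rule set_integral_ge_const)
      fix x assume x: "x \<in> {a<..<0}"
      then show "?A powr (-1/2) * ((2 * ?A) powr (-1/4) * ((2 * ?A) powr (-1/4) * (2 * ?A) powr (-1/4)))
          \<le> sc_abs (K_list a \<delta>) x"
        unfolding K_list_def sc_abs_def using A assms by (auto intro!: mult_mono powr_mono2')
    qed (use CS4_integrable[OF ad] A in \<open>auto simp: sc_abs_nonneg\<close>)
    have g3: "?A powr (1/2) * (2 powr (-3/4) * (2 powr (-3/4) * 1 powr (-3/4))) * (2 - 1) \<le> side3 (G_list a \<delta>)"
      unfolding side3_def
    proof (rule set_integral_ge_const)
      fix x :: real assume x: "x \<in> {1<..<2}"
      have "?A powr (1/2) \<le> \<bar>x - a\<bar> powr (1/2)" using x A by (intro powr_mono2) auto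
      moreover have "2 powr (-3/4) \<le> \<bar>x\<bar> powr (-3/4)" "2 powr (-3/4) \<le> \<bar>x - \<delta>\<bar> powr (-3/4)"
          "1 powr (-3/4) \<le> \<bar>x - 1\<bar> powr (-3/4)"
        using x assms by (intro powr_mono2'; auto)+
      ultimately have "?A powr (1/2) * (2 powr (-3/4) * (2 powr (-3/4) * 1 powr (-3/4)))
          \<le> \<bar>x - a\<bar> powr (1/2) * (\<bar>x\<bar> powr (-3/4) * (\<bar>x - \<delta>\<bar> powr (-3/4) * \<bar>x - 1\<bar> powr (-3/4)))"
        by (intro mult_mono) auto
      then show "?A powr (1/2) * (2 powr (-3/4) * (2 powr (-3/4) * 1 powr (-3/4))) \<le> sc_abs (G_list a \<delta>) x"
        by (simp add: G_list_def sc_abs_def)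
    qed (use CS4_integrable[OF ad] A in \<open>auto simp: sc_abs_nonneg\<close>)
    have "(?A powr (-1/2) * ((2 * ?A) powr (-1/4) * ((2 * ?A) powr (-1/4) * (2 * ?A) powr (-1/4))) * (0 - a)) *
       (?A powr (1/2) * (2 powr (-3/4) * (2 powr (-3/4) * 1 powr (-3/4))) * (2 - 1))
       \<le> side5 (K_list a \<delta>) a * (sqrt 2 * side4 (G_list a \<delta>) a + side3 (G_list a \<delta>))"
      using k5 g3 side_nonneg ad
      by (intro mult_mono) (auto intro!: add_increasing mult_nonneg_nonneg)
    moreover have "(?A powr (-1/2) * ((2 * ?A) powr (-1/4) * ((2 * ?A) powr (-1/4) * (2 * ?A) powr (-1/4))) * (0 - a)) *
       (?A powr (1/2) * (2 powr (-3/4) * (2 powr (-3/4) * 1 powr (-3/4))) * (2 - 1))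
       = 2 powr (-9/4) * ?A powr (1/4)"
    proof -
      have "(?A powr (-1/2) * ((2 * ?A) powr (-1/4) * ((2 * ?A) powr (-1/4) * (2 * ?A) powr (-1/4))) * (0 - a)) *
       (?A powr (1/2) * (2 powr (-3/4) * (2 powr (-3/4) * 1 powr (-3/4))) * (2 - 1))
       = (2 powr (-1/4) * (2 powr (-1/4) * (2 powr (-1/4) * (2 powr (-3/4) * 2 powr (-3/4))))) *
         (?A powr (-1/2) * (?A powr (-1/4) * (?A powr (-1/4) * (?A powr (-1/4) * (?A powr 1 * ?A powr (1/2))))))"
      proof -
        have "(2 * ?A) powr (-1/4) = 2 powr (-1/4) * ?A powr (-1/4)" by (rule powr_mult)
        then show ?thesis using A by simp
      qed
      also have "\<dots> = 2 powr (-9/4) * ?A powr (1/4)"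
        by (simp only: powr_add[symmetric]) simp
      finally show ?thesis .
    qed
    moreover have "C * D < 2 powr (-9/4) * ?A powr (1/4)"
    proof -
      have "2 powr (-3) \<le> (2::real) powr (-9/4)" by (intro powr_mono) auto
      then have "1/8 \<le> (2::real) powr (-9/4)" by (simp add: powr_minus_divide)
      moreover have "8 * (C * D) + 1 \<le> ?A powr (1/4)"
      proof -
        have p: "8 * (C * D) + 1 > 0" using C0 by (simp add: add_nonneg_pos)
        have "((8 * (C * D) + 1) ^ 4) powr (1/4) \<le> ?A powr (1/4)" using a p by (intro powr_mono2) auto
        moreover have "((8 * (C * D) + 1) ^ 4) powr (1/4) = 8 * (C * D) + 1"
          using p by (simp add: powr_powr flip: powr_numeral)
        ultimately show ?thesis by simp
      qed
      ultimately have "1/8 * (8 * (C * D) + 1) \<le> 2 powr (-9/4) * ?A powr (1/4)"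
        using C0 by (intro mult_mono) auto
      then show ?thesis by simp
    qed
    ultimately show ?thesis using up by (simp add: period_gap_def)
  qed
  moreover have "(8 * (C * D) + 1) ^ 4 \<ge> 1" using C0 by (intro one_le_power) simp
  ultimately show ?thesis by blast
qed

lemma period_gap_zero:
  assumes "0 < \<delta>" "\<delta> < 1"
  shows "\<exists>A\<ge>1. \<forall>a\<le>-A. \<exists>b. 0 < b \<and> b < \<delta> \<and> period_gap a b = 0"
proof -
  obtain A where A: "A \<ge> 1" "\<And>a. a \<le> -A \<Longrightarrow> period_gap a \<delta> > 0" using period_gap_pos[OF assms] by blast
  have "\<exists>b. 0 < b \<and> b < \<delta> \<and> period_gap a b = 0" if a: "a \<le> -A" for a
  proof -
    obtain b0 where b0: "0 < b0" "b0 < \<delta>" "period_gap a b0 < 0"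
      using period_gap_neg[of a \<delta>] a A(1) assms by auto
    have "\<exists>b\<ge>b0. b \<le> \<delta> \<and> period_gap a b = 0"
      using b0 A(2)[OF a] period_gap_continuous[of a b0 \<delta>] A(1) a assms by (intro IVT') auto
    then obtain b where b: "b0 \<le> b" "b \<le> \<delta>" "period_gap a b = 0" by blast
    moreover have "b \<noteq> \<delta>" using b A(2)[OF a] by auto
    ultimately show ?thesis using b0 by (intro exI[of _ b]) auto
  qed
  then show ?thesis using A(1) by blast
qed

section \<open>The degeneration of the side lengths\<close>

text \<open>For an integral with a moving end point, dominated convergence applies after this
  substitution.\<close>

lemma set_integral_affine:
  fixes f :: "real \<Rightarrow> real"
  assumes "p < q"
  shows "(LBINT x:{p<..<q}. f x) = (LBINT t:{0<..<1}. (q - p) * f (p + (q - p) * t))"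
proof -
  have "(LBINT x:{p<..<q}. f x) = \<bar>q - p\<bar> *\<^sub>R (\<integral>x. indicator {p<..<q} (p + (q - p) * x) *\<^sub>R f (p + (q - p) * x) \<partial>lborel)"
    unfolding set_lebesgue_integral_def using assms by (intro lborel_integral_real_affine) auto
  also have "(\<lambda>x. indicator {p<..<q} (p + (q - p) * x) *\<^sub>R f (p + (q - p) * x))
      = (\<lambda>x. indicator {0<..<1} x *\<^sub>R f (p + (q - p) * x))"
  proof
    fix x
    have "p + (q - p) * x < q \<longleftrightarrow> (q - p) * x < (q - p) * 1" by (simp add: algebra_simps)
    then have "p + (q - p) * x \<in> {p<..<q} \<longleftrightarrow> x \<in> {0<..<1}" using assms by (auto simp: zero_less_mult_iff)
    then show "indicator {p<..<q} (p + (q - p) * x) *\<^sub>R f (p + (q - p) * x)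
        = indicator {0<..<1} x *\<^sub>R f (p + (q - p) * x)" by (simp add: indicator_def)
  qed
  finally show ?thesis using assms by (simp add: set_lebesgue_integral_def mult.left_commute flip: integral_mult_right_zero)
qed

lemma limit_integrable:
  "set_integrable lborel {1<..} (sc_abs G_lim)" "set_integrable lborel {0<..<1} (sc_abs K_lim)"
  using sc_integrable[of "ereal 1" 2 "\<infinity>" G_lim] sc_integrable[of "ereal 0" "1/2" "ereal 1" K_lim]
  by (auto simp: sc_regular_def sc_order_def sc_degree_def sc_list_defs sc_points_def)

locale CS4_degeneration =
  fixes a b :: "nat \<Rightarrow> real"
  assumes a: "\<And>n. a n \<le> -1" and b: "\<And>n. 0 < b n" "\<And>n. b n < 1/2"
    and a_lim: "filterlim a at_bot sequentially" and b_lim: "b \<longlonglongrightarrow> 0"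
begin

lemma ab: "a n < 0" "0 < b n" "b n < 1" using a[of n] b[of n] by auto

lemma neg_a_lim: "filterlim (\<lambda>n. - a n) at_top sequentially"
  using a_lim by (simp add: filterlim_uminus_at_top)

lemma ratio_lim:
  assumes "x \<longlonglongrightarrow> l" shows "(\<lambda>n. \<bar>x n - a n\<bar> / - a n) \<longlonglongrightarrow> 1"
proof -
  have "(\<lambda>n. x n / - a n) \<longlonglongrightarrow> 0" by (rule tendsto_divide_0[OF assms]) (rule filterlim_at_top_imp_at_infinity[OF neg_a_lim])
  then have "(\<lambda>n. \<bar>1 + x n / - a n\<bar>) \<longlonglongrightarrow> \<bar>1 + 0\<bar>" by (intro tendsto_intros)
  moreover have "\<bar>1 + x n / - a n\<bar> = \<bar>x n - a n\<bar> / - a n" for n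
  proof -
    have "1 + x n / - a n = (x n - a n) / - a n" using ab[of n] by (simp add: field_simps)
    then show ?thesis using ab[of n] by (simp add: abs_divide)
  qed
  ultimately show ?thesis by simp
qed

lemma pow_ratio: "e = - f \<Longrightarrow> (- a n) powr f * \<bar>x - a n\<bar> powr e = (\<bar>x - a n\<bar> / - a n) powr e"
  unfolding powr_divide[of "\<bar>x - a n\<bar>" "- a n"] by (simp add: powr_minus divide_inverse)

text \<open>For \<open>a \<le> -1\<close> and \<open>x > 1\<close> the quotient \<open>\<bar>x - a\<bar> / (-a)\<close> is at most \<open>x + 1\<close>, its
  value for \<open>a = -1\<close>; so the integrand with \<open>a = -1\<close> and \<open>b = 1/2\<close> is a dominating
  function.\<close>

lemma side3_lim: "(\<lambda>n. (- a n) powr (-1/2) * side3 (G_list (a n) (b n))) \<longlonglongrightarrow> side3 G_lim"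
proof -
  have "(\<lambda>n. LBINT x:{1<..}. (- a n) powr (-1/2) * sc_abs (G_list (a n) (b n)) x) \<longlonglongrightarrow> (LBINT x:{1<..}. sc_abs G_lim x)"
  proof (rule set_integral_dominated_convergence)
    show "set_integrable lborel {1<..} (sc_abs (G_list (-1) (1/2)))" by (rule CS4_integrable) auto
    fix x :: real assume x: "x \<in> {1<..}"
    have eq: "(- a n) powr (-1/2) * sc_abs (G_list (a n) (b n)) x
       = (\<bar>x - a n\<bar> / - a n) powr (1/2) * (\<bar>x\<bar> powr (-3/4) * (\<bar>x - b n\<bar> powr (-3/4) * \<bar>x - 1\<bar> powr (-3/4)))" for n
      using pow_ratio[of "1/2" "-1/2" n x] by (simp add: G_list_def sc_abs_def flip: mult.assoc)
    show "\<bar>(- a n) powr (-1/2) * sc_abs (G_list (a n) (b n)) x\<bar> \<le> sc_abs (G_list (-1) (1/2)) x" for n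
    proof -
      have "\<bar>x - a n\<bar> / - a n \<le> \<bar>x - (-1)\<bar>"
      proof -
        have "x - a n = x + - a n" by simp
        also have "\<dots> \<le> x * - a n + - a n" using x a[of n] mult_left_mono[of 1 "- a n" x] by simp
        finally show ?thesis using x ab[of n] by (simp add: field_simps)
      qed
      then have "(\<bar>x - a n\<bar> / - a n) powr (1/2) \<le> \<bar>x - (-1)\<bar> powr (1/2)"
        using ab[of n] by (intro powr_mono2) (auto intro: divide_nonneg_neg)
      moreover have "\<bar>x - b n\<bar> powr (-3/4) \<le> \<bar>x - 1/2\<bar> powr (-3/4)"
        using x b[of n] by (intro powr_mono2') auto
      ultimately have "(\<bar>x - a n\<bar> / - a n) powr (1/2) * (\<bar>x\<bar> powr (-3/4) * (\<bar>x - b n\<bar> powr (-3/4) * \<bar>x - 1\<bar> powr (-3/4)))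
        \<le> \<bar>x - (-1)\<bar> powr (1/2) * (\<bar>x\<bar> powr (-3/4) * (\<bar>x - 1/2\<bar> powr (-3/4) * \<bar>x - 1\<bar> powr (-3/4)))"
        by (intro mult_mono) auto
      then show ?thesis unfolding eq by (simp add: G_list_def sc_abs_def)
    qed
    have "(\<lambda>n. (\<bar>x - a n\<bar> / - a n) powr (1/2) * (\<bar>x\<bar> powr (-3/4) * (\<bar>x - b n\<bar> powr (-3/4) * \<bar>x - 1\<bar> powr (-3/4))))
        \<longlonglongrightarrow> 1 powr (1/2) * (\<bar>x\<bar> powr (-3/4) * (\<bar>x - 0\<bar> powr (-3/4) * \<bar>x - 1\<bar> powr (-3/4)))"
      using x by (intro tendsto_intros ratio_lim b_lim) auto
    also have "1 powr (1/2) * (\<bar>x\<bar> powr (-3/4) * (\<bar>x - 0\<bar> powr (-3/4) * \<bar>x - 1\<bar> powr (-3/4))) = sc_abs G_lim x"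
      using x by (simp add: G_lim_def sc_abs_def flip: powr_add mult.assoc)
    finally show "(\<lambda>n. (- a n) powr (-1/2) * sc_abs (G_list (a n) (b n)) x) \<longlonglongrightarrow> sc_abs G_lim x"
      unfolding eq .
  qed auto
  then show ?thesis by (simp add: side3_def)
qed

lemma powr_neg_lim: "(\<lambda>n. (- a n) powr (-1/2)) \<longlonglongrightarrow> 0"
  by (rule tendsto_neg_powr[OF _ neg_a_lim]) simp

text \<open>Beyond \<open>a\<close> every factor is bounded by the power of \<open>\<bar>x\<bar>\<close> with the same exponent.\<close>

lemma side4_lim: "(\<lambda>n. (- a n) powr (-1/2) * side4 (G_list (a n) (b n)) (a n)) \<longlonglongrightarrow> 0"
proof (rule tendsto_sandwich[OF always_eventually always_eventually])
  define J where "J = (LBINT x:{..<-1}. sc_abs [(0,-7/4)] x)"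
  have iJ: "set_integrable lborel {..<-1} (sc_abs [(0,-7/4)])"
    using sc_integrable[of "-\<infinity>" "-2" "ereal (-1)" "[(0,-7/4)]"] by (simp add: sc_regular_def sc_order_def sc_points_def sc_degree_def)
  show "\<forall>n. 0 \<le> (- a n) powr (-1/2) * side4 (G_list (a n) (b n)) (a n)" by (simp add: side_nonneg)
  have "side4 (G_list (a n) (b n)) (a n) \<le> J" for n
  proof -
    have iA: "set_integrable lborel {..<a n} (sc_abs [(0,-7/4)])"
      by (rule set_integrable_subset[OF iJ]) (use a[of n] in auto)
    have "side4 (G_list (a n) (b n)) (a n) \<le> (LBINT x:{..<a n}. sc_abs [(0,-7/4)] x)"
      unfolding side4_def
    proof (rule set_integral_mono)
      fix x assume x: "x \<in> {..<a n}"
      have "\<bar>x - a n\<bar> powr (1/2) \<le> \<bar>x\<bar> powr (1/2)" using x a[of n] by (intro powr_mono2) auto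
      moreover have "\<bar>x - b n\<bar> powr (-3/4) \<le> \<bar>x\<bar> powr (-3/4)" "\<bar>x - 1\<bar> powr (-3/4) \<le> \<bar>x\<bar> powr (-3/4)"
        using x a[of n] b[of n] by (intro powr_mono2'; auto)+
      ultimately have "\<bar>x - a n\<bar> powr (1/2) * (\<bar>x\<bar> powr (-3/4) * (\<bar>x - b n\<bar> powr (-3/4) * \<bar>x - 1\<bar> powr (-3/4)))
          \<le> \<bar>x\<bar> powr (1/2) * (\<bar>x\<bar> powr (-3/4) * (\<bar>x\<bar> powr (-3/4) * \<bar>x\<bar> powr (-3/4)))"
        by (intro mult_mono) auto
      also have "\<dots> = \<bar>x\<bar> powr (-7/4)" by (simp only: powr_add[symmetric]) simp
      finally show "sc_abs (G_list (a n) (b n)) x \<le> sc_abs [(0,-7/4)] x" by (simp add: G_list_def sc_abs_def)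
    qed (use CS4_integrable[OF ab] iA in auto)
    also have "\<dots> \<le> J"
      unfolding J_def set_lebesgue_integral_def using iA iJ a[of n]
      by (intro integral_mono) (auto simp: set_integrable_def indicator_def sc_abs_nonneg)
    finally show ?thesis .
  qed
  then show "\<forall>n. (- a n) powr (-1/2) * side4 (G_list (a n) (b n)) (a n) \<le> (- a n) powr (-1/2) * J"
    by (auto intro: mult_left_mono)
  show "(\<lambda>n. (- a n) powr (-1/2) * J) \<longlonglongrightarrow> 0"
    using tendsto_mult_left_zero[OF powr_neg_lim, of J] .
qed simp

lemma side2_lim: "(\<lambda>n. (- a n) powr (1/2) * side2 (K_list (a n) (b n)) (b n)) \<longlonglongrightarrow> (LBINT x:{0<..<1}. sc_abs K_lim x)"
proof -
  define y where "y n t = b n + (1 - b n) * t" for n t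
  have "(\<lambda>n. LBINT t:{0<..<1}. (- a n) powr (1/2) * ((1 - b n) * sc_abs (K_list (a n) (b n)) (y n t)))
      \<longlonglongrightarrow> (LBINT x:{0<..<1}. sc_abs K_lim x)"
  proof (rule set_integral_dominated_convergence)
    show "set_integrable lborel {0<..<1} (sc_abs K_lim)" by (rule limit_integrable)
    show "(\<lambda>t. (- a n) powr (1/2) * ((1 - b n) * sc_abs (K_list (a n) (b n)) (y n t))) \<in> borel_measurable borel" for n
      unfolding y_def by measurable
    fix t :: real assume t: "t \<in> {0<..<1}"
    have y: "\<bar>y n t - b n\<bar> = (1 - b n) * t" "\<bar>y n t - 1\<bar> = (1 - b n) * (1 - t)" "y n t \<ge> t" "y n t > 0" for n
    proof -
      have "y n t - b n = (1 - b n) * t" "y n t - 1 = - ((1 - b n) * (1 - t))"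
        by (simp_all add: y_def algebra_simps)
      moreover have "(1 - b n) * t \<ge> 0" "(1 - b n) * (1 - t) \<ge> 0" using t ab[of n] by auto
      ultimately show "\<bar>y n t - b n\<bar> = (1 - b n) * t" "\<bar>y n t - 1\<bar> = (1 - b n) * (1 - t)" by auto
      have "y n t - t = b n * (1 - t)" by (simp add: y_def algebra_simps)
      moreover have "b n * (1 - t) \<ge> 0" using t ab[of n] by auto
      ultimately show "y n t \<ge> t" by simp
      then show "y n t > 0" using t by auto
    qed
    have eq: "(- a n) powr (1/2) * ((1 - b n) * sc_abs (K_list (a n) (b n)) (y n t))
       = (\<bar>y n t - a n\<bar> / - a n) powr (-1/2) * ((1 - b n) * (\<bar>y n t\<bar> powr (-1/4) *
         (((1 - b n) * t) powr (-1/4) * ((1 - b n) * (1 - t)) powr (-1/4))))" for n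
      using pow_ratio[of "-1/2" "1/2" n "y n t"]
      by (simp add: K_list_def sc_abs_def y mult.left_commute flip: mult.assoc)
    show "\<bar>(- a n) powr (1/2) * ((1 - b n) * sc_abs (K_list (a n) (b n)) (y n t))\<bar> \<le> sc_abs K_lim t" for n
    proof -
      have "1 \<le> \<bar>y n t - a n\<bar> / - a n" using y[of n] ab[of n] by (simp add: field_simps)
      then have 1: "(\<bar>y n t - a n\<bar> / - a n) powr (-1/2) \<le> 1 powr (-1/2)" by (intro powr_mono2') auto
      have 2: "\<bar>y n t\<bar> powr (-1/4) \<le> t powr (-1/4)" using y[of n] t by (intro powr_mono2') auto
      have "(1 - b n) * ((1 - b n) powr (-1/4) * (1 - b n) powr (-1/4)) = (1 - b n) powr 1 * ((1 - b n) powr (-1/4) * (1 - b n) powr (-1/4))"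
        using ab[of n] by simp
      also have "\<dots> = (1 - b n) powr (1/2)" by (simp only: powr_add[symmetric]) simp
      also have "\<dots> \<le> 1 powr (1/2)" using ab[of n] by (intro powr_mono2) auto
      finally have 3: "(1 - b n) * ((1 - b n) powr (-1/4) * (1 - b n) powr (-1/4)) \<le> 1" by simp
      have "(\<bar>y n t - a n\<bar> / - a n) powr (-1/2) * ((1 - b n) * (\<bar>y n t\<bar> powr (-1/4) *
         (((1 - b n) * t) powr (-1/4) * ((1 - b n) * (1 - t)) powr (-1/4))))
        = (\<bar>y n t - a n\<bar> / - a n) powr (-1/2) * (\<bar>y n t\<bar> powr (-1/4) *
          (((1 - b n) * ((1 - b n) powr (-1/4) * (1 - b n) powr (-1/4))) * (t powr (-1/4) * (1 - t) powr (-1/4))))"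
        using t ab[of n] by (simp add: powr_mult)
      also have "\<dots> \<le> 1 powr (-1/2) * (t powr (-1/4) * (1 * (t powr (-1/4) * (1 - t) powr (-1/4))))"
        using ab[of n] by (intro mult_mono 1 2 3) auto
      also have "\<dots> = (t powr (-1/4) * t powr (-1/4)) * (1 - t) powr (-1/4)" by simp
      also have "t powr (-1/4) * t powr (-1/4) = t powr (-1/2)" by (simp flip: powr_add)
      also have "t powr (-1/2) * (1 - t) powr (-1/4) = sc_abs K_lim t" using t by (simp add: K_lim_def sc_abs_def)
      finally show ?thesis unfolding eq using ab[of n] by simp
    qed
    have yl: "(\<lambda>n. y n t) \<longlonglongrightarrow> t"
      unfolding y_def by (rule tendsto_eq_intros b_lim refl)+ simp
    have "(\<lambda>n. (\<bar>y n t - a n\<bar> / - a n) powr (-1/2) * ((1 - b n) * (\<bar>y n t\<bar> powr (-1/4) *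
         (((1 - b n) * t) powr (-1/4) * ((1 - b n) * (1 - t)) powr (-1/4)))))
        \<longlonglongrightarrow> 1 powr (-1/2) * ((1 - 0) * (\<bar>t\<bar> powr (-1/4) *
         (((1 - 0) * t) powr (-1/4) * ((1 - 0) * (1 - t)) powr (-1/4))))"
      using t by (intro tendsto_intros ratio_lim[OF yl] yl b_lim) auto
    also have "1 powr (-1/2) * ((1 - 0) * (\<bar>t\<bar> powr (-1/4) *
         (((1 - 0) * t) powr (-1/4) * ((1 - 0) * (1 - t)) powr (-1/4)))) = (t powr (-1/4) * t powr (-1/4)) * (1 - t) powr (-1/4)"
      using t by simp
    also have "t powr (-1/4) * t powr (-1/4) = t powr (-1/2)" by (simp flip: powr_add)
    also have "t powr (-1/2) * (1 - t) powr (-1/4) = sc_abs K_lim t" using t by (simp add: K_lim_def sc_abs_def)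
    finally show "(\<lambda>n. (- a n) powr (1/2) * ((1 - b n) * sc_abs (K_list (a n) (b n)) (y n t))) \<longlonglongrightarrow> sc_abs K_lim t"
      unfolding eq .
  qed auto
  moreover have "(LBINT t:{0<..<1}. (- a n) powr (1/2) * ((1 - b n) * sc_abs (K_list (a n) (b n)) (y n t)))
      = (- a n) powr (1/2) * side2 (K_list (a n) (b n)) (b n)" for n
    unfolding side2_def using set_integral_affine[of "b n" 1 "sc_abs (K_list (a n) (b n))"] ab[of n] by (simp add: y_def)
  ultimately show ?thesis by (simp only:)
qed

lemma side1_lim: "(\<lambda>n. (- a n) powr (1/2) * side1 (K_list (a n) (b n)) (b n)) \<longlonglongrightarrow> 0"
proof (rule tendsto_sandwich[OF always_eventually always_eventually])
  define J where "J = (LBINT t:{0<..<1}. 2 * sc_abs [(0,-1/4),(1,-1/4)] t)"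
  have iJ: "set_integrable lborel {0<..<1} (\<lambda>t. 2 * sc_abs [(0,-1/4),(1,-1/4)] t)"
    using sc_integrable[of "ereal 0" "1/2" "ereal 1" "[(0,-1/4),(1,-1/4)]"]
    by (simp add: sc_regular_def sc_order_def sc_points_def)
  show "\<forall>n. 0 \<le> (- a n) powr (1/2) * side1 (K_list (a n) (b n)) (b n)" by (simp add: side_nonneg)
  show "\<forall>n. (- a n) powr (1/2) * side1 (K_list (a n) (b n)) (b n) \<le> b n powr (1/2) * J"
  proof
    fix n
    let ?f = "\<lambda>t. (- a n) powr (1/2) * (b n * sc_abs (K_list (a n) (b n)) (b n * t))"
    have eq: "(- a n) powr (1/2) * side1 (K_list (a n) (b n)) (b n) = (LBINT t:{0<..<1}. ?f t)"
      unfolding side1_def using set_integral_affine[of 0 "b n" "sc_abs (K_list (a n) (b n))"] ab[of n] by simp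
    have bd: "?f t \<le> b n powr (1/2) * (2 * sc_abs [(0,-1/4),(1,-1/4)] t)" if t: "t \<in> {0<..<1}" for t
    proof -
      have bt: "0 < b n * t" "b n * t < b n" using t ab[of n] by auto
      have bt2: "b n * t < 1/2" using bt(2) b(2)[of n] by linarith
      have "1 \<le> \<bar>b n * t - a n\<bar> / - a n" using bt ab[of n] by (simp add: field_simps)
      then have 1: "(\<bar>b n * t - a n\<bar> / - a n) powr (-1/2) \<le> 1 powr (-1/2)" by (intro powr_mono2') auto
      have "\<bar>b n * t - 1\<bar> powr (-1/4) \<le> (1/2) powr (-1/4)" using bt2 by (intro powr_mono2') auto
      also have "(1/2::real) powr (-1/4) = 2 powr (1/4)" by (simp add: powr_divide powr_minus_divide)
      also have "2 powr (1/4) \<le> (2::real) powr 1" by (intro powr_mono) auto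
      finally have 2: "\<bar>b n * t - 1\<bar> powr (-1/4) \<le> 2" by simp
      have tb: "\<bar>b n * t - b n\<bar> = b n * (1 - t)"
      proof -
        have "b n * t - b n = - (b n * (1 - t))" by (simp add: algebra_simps)
        then show ?thesis using t ab[of n] by (simp add: abs_mult)
      qed
      have "?f t = (\<bar>b n * t - a n\<bar> / - a n) powr (-1/2) * (b n * ((b n * t) powr (-1/4) *
         ((b n * (1 - t)) powr (-1/4) * \<bar>b n * t - 1\<bar> powr (-1/4))))"
        using pow_ratio[of "-1/2" "1/2" n "b n * t"] bt
        by (simp add: K_list_def sc_abs_def tb mult.left_commute flip: mult.assoc)
      also have "\<dots> = (\<bar>b n * t - a n\<bar> / - a n) powr (-1/2) * ((b n powr 1 * (b n powr (-1/4) * b n powr (-1/4))) *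
         (t powr (-1/4) * (1 - t) powr (-1/4) * \<bar>b n * t - 1\<bar> powr (-1/4)))"
        using t ab[of n] by (simp add: powr_mult)
      also have "b n powr 1 * (b n powr (-1/4) * b n powr (-1/4)) = b n powr (1/2)"
        by (simp only: powr_add[symmetric]) simp
      also have "(\<bar>b n * t - a n\<bar> / - a n) powr (-1/2) * (b n powr (1/2) *
         (t powr (-1/4) * (1 - t) powr (-1/4) * \<bar>b n * t - 1\<bar> powr (-1/4)))
         \<le> 1 powr (-1/2) * (b n powr (1/2) * (t powr (-1/4) * (1 - t) powr (-1/4) * 2))"
        by (intro mult_mono 1 2) auto
      finally show ?thesis using t by (simp add: sc_abs_def mult_ac)
    qed
    have "?f t \<ge> 0" for t using ab[of n] by (simp add: sc_abs_nonneg)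
    have iR: "set_integrable lborel {0<..<1} (\<lambda>t. b n powr (1/2) * (2 * sc_abs [(0,-1/4),(1,-1/4)] t))"
      by (intro set_integrable_mult_right iJ)
    have iL: "set_integrable lborel {0<..<1} ?f"
      by (rule set_integrable_bound[OF iR]) (use bd ab[of n] in \<open>auto simp: set_borel_measurable_def sc_abs_nonneg abs_mult intro!: AE_I2\<close>)
    show "(- a n) powr (1/2) * side1 (K_list (a n) (b n)) (b n) \<le> b n powr (1/2) * J"
      unfolding eq J_def set_integral_mult_right[symmetric] by (rule set_integral_mono[OF iL iR bd])
  qed
  have "(\<lambda>n. b n powr (1/2) * J) \<longlonglongrightarrow> 0 powr (1/2) * J"
    by (intro tendsto_intros tendsto_powr2 b_lim) (auto simp: less_imp_le[OF ab(2)])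
  then show "(\<lambda>n. b n powr (1/2) * J) \<longlonglongrightarrow> 0" by simp
qed simp

end

text \<open>This and the next estimate show that the limit \<open>c\<^sup>2\<close> of \<open>\<rho>\<^sup>2 (-a)\<close> is larger than
  \<open>1/2\<close>, which makes \<open>\<bar>G\<bar>\<close> at least \<open>1\<close> between \<open>b\<close> and \<open>1\<close>. The comparison function is the
  derivative of \<open>4 ((x - 1) / x)\<^sup>1\<^sup>/\<^sup>4\<close>.\<close>

lemma side3_G_lim_le: "side3 G_lim \<le> 4"
proof -
  define F where "F x = 4 * ((x - 1) / x) powr (1/4)" for x :: real
  define f where "f x = ((x - 1) / x) powr (-3/4) * (1 / x^2)" for x :: real
  have d: "DERIV F x :> f x" and c: "isCont f x" if "1 < ereal x" "ereal x < \<infinity>" for x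
  proof -
    have x: "x > 1" using that by (simp add: one_ereal_def)
    then show "DERIV F x :> f x"
      unfolding F_def f_def by (auto intro!: derivative_eq_intros simp: field_simps power2_eq_square powr_diff)
    show "isCont f x" unfolding f_def using x by (intro continuous_intros) auto
  qed
  have "((\<lambda>x. 4 * ((x - 1) / x) powr (1/4)) \<longlongrightarrow> 0) (at_right (1::real))"
      by (auto intro!: tendsto_eq_intros simp: eventually_at_right_field gt_ex)
  then have l0: "((F \<circ> real_of_ereal) \<longlongrightarrow> 0) (at_right 1)" by (simp add: one_ereal_def ereal_tendsto_simps F_def[abs_def] del: o_apply)
  have "((\<lambda>x. 4 * ((x - 1) / x) powr (1/4)) \<longlongrightarrow> 4) (at_top :: real filter)" by real_asymp
  then have l1: "((F \<circ> real_of_ereal) \<longlongrightarrow> 4) (at_left \<infinity>)" by (simp add: ereal_tendsto_simps F_def[abs_def] del: o_apply)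
  have n: "AE x in lborel. 1 < ereal x \<longrightarrow> ereal x < \<infinity> \<longrightarrow> 0 \<le> f x" by (simp add: f_def)
  have "(1::ereal) < \<infinity>" by simp
  note I = interval_integral_FTC_nonneg[OF this d c n l0 l1]
  have "side3 G_lim \<le> (LBINT x:{1<..}. f x)"
    unfolding side3_def
  proof (rule set_integral_mono)
    show "set_integrable lborel {1<..} f" using I(1) by (simp add: one_ereal_def)
    fix x :: real assume x: "x \<in> {1<..}"
    have "x powr (-3/2) \<le> x powr (-5/4)" using x by (intro powr_mono) auto
    also have "x powr (-5/4) = x powr (3/4) * x powr (-2)" by (simp flip: powr_add)
    also have "x powr (-2) = 1/x^2" using x by (simp add: powr_minus_divide)
    finally have "x powr (-3/2) * (x - 1) powr (-3/4) \<le> (x powr (3/4) * (1 / x^2)) * (x - 1) powr (-3/4)"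
      by (rule mult_right_mono) simp
    also have "\<dots> = f x" using x by (simp add: f_def powr_divide powr_minus field_simps)
    finally show "sc_abs G_lim x \<le> f x" using x by (simp add: G_lim_def sc_abs_def)
  qed (rule limit_integrable)
  also have "\<dots> = 4" using I(2) by (simp add: interval_lebesgue_integral_le_eq one_ereal_def)
  finally show ?thesis .
qed

lemma side_K_lim_ge: "(LBINT x:{0<..<1}. sc_abs K_lim x) \<ge> 2"
proof -
  define F where "F x = 2 * x powr (1/2)" for x :: real
  define f where "f x = x powr (-1/2)" for x :: real
  have d: "DERIV F x :> f x" and c: "isCont f x" if "0 < ereal x" "ereal x < 1" for x
  proof -
    have x: "x > 0" using that by simp
    then show "DERIV F x :> f x"
      unfolding F_def f_def by (auto intro!: derivative_eq_intros)
    show "isCont f x" unfolding f_def using x by (intro continuous_intros) auto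
  qed
  have "((\<lambda>x. 2 * x powr (1/2)) \<longlongrightarrow> 0) (at_right (0::real))"
      by (auto intro!: tendsto_eq_intros simp: eventually_at_right_field gt_ex)
  then have l0: "((F \<circ> real_of_ereal) \<longlongrightarrow> 0) (at_right 0)" by (simp add: zero_ereal_def ereal_tendsto_simps F_def[abs_def] del: o_apply)
  have "((\<lambda>x. 2 * x powr (1/2)) \<longlongrightarrow> 2) (at_left (1::real))"
      by (auto intro!: tendsto_eq_intros)
  then have l1: "((F \<circ> real_of_ereal) \<longlongrightarrow> 2) (at_left 1)" by (simp add: one_ereal_def ereal_tendsto_simps F_def[abs_def] del: o_apply)
  have n: "AE x in lborel. 0 < ereal x \<longrightarrow> ereal x < 1 \<longrightarrow> 0 \<le> f x" by (simp add: f_def)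
  have "(0::ereal) < 1" by simp
  note I = interval_integral_FTC_nonneg[OF this d c n l0 l1]
  have "2 = (LBINT x:{0<..<1}. f x)" using I(2) by (simp add: interval_lebesgue_integral_le_eq one_ereal_def zero_ereal_def)
  also have "\<dots> \<le> (LBINT x:{0<..<1}. sc_abs K_lim x)"
  proof (rule set_integral_mono)
    show "set_integrable lborel {0<..<1} f" using I(1) by (simp add: one_ereal_def zero_ereal_def)
    fix x :: real assume x: "x \<in> {0<..<1}"
    have "1 powr (-1/4) \<le> \<bar>x - 1\<bar> powr (-1/4)" using x by (intro powr_mono2') auto
    then have "x powr (-1/2) * 1 \<le> x powr (-1/2) * \<bar>x - 1\<bar> powr (-1/4)" by (intro mult_left_mono) auto
    then show "f x \<le> sc_abs K_lim x" using x by (simp add: K_lim_def sc_abs_def f_def)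
  qed (rule limit_integrable)
  finally show ?thesis .
qed

section \<open>Solutions of the period problem\<close>

lemma set_integral_sc_pos:
  assumes int: "set_integrable lborel S (sc_abs xs)" and "p < q" "{p..q} \<subseteq> S" "{p..q} \<inter> sc_points xs = {}"
  shows "(LBINT x:S. sc_abs xs x) > 0"
proof -
  have pts: "x \<notin> sc_points xs" if "x \<in> {p..q}" for x using assms(4) that by blast
  have "continuous_on {p..q} (sc_abs xs)"
    by (intro continuous_at_imp_continuous_on ballI sc_abs_continuous pts)
  then obtain y where y: "y \<in> {p..q}" "\<forall>x\<in>{p..q}. sc_abs xs y \<le> sc_abs xs x"
    using continuous_attains_inf[of "{p..q}" "sc_abs xs"] assms(2) by auto
  have "0 < sc_abs xs y * (q - p)" using sc_abs_pos[OF pts[OF y(1)]] assms(2) by simp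
  also have "\<dots> \<le> (LBINT x:S. sc_abs xs x)"
    by (rule set_integral_ge_const[OF int]) (use assms y in \<open>auto simp: sc_abs_nonneg\<close>)
  finally show ?thesis .
qed

lemma CS4_side_pos:
  assumes "a < 0" "0 < b" "b < 1"
  shows "side5 (G_list a b) a > 0" "side5 (K_list a b) a > 0" "side3 (G_list a b) > 0" "side3 (K_list a b) > 0"
    "side1 (K_list a b) b > 0"
  unfolding side_defs using assms
  by (auto intro!: set_integral_sc_pos[OF CS4_integrable(1)[OF assms], of "a*2/3" "a/3"]
    set_integral_sc_pos[OF CS4_integrable(2)[OF assms], of "a*2/3" "a/3"]
    set_integral_sc_pos[OF CS4_integrable(7)[OF assms], of 2 3]
    set_integral_sc_pos[OF CS4_integrable(8)[OF assms], of 2 3]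
    set_integral_sc_pos[OF CS4_integrable(4)[OF assms], of "b/3" "b*2/3"] simp: CS4_points)

text \<open>The first equation makes the edge over \<open>(a, 0)\<close> start and end on the same vertical
  line; given the first, the second one makes the edge over \<open>(b, 1)\<close> span the whole width of
  the box.\<close>

definition CS4_period :: "real \<Rightarrow> real \<Rightarrow> real \<Rightarrow> bool" where
  "CS4_period a b \<rho> \<longleftrightarrow> \<rho>\<^sup>2 * side5 (G_list a b) a = side5 (K_list a b) a \<and>
     \<rho>\<^sup>2 * (sqrt 2 * side4 (G_list a b) a + side3 (G_list a b)) = sqrt 2 * side2 (K_list a b) b + side1 (K_list a b) b"

lemma CS4_period_gap:
  assumes "a < 0" "0 < b" "b < 1" "period_gap a b = 0"
  shows "CS4_period a b (sqrt (side5 (K_list a b) a / side5 (G_list a b) a))"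
proof -
  note p = CS4_side_pos[OF assms(1-3)]
  have "(sqrt (side5 (K_list a b) a / side5 (G_list a b) a))\<^sup>2 = side5 (K_list a b) a / side5 (G_list a b) a"
    using p by simp
  then show ?thesis using assms(4) p by (simp add: CS4_period_def period_gap_def field_simps)
qed

text \<open>By the period equations \<open>\<rho>\<^sup>2 (-a)\<close> is a quotient of side lengths scaled by powers of
  \<open>-a\<close>, all of which converge. The bounds on \<open>\<rho>\<close> are obtained by dropping finitely many terms;
  they determine on which arcs \<open>\<bar>G\<bar>\<close> exceeds \<open>1\<close>.\<close>

lemma CS4_parameters:
  obtains a b \<rho> :: "nat \<Rightarrow> real" and c :: real where "CS4_degeneration a b"
    "\<And>n. \<rho> n > 0" "\<And>n. CS4_period (a n) (b n) (\<rho> n)" "\<And>n. 1/2 \<le> (\<rho> n)\<^sup>2 * - a n" "\<And>n. (\<rho> n)\<^sup>2 \<le> 1"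
    "(\<lambda>n. \<rho> n * sqrt (- a n)) \<longlonglongrightarrow> c" "c > 0" "c\<^sup>2 * side3 G_lim = sqrt 2 * (LBINT x:{0<..<1}. sc_abs K_lim x)"
proof -
  have "\<exists>a b. a \<le> - (real n + 1) \<and> 0 < b \<and> b < 1 / (real n + 2) \<and> period_gap a b = 0" for n
  proof -
    obtain A where A: "A \<ge> 1" "\<forall>a\<le>-A. \<exists>b. 0 < b \<and> b < 1 / (real n + 2) \<and> period_gap a b = 0"
      using period_gap_zero[of "1 / (real n + 2)"] by auto
    have "- max A (real n + 1) \<le> -A" by simp
    then obtain b where "0 < b" "b < 1 / (real n + 2)" "period_gap (- max A (real n + 1)) b = 0" using A by blast
    then show ?thesis by (intro exI[of _ "- max A (real n + 1)"] exI[of _ b]) auto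
  qed
  then obtain a b where sel: "\<And>n. a n \<le> - (real n + 1)" "\<And>n. 0 < b n" "\<And>n. b n < 1 / (real n + 2)"
    "\<And>n. period_gap (a n) (b n) = 0" by metis
  have blt: "1 / (real n + 2) \<le> 1/2" for n by (simp add: field_simps)
  interpret CS4_degeneration a b
  proof
    show "a n \<le> -1" for n using sel(1)[of n] by simp
    show "0 < b n" for n by (rule sel)
    show "b n < 1/2" for n by (rule less_le_trans[OF sel(3) blt])
    have "filterlim (\<lambda>n. - (real n + 1)) at_bot sequentially" by real_asymp
    then show "filterlim a at_bot sequentially"
      by (rule filterlim_at_bot_mono) (use sel(1) in \<open>auto intro: always_eventually\<close>)
    have "(\<lambda>n. 1 / (real n + 2)) \<longlonglongrightarrow> 0" by real_asymp
    then show "b \<longlonglongrightarrow> 0"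
      by (rule tendsto_sandwich[OF always_eventually always_eventually tendsto_const, rotated 2])
         (use sel(2,3) in \<open>auto intro: less_imp_le\<close>)
  qed
  define \<rho> where "\<rho> n = sqrt (side5 (K_list (a n) (b n)) (a n) / side5 (G_list (a n) (b n)) (a n))" for n
  have pos: "\<rho> n > 0" for n using CS4_side_pos[OF ab, of n] by (simp add: \<rho>_def)
  have per: "CS4_period (a n) (b n) (\<rho> n)" for n
    unfolding \<rho>_def by (rule CS4_period_gap[OF ab sel(4)])
  let ?KL = "LBINT x:{0<..<1}. sc_abs K_lim x"
  have GL: "side3 G_lim > 0"
    unfolding side3_def by (rule set_integral_sc_pos[OF limit_integrable(1), of 2 3]) (auto simp: G_lim_def sc_points_def)
  define C where "C = sqrt 2 * ?KL / side3 G_lim"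
  have eq: "(\<rho> n)\<^sup>2 * - a n = (sqrt 2 * ((- a n) powr (1/2) * side2 (K_list (a n) (b n)) (b n)) + (- a n) powr (1/2) * side1 (K_list (a n) (b n)) (b n)) /
      (sqrt 2 * ((- a n) powr (-1/2) * side4 (G_list (a n) (b n)) (a n)) + (- a n) powr (-1/2) * side3 (G_list (a n) (b n)))" for n
  proof -
    define N where "N = sqrt 2 * side2 (K_list (a n) (b n)) (b n) + side1 (K_list (a n) (b n)) (b n)"
    define D where "D = sqrt 2 * side4 (G_list (a n) (b n)) (a n) + side3 (G_list (a n) (b n))"
    have "D > 0" unfolding D_def using CS4_side_pos(3)[OF ab, of n] side_nonneg(4)
      by (intro add_nonneg_pos) auto
    moreover have "(\<rho> n)\<^sup>2 * D = N" using per[of n] by (simp add: CS4_period_def N_def D_def)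
    ultimately have r: "(\<rho> n)\<^sup>2 = N / D" by (simp add: field_simps)
    have A: "- a n > 0" using ab(1)[of n] by simp
    have "(- a n) powr (1/2) / (- a n) powr (-1/2) = (- a n) powr 1" by (simp flip: powr_diff)
    then have A2: "(- a n) powr (1/2) / (- a n) powr (-1/2) = - a n" using A by simp
    have "N / D * - a n = ((- a n) powr (1/2) * N) / ((- a n) powr (-1/2) * D)"
      unfolding times_divide_times_eq[symmetric] A2 by simp
    then show ?thesis unfolding r by (simp add: N_def D_def algebra_simps)
  qed
  have lim: "(\<lambda>n. (\<rho> n)\<^sup>2 * - a n) \<longlonglongrightarrow> C"
  proof -
    have "(\<lambda>n. (\<rho> n)\<^sup>2 * - a n) \<longlonglongrightarrow> (sqrt 2 * ?KL + 0) / (sqrt 2 * 0 + side3 G_lim)"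
      unfolding eq by (intro tendsto_intros side1_lim side2_lim side3_lim side4_lim) (use GL in auto)
    then show ?thesis by (simp add: C_def)
  qed
  have C: "C > 1/2"
  proof -
    have "1/2 < 1 * 2 / (4::real) * sqrt 2" by simp
    also have "1 * 2 / 4 * sqrt 2 \<le> sqrt 2 * ?KL / side3 G_lim"
      using side_K_lim_ge side3_G_lim_le GL
      by (simp add: field_simps)
    finally show ?thesis by (simp add: C_def)
  qed
  have "\<forall>\<^sub>F n in sequentially. (\<rho> n)\<^sup>2 * - a n > 1/2" using order_tendstoD(1)[OF lim C] .
  moreover have "\<forall>\<^sub>F n in sequentially. (\<rho> n)\<^sup>2 < 1"
  proof -
    have "(\<lambda>n. (\<rho> n)\<^sup>2 * - a n / - a n) \<longlonglongrightarrow> 0"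
      by (rule tendsto_divide_0[OF lim]) (rule filterlim_at_top_imp_at_infinity[OF neg_a_lim])
    moreover have "(\<rho> n)\<^sup>2 * - a n / - a n = (\<rho> n)\<^sup>2" for n
      using ab(1)[of n] by simp
    ultimately have "(\<lambda>n. (\<rho> n)\<^sup>2) \<longlonglongrightarrow> 0" by (simp only:)
    then show ?thesis by (rule order_tendstoD) simp
  qed
  ultimately have "\<forall>\<^sub>F n in sequentially. (\<rho> n)\<^sup>2 * - a n > 1/2 \<and> (\<rho> n)\<^sup>2 < 1" by (rule eventually_conj)
  then obtain N where N: "\<And>n. n \<ge> N \<Longrightarrow> (\<rho> n)\<^sup>2 * - a n > 1/2 \<and> (\<rho> n)\<^sup>2 < 1" by (auto simp: eventually_sequentially)
  show ?thesis
  proof (rule that[of "\<lambda>n. a (n + N)" "\<lambda>n. b (n + N)" "\<lambda>n. \<rho> (n + N)" "sqrt C"])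
    show "CS4_degeneration (\<lambda>n. a (n + N)) (\<lambda>n. b (n + N))"
    proof
      show "filterlim (\<lambda>n. a (n + N)) at_bot sequentially"
        by (rule filterlim_compose[OF a_lim filterlim_add_const_nat_at_top])
      show "(\<lambda>n. b (n + N)) \<longlonglongrightarrow> 0" by (rule LIMSEQ_ignore_initial_segment[OF b_lim])
    qed (use a b in auto)
    have "(\<lambda>n. sqrt ((\<rho> n)\<^sup>2 * - a n)) \<longlonglongrightarrow> sqrt C" by (intro tendsto_intros lim)
    moreover have "sqrt ((\<rho> n)\<^sup>2 * - a n) = \<rho> n * sqrt (- a n)" for n
      unfolding real_sqrt_mult using pos[of n] by simp
    ultimately have "(\<lambda>n. \<rho> n * sqrt (- a n)) \<longlonglongrightarrow> sqrt C" by (simp only:)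
    then show "(\<lambda>n. \<rho> (n + N) * sqrt (- a (n + N))) \<longlonglongrightarrow> sqrt C" by (rule LIMSEQ_ignore_initial_segment)
    show "sqrt C > 0" using C by simp
    show "(sqrt C)\<^sup>2 * side3 G_lim = sqrt 2 * ?KL" using C GL by (simp add: C_def)
    show "1/2 \<le> (\<rho> (n + N))\<^sup>2 * - a (n + N)" "(\<rho> (n + N))\<^sup>2 \<le> 1" for n using N[of "n + N"] by auto
  qed (use pos per in auto)
qed

section \<open>Weierstrass data of Schwarz--Christoffel type\<close>

text \<open>The constants \<open>exp (\<i> pi / 4)\<close> and \<open>exp (3 \<i> pi / 4)\<close> by which, on the upper
  half plane, the powers of \<open>1 - z\<close> with exponents \<open>-1/4\<close> and \<open>-3/4\<close> differ from those of
  \<open>z - 1\<close>.\<close>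

abbreviation e1 :: complex where "e1 \<equiv> Complex (sqrt 2 / 2) (sqrt 2 / 2)"
abbreviation e3 :: complex where "e3 \<equiv> Complex (- (sqrt 2 / 2)) (sqrt 2 / 2)"

lemma e1_e3: "e1 * e3 = -1"
proof -
  have "sqrt 2 / 2 * (sqrt 2 / 2) = (1/2 :: real)" by simp
  then show ?thesis by (simp add: complex_eq_iff)
qed

text \<open>The three lists encode \<open>G dh\<close>, \<open>dh / G\<close> and \<open>dh\<close>; the assumption \<open>prod\<close> says that the
  first two have product \<open>dh\<^sup>2\<close>.\<close>

locale sc_weierstrass =
  fixes Gs Ks Hs :: "(real \<times> real) list" and \<rho> :: real
  assumes \<rho>: "\<rho> > 0"
    and prod: "\<And>z. z \<notin> of_real ` (sc_points Gs \<union> sc_points Ks \<union> sc_points Hs) \<Longrightarrow> sc_form Gs z * sc_form Ks z = (sc_form Hs z)\<^sup>2"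
begin

definition points :: "real set" where "points = sc_points Gs \<union> sc_points Ks \<union> sc_points Hs"

definition form :: "complex \<Rightarrow> complex^3" where
  "form z = weierstrass_form (of_real \<rho> * e3 * sc_form Gs z) (of_real (1/\<rho>) * e1 * sc_form Ks z) (\<i> * sc_form Hs z)"

definition \<Phi> :: "complex option \<Rightarrow> complex^3" where
  "\<Phi> \<zeta> = weierstrass_form (of_real \<rho> * e3 * sc_ext Gs \<zeta>) (of_real (1/\<rho>) * e1 * sc_ext Ks \<zeta>) (\<i> * sc_ext Hs \<zeta>)"

definition X :: "complex option \<Rightarrow> real^3" where "X \<zeta> = (\<chi> k. Re (\<Phi> \<zeta> $ k))"

definition dom :: "complex set" where "dom = sc_domain Gs \<inter> sc_domain Ks \<inter> sc_domain Hs"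

lemma form_null: "z \<notin> of_real ` points \<Longrightarrow> (form z $ 1)\<^sup>2 + (form z $ 2)\<^sup>2 + (form z $ 3)\<^sup>2 = 0"
proof (unfold form_def, rule weierstrass_form_null)
  assume z: "z \<notin> of_real ` points"
  have "of_real \<rho> * e3 * sc_form Gs z * (of_real (1/\<rho>) * e1 * sc_form Ks z)
    = of_real (\<rho> * (1/\<rho>)) * (e1 * e3) * (sc_form Gs z * sc_form Ks z)" unfolding of_real_mult by (simp only: mult_ac)
  also have "\<dots> = (\<i> * sc_form Hs z)\<^sup>2"
    unfolding e1_e3 prod[OF z[unfolded points_def]] using \<rho> by (simp add: power_mult_distrib)
  finally show "of_real \<rho> * e3 * sc_form Gs z * (of_real (1/\<rho>) * e1 * sc_form Ks z) = (\<i> * sc_form Hs z)\<^sup>2" .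
qed

lemma form_nonzero:
  assumes "z \<notin> of_real ` points" shows "form z \<noteq> 0"
proof -
  have "z \<notin> of_real ` sc_points Hs" using assms by (auto simp: points_def)
  then show ?thesis unfolding form_def by (intro weierstrass_form_nonzero) (simp add: sc_form_nonzero)
qed

lemma upper_not_real: "z \<in> upper_half_plane \<Longrightarrow> z \<notin> of_real ` S"
  by (auto simp: upper_half_plane_def)

lemma form_holomorphic: "(\<lambda>z. form z $ k) holomorphic_on upper_half_plane"
proof -
  have "(\<lambda>z. (of_real (1/\<rho>) * e1 * sc_form Ks z - of_real \<rho> * e3 * sc_form Gs z) / 2) holomorphic_on upper_half_plane"
    "(\<lambda>z. (\<i> / 2) * (of_real (1/\<rho>) * e1 * sc_form Ks z + of_real \<rho> * e3 * sc_form Gs z)) holomorphic_on upper_half_plane"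
    "(\<lambda>z. \<i> * sc_form Hs z) holomorphic_on upper_half_plane"
    by (intro holomorphic_intros sc_form_holomorphic; simp)+
  then show ?thesis using exhaust_3[of k] by (auto simp: form_def)
qed

lemma form_tendsto:
  assumes "p \<notin> points"
  shows "((\<lambda>z. form z $ k) \<longlongrightarrow> form (of_real p) $ k) (at (of_real p) within upper_half_plane)"
proof -
  note t = sc_form_tendsto[of p Gs] sc_form_tendsto[of p Ks] sc_form_tendsto[of p Hs]
  have "((\<lambda>z. (of_real (1/\<rho>) * e1 * sc_form Ks z - of_real \<rho> * e3 * sc_form Gs z) / 2) \<longlongrightarrow>
      (of_real (1/\<rho>) * e1 * sc_form Ks (of_real p) - of_real \<rho> * e3 * sc_form Gs (of_real p)) / 2) (at (of_real p) within upper_half_plane)"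
    "((\<lambda>z. (\<i> / 2) * (of_real (1/\<rho>) * e1 * sc_form Ks z + of_real \<rho> * e3 * sc_form Gs z)) \<longlongrightarrow>
      (\<i> / 2) * (of_real (1/\<rho>) * e1 * sc_form Ks (of_real p) + of_real \<rho> * e3 * sc_form Gs (of_real p))) (at (of_real p) within upper_half_plane)"
    "((\<lambda>z. \<i> * sc_form Hs z) \<longlongrightarrow> \<i> * sc_form Hs (of_real p)) (at (of_real p) within upper_half_plane)"
    using assms by (intro tendsto_intros t; simp add: points_def)+
  then show ?thesis using exhaust_3[of k] by (auto simp: form_def)
qed

lemma \<Phi>_derivative:
  assumes "\<And>xs. xs \<in> {Gs, Ks, Hs} \<Longrightarrow> ((\<lambda>z. sc_ext xs (Some z)) has_field_derivative sc_form xs z) (at z within S)"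
  shows "((\<lambda>z. \<Phi> (Some z) $ k) has_field_derivative form z $ k) (at z within S)"
proof -
  note d = assms[of Gs, simplified] assms[of Ks, simplified] assms[of Hs, simplified]
  have "((\<lambda>z. (of_real (1/\<rho>) * e1 * sc_ext Ks (Some z) - of_real \<rho> * e3 * sc_ext Gs (Some z)) / 2) has_field_derivative
     (of_real (1/\<rho>) * e1 * sc_form Ks z - of_real \<rho> * e3 * sc_form Gs z) / 2) (at z within S)"
    "((\<lambda>z. (\<i> / 2) * (of_real (1/\<rho>) * e1 * sc_ext Ks (Some z) + of_real \<rho> * e3 * sc_ext Gs (Some z))) has_field_derivative
     (\<i> / 2) * (of_real (1/\<rho>) * e1 * sc_form Ks z + of_real \<rho> * e3 * sc_form Gs z)) (at z within S)"
    "((\<lambda>z. \<i> * sc_ext Hs (Some z)) has_field_derivative \<i> * sc_form Hs z) (at z within S)"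
    by (intro DERIV_cdivide DERIV_diff DERIV_add DERIV_cmult d)+
  then show ?thesis using exhaust_3[of k] by (auto simp: form_def \<Phi>_def)
qed

lemma sc_ext_derivative_upper:
  assumes z: "z \<in> upper_half_plane"
  shows "((\<lambda>z. sc_ext xs (Some z)) has_field_derivative sc_form xs z) (at z)"
proof -
  have "\<forall>\<^sub>F z in nhds z. sc_ext xs (Some z) = sc_map xs z"
    using eventually_nhds_in_open[OF open_upper_half_plane z] by eventually_elim (rule sc_ext_upper)
  then show ?thesis using sc_map_derivative[OF z] by (subst DERIV_cong_ev[OF refl _ refl])
qed

lemma rep: "weierstrass_rep (\<lambda>z. X (Some z)) form upper_half_plane"
  unfolding weierstrass_rep_def X_def
  by (intro conjI allI ballI open_upper_half_plane form_holomorphic has_derivative_vec_lambda has_derivative_Re_mult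
      \<Phi>_derivative sc_ext_derivative_upper)

lemma \<Phi>_contour_integral:
  assumes "\<And>z. z \<in> upper_half_plane \<Longrightarrow> F z $ k = form z $ k" "z \<in> upper_half_plane"
  shows "contour_integral (linepath \<i> z) (\<lambda>z. F z $ k) = \<Phi> (Some z) $ k"
proof -
  have i: "\<i> \<in> upper_half_plane" by (simp add: upper_half_plane_def)
  have "(\<lambda>z. F z $ k) holomorphic_on upper_half_plane"
    using form_holomorphic[of k] by (rule holomorphic_transform) (simp add: assms)
  then have "contour_integral (linepath \<i> z) (\<lambda>z. F z $ k) = \<Phi> (Some z) $ k - \<Phi> (Some \<i>) $ k"
    by (rule half_plane_primitive(2)[OF _ assms(2)])
       (simp add: assms(1) \<Phi>_derivative sc_ext_derivative_upper)
  moreover have "\<Phi> (Some \<i>) $ k = 0"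
    using exhaust_3[of k] by (auto simp: \<Phi>_def sc_ext_upper[OF i] sc_map_def)
  ultimately show ?thesis by simp
qed

lemma \<Phi>_continuous: "continuous_on dom (\<lambda>z. \<Phi> (Some z) $ k)"
proof -
  have c: "continuous_on dom (\<lambda>z. sc_ext xs (Some z))" if "xs \<in> {Gs, Ks, Hs}" for xs
    by (rule continuous_on_subset[OF sc_ext_continuous]) (use that in \<open>auto simp: dom_def\<close>)
  note c = c[of Gs, simplified] c[of Ks, simplified] c[of Hs, simplified]
  have "continuous_on dom (\<lambda>z. (of_real (1/\<rho>) * e1 * sc_ext Ks (Some z) - of_real \<rho> * e3 * sc_ext Gs (Some z)) / 2)"
    "continuous_on dom (\<lambda>z. (\<i> / 2) * (of_real (1/\<rho>) * e1 * sc_ext Ks (Some z) + of_real \<rho> * e3 * sc_ext Gs (Some z)))"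
    "continuous_on dom (\<lambda>z. \<i> * sc_ext Hs (Some z))"
    by (intro continuous_intros c; simp)+
  then show ?thesis using exhaust_3[of k] by (auto simp: \<Phi>_def)
qed

lemma X_continuous: "continuous_on dom (\<lambda>z. X (Some z))"
  unfolding X_def by (intro continuous_intros \<Phi>_continuous)

lemma \<Phi>_tendsto_infinity:
  assumes "sc_degree Gs \<le> -5/4" "sc_degree Ks \<le> -5/4" "sc_degree Hs \<le> -5/4"
  shows "((\<lambda>z. \<Phi> (Some z) $ k) \<longlongrightarrow> \<Phi> None $ k) (inf at_infinity (principal dom))"
proof -
  have le: "inf at_infinity (principal dom) \<le> inf at_infinity (principal (sc_domain Gs))"
     "inf at_infinity (principal dom) \<le> inf at_infinity (principal (sc_domain Ks))"
     "inf at_infinity (principal dom) \<le> inf at_infinity (principal (sc_domain Hs))"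
    by (intro inf_mono; auto simp: dom_def)+
  note l = tendsto_mono[OF le(1) sc_ext_tendsto_infinity[OF assms(1)]]
     tendsto_mono[OF le(2) sc_ext_tendsto_infinity[OF assms(2)]]
     tendsto_mono[OF le(3) sc_ext_tendsto_infinity[OF assms(3)]]
  have "((\<lambda>z. (of_real (1/\<rho>) * e1 * sc_ext Ks (Some z) - of_real \<rho> * e3 * sc_ext Gs (Some z)) / 2) \<longlongrightarrow>
      (of_real (1/\<rho>) * e1 * sc_ext Ks None - of_real \<rho> * e3 * sc_ext Gs None) / 2) (inf at_infinity (principal dom))"
    "((\<lambda>z. (\<i> / 2) * (of_real (1/\<rho>) * e1 * sc_ext Ks (Some z) + of_real \<rho> * e3 * sc_ext Gs (Some z))) \<longlongrightarrow>
      (\<i> / 2) * (of_real (1/\<rho>) * e1 * sc_ext Ks None + of_real \<rho> * e3 * sc_ext Gs None)) (inf at_infinity (principal dom))"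
    "((\<lambda>z. \<i> * sc_ext Hs (Some z)) \<longlongrightarrow> \<i> * sc_ext Hs None) (inf at_infinity (principal dom))"
    by (intro tendsto_intros l; simp)+
  then show ?thesis using exhaust_3[of k] by (auto simp: \<Phi>_def)
qed

lemma X_real_derivative:
  assumes "t \<notin> points"
  shows "DERIV (\<lambda>t. X (Some (of_real t)) $ k) t :> Re (form (of_real t) $ k)"
proof -
  have "((\<lambda>z. \<Phi> (Some z) $ k) has_field_derivative form (of_real t) $ k) (at (of_real t) within closed_half_plane)"
    using assms by (intro \<Phi>_derivative sc_ext_derivative) (auto simp: points_def)
  then have "((\<lambda>z. \<Phi> (Some z) $ k) has_field_derivative form (of_real t) $ k) (at (of_real t) within range of_real)"
    by (rule DERIV_subset) (auto simp: closed_half_plane_def)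
  then have "((\<lambda>z. \<Phi> (Some z) $ k) \<circ> of_real has_vector_derivative 1 * form (of_real t) $ k) (at t)"
    by (intro field_vector_diff_chain_within)
       (auto simp: has_vector_derivative_def fun_eq_iff scaleR_conv_of_real
          intro!: bounded_linear_imp_has_derivative[OF bounded_linear_of_real, THEN has_derivative_eq_rhs])
  from bounded_linear.has_vector_derivative[OF bounded_linear_Re this]
  show ?thesis by (simp add: X_def o_def has_real_derivative_iff_has_vector_derivative)
qed

lemma form_of_real:
  assumes "t \<notin> points"
  shows "form (of_real t) = weierstrass_form (of_real (\<rho> * sc_abs Gs t) * (e3 * cis (pi * sc_turn Gs t)))
     (of_real (sc_abs Ks t / \<rho>) * (e1 * cis (pi * sc_turn Ks t))) (of_real (sc_abs Hs t) * (\<i> * cis (pi * sc_turn Hs t)))"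
proof -
  have "t \<notin> sc_points Gs" "t \<notin> sc_points Ks" "t \<notin> sc_points Hs" using assms by (auto simp: points_def)
  note f = this[THEN sc_form_of_real]
  have m: "of_real \<rho> * u * (v * of_real w) = of_real (\<rho> * w) * (u * v)"
      "of_real (1/\<rho>) * u * (v * of_real w) = of_real (w / \<rho>) * (u * v)"
      "\<i> * (v * of_real w) = of_real w * (\<i> * v)" for u v :: complex and w
    by (simp_all add: mult_ac)
  show ?thesis unfolding form_def f m by (rule refl)
qed

end

lemma CS4_weierstrass:
  assumes "\<rho> > 0" shows "sc_weierstrass (G_list a b) (K_list a b) (H_list b) \<rho>"
proof
  fix z :: complex
  assume z: "z \<notin> of_real ` (sc_points (G_list a b) \<union> sc_points (K_list a b) \<union> sc_points (H_list b))"
  have *: "w powr of_real e * w powr of_real f = w powr of_real (e + f)" for w :: complex and e f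
    by (simp add: powr_add)
  have "sc_form (G_list a b) z * sc_form (K_list a b) z =
     ((z - of_real a) powr of_real (1/2) * (z - of_real a) powr of_real (-1/2)) *
     ((z - of_real 0) powr of_real (-3/4) * (z - of_real 0) powr of_real (-1/4)) *
     ((z - of_real b) powr of_real (-3/4) * (z - of_real b) powr of_real (-1/4)) *
     ((z - of_real 1) powr of_real (-3/4) * (z - of_real 1) powr of_real (-1/4))"
    unfolding G_list_def K_list_def sc_form_def by (simp add: mult_ac)
  also have "\<dots> = (z - of_real 0) powr of_real (-1) * (z - of_real b) powr of_real (-1) * (z - of_real 1) powr of_real (-1)"
    unfolding * using z by (simp add: CS4_points)
  also have "\<dots> = ((z - of_real 0) powr of_real (-1/2) * (z - of_real 0) powr of_real (-1/2)) *
     ((z - of_real b) powr of_real (-1/2) * (z - of_real b) powr of_real (-1/2)) *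
     ((z - of_real 1) powr of_real (-1/2) * (z - of_real 1) powr of_real (-1/2))"
    unfolding * by simp
  also have "\<dots> = (sc_form (H_list b) z)\<^sup>2"
    unfolding H_list_def sc_form_def by (simp add: power2_eq_square mult_ac)
  finally show "sc_form (G_list a b) z * sc_form (K_list a b) z = (sc_form (H_list b) z)\<^sup>2" .
qed (rule assms)

lemma limit_weierstrass:
  assumes "\<rho> > 0" shows "sc_weierstrass G_lim K_lim H_lim \<rho>"
proof
  fix z :: complex
  have *: "w powr of_real e * w powr of_real f = w powr of_real (e + f)" for w :: complex and e f
    by (simp add: powr_add)
  have "sc_form G_lim z * sc_form K_lim z =
     ((z - of_real 0) powr of_real (-3/2) * (z - of_real 0) powr of_real (-1/2)) *
     ((z - of_real 1) powr of_real (-3/4) * (z - of_real 1) powr of_real (-1/4))"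
    unfolding G_lim_def K_lim_def sc_form_def by (simp add: mult_ac)
  also have "\<dots> = ((z - of_real 0) powr of_real (-1) * (z - of_real 0) powr of_real (-1)) *
     ((z - of_real 1) powr of_real (-1/2) * (z - of_real 1) powr of_real (-1/2))"
    unfolding * by simp
  also have "\<dots> = (sc_form H_lim z)\<^sup>2"
    unfolding H_lim_def sc_form_def by (simp add: power2_eq_square mult_ac)
  finally show "sc_form G_lim z * sc_form K_lim z = (sc_form H_lim z)\<^sup>2" .
qed (rule assms)

lemma powr_one_minus:
  assumes "z \<in> upper_half_plane"
  shows "(1 - z) powr of_real e = cis (- (pi * e)) * (z - 1) powr of_real e"
proof -
  have "Im (z - 1) > 0" using assms by (simp add: upper_half_plane_def)
  then have nz: "z \<noteq> 1" by auto
  have L: "Ln (1 - z) = Ln (z - 1) - \<i> * of_real pi"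
    using Ln_minus[of "z - 1"] nz \<open>Im (z - 1) > 0\<close> by simp
  show ?thesis using nz by (simp add: powr_def L cis_conv_exp algebra_simps flip: exp_add)
qed

text \<open>The powers of \<open>1 - z\<close> are positive on \<open>(b, 1)\<close>; the powers of \<open>z - 1\<close>, to which the
  lists refer, differ from them by the constants \<open>e3\<close>, \<open>e1\<close> and \<open>\<i>\<close>.\<close>

lemma CS4_form_eq:
  assumes "\<rho> > 0" "z \<in> upper_half_plane"
  shows "CS4_form a b \<rho> z = sc_weierstrass.form (G_list a b) (K_list a b) (H_list b) \<rho> z"
proof -
  interpret sc_weierstrass "G_list a b" "K_list a b" "H_list b" \<rho> by (rule CS4_weierstrass) fact
  have c: "cis (- (pi * (-3/4))) = e3" "cis (- (pi * (-1/4))) = e1" "cis (- (pi * (-1/2))) = \<i>"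
    using arg_cong[OF cis_eighths(1), of cnj] arg_cong[OF cis_eighths(5), of cnj] arg_cong[OF cis_eighths(6), of cnj]
    by (simp_all add: cis_cnj complex_eq_iff)
  have p: "(1 - z) powr of_real (-3/4) = e3 * (z - 1) powr of_real (-3/4)"
    "(1 - z) powr of_real (-1/4) = e1 * (z - 1) powr of_real (-1/4)"
    "(1 - z) powr of_real (-1/2) = \<i> * (z - 1) powr of_real (-1/2)"
    unfolding powr_one_minus[OF assms(2)] c by (rule refl)+
  show ?thesis
    unfolding CS4_form_def form_def p unfolding G_list_def K_list_def H_list_def sc_form_def
    by (simp add: p[simplified] mult_ac)
qed

section \<open>The pentagons of type CS\<close>

lemma phases:
  "e3 * cis (pi * 0) = e3" "e1 * cis (pi * 0) = e1" "\<i> * cis (pi * 0) = \<i>"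
  "e3 * cis (pi * (-3/4)) = 1" "e1 * cis (pi * (-1/4)) = 1" "\<i> * cis (pi * (-1/2)) = 1"
  "e3 * cis (pi * (-3/2)) = Complex (- (sqrt 2 / 2)) (- (sqrt 2 / 2))"
  "e1 * cis (pi * (-1/2)) = Complex (sqrt 2 / 2) (- (sqrt 2 / 2))" "\<i> * cis (pi * (-1)) = -\<i>"
  "e3 * cis (pi * (-9/4)) = \<i>" "e1 * cis (pi * (-3/4)) = -\<i>" "\<i> * cis (pi * (-3/2)) = -1"
  "e3 * cis (pi * (-7/4)) = -1" "e1 * cis (pi * (-5/4)) = -1"
proof -
  have *: "sqrt 2 / 2 * (sqrt 2 / 2) = (1/2 :: real)" by simp
  show "e3 * cis (pi * 0) = e3" "e1 * cis (pi * 0) = e1" "\<i> * cis (pi * 0) = \<i>" by simp_all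
  show "\<i> * cis (pi * (-1)) = -\<i>" by (simp add: complex_eq_iff)
  show "e3 * cis (pi * (-3/4)) = 1" "e1 * cis (pi * (-1/4)) = 1" "\<i> * cis (pi * (-1/2)) = 1"
    "e3 * cis (pi * (-3/2)) = Complex (- (sqrt 2 / 2)) (- (sqrt 2 / 2))"
    "e1 * cis (pi * (-1/2)) = Complex (sqrt 2 / 2) (- (sqrt 2 / 2))"
    "e3 * cis (pi * (-9/4)) = \<i>" "e1 * cis (pi * (-3/4)) = -\<i>" "\<i> * cis (pi * (-3/2)) = -1"
    "e3 * cis (pi * (-7/4)) = -1" "e1 * cis (pi * (-5/4)) = -1"
    unfolding cis_eighths using * by (simp_all add: complex_eq_iff)
qed

text \<open>The bounds on \<open>\<rho>\<close> ensure that \<open>\<bar>G\<bar> \<ge> 1\<close> on \<open>(b, 1)\<close> and \<open>\<bar>G\<bar> \<le> 1\<close> on \<open>(-\<infinity>, a)\<close>, so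
  that the edges over these arcs do not leave the box.\<close>

locale CS4_pentagon =
  fixes a b \<rho> :: real
  assumes a: "a \<le> -1" and b: "0 < b" "b < 1" and rho: "\<rho> > 0"
    and period: "CS4_period a b \<rho>" and rho_lower: "1/2 \<le> \<rho>\<^sup>2 * - a" and rho_upper: "\<rho>\<^sup>2 \<le> 1"

sublocale CS4_pentagon \<subseteq> sc_weierstrass "G_list a b" "K_list a b" "H_list b" \<rho>
  by (rule CS4_weierstrass[OF rho])

context CS4_pentagon
begin

lemma ab: "a < 0" "0 < b" "b < 1" using a b by auto

lemma points_eq: "points = {a, 0, b, 1}" by (auto simp: points_def CS4_points)

lemma dom_eq: "dom = closed_half_plane"
proof -
  have "\<not> sc_order (G_list a b) x < -3/4" "\<not> sc_order (K_list a b) x < -3/4" "\<not> sc_order (H_list b) x < -3/4" for x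
    using CS4_regular[OF ab, of "ereal x"] by (simp_all add: sc_regular_def not_less)
  then show ?thesis by (simp add: dom_def sc_domain_def)
qed

text \<open>The moduli of \<open>G dh\<close>, \<open>dh / G\<close> and \<open>dh\<close> along the real axis.\<close>

definition g where "g t = \<rho> * sc_abs (G_list a b) t"
definition k where "k t = sc_abs (K_list a b) t / \<rho>"
definition h where "h t = sc_abs (H_list b) t"

lemma ghk_pos: "t \<notin> {a, 0, b, 1} \<Longrightarrow> g t > 0" "t \<notin> {a, 0, b, 1} \<Longrightarrow> k t > 0" "t \<notin> {a, 0, b, 1} \<Longrightarrow> h t > 0"
  using sc_abs_pos[of t "G_list a b"] sc_abs_pos[of t "K_list a b"] sc_abs_pos[of t "H_list b"] rho
  by (auto simp: g_def k_def h_def CS4_points)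

lemma form_arc:
  "1 < t \<Longrightarrow> form (of_real t) = weierstrass_form (of_real (g t) * e3) (of_real (k t) * e1) (of_real (h t) * \<i>)"
  "b < t \<Longrightarrow> t < 1 \<Longrightarrow> form (of_real t) = weierstrass_form (of_real (g t)) (of_real (k t)) (of_real (h t))"
  "0 < t \<Longrightarrow> t < b \<Longrightarrow> form (of_real t) = weierstrass_form (of_real (g t) * Complex (- (sqrt 2 / 2)) (- (sqrt 2 / 2)))
     (of_real (k t) * Complex (sqrt 2 / 2) (- (sqrt 2 / 2))) (of_real (h t) * -\<i>)"
  "a < t \<Longrightarrow> t < 0 \<Longrightarrow> form (of_real t) = weierstrass_form (of_real (g t) * \<i>) (of_real (k t) * -\<i>) (- of_real (h t))"
  "t < a \<Longrightarrow> form (of_real t) = weierstrass_form (- of_real (g t)) (- of_real (k t)) (- of_real (h t))"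
proof -
  have f: "form (of_real t) = weierstrass_form (of_real (g t) * (e3 * cis (pi * sc_turn (G_list a b) t)))
     (of_real (k t) * (e1 * cis (pi * sc_turn (K_list a b) t))) (of_real (h t) * (\<i> * cis (pi * sc_turn (H_list b) t)))"
    if "t \<notin> {a, 0, b, 1}" for t
    using form_of_real[of t] that unfolding points_eq g_def k_def h_def by simp
  show "form (of_real t) = weierstrass_form (of_real (g t) * e3) (of_real (k t) * e1) (of_real (h t) * \<i>)" if "1 < t"
  proof -
    have "sc_turn (G_list a b) t = 0" "sc_turn (K_list a b) t = 0" "sc_turn (H_list b) t = 0"
      using that ab by (auto simp: sc_turn_def sc_list_defs)
    then show ?thesis using f[of t] that ab by simp
  qed
  show "form (of_real t) = weierstrass_form (of_real (g t)) (of_real (k t)) (of_real (h t))" if "b < t" "t < 1"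
  proof -
    have t: "sc_turn (G_list a b) t = -3/4" "sc_turn (K_list a b) t = -1/4" "sc_turn (H_list b) t = -1/2"
      using that ab by (auto simp: sc_turn_def sc_list_defs)
    have "t \<notin> {a, 0, b, 1}" using that ab by auto
    then show ?thesis using f[of t] unfolding t phases by simp
  qed
  show "form (of_real t) = weierstrass_form (of_real (g t) * Complex (- (sqrt 2 / 2)) (- (sqrt 2 / 2)))
     (of_real (k t) * Complex (sqrt 2 / 2) (- (sqrt 2 / 2))) (of_real (h t) * -\<i>)" if "0 < t" "t < b"
  proof -
    have t: "sc_turn (G_list a b) t = -3/2" "sc_turn (K_list a b) t = -1/2" "sc_turn (H_list b) t = -1"
      using that ab by (auto simp: sc_turn_def sc_list_defs)
    have "t \<notin> {a, 0, b, 1}" using that ab by auto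
    then show ?thesis using f[of t] unfolding t phases by simp
  qed
  show "form (of_real t) = weierstrass_form (of_real (g t) * \<i>) (of_real (k t) * -\<i>) (- of_real (h t))" if "a < t" "t < 0"
  proof -
    have t: "sc_turn (G_list a b) t = -9/4" "sc_turn (K_list a b) t = -3/4" "sc_turn (H_list b) t = -3/2"
      using that ab by (auto simp: sc_turn_def sc_list_defs)
    have "t \<notin> {a, 0, b, 1}" using that ab by auto
    then show ?thesis using f[of t] unfolding t phases by simp
  qed
  show "form (of_real t) = weierstrass_form (- of_real (g t)) (- of_real (k t)) (- of_real (h t))" if "t < a"
  proof -
    have t: "sc_turn (G_list a b) t = -7/4" "sc_turn (K_list a b) t = -5/4" "sc_turn (H_list b) t = -3/2"
      using that ab by (auto simp: sc_turn_def sc_list_defs)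
    have "t \<notin> {a, 0, b, 1}" using that ab by auto
    then show ?thesis using f[of t] unfolding t phases by simp
  qed
qed

text \<open>The side length of the box before scaling. The vertex over \<open>0\<close> is moved to the origin.\<close>

definition L where "L = sqrt 2 / 4 * (side3 (K_list a b) / \<rho> + \<rho> * side3 (G_list a b))"

lemma L_pos: "L > 0"
  unfolding L_def using CS4_side_pos[OF ab] rho by (intro mult_pos_pos add_pos_pos) auto

definition F :: "complex option \<Rightarrow> real^3" where "F \<zeta> = (1 / L) *\<^sub>R X \<zeta> + (- (1 / L)) *\<^sub>R X (Some 0)"

definition y :: "3 \<Rightarrow> real \<Rightarrow> real" where "y j t = F (Some (of_real t)) $ j"

lemma y_derivative: "t \<notin> {a, 0, b, 1} \<Longrightarrow> DERIV (y j) t :> Re (form (of_real t) $ j) / L"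
  unfolding y_def[abs_def] F_def using X_real_derivative[of t j]
  by (auto intro!: derivative_eq_intros simp: points_eq divide_inverse)

lemma F_continuous: "continuous_on closed_half_plane (\<lambda>z. F (Some z))"
  unfolding F_def using X_continuous unfolding dom_eq by (intro continuous_intros)

lemma \<Phi>_limit: "((\<lambda>z. \<Phi> (Some z) $ j) \<longlongrightarrow> \<Phi> None $ j) (inf at_infinity (principal closed_half_plane))"
  using \<Phi>_tendsto_infinity[of j] unfolding dom_eq by (simp add: sc_degree_def sc_list_defs)

lemma F_limit: "((\<lambda>z. F (Some z)) \<longlongrightarrow> F None) (inf at_infinity (principal closed_half_plane))"
  unfolding F_def X_def by (intro tendsto_intros \<Phi>_limit)

lemma y_continuous: "continuous_on S (y j)"
proof -
  have "continuous_on S (\<lambda>t. F (Some (complex_of_real t)))"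
    by (rule continuous_on_compose2[OF F_continuous]) (auto simp: closed_half_plane_def intro!: continuous_intros)
  then show ?thesis unfolding y_def[abs_def] by (intro continuous_intros)
qed

lemma of_real_at_infinity:
  "filterlim (of_real :: real \<Rightarrow> complex) (inf at_infinity (principal closed_half_plane)) at_infinity"
  unfolding filterlim_inf filterlim_principal
  using filterlim_norm_at_top[where 'a = real]
  by (auto simp: filterlim_at_infinity_conv_norm_at_top real_norm_def[abs_def] closed_half_plane_def)

lemma y_limits: "(y j \<longlongrightarrow> F None $ j) at_top" "(y j \<longlongrightarrow> F None $ j) at_bot"
proof -
  have "((\<lambda>t. F (Some (complex_of_real t))) \<longlongrightarrow> F None) at_infinity"
    by (rule filterlim_compose[OF F_limit of_real_at_infinity])
  then have "(y j \<longlongrightarrow> F None $ j) at_infinity" unfolding y_def[abs_def] by (intro tendsto_intros)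
  then show "(y j \<longlongrightarrow> F None $ j) at_top" "(y j \<longlongrightarrow> F None $ j) at_bot"
    by (auto intro: tendsto_mono[OF at_top_le_at_infinity] tendsto_mono[OF at_bot_le_at_infinity])
qed

lemma y_zero: "y j 0 = 0" by (simp add: y_def F_def)

section \<open>The vertices of the pentagon\<close>

text \<open>The horizontal displacements along the edges, each expressed by the length \<open>L\<close> with the
  help of the period and closing relations. The last estimate bounds how far the edge over
  \<open>(a, 0)\<close> can move away from its end points.\<close>

lemma period_lengths:
  "sqrt 2 / 4 * (side1 (K_list a b) b / \<rho> + \<rho> * side1 (G_list a b) b) = L"
  "(\<rho> * side2 (G_list a b) b - side2 (K_list a b) b / \<rho>) / 2 = L"
  "side5 (K_list a b) a / \<rho> = \<rho> * side5 (G_list a b) a"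
  "side5 (K_list a b) a / (2 * \<rho>) \<le> L"
proof -
  note c = CS4_closing[OF ab]
  define G1 G2 G3 G4 G5 where "G1 = side1 (G_list a b) b" and "G2 = side2 (G_list a b) b" and "G3 = side3 (G_list a b)"
    and "G4 = side4 (G_list a b) a" and "G5 = side5 (G_list a b) a"
  define K1 K2 K3 K4 K5 where "K1 = side1 (K_list a b) b" and "K2 = side2 (K_list a b) b" and "K3 = side3 (K_list a b)"
    and "K4 = side4 (K_list a b) a" and "K5 = side5 (K_list a b) a"
  note defs = G1_def G2_def G3_def G4_def G5_def K1_def K2_def K3_def K4_def K5_def
  have p: "\<rho>\<^sup>2 * G5 = K5" "\<rho>\<^sup>2 * (sqrt 2 * G4 + G3) = sqrt 2 * K2 + K1"
    using period by (auto simp: CS4_period_def defs)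
  have cl: "G1 = G3 + sqrt 2 * G5" "G2 = sqrt 2 * G3 + G5 + G4" "K3 = K1 + sqrt 2 * K5"
    using c by (auto simp: defs)
  have q: "sqrt 2 * (sqrt 2 * x) = 2 * x" for x by (simp flip: mult.assoc)
  have "K1 + \<rho>\<^sup>2 * G1 = K3 + \<rho>\<^sup>2 * G3" unfolding cl(1,3) p(1)[symmetric] by (simp add: algebra_simps)
  then have 1: "K1 / \<rho> + \<rho> * G1 = K3 / \<rho> + \<rho> * G3" using rho by (simp add: field_simps power2_eq_square)
  then show "sqrt 2 / 4 * (side1 (K_list a b) b / \<rho> + \<rho> * side1 (G_list a b) b) = L"
    by (simp add: L_def defs)
  have "sqrt 2 * (\<rho>\<^sup>2 * (sqrt 2 * G4 + G3)) = sqrt 2 * (sqrt 2 * K2 + K1)" unfolding p by simp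
  then have e: "2 * (\<rho>\<^sup>2 * G4) + sqrt 2 * (\<rho>\<^sup>2 * G3) = 2 * K2 + sqrt 2 * K1" by (simp add: algebra_simps q)
  have "2 * (\<rho>\<^sup>2 * G2 - K2) = 2 * (sqrt 2 * (\<rho>\<^sup>2 * G3)) + 2 * (\<rho>\<^sup>2 * G5) + 2 * (\<rho>\<^sup>2 * G4) - 2 * K2"
    unfolding cl(2) by (simp add: algebra_simps)
  also have "\<dots> = sqrt 2 * (\<rho>\<^sup>2 * G3) + 2 * K5 + sqrt 2 * K1" using e p(1) by linarith
  also have "\<dots> = sqrt 2 * (K3 + \<rho>\<^sup>2 * G3)" unfolding cl(3) by (simp add: algebra_simps q)
  finally have "2 * (\<rho>\<^sup>2 * G2 - K2) / \<rho> = sqrt 2 * (K3 + \<rho>\<^sup>2 * G3) / \<rho>" by simp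
  then have e2: "2 * (\<rho> * G2 - K2 / \<rho>) = sqrt 2 * (K3 / \<rho> + \<rho> * G3)"
    using rho by (simp add: power2_eq_square add_divide_distrib diff_divide_distrib algebra_simps)
  have half: "x / 2 = (2 * x) / 4" for x :: real by simp
  have "(\<rho> * G2 - K2 / \<rho>) / 2 = (2 * (\<rho> * G2 - K2 / \<rho>)) / 4" by (rule half)
  also have "\<dots> = L" unfolding e2 by (simp add: L_def defs)
  finally have "(\<rho> * G2 - K2 / \<rho>) / 2 = L" .
  then show "(\<rho> * side2 (G_list a b) b - side2 (K_list a b) b / \<rho>) / 2 = L" by (simp only: defs)
  show "side5 (K_list a b) a / \<rho> = \<rho> * side5 (G_list a b) a"
    using p(1) rho by (simp add: defs field_simps power2_eq_square)
  have "2 * K5 \<le> sqrt 2 * K3" unfolding cl(3) using side_nonneg(1)[of "K_list a b" b]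
    by (simp add: algebra_simps q defs)
  then have "2 * K5 / (4 * \<rho>) \<le> sqrt 2 * K3 / (4 * \<rho>)" using rho by (intro divide_right_mono) auto
  also have "\<dots> \<le> L" using CS4_side_pos[OF ab] rho by (simp add: L_def defs field_simps)
  finally show "side5 (K_list a b) a / (2 * \<rho>) \<le> L" by (simp add: defs)
qed

lemma X_diff:
  "X \<zeta> $ 1 - X \<eta> $ 1 = Re (e1 * (sc_ext (K_list a b) \<zeta> - sc_ext (K_list a b) \<eta>)) / (2 * \<rho>)
     - \<rho> * Re (e3 * (sc_ext (G_list a b) \<zeta> - sc_ext (G_list a b) \<eta>)) / 2"
  "X \<zeta> $ 2 - X \<eta> $ 2 = - Im (e1 * (sc_ext (K_list a b) \<zeta> - sc_ext (K_list a b) \<eta>)) / (2 * \<rho>)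
     - \<rho> * Im (e3 * (sc_ext (G_list a b) \<zeta> - sc_ext (G_list a b) \<eta>)) / 2"
  using rho by (simp_all add: X_def \<Phi>_def field_simps)

lemma boundary_points [simp]: "boundary_point (ereal t) = Some (of_real t)" "boundary_point \<infinity> = None"
  "boundary_point (-\<infinity>) = None" "boundary_point 0 = Some 0" "boundary_point 1 = Some 1"
  by (auto simp: boundary_point_def zero_ereal_def one_ereal_def)

lemma vertex_values:
  "y 1 b = 1" "y 2 b = 1" "y 1 1 = 0" "y 2 1 = 1" "y 1 a = 0" "y 2 a = 0" "F None $ 1 = 1" "F None $ 2 = 0"
proof -
  note s = CS4_sides[OF ab, simplified boundary_points]
  have q: "sqrt 2 * (sqrt 2 * x) = 2 * x" for x by (simp flip: mult.assoc)
  note pl = period_lengths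
  have d: "F \<zeta> $ j - F \<eta> $ j = (X \<zeta> $ j - X \<eta> $ j) / L" for \<zeta> \<eta> j
    by (simp add: F_def diff_divide_distrib)
  have b0: "X (Some (of_real b)) $ 1 - X (Some 0) $ 1 = L" "X (Some (of_real b)) $ 2 - X (Some 0) $ 2 = L"
    unfolding X_diff s pl(1)[symmetric] using rho by (simp_all add: field_simps)
  have b1: "X (Some 1) $ 1 - X (Some (of_real b)) $ 1 = - L" "X (Some 1) $ 2 - X (Some (of_real b)) $ 2 = 0"
    unfolding X_diff s pl(2)[symmetric] using rho by (simp_all add: field_simps q)
  have a0: "X (Some 0) $ 1 - X (Some (of_real a)) $ 1 = 0" "X (Some 0) $ 2 - X (Some (of_real a)) $ 2 = 0"
    unfolding X_diff s using pl(3) rho by (simp_all add: field_simps q)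
  have i1: "X None $ 1 - X (Some 1) $ 1 = L" "X None $ 2 - X (Some 1) $ 2 = - L"
    unfolding X_diff s unfolding L_def using rho by (simp_all add: field_simps)
  have L: "L \<noteq> 0" using L_pos by simp
  have F0: "F (Some 0) = 0" by (simp add: F_def)
  have b': "F (Some (of_real b)) $ 1 = 1" "F (Some (of_real b)) $ 2 = 1"
    using d[of "Some (of_real b)" 1 "Some 0"] d[of "Some (of_real b)" 2 "Some 0"] b0 L by (simp_all add: F0)
  have o': "F (Some 1) $ 1 = 0" "F (Some 1) $ 2 = 1"
    using d[of "Some 1" 1 "Some (of_real b)"] d[of "Some 1" 2 "Some (of_real b)"] b1 L b' by simp_all
  show "y 1 b = 1" "y 2 b = 1" "y 1 1 = 0" "y 2 1 = 1" using b' o' by (simp_all add: y_def)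
  show "y 1 a = 0" "y 2 a = 0" using d[of "Some 0" 1 "Some (of_real a)"] d[of "Some 0" 2 "Some (of_real a)"] a0 L by (simp_all add: F0 y_def)
  show "F None $ 1 = 1" "F None $ 2 = 0" using d[of None 1 "Some 1"] d[of None 2 "Some 1"] i1 L o' by simp_all
qed

end

section \<open>The boundary of the pentagon in the box\<close>

lemma antimono_ray_bounds:
  fixes f :: "real \<Rightarrow> real"
  assumes "\<And>s t. s \<le> t \<Longrightarrow> t \<le> p \<Longrightarrow> f t \<le> f s" "(f \<longlongrightarrow> l) at_bot" "x \<le> p"
  shows "f p \<le> f x" "f x \<le> l"
proof -
  show "f p \<le> f x" using assms(1)[of x p] assms(3) by simp
  show "f x \<le> l"
    by (rule tendsto_lowerbound[OF assms(2)]) (use assms in \<open>auto intro!: eventually_mono[OF eventually_le_at_bot[of x]]\<close>)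
qed

lemma mono_ray_bounds:
  fixes f :: "real \<Rightarrow> real"
  assumes "\<And>s t. p \<le> s \<Longrightarrow> s \<le> t \<Longrightarrow> f s \<le> f t" "(f \<longlongrightarrow> l) at_top" "p \<le> x"
  shows "f p \<le> f x" "f x \<le> l"
proof -
  show "f p \<le> f x" using assms(1)[of p x] assms(3) by simp
  show "f x \<le> l"
    by (rule tendsto_lowerbound[OF assms(2)]) (use assms in \<open>auto intro!: eventually_mono[OF eventually_ge_at_top[of x]]\<close>)
qed

context CS4_pentagon
begin

text \<open>The quotient of the moduli of the two integrands, so that \<open>\<rho>\<^sup>2 R\<close> is \<open>\<bar>G\<bar>\<^sup>2\<close> on the
  real axis. On the arcs with edges in vertical planes, the sign of the horizontal derivative
  is decided by comparing \<open>\<rho>\<^sup>2 R\<close> with \<open>1\<close>.\<close>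

definition R where "R t = \<bar>t - a\<bar> * (\<bar>t\<bar> * \<bar>t - b\<bar> * \<bar>t - 1\<bar>) powr (-1/2)"

lemma g_eq_R:
  assumes "t \<notin> {a, 0, b, 1}" shows "g t = \<rho>\<^sup>2 * R t * k t"
proof -
  have *: "x powr (-1/2) * x powr (-1/4) = x powr (-3/4)" "x powr (-1/4) * x powr (-1/2) = x powr (-3/4)" for x :: real
    by (simp_all flip: powr_add)
  have "\<bar>t - a\<bar> = \<bar>t - a\<bar> powr 1" using assms by simp
  then have "R t * sc_abs (K_list a b) t = (\<bar>t - a\<bar> powr 1 * \<bar>t - a\<bar> powr (-1/2)) * ((\<bar>t\<bar> powr (-1/2) * \<bar>t\<bar> powr (-1/4)) *
    ((\<bar>t - b\<bar> powr (-1/2) * \<bar>t - b\<bar> powr (-1/4)) * (\<bar>t - 1\<bar> powr (-1/2) * \<bar>t - 1\<bar> powr (-1/4))))"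
    unfolding R_def K_list_def sc_abs_def by (simp add: powr_mult mult_ac)
  also have "\<bar>t - a\<bar> powr 1 * \<bar>t - a\<bar> powr (-1/2) = \<bar>t - a\<bar> powr (1/2)" by (simp only: powr_add[symmetric]) simp
  finally have "R t * sc_abs (K_list a b) t = sc_abs (G_list a b) t"
    unfolding * by (simp add: G_list_def sc_abs_def)
  then show ?thesis using rho by (simp add: g_def k_def power2_eq_square)
qed

text \<open>The product under the root is at most \<open>1/4\<close>, so that \<open>R \<ge> -2 a\<close>.\<close>

lemma R_middle: "b < t \<Longrightarrow> t < 1 \<Longrightarrow> \<rho>\<^sup>2 * R t \<ge> 1"
proof -
  assume t: "b < t" "t < 1"
  have tp: "0 < t" using t ab by simp
  have "\<bar>t\<bar> * \<bar>t - b\<bar> * \<bar>t - 1\<bar> \<le> 1/4"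
  proof -
    have "t * (1 - t) \<le> 1/4" using zero_le_power2[of "t - 1/2"] by (simp add: power2_eq_square algebra_simps)
    moreover have "(t - b) * (t * (1 - t)) \<le> 1 * (t * (1 - t))" using t tp ab by (intro mult_right_mono) auto
    moreover have "\<bar>t\<bar> * \<bar>t - b\<bar> * \<bar>t - 1\<bar> = (t - b) * (t * (1 - t))" using t tp by (simp add: mult_ac)
    ultimately show ?thesis by linarith
  qed
  then have "(1/4) powr (-1/2) \<le> (\<bar>t\<bar> * \<bar>t - b\<bar> * \<bar>t - 1\<bar>) powr (-1/2)" using t tp by (intro powr_mono2') auto
  moreover have "(1/4::real) powr (-1/2) = 2"
    by (simp add: powr_minus_divide powr_half_sqrt real_sqrt_divide)
  ultimately have "- a * 2 \<le> R t" unfolding R_def using t tp ab by (intro mult_mono) auto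
  then have "\<rho>\<^sup>2 * (- a * 2) \<le> \<rho>\<^sup>2 * R t" by (intro mult_left_mono) auto
  then show ?thesis using rho_lower by simp
qed

text \<open>The product under the root is at least \<open>\<bar>t\<bar>\<^sup>2\<close>, so that \<open>R \<le> 1\<close>.\<close>

lemma R_left: "t < a \<Longrightarrow> \<rho>\<^sup>2 * R t \<le> 1"
proof -
  assume t: "t < a"
  have t1: "1 \<le> \<bar>t\<bar>" using t a by simp
  have "\<bar>t\<bar> * \<bar>t\<bar> * \<bar>t\<bar> \<le> \<bar>t\<bar> * \<bar>t - b\<bar> * \<bar>t - 1\<bar>" by (intro mult_mono mult_nonneg_nonneg abs_ge_zero) (use t a b in auto)
  moreover have p: "\<bar>t\<bar> * \<bar>t\<bar> * 1 > 0" using t1 by (intro mult_pos_pos) auto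
  moreover have "\<bar>t\<bar> * \<bar>t\<bar> * 1 \<le> \<bar>t\<bar> * \<bar>t\<bar> * \<bar>t\<bar>" using t1 by (intro mult_left_mono) auto
  ultimately have "(\<bar>t\<bar> * \<bar>t - b\<bar> * \<bar>t - 1\<bar>) powr (-1/2) \<le> (\<bar>t\<bar> * \<bar>t\<bar> * 1) powr (-1/2)"
    by (intro powr_mono2'[OF _ p]) (simp, linarith)
  also have "\<dots> = \<bar>t\<bar> powr (-1/2) * \<bar>t\<bar> powr (-1/2)" by (simp only: mult_1_right powr_mult)
  also have "\<dots> = \<bar>t\<bar> powr (-1)" by (simp flip: powr_add)
  finally have "R t \<le> \<bar>t\<bar> * \<bar>t\<bar> powr (-1)" unfolding R_def using t a by (intro mult_mono) auto
  also have "\<dots> = 1" using t1 by (simp add: powr_minus_divide)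
  finally have "\<rho>\<^sup>2 * R t \<le> 1 * 1" using rho_upper by (intro mult_mono) (auto simp: R_def)
  then show ?thesis by simp
qed

lemma R_strict_mono:
  assumes "a < s" "s < t" "t < 0" shows "R s < R t"
proof -
  have "\<bar>t\<bar> * \<bar>t - b\<bar> * \<bar>t - 1\<bar> \<le> \<bar>s\<bar> * \<bar>s - b\<bar> * \<bar>s - 1\<bar>" by (intro mult_mono mult_nonneg_nonneg abs_ge_zero) (use assms b in auto)
  then have "(\<bar>s\<bar> * \<bar>s - b\<bar> * \<bar>s - 1\<bar>) powr (-1/2) \<le> (\<bar>t\<bar> * \<bar>t - b\<bar> * \<bar>t - 1\<bar>) powr (-1/2)"
    using assms b by (intro powr_mono2' mult_pos_pos) auto
  moreover have "(\<bar>t\<bar> * \<bar>t - b\<bar> * \<bar>t - 1\<bar>) powr (-1/2) > 0" using assms b by simp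
  ultimately have "\<bar>s - a\<bar> * (\<bar>s\<bar> * \<bar>s - b\<bar> * \<bar>s - 1\<bar>) powr (-1/2) \<le> \<bar>s - a\<bar> * (\<bar>t\<bar> * \<bar>t - b\<bar> * \<bar>t - 1\<bar>) powr (-1/2)"
    "\<bar>s - a\<bar> * (\<bar>t\<bar> * \<bar>t - b\<bar> * \<bar>t - 1\<bar>) powr (-1/2) < \<bar>t - a\<bar> * (\<bar>t\<bar> * \<bar>t - b\<bar> * \<bar>t - 1\<bar>) powr (-1/2)"
    using assms by (intro mult_left_mono mult_strict_right_mono; simp)+
  then show ?thesis unfolding R_def by linarith
qed

lemma y_derivs:
  "1 < t \<Longrightarrow> DERIV (y 1) t :> sqrt 2 / 4 * (k t + g t) / L" "1 < t \<Longrightarrow> DERIV (y 2) t :> - (sqrt 2 / 4 * (k t + g t) / L)"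
  "1 < t \<Longrightarrow> DERIV (y 3) t :> 0"
  "b < t \<Longrightarrow> t < 1 \<Longrightarrow> DERIV (y 1) t :> (k t - g t) / 2 / L" "b < t \<Longrightarrow> t < 1 \<Longrightarrow> DERIV (y 2) t :> 0"
  "b < t \<Longrightarrow> t < 1 \<Longrightarrow> DERIV (y 3) t :> h t / L"
  "0 < t \<Longrightarrow> t < b \<Longrightarrow> DERIV (y 1) t :> sqrt 2 / 4 * (k t + g t) / L" "0 < t \<Longrightarrow> t < b \<Longrightarrow> DERIV (y 2) t :> sqrt 2 / 4 * (k t + g t) / L"
  "0 < t \<Longrightarrow> t < b \<Longrightarrow> DERIV (y 3) t :> 0"
  "a < t \<Longrightarrow> t < 0 \<Longrightarrow> DERIV (y 1) t :> 0" "a < t \<Longrightarrow> t < 0 \<Longrightarrow> DERIV (y 2) t :> (k t - g t) / 2 / L"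
  "a < t \<Longrightarrow> t < 0 \<Longrightarrow> DERIV (y 3) t :> - (h t / L)"
  "t < a \<Longrightarrow> DERIV (y 1) t :> (g t - k t) / 2 / L" "t < a \<Longrightarrow> DERIV (y 2) t :> 0"
  "t < a \<Longrightarrow> DERIV (y 3) t :> - (h t / L)"
proof -
  note d = y_derivative[of t]
  assume t: "1 < t"
  then have "t \<notin> {a, 0, b, 1}" using ab by auto
  note d = d[OF this, unfolded form_arc(1)[OF t]]
  show "DERIV (y 1) t :> sqrt 2 / 4 * (k t + g t) / L" "DERIV (y 2) t :> - (sqrt 2 / 4 * (k t + g t) / L)"
    "DERIV (y 3) t :> 0"
    by (rule DERIV_cong[OF d], simp add: add_divide_distrib diff_divide_distrib algebra_simps)+
next
  note d = y_derivative[of t]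
  assume t: "b < t" "t < 1"
  then have "t \<notin> {a, 0, b, 1}" using ab by auto
  note d = d[OF this, unfolded form_arc(2)[OF t]]
  show "DERIV (y 1) t :> (k t - g t) / 2 / L" "DERIV (y 2) t :> 0" "DERIV (y 3) t :> h t / L"
    by (rule DERIV_cong[OF d], simp add: add_divide_distrib diff_divide_distrib algebra_simps)+
next
  note d = y_derivative[of t]
  assume t: "0 < t" "t < b"
  then have "t \<notin> {a, 0, b, 1}" using ab by auto
  note d = d[OF this, unfolded form_arc(3)[OF t]]
  show "DERIV (y 1) t :> sqrt 2 / 4 * (k t + g t) / L" "DERIV (y 2) t :> sqrt 2 / 4 * (k t + g t) / L"
    "DERIV (y 3) t :> 0"
    by (rule DERIV_cong[OF d], simp add: add_divide_distrib diff_divide_distrib algebra_simps)+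
next
  note d = y_derivative[of t]
  assume t: "a < t" "t < 0"
  then have "t \<notin> {a, 0, b, 1}" using ab by auto
  note d = d[OF this, unfolded form_arc(4)[OF t]]
  show "DERIV (y 1) t :> 0" "DERIV (y 2) t :> (k t - g t) / 2 / L" "DERIV (y 3) t :> - (h t / L)"
    by (rule DERIV_cong[OF d], simp add: add_divide_distrib diff_divide_distrib algebra_simps)+
next
  note d = y_derivative[of t]
  assume t: "t < a"
  then have "t \<notin> {a, 0, b, 1}" using ab by auto
  note d = d[OF this, unfolded form_arc(5)[OF t]]
  show "DERIV (y 1) t :> (g t - k t) / 2 / L" "DERIV (y 2) t :> 0" "DERIV (y 3) t :> - (h t / L)"
    by (rule DERIV_cong[OF d], simp add: add_divide_distrib diff_divide_distrib algebra_simps)+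
qed

lemma y_mono:
  assumes "s \<le> t" "\<And>x. s < x \<Longrightarrow> x < t \<Longrightarrow> \<exists>D. DERIV (y j) x :> D \<and> D \<ge> 0"
  shows "y j s \<le> y j t"
  by (rule DERIV_nonneg_imp_increasing_open[OF assms y_continuous])

lemma y_antimono:
  assumes "s \<le> t" "\<And>x. s < x \<Longrightarrow> x < t \<Longrightarrow> \<exists>D. DERIV (y j) x :> D \<and> D \<le> 0"
  shows "y j t \<le> y j s"
  by (rule DERIV_nonpos_imp_decreasing_open[OF assms y_continuous])

lemma y_const:
  assumes "s \<le> t" "\<And>x. s < x \<Longrightarrow> x < t \<Longrightarrow> DERIV (y j) x :> 0"
  shows "y j t = y j s"
  using y_mono[of s t j] y_antimono[of s t j] assms by fastforce

lemma gk_nonneg: "g t \<ge> 0" "k t \<ge> 0" "h t \<ge> 0"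
  using rho by (auto simp: g_def k_def h_def sc_abs_nonneg)

text \<open>On each arc every coordinate is constant, a linear function of another one, or monotone
  by the sign of its derivative; the second coordinate on \<open>(a, 0)\<close> needs an extra argument.
  The arcs are numbered as in the boundary of the pentagon, starting with \<open>(a, 0)\<close>.\<close>

lemma arc1: "0 \<le> s \<Longrightarrow> s \<le> t \<Longrightarrow> t \<le> b \<Longrightarrow> y j s \<le> y j t" "0 \<le> t \<Longrightarrow> t \<le> b \<Longrightarrow> y 3 t = 0"
  "0 \<le> t \<Longrightarrow> t \<le> b \<Longrightarrow> y 2 t = y 1 t"
proof -
  show 3: "y 3 t = 0" if "0 \<le> t" "t \<le> b" for t
    using y_const[of 0 t 3] y_derivs(9) that y_zero by auto
  have m: "y j s \<le> y j t" if "0 \<le> s" "s \<le> t" "t \<le> b" "j \<in> {1, 2}" for j s t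
  proof (rule y_mono)
    fix x assume x: "s < x" "x < t"
    have "sqrt 2 / 4 * (k x + g x) / L \<ge> 0" using L_pos gk_nonneg[of x] by simp
    then show "\<exists>D. DERIV (y j) x :> D \<and> D \<ge> 0" using y_derivs(7,8)[of x] x that by (auto intro!: exI)
  qed (use that in auto)
  show "y j s \<le> y j t" if "0 \<le> s" "s \<le> t" "t \<le> b"
    using exhaust_3[of j] m[OF that, of j] 3 that by auto
  show "y 2 t = y 1 t" if "0 \<le> t" "t \<le> b"
  proof (cases "t = 0")
    case False
    have "y 2 t - y 1 t = y 2 0 - y 1 0"
    proof (rule DERIV_isconst_end[of 0 t "\<lambda>x. y 2 x - y 1 x"])
      show "0 < t" using False that by simp
      show "continuous_on {0..t} (\<lambda>x. y 2 x - y 1 x)" by (intro continuous_intros y_continuous)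
      show "DERIV (\<lambda>x. y 2 x - y 1 x) x :> 0" if "0 < x" "x < t" for x
        using DERIV_diff[OF y_derivs(8) y_derivs(7), of x] that \<open>t \<le> b\<close> by simp
    qed
    then show ?thesis by (simp add: y_zero)
  qed (simp add: y_zero)
qed

lemma arc2: "b \<le> s \<Longrightarrow> s \<le> t \<Longrightarrow> t \<le> 1 \<Longrightarrow> y 1 t \<le> y 1 s" "b \<le> t \<Longrightarrow> t \<le> 1 \<Longrightarrow> y 2 t = 1"
  "b \<le> s \<Longrightarrow> s \<le> t \<Longrightarrow> t \<le> 1 \<Longrightarrow> y 3 s \<le> y 3 t" "y 3 b < y 3 1"
proof -
  show "y 1 t \<le> y 1 s" if "b \<le> s" "s \<le> t" "t \<le> 1"
  proof (rule y_antimono)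
    fix x assume x: "s < x" "x < t"
    then have bx: "b < x" "x < 1" "x \<notin> {a, 0, b, 1}" using that ab by auto
    have "1 * k x \<le> (\<rho>\<^sup>2 * R x) * k x" using R_middle[OF bx(1,2)] gk_nonneg by (intro mult_right_mono) auto
    then have "k x \<le> g x" using g_eq_R[OF bx(3)] by simp
    then have "(k x - g x) / 2 / L \<le> 0" using L_pos by (simp add: field_simps)
    then show "\<exists>D. DERIV (y 1) x :> D \<and> D \<le> 0" using y_derivs(4)[OF bx(1,2)] by blast
  qed fact
  show "y 2 t = 1" if "b \<le> t" "t \<le> 1"
    using y_const[of b t 2] y_derivs(5) that vertex_values(2) by auto
  show "y 3 s \<le> y 3 t" if "b \<le> s" "s \<le> t" "t \<le> 1"
  proof (rule y_mono)
    fix x assume x: "s < x" "x < t"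
    have "h x / L \<ge> 0" using L_pos gk_nonneg[of x] by simp
    then show "\<exists>D. DERIV (y 3) x :> D \<and> D \<ge> 0" using y_derivs(6)[of x] x that by (auto intro!: exI)
  qed fact
  show "y 3 b < y 3 1"
  proof (rule DERIV_pos_imp_increasing_open[OF b(2) _ y_continuous])
    fix x assume x: "b < x" "x < 1"
    then have "h x > 0" using ghk_pos[of x] ab by auto
    then show "\<exists>D. DERIV (y 3) x :> D \<and> D > 0" using y_derivs(6)[OF x] L_pos by (intro exI[of _ "h x / L"]) auto
  qed
qed

definition height where "height = y 3 1"

lemma height_pos: "height > 0"
  using arc2(4) arc1(2)[of b] b by (simp add: height_def)

lemma arc3: "1 \<le> s \<Longrightarrow> s \<le> t \<Longrightarrow> y 1 s \<le> y 1 t" "1 \<le> t \<Longrightarrow> y 3 t = height" "1 \<le> t \<Longrightarrow> y 2 t = 1 - y 1 t"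
  "F None $ 3 = height"
proof -
  show "y 1 s \<le> y 1 t" if "1 \<le> s" "s \<le> t"
  proof (rule y_mono)
    fix x assume x: "s < x" "x < t"
    have "sqrt 2 / 4 * (k x + g x) / L \<ge> 0" using L_pos gk_nonneg[of x] by simp
    then show "\<exists>D. DERIV (y 1) x :> D \<and> D \<ge> 0" using y_derivs(1)[of x] x that by (auto intro!: exI)
  qed fact
  show 3: "y 3 t = height" if "1 \<le> t" for t
    using y_const[of 1 t 3] y_derivs(3) that by (auto simp: height_def)
  show "y 2 t = 1 - y 1 t" if "1 \<le> t"
  proof (cases "t = 1")
    case False
    have "y 2 t + y 1 t = y 2 1 + y 1 1"
    proof (rule DERIV_isconst_end[of 1 t "\<lambda>x. y 2 x + y 1 x"])
      show "1 < t" using False that by simp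
      show "continuous_on {1..t} (\<lambda>x. y 2 x + y 1 x)" by (intro continuous_intros y_continuous)
      show "DERIV (\<lambda>x. y 2 x + y 1 x) x :> 0" if "1 < x" "x < t" for x
        using DERIV_add[OF y_derivs(2) y_derivs(1), of x] that by simp
    qed
    then show ?thesis by (simp add: vertex_values)
  qed (simp add: vertex_values)
  have "(y 3 \<longlongrightarrow> height) at_top"
    by (rule tendsto_eventually) (use 3 in \<open>auto intro: eventually_mono[OF eventually_ge_at_top[of 1]]\<close>)
  then show "F None $ 3 = height" using y_limits(1)[of 3] by (rule tendsto_unique[OF trivial_limit_at_top_linorder, rotated])
qed

lemma arc4: "s \<le> t \<Longrightarrow> t \<le> a \<Longrightarrow> y 1 t \<le> y 1 s" "s \<le> t \<Longrightarrow> t \<le> 0 \<Longrightarrow> y 3 t \<le> y 3 s" "t \<le> a \<Longrightarrow> y 2 t = 0"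
proof -
  show "y 1 t \<le> y 1 s" if "s \<le> t" "t \<le> a"
  proof (rule y_antimono)
    fix x assume x: "s < x" "x < t"
    then have bx: "x < a" "x \<notin> {a, 0, b, 1}" using that ab by auto
    have "(\<rho>\<^sup>2 * R x) * k x \<le> 1 * k x" using R_left[OF bx(1)] gk_nonneg by (intro mult_right_mono) auto
    then have "g x \<le> k x" using g_eq_R[OF bx(2)] by simp
    then have "(g x - k x) / 2 / L \<le> 0" using L_pos by (simp add: field_simps)
    then show "\<exists>D. DERIV (y 1) x :> D \<and> D \<le> 0" using y_derivs(13)[OF bx(1)] by blast
  qed fact
  have m: "y 3 t \<le> y 3 s" if "s \<le> t" "t \<le> a \<or> a \<le> s \<and> t \<le> 0" for s t
  proof (rule y_antimono)
    fix x assume x: "s < x" "x < t"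
    have "- (h x / L) \<le> 0" using L_pos gk_nonneg[of x] by simp
    then show "\<exists>D. DERIV (y 3) x :> D \<and> D \<le> 0" using y_derivs(12,15)[of x] x that by (auto intro!: exI)
  qed fact
  show "y 3 t \<le> y 3 s" if "s \<le> t" "t \<le> 0"
  proof (cases "t \<le> a \<or> a \<le> s")
    case False
    then show ?thesis using m[of s a] m[of a t] that by auto
  qed (use m that in auto)
  show "y 2 t = 0" if "t \<le> a"
    using y_const[of t a 2] y_derivs(14) that vertex_values(6) by auto
qed

text \<open>Since \<open>R\<close> increases along the arc, the second coordinate first increases and then
  decreases; it vanishes at both ends and is therefore nonnegative. For the upper bound the
  contribution of \<open>G dh\<close>, which is negative, is discarded; what remains is the increment of
  the primitive of \<open>dh / G\<close>, which is at most \<open>1\<close> by \<open>period_lengths\<close>.\<close>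

lemma arc0: "a \<le> t \<Longrightarrow> t \<le> 0 \<Longrightarrow> y 1 t = 0" "a \<le> t \<Longrightarrow> t \<le> 0 \<Longrightarrow> 0 \<le> y 2 t" "a \<le> t \<Longrightarrow> t \<le> 0 \<Longrightarrow> y 2 t \<le> 1"
proof -
  show "y 1 t = 0" if "a \<le> t" "t \<le> 0"
    using y_const[of a t 1] y_derivs(10) that vertex_values(5) by auto
  show "0 \<le> y 2 t" if t: "a \<le> t" "t \<le> 0"
  proof (cases "t = a \<or> t = 0 \<or> \<rho>\<^sup>2 * R t \<le> 1")
    case True
    consider "t = 0" | "a < t" "t < 0" "\<rho>\<^sup>2 * R t \<le> 1" | "t = a" using True t by fastforce
    then show ?thesis
    proof cases
      case 2
      have "y 2 a \<le> y 2 t"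
      proof (rule y_mono)
        fix x assume x: "a < x" "x < t"
        then have "x \<notin> {a, 0, b, 1}" "x < 0" using 2 ab by auto
        have "\<rho>\<^sup>2 * R x \<le> \<rho>\<^sup>2 * R t" using R_strict_mono[of x t] x 2 by (intro mult_left_mono) auto
        then have "(\<rho>\<^sup>2 * R x) * k x \<le> 1 * k x" using 2 gk_nonneg by (intro mult_right_mono) auto
        then have "g x \<le> k x" using g_eq_R[OF \<open>x \<notin> {a, 0, b, 1}\<close>] by simp
        then have "(k x - g x) / 2 / L \<ge> 0" using L_pos by (simp add: field_simps)
        then show "\<exists>D. DERIV (y 2) x :> D \<and> D \<ge> 0" using y_derivs(11)[OF x(1) \<open>x < 0\<close>] by blast
      qed (use 2 in auto)
      then show ?thesis by (simp add: vertex_values)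
    qed (auto simp: y_zero vertex_values)
  next
    case False
    have "y 2 0 \<le> y 2 t"
    proof (rule y_antimono)
      fix x assume x: "t < x" "x < 0"
      then have "x \<notin> {a, 0, b, 1}" "a < x" using t ab by auto
      have "\<rho>\<^sup>2 * R t \<le> \<rho>\<^sup>2 * R x" using R_strict_mono[of t x] x t False by (intro mult_left_mono) auto
      then have "1 * k x \<le> (\<rho>\<^sup>2 * R x) * k x" using False gk_nonneg by (intro mult_right_mono) auto
      then have "k x \<le> g x" using g_eq_R[OF \<open>x \<notin> {a, 0, b, 1}\<close>] by simp
      then have "(k x - g x) / 2 / L \<le> 0" using L_pos by (simp add: field_simps)
      then show "\<exists>D. DERIV (y 2) x :> D \<and> D \<le> 0" using y_derivs(11)[OF \<open>a < x\<close> x(2)] by blast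
    qed fact
    then show ?thesis by (simp add: y_zero)
  qed
  show "y 2 t \<le> 1" if t: "a \<le> t" "t \<le> 0"
  proof -
    \<comment> \<open>The part of the second coordinate that comes from \<open>dh / G\<close>.\<close>
    define u where "u t = - Im (e1 * sc_ext (K_list a b) (Some (of_real t))) / (2 * \<rho>) / L" for t
    have uc: "continuous_on {p..q} u" for p q
    proof -
      have "closed_half_plane \<subseteq> sc_domain (K_list a b)" using dom_eq by (auto simp: dom_def)
      then have "continuous_on {p..q} (\<lambda>t. sc_ext (K_list a b) (Some (complex_of_real t)))"
        by (intro continuous_on_compose2[OF sc_ext_continuous[of "K_list a b"]] continuous_intros)
           (auto simp: closed_half_plane_def)
      then show ?thesis unfolding u_def by (intro continuous_intros) (use rho L_pos in auto)
    qed
    have ud: "DERIV u x :> k x / 2 / L" if "a < x" "x < 0" for x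
    proof -
      have "x \<notin> sc_points (K_list a b)" using that ab by (auto simp: CS4_points)
      from sc_ext_vector_derivative[OF this]
      have "((\<lambda>t. e1 * sc_ext (K_list a b) (Some (of_real t))) has_vector_derivative
          e1 * (cis (pi * sc_turn (K_list a b) x) * of_real (sc_abs (K_list a b) x))) (at x)"
        by (intro has_vector_derivative_mult_right)
      moreover have "sc_turn (K_list a b) x = -3/4" using that ab by (auto simp: sc_turn_def sc_list_defs)
      ultimately have "((\<lambda>t. e1 * sc_ext (K_list a b) (Some (of_real t))) has_vector_derivative
          -\<i> * of_real (sc_abs (K_list a b) x)) (at x)"
        using phases(11) by (simp add: mult.assoc[symmetric])
      from bounded_linear.has_vector_derivative[OF bounded_linear_Im this]
      have d0: "DERIV (\<lambda>t. Im (e1 * sc_ext (K_list a b) (Some (of_real t)))) x :> - sc_abs (K_list a b) x"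
        by (simp add: has_real_derivative_iff_has_vector_derivative)
      show ?thesis unfolding u_def
        by (rule DERIV_cong[OF DERIV_cdivide[OF DERIV_cdivide[OF DERIV_minus[OF d0]]]]) (simp add: k_def)
    qed
    have "y 2 t - u t \<le> y 2 a - u a"
    proof (rule DERIV_nonpos_imp_decreasing_open[OF t(1), of "\<lambda>x. y 2 x - u x"])
      show "continuous_on {a..t} (\<lambda>x. y 2 x - u x)" by (intro continuous_intros y_continuous uc)
      fix x assume x: "a < x" "x < t"
      have "DERIV (\<lambda>x. y 2 x - u x) x :> (k x - g x) / 2 / L - k x / 2 / L"
        using x t by (intro DERIV_diff y_derivs ud) auto
      moreover have "(k x - g x) / 2 / L - k x / 2 / L \<le> 0" using L_pos gk_nonneg[of x] by (simp add: field_simps)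
      ultimately show "\<exists>D. DERIV (\<lambda>x. y 2 x - u x) x :> D \<and> D \<le> 0" by blast
    qed
    moreover have "u t \<le> u 0"
    proof (rule DERIV_nonneg_imp_increasing_open[OF t(2) _ uc])
      fix x assume x: "t < x" "x < 0"
      then show "\<exists>D. DERIV u x :> D \<and> D \<ge> 0" using ud[of x] t L_pos gk_nonneg[of x] by (intro exI[of _ "k x / 2 / L"]) auto
    qed
    moreover have "u 0 - u a \<le> 1"
    proof -
      have s: "sc_ext (K_list a b) (Some 0) - sc_ext (K_list a b) (Some (of_real a)) = - e1 * of_real (side5 (K_list a b) a)"
        using CS4_sides(9)[OF ab] by simp
      have m: "e1 * (sc_ext (K_list a b) (Some 0) - sc_ext (K_list a b) (Some (of_real a))) = - \<i> * of_real (side5 (K_list a b) a)"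
        unfolding s by (simp add: complex_eq_iff)
      have I: "Im (e1 * A) - Im (e1 * B) = Im (e1 * (A - B))" for A B
        by (simp only: right_diff_distrib minus_complex.sel)
      have "Im (e1 * sc_ext (K_list a b) (Some 0)) - Im (e1 * sc_ext (K_list a b) (Some (of_real a))) = - side5 (K_list a b) a"
        unfolding I m by simp
      then have "u 0 - u a = side5 (K_list a b) a / (2 * \<rho>) / L"
        unfolding u_def of_real_0 diff_divide_distrib[symmetric] by (simp del: times_complex.sel)
      also have "\<dots> \<le> L / L" using period_lengths(4) L_pos by (intro divide_right_mono) auto
      also have "\<dots> = 1" using L_pos by simp
      finally show ?thesis .
    qed
    ultimately show ?thesis by (simp add: vertex_values)
  qed
qed

lemma boundary_box: "0 \<le> y 1 t \<and> y 1 t \<le> 1 \<and> 0 \<le> y 2 t \<and> y 2 t \<le> 1 \<and> 0 \<le> y 3 t \<and> y 3 t \<le> height"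
proof -
  note v = vertex_values y_zero
  have y3: "y 3 t \<le> height \<and> 0 \<le> y 3 t" if "t \<le> 0" for t
    using antimono_ray_bounds[of 0 "y 3" height t] arc4(2) y_limits(2)[of 3] that unfolding arc3(4) by (auto simp: v)
  consider "t \<le> a" | "a \<le> t" "t \<le> 0" | "0 \<le> t" "t \<le> b" | "b \<le> t" "t \<le> 1" | "1 \<le> t" by linarith
  then show ?thesis
  proof cases
    case 1
    have "y 1 a \<le> y 1 t" "y 1 t \<le> F None $ 1"
      using antimono_ray_bounds[of a "y 1" "F None $ 1" t] arc4(1) y_limits 1 by blast+
    then show ?thesis using 1 ab arc4(3)[OF 1] y3[of t] by (simp add: v)
  next
    case 2
    then show ?thesis using arc0[of t] y3[of t] by simp
  next
    case 3
    then show ?thesis using arc1(1)[of 0 t 1] arc1(1)[of t b 1] arc1(2,3)[of t] height_pos by (simp add: v)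
  next
    case 4
    then show ?thesis using arc2(1)[of b t] arc2(1)[of t 1] arc2(2)[of t] arc2(3)[of b t] arc2(3)[of t 1] arc1(2)[of b] b
      by (simp add: v height_def)
  next
    case 5
    have "y 1 1 \<le> y 1 t" "y 1 t \<le> F None $ 1"
      using mono_ray_bounds[of 1 "y 1" "F None $ 1" t] arc3(1) y_limits 5 by blast+
    then show ?thesis using arc3(2,3)[OF 5] height_pos by (simp add: v)
  qed
qed

end

section \<open>The pentagons are of type CS\<close>

lemma weierstrass_rep_affine:
  assumes "weierstrass_rep X \<omega> U"
  shows "weierstrass_rep (\<lambda>z. c *\<^sub>R X z + t) (\<lambda>z. \<chi> k. of_real c * \<omega> z $ k) U"
  unfolding weierstrass_rep_def
proof (intro conjI allI ballI)
  show "open U" using assms by (simp add: weierstrass_rep_def)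
  fix k show "(\<lambda>z. (\<chi> k. of_real c * \<omega> z $ k) $ k) holomorphic_on U"
    using assms by (auto simp: weierstrass_rep_def intro!: holomorphic_intros)
next
  fix z assume "z \<in> U"
  then have "(X has_derivative (\<lambda>\<delta>. \<chi> k. Re (\<omega> z $ k * \<delta>))) (at z)" using assms by (simp add: weierstrass_rep_def)
  then have "((\<lambda>z. c *\<^sub>R X z + t) has_derivative (\<lambda>\<delta>. c *\<^sub>R (\<chi> k. Re (\<omega> z $ k * \<delta>)))) (at z)"
    by (auto intro!: derivative_eq_intros)
  moreover have "c *\<^sub>R (\<chi> k. Re (\<omega> z $ k * \<delta>)) = (\<chi> k. Re ((\<chi> k. of_real c * \<omega> z $ k) $ k * \<delta>))" for \<delta>
    by (simp add: vec_eq_iff mult.assoc)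
  ultimately show "((\<lambda>z. c *\<^sub>R X z + t) has_derivative (\<lambda>\<delta>. \<chi> k. Re ((\<chi> k. of_real c * \<omega> z $ k) $ k * \<delta>))) (at z)"
    by simp
qed

context sc_weierstrass
begin

lemma scaled_rep: "weierstrass_rep (\<lambda>z. c *\<^sub>R X (Some z) + t) (\<lambda>z. \<chi> k. of_real c * form z $ k) upper_half_plane"
  by (rule weierstrass_rep_affine[OF rep])

lemma scaled_null:
  assumes "z \<notin> of_real ` points"
  shows "((\<chi> k. of_real c * form z $ k) $ 1)\<^sup>2 + ((\<chi> k. of_real c * form z $ k) $ 2)\<^sup>2 + ((\<chi> k. of_real c * form z $ k) $ 3)\<^sup>2 = 0"
proof -
  have "((\<chi> k. of_real c * form z $ k) $ 1)\<^sup>2 + ((\<chi> k. of_real c * form z $ k) $ 2)\<^sup>2 + ((\<chi> k. of_real c * form z $ k) $ 3)\<^sup>2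
    = (of_real c)\<^sup>2 * ((form z $ 1)\<^sup>2 + (form z $ 2)\<^sup>2 + (form z $ 3)\<^sup>2)"
    by (simp add: power_mult_distrib distrib_left)
  then show ?thesis unfolding form_null[OF assms] by simp
qed

lemma scaled_nonzero:
  assumes "z \<notin> of_real ` points" "c \<noteq> 0"
  shows "(\<chi> k. of_real c * form z $ k) \<noteq> (0 :: complex^3)"
proof
  assume "(\<chi> k. of_real c * form z $ k) = (0 :: complex^3)"
  then have "form z = 0" using assms(2) by (simp add: vec_eq_iff)
  then show False using form_nonzero[OF assms(1)] by simp
qed

lemma scaled_conformal: "c \<noteq> 0 \<Longrightarrow> conformal_minimal_immersion (\<lambda>z. c *\<^sub>R X (Some z) + t) upper_half_plane"
  by (intro weierstrass_conformal_minimal[OF scaled_rep] scaled_null scaled_nonzero upper_not_real)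

lemma scaled_normal_limit:
  assumes "p \<notin> points" "c \<noteq> 0"
  shows "(unit_normal (\<lambda>z. c *\<^sub>R X (Some z) + t) \<longlongrightarrow>
      sgn ((\<chi> k. c * Re (form (of_real p) $ k)) \<times> (\<chi> k. - (c * Im (form (of_real p) $ k)))))
    (at (of_real p) within upper_half_plane)"
proof -
  have nr: "complex_of_real p \<notin> of_real ` points" using assms by auto
  have "(unit_normal (\<lambda>z. c *\<^sub>R X (Some z) + t) \<longlongrightarrow>
      sgn ((\<chi> k. Re ((\<chi> k. of_real c * form (of_real p) $ k) $ k)) \<times> (\<chi> k. - Im ((\<chi> k. of_real c * form (of_real p) $ k) $ k))))
    (at (of_real p) within upper_half_plane)"
  proof (rule weierstrass_normal_limit[OF scaled_rep _ scaled_null[OF nr] scaled_nonzero[OF nr assms(2)]])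
    show "((\<lambda>z. (\<chi> k. of_real c * form z $ k) $ k) \<longlongrightarrow> (\<chi> k. of_real c * form (of_real p) $ k) $ k)
        (at (of_real p) within upper_half_plane)" for k
      by (auto intro!: tendsto_intros form_tendsto assms)
  qed
  then show ?thesis by simp
qed

end

lemma sgn_nth_zero: "(x :: real^3) $ j = 0 \<Longrightarrow> sgn x $ j = 0"
  by (simp add: sgn_div_norm)

lemma mem_box_of_height: "x \<in> box_of_height h \<longleftrightarrow> 0 \<le> x$1 \<and> x$1 \<le> 1 \<and> 0 \<le> x$2 \<and> x$2 \<le> 1 \<and> 0 \<le> x$3 \<and> x$3 \<le> h"
  by (auto simp: box_of_height_def mem_box_cart forall_3)

lemma boundary_point_segment:
  "boundary_point ` {ereal p..ereal q} = (\<lambda>t. Some (complex_of_real t)) ` {p..q}"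
  "boundary_point ` {ereal p..\<infinity>} = insert None ((\<lambda>t. Some (complex_of_real t)) ` {p..})"
  "boundary_point ` ({\<infinity>..} \<union> {..ereal q}) = insert None ((\<lambda>t. Some (complex_of_real t)) ` {..q})"
proof -
  have bp: "boundary_point \<xi> = (case \<xi> of ereal t \<Rightarrow> Some (of_real t) | _ \<Rightarrow> None)" for \<xi>
    by (cases \<xi>) (auto simp: boundary_point_def)
  have 1: "{ereal p..ereal q} = ereal ` {p..q}" "{ereal p..\<infinity>} = insert \<infinity> (ereal ` {p..})"
    "{\<infinity>..} \<union> {..ereal q} = {\<infinity>, -\<infinity>} \<union> ereal ` {..q}"
  proof -
    show "{ereal p..ereal q} = ereal ` {p..q}"
    proof safe
      fix x assume "x \<in> {ereal p..ereal q}" then show "x \<in> ereal ` {p..q}" by (cases x) auto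
    qed auto
    show "{ereal p..\<infinity>} = insert \<infinity> (ereal ` {p..})"
    proof safe
      fix x assume "x \<in> {ereal p..\<infinity>}" "x \<notin> ereal ` {p..}" then show "x = \<infinity>" by (cases x) auto
    qed auto
    show "{\<infinity>..} \<union> {..ereal q} = {\<infinity>, -\<infinity>} \<union> ereal ` {..q}"
    proof (intro set_eqI)
      fix x :: ereal show "x \<in> {\<infinity>..} \<union> {..ereal q} \<longleftrightarrow> x \<in> {\<infinity>, -\<infinity>} \<union> ereal ` {..q}" by (cases x) auto
    qed
  qed
  show "boundary_point ` {ereal p..ereal q} = (\<lambda>t. Some (complex_of_real t)) ` {p..q}"
    "boundary_point ` {ereal p..\<infinity>} = insert None ((\<lambda>t. Some (complex_of_real t)) ` {p..})"
    "boundary_point ` ({\<infinity>..} \<union> {..ereal q}) = insert None ((\<lambda>t. Some (complex_of_real t)) ` {..q})"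
    unfolding 1 by (auto simp: bp image_image)
qed

lemma nat_less_5_cases: "(n::nat) < 5 \<Longrightarrow> n = 0 \<or> n = 1 \<or> n = 2 \<or> n = 3 \<or> n = 4" by auto

context CS4_pentagon
begin

lemma F_None: "F None = vector [1, 0, height]"
  by (simp add: vec_eq_iff forall_3 vertex_values arc3(4))

text \<open>The coordinates are real parts of holomorphic functions, so they are bounded by their
  boundary values.\<close>

lemma F_in_box: "\<zeta> \<in> compact_half_plane \<Longrightarrow> F \<zeta> \<in> box_of_height height"
proof (cases \<zeta>)
  case None
  then show ?thesis using height_pos by (simp add: F_None mem_box_of_height)
next
  case (Some z)
  assume "\<zeta> \<in> compact_half_plane"
  then have z: "z \<in> closed_half_plane" by (auto simp: Some compact_half_plane_def)
  have bd: "s * F (Some z) $ j \<le> M" if M: "\<And>t. s * y j t \<le> M" for s j M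
  proof -
    define f where "f z = of_real (s / L) * (\<Phi> (Some z) $ j - \<Phi> (Some 0) $ j)" for z
    have re: "Re (f z) = s * F (Some z) $ j" for z
      by (simp add: f_def F_def X_def diff_divide_distrib right_diff_distrib)
    have "Re (f z) \<le> M"
    proof (rule half_plane_maximum_principle[OF _ _ _ _ z])
      show "f holomorphic_on upper_half_plane"
        unfolding f_def holomorphic_on_open[OF open_upper_half_plane]
        using L_pos by (auto intro!: exI derivative_eq_intros \<Phi>_derivative sc_ext_derivative_upper)
      show "continuous_on closed_half_plane f"
        unfolding f_def by (rule continuous_on_mult[OF continuous_on_const continuous_on_diff[OF \<Phi>_continuous[of j, unfolded dom_eq] continuous_on_const]])
      show "(f \<longlongrightarrow> of_real (s / L) * (\<Phi> None $ j - \<Phi> (Some 0) $ j)) (inf at_infinity (principal closed_half_plane))"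
        unfolding f_def by (rule tendsto_mult[OF tendsto_const tendsto_diff[OF \<Phi>_limit tendsto_const]])
      show "Re (f (of_real t)) \<le> M" for t using M[of t] unfolding re y_def .
    qed
    then show ?thesis by (simp add: re)
  qed
  note b = boundary_box
  show ?thesis
    unfolding Some mem_box_of_height
    using bd[of 1 1 1] bd[of 1 2 1] bd[of 1 3 height] bd[of "-1" 1 0] bd[of "-1" 2 0] bd[of "-1" 3 0] b by simp
qed

abbreviation p where "p \<equiv> CS4_marked_points a b"

lemma marked: "p 0 = ereal a" "p 1 = ereal 0" "p (Suc 0) = ereal 0" "p 2 = ereal b" "p 3 = ereal 1" "p 4 = \<infinity>"
  by (simp_all add: CS4_marked_points_def zero_ereal_def one_ereal_def numeral_eq_Suc)

lemma arcs:
  "boundary_arc p 0 = (\<lambda>t. Some (complex_of_real t)) ` {a..0}"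
  "boundary_arc p 1 = (\<lambda>t. Some (complex_of_real t)) ` {0..b}"
  "boundary_arc p 2 = (\<lambda>t. Some (complex_of_real t)) ` {b..1}"
  "boundary_arc p 3 = insert None ((\<lambda>t. Some (complex_of_real t)) ` {1..})"
  "boundary_arc p 4 = insert None ((\<lambda>t. Some (complex_of_real t)) ` {..a})"
proof -
  have s: "Suc 1 = 2" "Suc 2 = 3" "Suc 3 = 4" by simp_all
  show "boundary_arc p 0 = (\<lambda>t. Some (complex_of_real t)) ` {a..0}"
    "boundary_arc p 1 = (\<lambda>t. Some (complex_of_real t)) ` {0..b}"
    "boundary_arc p 2 = (\<lambda>t. Some (complex_of_real t)) ` {b..1}"
    "boundary_arc p 3 = insert None ((\<lambda>t. Some (complex_of_real t)) ` {1..})"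
    "boundary_arc p 4 = insert None ((\<lambda>t. Some (complex_of_real t)) ` {..a})"
    unfolding boundary_arc_def s by (simp_all only: marked boundary_point_segment if_True if_False; simp add: marked boundary_point_segment)+
qed

lemma marked_image: "(boundary_point \<circ> p) ` {..<5} = {Some (of_real a), Some 0, Some (of_real b), Some 1, None}"
proof -
  have "{..<5::nat} = {0, 1, 2, 3, 4}" by auto
  then show ?thesis by (simp add: marked)
qed

lemma F_eq_y: "F (Some (of_real t)) = vector [y 1 t, y 2 t, y 3 t]"
  by (simp add: vec_eq_iff forall_3 y_def)

lemma edge1: "edge F p 1 = closed_segment (vector [0, 0, 0]) (vector [1, 1, 0])"
proof -
  have seg: "x \<in> closed_segment (vector [0, 0, 0]) (vector [1, 1, 0 :: real]) \<longleftrightarrow> (\<exists>u. 0 \<le> u \<and> u \<le> 1 \<and> x = vector [u, u, 0])"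
    for x :: "real^3" by (auto simp: in_segment vec_eq_iff forall_3)
  show ?thesis
  proof (rule set_eqI)
    fix x
    have "x \<in> edge F p 1 \<longleftrightarrow> (\<exists>t. 0 \<le> t \<and> t \<le> b \<and> x = vector [y 1 t, y 1 t, 0])"
      unfolding edge_def arcs using arc1(2,3) by (auto simp: F_eq_y image_iff)
    also have "\<dots> \<longleftrightarrow> (\<exists>u. 0 \<le> u \<and> u \<le> 1 \<and> x = vector [u, u, 0])"
    proof safe
      fix t assume "0 \<le> t" "t \<le> b"
      then show "\<exists>u\<ge>0. u \<le> 1 \<and> vector [y 1 t, y 1 t, 0] = (vector [u, u, 0] :: real^3)"
        using boundary_box[of t] by blast
    next
      fix u :: real assume "0 \<le> u" "u \<le> 1"
      then have "\<exists>t\<ge>0. t \<le> b \<and> y 1 t = u"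
        using b by (intro IVT' y_continuous) (auto simp: y_zero vertex_values)
      then show "\<exists>t\<ge>0. t \<le> b \<and> vector [u, u, 0] = (vector [y 1 t, y 1 t, 0] :: real^3)" by auto
    qed
    finally show "x \<in> edge F p 1 \<longleftrightarrow> x \<in> closed_segment (vector [0, 0, 0]) (vector [1, 1, 0])" by (simp only: seg)
  qed
qed

lemma edge3: "edge F p 3 = closed_segment (vector [1, 0, height]) (vector [0, 1, height])"
proof -
  have seg: "x \<in> closed_segment (vector [1, 0, height]) (vector [0, 1, height])
      \<longleftrightarrow> (\<exists>u. 0 \<le> u \<and> u \<le> 1 \<and> x = vector [u, 1 - u, height])" for x :: "real^3"
  proof
    assume "x \<in> closed_segment (vector [1, 0, height]) (vector [0, 1, height])"
    then obtain u where "0 \<le> u" "u \<le> 1" "x = (1 - u) *\<^sub>R vector [1, 0, height] + u *\<^sub>R vector [0, 1, height]"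
      by (auto simp: in_segment)
    then show "\<exists>u. 0 \<le> u \<and> u \<le> 1 \<and> x = vector [u, 1 - u, height]"
      by (intro exI[of _ "1 - u"]) (auto simp: vec_eq_iff forall_3 algebra_simps)
  next
    assume "\<exists>u. 0 \<le> u \<and> u \<le> 1 \<and> x = vector [u, 1 - u, height]"
    then obtain u where "0 \<le> u" "u \<le> 1" "x = vector [u, 1 - u, height]" by blast
    then show "x \<in> closed_segment (vector [1, 0, height]) (vector [0, 1, height])"
      unfolding in_segment by (intro exI[of _ "1 - u"]) (auto simp: vec_eq_iff forall_3 algebra_simps)
  qed
  show ?thesis
  proof (rule set_eqI)
    fix x
    have "x \<in> edge F p 3 \<longleftrightarrow> x = vector [1, 0, height] \<or> (\<exists>t\<ge>1. x = vector [y 1 t, 1 - y 1 t, height])"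
      unfolding edge_def arcs using arc3(2,3) by (auto simp: F_eq_y F_None image_iff)
    also have "\<dots> \<longleftrightarrow> (\<exists>u. 0 \<le> u \<and> u \<le> 1 \<and> x = vector [u, 1 - u, height])"
    proof safe
      show "\<exists>u\<ge>0. u \<le> 1 \<and> vector [1, 0, height] = (vector [u, 1 - u, height] :: real^3)"
        by (intro exI[of _ 1]) simp
    next
      fix t :: real assume "1 \<le> t"
      then show "\<exists>u\<ge>0. u \<le> 1 \<and> vector [y 1 t, 1 - y 1 t, height] = (vector [u, 1 - u, height] :: real^3)"
        using boundary_box[of t] by blast
    next
      fix u :: real
      assume u: "0 \<le> u" "u \<le> 1" and n: "\<not> (\<exists>t\<ge>1. vector [u, 1 - u, height] = (vector [y 1 t, 1 - y 1 t, height] :: real^3))"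
      have "u = 1"
      proof (rule ccontr)
        assume "u \<noteq> 1"
        then have "u < F None $ 1" using u by (simp add: vertex_values)
        then have "\<forall>\<^sub>F t in at_top. y 1 t > u" using y_limits(1)[of 1] by (rule order_tendstoD(1)[rotated])
        then have "\<forall>\<^sub>F t in at_top. y 1 t > u \<and> t \<ge> 1" using eventually_ge_at_top[of 1] by eventually_elim simp
        then obtain T where T: "y 1 T > u" "T \<ge> 1" by (auto dest: eventually_happens)
        have "\<exists>t\<ge>1. t \<le> T \<and> y 1 t = u" using T u by (intro IVT' y_continuous) (auto simp: vertex_values)
        then show False using n by auto
      qed
      then show "vector [u, 1 - u, height] = (vector [1, 0, height] :: real^3)" by simp
    qed
    finally show "x \<in> edge F p 3 \<longleftrightarrow> x \<in> closed_segment (vector [1, 0, height]) (vector [0, 1, height])"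
      by (simp only: seg)
  qed
qed

text \<open>If only the component \<open>j\<close> of the form has an imaginary part, then the derivative of the
  surface across the boundary points in the direction of the axis \<open>j\<close>, and the normal vector
  is orthogonal to it.\<close>

lemma normal_vertical:
  assumes "t \<notin> points" and "\<forall>k. k \<noteq> j \<longrightarrow> Im (form (of_real t) $ k) = 0" and "j \<in> {1, 2}"
  shows "\<exists>n. normal_along F (Some (of_real t)) n \<and> n $ j = 0"
proof -
  let ?n = "sgn ((\<chi> k. (1/L) * Re (form (of_real t) $ k)) \<times> (\<chi> k. - ((1/L) * Im (form (of_real t) $ k))))"
  have "F \<circ> Some = (\<lambda>z. (1 / L) *\<^sub>R X (Some z) + (- (1 / L)) *\<^sub>R X (Some 0))" by (simp add: F_def fun_eq_iff)
  then have "normal_along F (Some (of_real t)) ?n"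
    using scaled_normal_limit[OF assms(1), of "1/L" "(- (1 / L)) *\<^sub>R X (Some 0)"] L_pos
    by (simp add: normal_along_def approach_def)
  moreover have "?n $ j = 0"
    using assms(2,3) by (intro sgn_nth_zero) (auto simp: cross3_def)
  ultimately show ?thesis by blast
qed

text \<open>The condition on the normal vector applies to every vertical face that contains an edge,
  so it has to be excluded that the edge over \<open>(a, 0)\<close> lies in a second face. Otherwise
  \<open>\<bar>G\<bar> = 1\<close> on the whole arc, but \<open>R\<close> is strictly increasing.\<close>

lemma edge0_not_in_face:
  assumes "edge F p 0 \<subseteq> vertical_face height 2 c" shows False
proof -
  have c: "y 2 t = c" if "a \<le> t" "t \<le> 0" for t
  proof -
    have "F (Some (of_real t)) \<in> edge F p 0" unfolding edge_def arcs using that by auto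
    then show ?thesis using assms by (auto simp: vertical_face_def y_def)
  qed
  have "g t = k t" if t: "a < t" "t < 0" for t
  proof -
    have "DERIV (y 2) t :> 0"
    proof (rule has_field_derivative_transform_within_open[of "\<lambda>_. c" 0 t "{a<..<0}"])
      show "c = y 2 x" if "x \<in> {a<..<0}" for x using c[of x] that by auto
    qed (use t in auto)
    from DERIV_unique[OF this y_derivs(11)[OF t]] show ?thesis using L_pos by simp
  qed
  then have e: "\<rho>\<^sup>2 * R t = 1" if t: "a < t" "t < 0" for t
    using g_eq_R[of t] ghk_pos(2)[of t] t ab by force
  have "\<rho>\<^sup>2 * R (a/2) < \<rho>\<^sup>2 * R (a/3)" using R_strict_mono[of "a/2" "a/3"] ab rho by simp
  then show False using e[of "a/2"] e[of "a/3"] ab by simp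
qed

lemma pentagon: "minimal_pentagon F p"
  unfolding minimal_pentagon_def
proof (intro conjI allI impI)
  have F: "F \<circ> Some = (\<lambda>z. (1 / L) *\<^sub>R X (Some z) + (- (1 / L)) *\<^sub>R X (Some 0))" by (simp add: F_def fun_eq_iff)
  show "conformal_minimal_immersion (F \<circ> Some) upper_half_plane"
    unfolding F using L_pos by (intro scaled_conformal) simp
  show "continuous_on closed_half_plane (F \<circ> Some)" using F_continuous by (simp add: o_def)
  show "((F \<circ> Some) \<longlongrightarrow> F None) (approach None closed_half_plane)" using F_limit by (simp add: o_def approach_def)
  show "-\<infinity> < p 0" by (simp add: marked)
  fix k :: nat assume "k < 4"
  then have "k = 0 \<or> k = 1 \<or> k = 2 \<or> k = 3" by auto
  then show "p k < p (Suc k)" using ab marked by (auto simp: numeral_eq_Suc)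
qed

lemma type_CS: "type_CS F p"
  unfolding type_CS_def
proof (intro conjI exI[of _ height])
  show "minimal_pentagon F p" by (rule pentagon)
  show "height > 0" by (rule height_pos)
  show box: "F ` compact_half_plane \<subseteq> box_of_height height" using F_in_box by auto
  have arc_sub: "boundary_arc p k \<subseteq> compact_half_plane" if "k < 5" for k
    using nat_less_5_cases[OF that] arcs by (auto simp: compact_half_plane_def closed_half_plane_def)
  have face: "edge F p m \<subseteq> vertical_face height j c" if "m < 5" "\<And>\<zeta>. \<zeta> \<in> boundary_arc p m \<Longrightarrow> F \<zeta> $ j = c" for m j c
    using that arc_sub[OF that(1)] F_in_box unfolding edge_def vertical_face_def by auto
  have f0: "edge F p 0 \<subseteq> vertical_face height 1 0"
    by (rule face) (auto simp: arcs arc0 simp flip: y_def)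
  have f2: "edge F p 2 \<subseteq> vertical_face height 2 1"
    by (rule face) (auto simp: arcs arc2 simp flip: y_def)
  have f4: "edge F p 4 \<subseteq> vertical_face height 2 0"
    by (rule face) (auto simp: arcs arc4 vertex_values simp flip: y_def)
  show "\<exists>k<5. \<exists>l<5. \<exists>P Q P' Q'.
           k \<noteq> l \<and>
           square_diagonal height P Q \<and> edge F p k = closed_segment P Q \<and>
           square_diagonal 0 P' Q' \<and> edge F p l = closed_segment P' Q' \<and>
           orthogonal (Q - P) (Q' - P') \<and>
           (\<forall>m<5. m \<noteq> k \<and> m \<noteq> l \<longrightarrow>
              (\<exists>j\<in>{1, 2}. \<exists>c\<in>{0, 1}. edge F p m \<subseteq> vertical_face height j c))"
  proof (intro exI conjI allI impI)
    show "edge F p 3 = closed_segment (vector [1, 0, height]) (vector [0, 1, height])" by (rule edge3)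
    show "edge F p 1 = closed_segment (vector [0, 0, 0]) (vector [1, 1, 0])" by (rule edge1)
    show "orthogonal (vector [0, 1, height] - vector [1, 0, height]) (vector [1, 1, 0] - vector [0, 0, 0] :: real^3)"
      by (simp add: orthogonal_def inner_vec_def sum_3)
    fix m :: nat assume "m < 5" "m \<noteq> 3 \<and> m \<noteq> 1"
    then consider "m = 0" | "m = 2" | "m = 4" using nat_less_5_cases by blast
    then show "\<exists>j\<in>{1, 2}. \<exists>c\<in>{0, 1}. edge F p m \<subseteq> vertical_face height j c"
      using f0 f2 f4 by cases auto
  qed (auto simp: square_diagonal_def)
  have v: "vertex F p 0 = vector [0, 0, y 3 a]" "vertex F p 1 = vector [0, 0, 0]" "vertex F p 2 = vector [1, 1, 0]"
    "vertex F p 3 = vector [0, 1, height]" "vertex F p 4 = vector [1, 0, height]"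
    using arc1(2)[of b] b F_eq_y[of 0] F_eq_y[of 1]
    by (simp_all add: vertex_def marked F_eq_y F_None vertex_values y_zero height_def)
  show "\<forall>k<5. vertex F p k \<in> box_edges height"
    using v height_pos boundary_box[of a] by (auto dest!: nat_less_5_cases simp: box_edges_def mem_box_of_height)
  show "\<forall>k<5. \<forall>j\<in>{1, 2}. \<forall>c\<in>{0, 1}. edge F p k \<subseteq> vertical_face height j c \<longrightarrow>
           (\<forall>\<zeta>\<in>open_boundary_arc p k. \<exists>n. normal_along F \<zeta> n \<and> n $ j = 0)"
  proof (intro allI impI ballI)
    fix k :: nat and j :: 3 and c :: real and \<zeta>
    assume k: "k < 5" and j: "j \<in> {1, 2}" and "c \<in> {0, 1}" and e: "edge F p k \<subseteq> vertical_face height j c"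
      and \<zeta>: "\<zeta> \<in> open_boundary_arc p k"
    have yc: "y j t = c" if "Some (of_real t) \<in> boundary_arc p k" for t
      using e that unfolding edge_def vertical_face_def y_def by auto
    have Nc: "F None $ j = c" if "None \<in> boundary_arc p k"
      using e that unfolding edge_def vertical_face_def by auto
    consider "k = 0" | "k = 1" | "k = 2" | "k = 3" | "k = 4" using nat_less_5_cases[OF k] by blast
    then show "\<exists>n. normal_along F \<zeta> n \<and> n $ j = 0"
    proof cases
      case 1
      have j1: "j = 1" using edge0_not_in_face[of c] e j unfolding 1 by auto
      obtain t where t: "\<zeta> = Some (of_real t)" "a < t" "t < 0"
        using \<zeta> unfolding open_boundary_arc_def 1 marked_image arcs by force
      show ?thesis unfolding t j1
        by (rule normal_vertical) (use t ab in \<open>auto simp: points_eq form_arc(4) forall_3\<close>)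
    next
      case 2
      have "y j 0 = c" "y j b = c" using b by (auto intro!: yc simp: 2 arcs(2)[unfolded One_nat_def])
      then have False using j by (auto simp: y_zero vertex_values)
      then show ?thesis ..
    next
      case 3
      have "y j b = c" "y j 1 = c" using b by (auto intro!: yc simp: 3 arcs)
      then have j2: "j = 2" using j by (auto simp: vertex_values)
      obtain t where t: "\<zeta> = Some (of_real t)" "b < t" "t < 1"
        using \<zeta> unfolding open_boundary_arc_def 3 marked_image arcs by force
      show ?thesis unfolding t j2
        by (rule normal_vertical) (use t ab in \<open>auto simp: points_eq form_arc(2) forall_3\<close>)
    next
      case 4
      have "y j 1 = c" "F None $ j = c" by (auto intro!: yc Nc simp: 4 arcs)
      then have False using j by (auto simp: vertex_values)
      then show ?thesis ..
    next
      case 5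
      have "y j a = c" "F None $ j = c" by (auto intro!: yc Nc simp: 5 arcs)
      then have j2: "j = 2" using j by (auto simp: vertex_values)
      obtain t where t: "\<zeta> = Some (of_real t)" "t < a"
        using \<zeta> unfolding open_boundary_arc_def 5 marked_image arcs by force
      show ?thesis unfolding t j2
        by (rule normal_vertical) (use t ab in \<open>auto simp: points_eq form_arc(5) forall_3\<close>)
    qed
  qed
qed

lemma CS4_map_eq: "z \<in> upper_half_plane \<Longrightarrow> CS4_map a b \<rho> z = X (Some z)"
  unfolding CS4_map_def X_def
  using \<Phi>_contour_integral[of "CS4_form a b \<rho>"] CS4_form_eq[OF rho] by (simp add: vec_eq_iff)

lemma surface: "\<exists>S. CS4_surface a b \<rho> S"
proof -
  have "CS4_surface a b \<rho> (extension_by (CS_symmetries F p) (F ` compact_half_plane))"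
    unfolding CS4_surface_def
  proof (intro conjI exI)
    show "0 < 1 / L" using L_pos by simp
    show "\<forall>z\<in>upper_half_plane. F (Some z) = (1 / L) *\<^sub>R CS4_map a b \<rho> z + (- (1 / L)) *\<^sub>R X (Some 0)"
      by (simp add: CS4_map_eq F_def)
  qed (use ab rho type_CS in auto)
  then show ?thesis ..
qed

end

section \<open>The limit piece\<close>

text \<open>The equation \<open>closing\<close> is the limit of the second period equation.\<close>

locale costa_piece =
  fixes c :: real
  assumes c: "c > 0" and closing: "c\<^sup>2 * side3 G_lim = sqrt 2 * (LBINT x:{0<..<1}. sc_abs K_lim x)"

sublocale costa_piece \<subseteq> sc_weierstrass G_lim K_lim H_lim c
  by (rule limit_weierstrass[OF c])

context costa_piece
begin

lemma lim_points: "sc_points G_lim = {0, 1}" "sc_points K_lim = {0, 1}" "sc_points H_lim = {0, 1}"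
  by (auto simp: sc_points_def sc_list_defs)

lemma points_eq: "points = {0, 1}" by (auto simp: points_def lim_points)

lemma dom_eq: "dom = closed_half_plane - {0}"
proof -
  have "sc_order G_lim x < -3/4 \<longleftrightarrow> x = 0" "\<not> sc_order K_lim x < -3/4" "sc_order H_lim x < -3/4 \<longleftrightarrow> x = 0" for x
    by (auto simp: sc_order_def sc_list_defs)
  then show ?thesis by (auto simp: dom_def sc_domain_def)
qed

text \<open>The moduli of the three limit forms along the real axis.\<close>

definition g where "g t = c * sc_abs G_lim t"
definition k where "k t = sc_abs K_lim t / c"
definition h where "h t = sc_abs H_lim t"

lemma h_pos: "t \<notin> {0, 1} \<Longrightarrow> h t > 0"
  using sc_abs_pos[of t H_lim] by (simp add: h_def lim_points)

lemma gk_pos: "t \<notin> {0, 1} \<Longrightarrow> g t > 0" "t \<notin> {0, 1} \<Longrightarrow> k t > 0"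
  using sc_abs_pos[of t G_lim] sc_abs_pos[of t K_lim] c by (simp_all add: g_def k_def lim_points)

lemma form_arc:
  "1 < t \<Longrightarrow> form (of_real t) = weierstrass_form (of_real (g t) * e3) (of_real (k t) * e1) (of_real (h t) * \<i>)"
  "0 < t \<Longrightarrow> t < 1 \<Longrightarrow> form (of_real t) = weierstrass_form (of_real (g t)) (of_real (k t)) (of_real (h t))"
  "t < 0 \<Longrightarrow> form (of_real t) = weierstrass_form (of_real (g t) * \<i>) (of_real (k t) * -\<i>) (- of_real (h t))"
proof -
  have f: "form (of_real t) = weierstrass_form (of_real (g t) * (e3 * cis (pi * sc_turn G_lim t)))
     (of_real (k t) * (e1 * cis (pi * sc_turn K_lim t))) (of_real (h t) * (\<i> * cis (pi * sc_turn H_lim t)))"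
    if "t \<notin> {0, 1}" for t
    using form_of_real[of t] that unfolding points_eq g_def k_def h_def by simp
  show "form (of_real t) = weierstrass_form (of_real (g t) * e3) (of_real (k t) * e1) (of_real (h t) * \<i>)" if "1 < t"
  proof -
    have "sc_turn G_lim t = 0" "sc_turn K_lim t = 0" "sc_turn H_lim t = 0"
      using that by (auto simp: sc_turn_def sc_list_defs)
    then show ?thesis using f[of t] that by simp
  qed
  show "form (of_real t) = weierstrass_form (of_real (g t)) (of_real (k t)) (of_real (h t))" if "0 < t" "t < 1"
  proof -
    have t: "sc_turn G_lim t = -3/4" "sc_turn K_lim t = -1/4" "sc_turn H_lim t = -1/2"
      using that by (auto simp: sc_turn_def sc_list_defs)
    have "t \<notin> {0, 1}" using that by auto
    then show ?thesis using f[of t] unfolding t phases by simp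
  qed
  show "form (of_real t) = weierstrass_form (of_real (g t) * \<i>) (of_real (k t) * -\<i>) (- of_real (h t))" if "t < 0"
  proof -
    have t: "sc_turn G_lim t = -9/4" "sc_turn K_lim t = -3/4" "sc_turn H_lim t = -3/2"
      using that by (auto simp: sc_turn_def sc_list_defs)
    have "t \<notin> {0, 1}" using that by auto
    then show ?thesis using f[of t] unfolding t phases by simp
  qed
qed

definition Y :: "complex \<Rightarrow> real^3" where "Y z = 1 *\<^sub>R X (Some z) + - X (Some 1)"

lemma Y_1: "Y 1 = 0" by (simp add: Y_def)

lemma Y_continuous: "continuous_on (closed_half_plane - {0}) Y"
  unfolding Y_def[abs_def] using X_continuous unfolding dom_eq by (intro continuous_intros)

lemma Y_conformal: "conformal_minimal_immersion Y upper_half_plane"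
  unfolding Y_def[abs_def] by (rule scaled_conformal) simp

lemma Y_rep: "weierstrass_rep Y form upper_half_plane"
proof -
  have "(\<lambda>z. \<chi> k. of_real 1 * form z $ k) = form" by (simp add: fun_eq_iff vec_eq_iff)
  then show ?thesis unfolding Y_def[abs_def] using scaled_rep[of 1 "- X (Some 1)"] by metis
qed

lemma Y_derivative: "t \<notin> {0, 1} \<Longrightarrow> DERIV (\<lambda>t. Y (of_real t) $ j) t :> Re (form (of_real t) $ j)"
  unfolding Y_def[abs_def] using X_real_derivative[of t j]
  by (auto intro!: derivative_eq_intros simp: points_eq)

lemma Y_real_continuous: "S \<subseteq> - {0} \<Longrightarrow> continuous_on S (\<lambda>t. Y (complex_of_real t) $ j)"
proof -
  assume S: "S \<subseteq> - {0}"
  have "continuous_on S (\<lambda>t. Y (complex_of_real t))"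
    by (rule continuous_on_compose2[OF Y_continuous]) (use S in \<open>auto simp: closed_half_plane_def intro!: continuous_intros\<close>)
  then show ?thesis by (intro continuous_intros)
qed

text \<open>By the phases of the three forms, the derivative along the arc beyond \<open>1\<close> is a multiple
  of \<open>(1, -1, 0)\<close>, and the derivative along \<open>(0, 1)\<close> has no second component.\<close>

lemma Y_line:
  assumes "1 \<le> t" shows "Y (of_real t) $ 2 = - Y (of_real t) $ 1" "Y (of_real t) $ 3 = 0"
proof -
  have d: "DERIV (\<lambda>t. Y (of_real t) $ 2 + Y (of_real t) $ 1) s :> 0" "DERIV (\<lambda>t. Y (of_real t) $ 3) s :> 0" if "1 < s" for s
  proof -
    have s: "s \<notin> {0, 1}" using that by auto
    have "Re (form (of_real s) $ 2) + Re (form (of_real s) $ 1) = 0" "Re (form (of_real s) $ 3) = 0"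
      unfolding form_arc(1)[OF that] by (simp_all add: field_simps)
    then show "DERIV (\<lambda>t. Y (of_real t) $ 2 + Y (of_real t) $ 1) s :> 0" "DERIV (\<lambda>t. Y (of_real t) $ 3) s :> 0"
      using DERIV_add[OF Y_derivative[OF s, of 2] Y_derivative[OF s, of 1]] Y_derivative[OF s, of 3] by simp_all
  qed
  have "Y (of_real t) $ 2 + Y (of_real t) $ 1 = 0 \<and> Y (of_real t) $ 3 = 0"
  proof (cases "t = 1")
    case False
    then have t: "1 < t" using assms by simp
    have "Y (of_real t) $ 2 + Y (of_real t) $ 1 = Y (of_real 1) $ 2 + Y (of_real 1) $ 1"
      by (rule DERIV_isconst_end[OF t _ d(1)]) (auto intro!: continuous_on_add Y_real_continuous)
    moreover have "Y (of_real t) $ 3 = Y (of_real 1) $ 3"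
      by (rule DERIV_isconst_end[OF t _ d(2)]) (auto intro!: Y_real_continuous)
    ultimately show ?thesis by (simp add: Y_1)
  qed (simp add: Y_1)
  then show "Y (of_real t) $ 2 = - Y (of_real t) $ 1" "Y (of_real t) $ 3 = 0" by auto
qed

lemma Y_plane2:
  assumes "0 < t" "t \<le> 1" shows "Y (of_real t) $ 2 = 0"
proof (cases "t = 1")
  case False
  then have t: "t < 1" using assms by simp
  have d: "DERIV (\<lambda>t. Y (of_real t) $ 2) s :> 0" if "t < s" "s < 1" for s
  proof -
    have s: "0 < s" "s < 1" "s \<notin> {0, 1}" using that assms by auto
    then show ?thesis using Y_derivative[OF s(3), of 2] unfolding form_arc(2)[OF s(1,2)] by simp
  qed
  have "Y (of_real 1) $ 2 = Y (of_real t) $ 2"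
    by (rule DERIV_isconst_end[OF t _ d]) (use assms in \<open>auto intro!: Y_real_continuous\<close>)
  then show ?thesis by (simp add: Y_1)
qed (simp add: Y_1)

text \<open>That the plane of the arc over the negative axis also passes through \<open>Y 1\<close> is the
  period condition of the Costa surface.\<close>

lemma Y_plane1:
  assumes "t < 0" shows "Y (of_real t) $ 1 = 0"
proof -
  let ?P = "\<lambda>z. sc_ext G_lim (Some z)" and ?Q = "\<lambda>z. sc_ext K_lim (Some z)"
  have rK: "sc_regular K_lim (ereal s)" for s by (auto simp: sc_regular_def sc_order_def sc_list_defs)
  have rG: "sc_regular G_lim (ereal s)" if "s \<noteq> 0" for s using that by (auto simp: sc_regular_def sc_order_def sc_list_defs)
  have rI: "sc_regular G_lim \<infinity>" "sc_regular G_lim (-\<infinity>)" by (auto simp: sc_regular_def sc_degree_def sc_list_defs)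
  have bp: "boundary_point (ereal s) = Some (of_real s)" "boundary_point \<infinity> = None" "boundary_point (-\<infinity>) = None" for s
    by (auto simp: boundary_point_def)
  have turn: "sc_turn K_lim (1/2) = -1/4" "sc_turn K_lim (t/2) = -3/4" "sc_turn G_lim 2 = 0" "sc_turn G_lim (t-1) = -9/4"
    using assms by (auto simp: sc_turn_def sc_list_defs)
  have K01: "?Q 1 - ?Q 0 = cis (pi * (-1/4)) * of_real (LBINT x:{0<..<1}. sc_abs K_lim x)"
    using sc_side_at(2)[of "ereal 0" "1/2" "ereal 1" K_lim, OF _ _ rK rK] unfolding turn bp by (simp add: lim_points)
  have Kt0: "?Q 0 - ?Q (of_real t) = cis (pi * (-3/4)) * of_real (LBINT x:{t<..<0}. sc_abs K_lim x)"
    using sc_side_at(2)[of "ereal t" "t/2" "ereal 0" K_lim, OF _ _ rK rK] assms unfolding turn bp by (simp add: lim_points)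
  have G1: "sc_ext G_lim None - ?P 1 = of_real (side3 G_lim)"
    using sc_side_at(2)[of "ereal 1" 2 "\<infinity>" G_lim, OF _ _ rG rI(1)] unfolding turn bp by (simp add: lim_points side3_def)
  have Gt: "?P (of_real t) - sc_ext G_lim None = cis (pi * (-9/4)) * of_real (LBINT x:{..<t}. sc_abs G_lim x)"
    using sc_side_at(2)[of "-\<infinity>" "t-1" "ereal t" G_lim, OF _ _ rI(2) rG] assms unfolding turn bp by (auto simp: lim_points)
  have "Re (e1 * (?Q (of_real t) - ?Q 1)) = - (LBINT x:{0<..<1}. sc_abs K_lim x)"
  proof -
    have "e1 * (?Q (of_real t) - ?Q 1) = - (e1 * (?Q 0 - ?Q (of_real t))) - e1 * (?Q 1 - ?Q 0)"
      by (simp only: right_diff_distrib) simp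
    also have "\<dots> = \<i> * of_real (LBINT x:{t<..<0}. sc_abs K_lim x) - of_real (LBINT x:{0<..<1}. sc_abs K_lim x)"
      unfolding K01 Kt0 mult.assoc[symmetric] phases by simp
    finally show ?thesis by (simp only:) simp
  qed
  moreover have "Re (e3 * (?P (of_real t) - ?P 1)) = - (sqrt 2 / 2) * side3 G_lim"
  proof -
    have "e3 * (?P (of_real t) - ?P 1) = e3 * (?P (of_real t) - sc_ext G_lim None) + e3 * (sc_ext G_lim None - ?P 1)"
      by (simp only: right_diff_distrib) simp
    also have "\<dots> = \<i> * of_real (LBINT x:{..<t}. sc_abs G_lim x) + e3 * of_real (side3 G_lim)"
      unfolding G1 Gt mult.assoc[symmetric] phases by simp
    finally show ?thesis by (simp only:) simp
  qed
  moreover have "Y (of_real t) $ 1 = Re (e1 * (?Q (of_real t) - ?Q 1)) / (2 * c) - c * Re (e3 * (?P (of_real t) - ?P 1)) / 2"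
    using c by (simp add: Y_def X_def \<Phi>_def field_simps)
  ultimately have "Y (of_real t) $ 1 = - (LBINT x:{0<..<1}. sc_abs K_lim x) / (2 * c) - c * (- (sqrt 2 / 2) * side3 G_lim) / 2"
    by simp
  also have "\<dots> = (sqrt 2 * (c\<^sup>2 * side3 G_lim) - 2 * (LBINT x:{0<..<1}. sc_abs K_lim x)) / (4 * c)"
    using c by (simp add: field_simps power2_eq_square)
  also have "\<dots> = 0" unfolding closing by simp
  finally show ?thesis .
qed

section \<open>The symmetries of the limit piece\<close>

text \<open>Up to the factor \<open>c\<close>, the modulus of the Gauss map is a power of this function.\<close>

definition W where "W t = t\<^sup>2 * \<bar>t - 1\<bar>" for t :: real

lemma k_g_quotient:
  assumes "t \<notin> {0, 1}" shows "(k t - g t) / h t = W t powr (1/4) / c - c * W t powr (-1/4)"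
proof -
  have t2: "t\<^sup>2 = \<bar>t\<bar> powr 2" using assms by (simp add: powr_numeral)
  have W: "W t powr e = \<bar>t\<bar> powr (2 * e) * \<bar>t - 1\<bar> powr e" for e
    by (simp only: W_def t2 powr_mult powr_powr)
  have "W t powr (1/4) * sc_abs H_lim t = (\<bar>t\<bar> powr (2 * (1/4)) * \<bar>t\<bar> powr (-1)) * (\<bar>t - 1\<bar> powr (1/4) * \<bar>t - 1\<bar> powr (-1/2))"
    unfolding W by (simp add: H_lim_def sc_abs_def mult_ac)
  also have "\<dots> = \<bar>t\<bar> powr (-1/2) * \<bar>t - 1\<bar> powr (-1/4)" by (simp only: powr_add[symmetric]) simp
  finally have "sc_abs K_lim t = W t powr (1/4) * sc_abs H_lim t" by (simp add: K_lim_def sc_abs_def)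
  moreover have "W t powr (-1/4) * sc_abs H_lim t = (\<bar>t\<bar> powr (2 * (-1/4)) * \<bar>t\<bar> powr (-1)) * (\<bar>t - 1\<bar> powr (-1/4) * \<bar>t - 1\<bar> powr (-1/2))"
    unfolding W by (simp add: H_lim_def sc_abs_def mult_ac)
  then have "W t powr (-1/4) * sc_abs H_lim t = \<bar>t\<bar> powr (-3/2) * \<bar>t - 1\<bar> powr (-3/4)" by (simp only: powr_add[symmetric]) simp
  then have "sc_abs G_lim t = W t powr (-1/4) * sc_abs H_lim t" by (simp add: G_lim_def sc_abs_def)
  ultimately show ?thesis using h_pos[OF assms] unfolding k_def g_def h_def by (simp add: diff_divide_distrib)
qed

text \<open>The extension uses every symmetry that some arc admits, so these have to be determined.
  The modulus of the Gauss map is not constant along any arc, and therefore a curved arc lies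
  in a single plane.\<close>

lemma quotient_strict_mono:
  assumes "s \<notin> {0, 1}" "t \<notin> {0, 1}" "W s < W t" shows "(k s - g s) / h s < (k t - g t) / h t"
proof -
  have W: "W s > 0" using assms by (simp add: W_def)
  have "W s powr (1/4) < W t powr (1/4)" using assms W by (intro powr_less_mono2) auto
  then have "W s powr (1/4) / c < W t powr (1/4) / c" using c by (simp add: divide_strict_right_mono)
  moreover have "W t powr (-1/4) \<le> W s powr (-1/4)" using assms W by (intro powr_mono2') auto
  then have "c * W t powr (-1/4) \<le> c * W s powr (-1/4)" using c by simp
  ultimately show ?thesis unfolding k_g_quotient[OF assms(1)] k_g_quotient[OF assms(2)] by linarith
qed

definition A0 where "A0 = complex_of_real ` {..<0}"
definition A1 where "A1 = complex_of_real ` {0<..<1}"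
definition A2 where "A2 = complex_of_real ` {1<..}"

definition \<sigma>0 :: "real^3 \<Rightarrow> real^3" where "\<sigma>0 x = vector [- x$1, x$2, x$3]"
definition \<sigma>1 :: "real^3 \<Rightarrow> real^3" where "\<sigma>1 x = vector [x$1, - x$2, x$3]"
definition \<sigma>2 :: "real^3 \<Rightarrow> real^3" where "\<sigma>2 x = vector [- x$2, - x$1, - x$3]"

lemma plane_derivative:
  assumes "\<And>t. t \<in> T \<Longrightarrow> (Y (of_real t) - q) \<bullet> n = 0" "open T" "t \<in> T" "t \<notin> {0, 1}"
  shows "(\<Sum>j\<in>UNIV. Re (form (of_real t) $ j) * n $ j) = 0"
proof -
  have "DERIV (\<lambda>t. \<Sum>j\<in>UNIV. (Y (of_real t) $ j - q $ j) * n $ j) t :> (\<Sum>j\<in>UNIV. Re (form (of_real t) $ j) * n $ j)"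
    by (rule derivative_eq_intros Y_derivative assms(4) refl)+ simp
  moreover have "DERIV (\<lambda>t. \<Sum>j\<in>UNIV. (Y (of_real t) $ j - q $ j) * n $ j) t :> 0"
    by (rule has_field_derivative_transform_within_open[of "\<lambda>_. 0" 0 t T]) (use assms in \<open>auto simp: inner_vec_def\<close>)
  ultimately show ?thesis by (rule DERIV_unique)
qed

lemma common_factor_zero: "(x::real) < y \<Longrightarrow> x * m = z \<Longrightarrow> y * m = z \<Longrightarrow> m = 0"
proof -
  assume "x < y" "x * m = z" "y * m = z"
  then have "(y - x) * m = 0" by (simp add: left_diff_distrib)
  then show "m = 0" using \<open>x < y\<close> by simp
qed

text \<open>The derivative along the arc is orthogonal to \<open>n\<close>. This is a linear relation between
  \<open>n $ 2\<close> and \<open>n $ 3\<close> whose coefficient depends on the modulus of the Gauss map; two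
  points of the arc with different moduli give two relations.\<close>

lemma plane_A0:
  assumes "\<And>t. t < 0 \<Longrightarrow> (Y (of_real t) - q) \<bullet> n = 0"
  shows "n $ 2 = 0" "n $ 3 = 0"
proof -
  have e: "(k t - g t) / h t * n $ 2 = 2 * n $ 3" if t: "t < 0" for t
  proof -
    have "(\<Sum>j\<in>UNIV. Re (form (of_real t) $ j) * n $ j) = 0"
      by (rule plane_derivative[of "{..<0}"]) (use assms t in auto)
    then show ?thesis using h_pos[of t] t unfolding form_arc(3)[OF t] by (simp add: sum_3 field_simps)
  qed
  have "(k (-1) - g (-1)) / h (-1) < (k (-2) - g (-2)) / h (-2)" by (rule quotient_strict_mono) (auto simp: W_def)
  then show "n $ 2 = 0" by (rule common_factor_zero[OF _ e e]) auto
  then show "n $ 3 = 0" using e[of "-1"] by simp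
qed

lemma plane_A1:
  assumes "\<And>t. 0 < t \<Longrightarrow> t < 1 \<Longrightarrow> (Y (of_real t) - q) \<bullet> n = 0"
  shows "n $ 1 = 0" "n $ 3 = 0"
proof -
  have e: "(k t - g t) / h t * n $ 1 = - 2 * n $ 3" if t: "0 < t" "t < 1" for t
  proof -
    have "(\<Sum>j\<in>UNIV. Re (form (of_real t) $ j) * n $ j) = 0"
      by (rule plane_derivative[of "{0<..<1}"]) (use assms t in auto)
    then show ?thesis using h_pos[of t] t unfolding form_arc(2)[OF t] by (simp add: sum_3 field_simps)
  qed
  have "(k (1/4) - g (1/4)) / h (1/4) < (k (1/2) - g (1/2)) / h (1/2)"
    by (rule quotient_strict_mono) (auto simp: W_def power2_eq_square)
  then show "n $ 1 = 0" by (rule common_factor_zero[OF _ e e]) auto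
  then show "n $ 3 = 0" using e[of "1/2"] by simp
qed

lemma line_in_planes:
  assumes "S \<subseteq> range (\<lambda>t. q + t *\<^sub>R d)" "n \<bullet> d = 0" "x \<in> S" shows "(x - q) \<bullet> n = 0"
proof -
  obtain t where "x = q + t *\<^sub>R d" using assms by auto
  then show ?thesis using assms(2) by (simp add: inner_commute)
qed

lemma unit_normal_Y:
  assumes "t \<notin> {0, 1}"
  shows "(unit_normal Y \<longlongrightarrow> sgn ((\<chi> k. Re (form (of_real t) $ k)) \<times> (\<chi> k. - Im (form (of_real t) $ k))))
    (at (of_real t) within upper_half_plane)"
  unfolding Y_def[abs_def] using scaled_normal_limit[of t 1 "- X (Some 1)"] assms by (simp add: points_eq)

lemma plane_reflection_axis:
  assumes "n $ j \<noteq> 0" "\<forall>i. i \<noteq> j \<longrightarrow> n $ i = 0" "q $ j = 0"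
  shows "plane_reflection q n x = (\<chi> i. if i = j then - x $ i else x $ i)"
proof -
  have "v \<bullet> n = v $ j * n $ j" for v
    using exhaust_3[of j] assms(2) by (auto simp: inner_vec_def sum_3)
  moreover have "n $ i = 0" if "i \<noteq> j" for i using assms(2) that by blast
  ultimately show ?thesis using assms(1,3) by (simp add: plane_reflection_def vec_eq_iff)
qed

text \<open>All planes that contain the arc are parallel, and so the arc does not lie in a line.\<close>

lemma arc_symmetry_A0: "arc_symmetry Y A0 \<sigma> \<longleftrightarrow> \<sigma> = \<sigma>0"
proof -
  have Y0: "Y (of_real t) $ 1 = 0" if "t < 0" for t using Y_plane1[OF that] .
  have refl: "plane_reflection q n = \<sigma>0" if "n $ 1 \<noteq> 0" "n $ 2 = 0" "n $ 3 = 0" "q $ 1 = 0" for q n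
    using plane_reflection_axis[of n 1 q] that by (auto simp: fun_eq_iff \<sigma>0_def vec_eq_iff forall_3)
  have ex: "arc_symmetry Y A0 \<sigma>0"
    unfolding arc_symmetry_def
  proof (rule disjI2, rule exI[of _ 0], rule exI[of _ "axis 1 1"], intro conjI ballI)
    show "(axis 1 1 :: real^3) \<noteq> 0" by (simp add: axis_eq_0_iff)
    show "Y ` A0 \<subseteq> {x. (x - 0) \<bullet> axis 1 1 = 0}" using Y0 by (auto simp: A0_def inner_axis)
    show "\<sigma>0 = plane_reflection 0 (axis 1 1)" by (rule refl[symmetric]) (auto simp: axis_def)
    fix z assume "z \<in> A0"
    then obtain t where t: "z = of_real t" "t < 0" by (auto simp: A0_def)
    have "t \<notin> {0, 1}" using t by auto
    from unit_normal_Y[OF this] show "\<exists>m. (unit_normal Y \<longlongrightarrow> m) (at z within upper_half_plane) \<and> m \<bullet> axis 1 1 = 0"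
      unfolding t form_arc(3)[OF t(2)]
      by (intro exI conjI, assumption) (simp add: inner_axis sgn_nth_zero cross3_def)
  qed
  have n0: "n $ 2 = 0 \<and> n $ 3 = 0" if "\<And>x. x \<in> Y ` A0 \<Longrightarrow> (x - q) \<bullet> n = 0" for q n
    using plane_A0[of q n] that by (auto simp: A0_def)
  have un: "\<sigma> = \<sigma>0" if "arc_symmetry Y A0 \<sigma>"
  proof -
    from that consider q d where "d \<noteq> 0" "Y ` A0 \<subseteq> range (\<lambda>t. q + t *\<^sub>R d)"
      | q n where "n \<noteq> 0" "Y ` A0 \<subseteq> {x. (x - q) \<bullet> n = 0}" "\<sigma> = plane_reflection q n"
      unfolding arc_symmetry_def by blast
    then show ?thesis
    proof cases
      case (1 q d)
      define n :: "real^3" where "n = (if d $ 2 = 0 \<and> d $ 3 = 0 then vector [0, 1, 0] else vector [0, - d $ 3, d $ 2])"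
      have "n \<bullet> d = 0" by (auto simp: n_def inner_vec_def sum_3)
      then have "n $ 2 = 0 \<and> n $ 3 = 0" using line_in_planes[OF 1(2)] by (intro n0[of q]) blast
      then show ?thesis by (auto simp: n_def split: if_splits)
    next
      case (2 q n)
      have n: "n $ 2 = 0 \<and> n $ 3 = 0" using 2(2) by (intro n0[of q]) blast
      then have n1: "n $ 1 \<noteq> 0" using 2(1) by (auto simp: vec_eq_iff forall_3)
      have "Y (of_real (-1)) \<in> Y ` A0" unfolding A0_def by (intro imageI) simp
      then have "(Y (of_real (-1)) - q) \<bullet> n = 0" using 2(2) by blast
      then have "q $ 1 = 0" using n n1 Y0[of "-1"] by (simp add: inner_vec_def sum_3)
      then show ?thesis using refl n n1 2(3) by simp
    qed
  qed
  show ?thesis using ex un by blast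
qed

lemma arc_symmetry_A1: "arc_symmetry Y A1 \<sigma> \<longleftrightarrow> \<sigma> = \<sigma>1"
proof -
  have Y0: "Y (of_real t) $ 2 = 0" if "0 < t" "t < 1" for t using Y_plane2[of t] that by simp
  have refl: "plane_reflection q n = \<sigma>1" if "n $ 2 \<noteq> 0" "n $ 1 = 0" "n $ 3 = 0" "q $ 2 = 0" for q n
    using plane_reflection_axis[of n 2 q] that by (auto simp: fun_eq_iff \<sigma>1_def vec_eq_iff forall_3)
  have ex: "arc_symmetry Y A1 \<sigma>1"
    unfolding arc_symmetry_def
  proof (rule disjI2, rule exI[of _ 0], rule exI[of _ "axis 2 1"], intro conjI ballI)
    show "(axis 2 1 :: real^3) \<noteq> 0" by (simp add: axis_eq_0_iff)
    show "Y ` A1 \<subseteq> {x. (x - 0) \<bullet> axis 2 1 = 0}" using Y0 by (auto simp: A1_def inner_axis)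
    show "\<sigma>1 = plane_reflection 0 (axis 2 1)" by (rule refl[symmetric]) (auto simp: axis_def)
    fix z assume "z \<in> A1"
    then obtain t where t: "z = of_real t" "0 < t" "t < 1" by (auto simp: A1_def)
    have "t \<notin> {0, 1}" using t by auto
    from unit_normal_Y[OF this] show "\<exists>m. (unit_normal Y \<longlongrightarrow> m) (at z within upper_half_plane) \<and> m \<bullet> axis 2 1 = 0"
      unfolding t form_arc(2)[OF t(2,3)]
      by (intro exI conjI, assumption) (simp add: inner_axis sgn_nth_zero cross3_def)
  qed
  have n0: "n $ 1 = 0 \<and> n $ 3 = 0" if "\<And>x. x \<in> Y ` A1 \<Longrightarrow> (x - q) \<bullet> n = 0" for q n
    using plane_A1[of q n] that by (auto simp: A1_def)
  have un: "\<sigma> = \<sigma>1" if "arc_symmetry Y A1 \<sigma>"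
  proof -
    from that consider q d where "d \<noteq> 0" "Y ` A1 \<subseteq> range (\<lambda>t. q + t *\<^sub>R d)"
      | q n where "n \<noteq> 0" "Y ` A1 \<subseteq> {x. (x - q) \<bullet> n = 0}" "\<sigma> = plane_reflection q n"
      unfolding arc_symmetry_def by blast
    then show ?thesis
    proof cases
      case (1 q d)
      define n :: "real^3" where "n = (if d $ 1 = 0 \<and> d $ 3 = 0 then vector [1, 0, 0] else vector [- d $ 3, 0, d $ 1])"
      have "n \<bullet> d = 0" by (auto simp: n_def inner_vec_def sum_3)
      then have "n $ 1 = 0 \<and> n $ 3 = 0" using line_in_planes[OF 1(2)] by (intro n0[of q]) blast
      then show ?thesis by (auto simp: n_def split: if_splits)
    next
      case (2 q n)
      have n: "n $ 1 = 0 \<and> n $ 3 = 0" using 2(2) by (intro n0[of q]) blast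
      then have n1: "n $ 2 \<noteq> 0" using 2(1) by (auto simp: vec_eq_iff forall_3)
      have "Y (of_real (1/2)) \<in> Y ` A1" unfolding A1_def by (intro imageI) simp
      then have "(Y (of_real (1/2)) - q) \<bullet> n = 0" using 2(2) by blast
      then have "q $ 2 = 0" using n n1 Y0[of "1/2"] by (simp add: inner_vec_def sum_3)
      then show ?thesis using refl n n1 2(3) by simp
    qed
  qed
  show ?thesis using ex un by blast
qed

lemma Y_line_moves: "Y (of_real 3) $ 1 > Y (of_real 2) $ 1"
proof (rule DERIV_pos_imp_increasing_open[of 2 3 "\<lambda>t. Y (of_real t) $ 1"])
  fix t :: real assume t: "2 < t" "t < 3"
  then have "t \<notin> {0, 1}" "1 < t" by auto
  have "Re (form (of_real t) $ 1) = sqrt 2 / 4 * (k t + g t)"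
    unfolding form_arc(1)[OF \<open>1 < t\<close>] by (simp add: field_simps)
  also have "\<dots> > 0" using gk_pos[OF \<open>t \<notin> {0, 1}\<close>] by simp
  finally show "\<exists>D. DERIV (\<lambda>t. Y (of_real t) $ 1) t :> D \<and> D > 0" using Y_derivative[OF \<open>t \<notin> {0, 1}\<close>, of 1] by blast
qed (auto intro!: Y_real_continuous)

text \<open>The arc lies in a line, and hence in many planes; but the normal vector of the surface
  turns along the arc, so it does not stay in the direction of any one of these planes.\<close>

lemma arc_symmetry_A2: "arc_symmetry Y A2 \<sigma> \<longleftrightarrow> \<sigma> = \<sigma>2"
proof -
  define d0 :: "real^3" where "d0 = vector [1, -1, 0]"
  define u where "u t = Y (of_real t) $ 1" for t
  have Yd: "Y (of_real t) = u t *\<^sub>R d0" if "1 < t" for t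
    using Y_line[of t] that by (simp add: vec_eq_iff forall_3 d0_def u_def)
  have turn: "half_turn (\<alpha> *\<^sub>R d0) (\<beta> *\<^sub>R d0) = \<sigma>2" if "\<beta> \<noteq> 0" for \<alpha> \<beta>
  proof
    fix x :: "real^3"
    have dd: "d0 \<bullet> d0 = 2" by (simp add: d0_def inner_vec_def sum_3)
    have "((x - \<alpha> *\<^sub>R d0) \<bullet> (\<beta> *\<^sub>R d0) / ((\<beta> *\<^sub>R d0) \<bullet> (\<beta> *\<^sub>R d0))) * \<beta> = (x \<bullet> d0) / 2 - \<alpha>"
      using that by (simp add: inner_diff_left dd field_simps power2_eq_square)
    then have "\<alpha> *\<^sub>R d0 + ((x - \<alpha> *\<^sub>R d0) \<bullet> (\<beta> *\<^sub>R d0) / ((\<beta> *\<^sub>R d0) \<bullet> (\<beta> *\<^sub>R d0))) *\<^sub>R (\<beta> *\<^sub>R d0) = ((x \<bullet> d0) / 2) *\<^sub>R d0"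
      by (simp add: scaleR_left_diff_distrib)
    then have "half_turn (\<alpha> *\<^sub>R d0) (\<beta> *\<^sub>R d0) x = 2 *\<^sub>R (((x \<bullet> d0) / 2) *\<^sub>R d0) - x" by (simp only: half_turn_def)
    then show "half_turn (\<alpha> *\<^sub>R d0) (\<beta> *\<^sub>R d0) x = \<sigma>2 x"
      by (simp add: \<sigma>2_def vec_eq_iff forall_3 d0_def inner_vec_def sum_3 diff_divide_distrib)
  qed
  have ex: "arc_symmetry Y A2 \<sigma>2"
    unfolding arc_symmetry_def
  proof (rule disjI1, rule exI[of _ "0 *\<^sub>R d0"], rule exI[of _ "1 *\<^sub>R d0"], intro conjI)
    show "1 *\<^sub>R d0 \<noteq> 0" by (simp add: d0_def vec_eq_iff forall_3)
    show "\<sigma>2 = half_turn (0 *\<^sub>R d0) (1 *\<^sub>R d0)" by (rule turn[symmetric]) simp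
    show "Y ` A2 \<subseteq> range (\<lambda>t. 0 *\<^sub>R d0 + t *\<^sub>R 1 *\<^sub>R d0)"
    proof
      fix x assume "x \<in> Y ` A2"
      then obtain t where "1 < t" "x = Y (of_real t)" by (auto simp: A2_def)
      then have "x = 0 *\<^sub>R d0 + u t *\<^sub>R 1 *\<^sub>R d0" using Yd[of t] by simp
      then show "x \<in> range (\<lambda>t. 0 *\<^sub>R d0 + t *\<^sub>R 1 *\<^sub>R d0)" by blast
    qed
  qed
  have un: "\<sigma> = \<sigma>2" if "arc_symmetry Y A2 \<sigma>"
  proof -
    from that consider q d where "d \<noteq> 0" "Y ` A2 \<subseteq> range (\<lambda>t. q + t *\<^sub>R d)" "\<sigma> = half_turn q d"
      | q n where "n \<noteq> 0" "Y ` A2 \<subseteq> {x. (x - q) \<bullet> n = 0}"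
        "\<forall>z\<in>A2. \<exists>m. (unit_normal Y \<longlongrightarrow> m) (at z within upper_half_plane) \<and> m \<bullet> n = 0"
      unfolding arc_symmetry_def by blast
    then show ?thesis
    proof cases
      case (1 q d)
      have "Y (of_real 2) \<in> Y ` A2" "Y (of_real 3) \<in> Y ` A2" unfolding A2_def by (intro imageI; simp)+
      then obtain s2 s3 where s: "Y (of_real 2) = q + s2 *\<^sub>R d" "Y (of_real 3) = q + s3 *\<^sub>R d" using 1(2) by blast
      have u: "q + s2 *\<^sub>R d = u 2 *\<^sub>R d0" "q + s3 *\<^sub>R d = u 3 *\<^sub>R d0"
        unfolding s[symmetric] by (rule Yd; simp)+
      have "(s3 - s2) *\<^sub>R d = (q + s3 *\<^sub>R d) - (q + s2 *\<^sub>R d)" by (simp add: scaleR_left_diff_distrib)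
      also have "\<dots> = (u 3 - u 2) *\<^sub>R d0" unfolding u by (simp add: scaleR_left_diff_distrib)
      finally have "(s3 - s2) *\<^sub>R d = (u 3 - u 2) *\<^sub>R d0" .
      moreover have "u 3 - u 2 \<noteq> 0" using Y_line_moves by (simp add: u_def)
      moreover have "d0 \<noteq> 0" by (simp add: d0_def vec_eq_iff forall_3)
      ultimately have s32: "s3 - s2 \<noteq> 0" by auto
      define \<beta> where "\<beta> = (u 3 - u 2) / (s3 - s2)"
      have "d = (1 / (s3 - s2)) *\<^sub>R ((s3 - s2) *\<^sub>R d)" using s32 by simp
      also have "\<dots> = \<beta> *\<^sub>R d0" unfolding \<open>(s3 - s2) *\<^sub>R d = (u 3 - u 2) *\<^sub>R d0\<close> by (simp add: \<beta>_def)
      finally have d: "d = \<beta> *\<^sub>R d0" .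
      have "q = u 2 *\<^sub>R d0 - s2 *\<^sub>R d" using u(1) by (simp add: algebra_simps)
      then have "q = (u 2 - s2 * \<beta>) *\<^sub>R d0" by (simp add: d scaleR_left_diff_distrib)
      then show ?thesis using turn[of \<beta> "u 2 - s2 * \<beta>"] 1(1,3) d by auto
    next
      case (2 q n)
      have Yn: "(Y (of_real t) - q) \<bullet> n = 0" if "1 < t" for t using 2(2) that by (auto simp: A2_def)
      have "(u 3 - u 2) * (d0 \<bullet> n) = (u 3 *\<^sub>R d0 - q) \<bullet> n - (u 2 *\<^sub>R d0 - q) \<bullet> n"
        by (simp add: inner_diff_left left_diff_distrib)
      also have "\<dots> = 0" using Yn[of 2] Yn[of 3] Yd[of 2] Yd[of 3] by simp
      finally have "d0 \<bullet> n = 0" using Y_line_moves by (simp add: u_def)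
      then have n12: "n $ 1 = n $ 2" by (simp add: d0_def inner_vec_def sum_3)
      have e: "(k t - g t) / h t * (sqrt 2 / 2 * n $ 3) = 2 * n $ 1" if t: "1 < t" for t
      proof -
        have t01: "t \<notin> {0, 1}" using t by auto
        let ?m = "(\<chi> k. Re (form (of_real t) $ k)) \<times> (\<chi> k. - Im (form (of_real t) $ k)) :: real^3"
        obtain m where m: "(unit_normal Y \<longlongrightarrow> m) (at (of_real t) within upper_half_plane)" "m \<bullet> n = 0"
          using 2(3) t by (auto simp: A2_def)
        have "m = sgn ?m"
          by (rule tendsto_unique[OF _ m(1) unit_normal_Y[OF t01]])
             (simp add: at_within_upper_half_plane_nontrivial closed_half_plane_def)
        then have "sgn ?m \<bullet> n = 0" using m(2) by simp
        then have "?m \<bullet> n = 0" by (auto simp: sgn_div_norm)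
        define P where "P = sqrt 2 / 4 * (k t + g t)"
        define M where "M = sqrt 2 / 4 * (k t - g t)"
        have F: "form (of_real t) $ 1 = Complex P M" "form (of_real t) $ 2 = Complex (-P) M" "form (of_real t) $ 3 = Complex 0 (h t)"
          unfolding form_arc(1)[OF t] by (simp_all add: complex_eq_iff P_def M_def field_simps)
        have "P * h t * n $ 1 + P * h t * n $ 1 - 2 * P * M * n $ 3 = 0"
          using \<open>?m \<bullet> n = 0\<close> by (simp add: F cross3_def inner_vec_def sum_3 n12 algebra_simps)
        then have "P * (2 * h t * n $ 1 - 2 * M * n $ 3) = 0" by (simp add: algebra_simps)
        moreover have "P > 0" using gk_pos[OF t01] by (simp add: P_def)
        ultimately have "h t * n $ 1 = M * n $ 3" by simp
        then show ?thesis using h_pos[OF t01] by (simp add: M_def field_simps)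
      qed
      have "(k 2 - g 2) / h 2 < (k 3 - g 3) / h 3" by (rule quotient_strict_mono) (auto simp: W_def)
      then have "sqrt 2 / 2 * n $ 3 = 0" by (rule common_factor_zero[OF _ e e]) auto
      then have "n $ 3 = 0" by simp
      moreover have "n $ 1 = 0" using e[of 2] \<open>n $ 3 = 0\<close> by simp
      ultimately have "n = 0" using n12 by (simp add: vec_eq_iff forall_3)
      then show ?thesis using 2(1) by simp
    qed
  qed
  show ?thesis using ex un by blast
qed

lemma arcs_eq: "boundary_arcs {0, 1} = {A0, A1, A2}"
proof -
  let ?S = "complex_of_real ` (- {0, 1})"
  have S: "?S = A0 \<union> A1 \<union> A2" unfolding A0_def A1_def A2_def image_Un[symmetric] by (rule arg_cong[where f = "image of_real"]) auto
  have con: "connected (complex_of_real ` I)" if "connected I" for I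
    using that by (intro connected_continuous_image continuous_intros)
  have max: "d \<subseteq> complex_of_real ` I"
    if I: "I \<in> {{..<0}, {0<..<1}, {1<..}}" and d: "complex_of_real ` I \<subseteq> d" "d \<subseteq> ?S" "connected d" for I d
  proof
    fix x assume x: "x \<in> d"
    have cR: "connected (Re ` d)" using d(3) by (intro connected_continuous_image continuous_intros)
    have n: "0 \<notin> Re ` d" "1 \<notin> Re ` d" using d(2) by auto
    have "-1 \<in> I \<or> 1/2 \<in> I \<or> 2 \<in> I" using I by auto
    then obtain i where i1: "i \<in> I" by blast
    then have "of_real i \<in> d" using d(1) by blast
    then have "Re (of_real i) \<in> Re ` d" by (rule imageI)
    then have i: "i \<in> I" "i \<in> Re ` d" using i1 by simp_all
    have xd: "Re x \<in> Re ` d" using x by blast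
    have sub: "{min i (Re x)..max i (Re x)} \<subseteq> Re ` d"
      using connected_contains_Icc[OF cR] i xd by (auto simp: min_def max_def)
    have "Re x \<in> I"
    proof (rule ccontr)
      assume "Re x \<notin> I"
      then have "0 \<in> {min i (Re x)..max i (Re x)} \<or> 1 \<in> {min i (Re x)..max i (Re x)}"
        using I i(1) by auto
      then show False using sub n by blast
    qed
    moreover have "x = of_real (Re x)" using x d(2) by (auto simp: complex_eq_iff)
    ultimately show "x \<in> complex_of_real ` I" by blast
  qed
  have comp: "complex_of_real ` I \<in> components ?S" if I: "I \<in> {{..<0}, {0<..<1}, {1<..}}" for I
    unfolding in_components_maximal
  proof (intro conjI allI impI)
    have "-1 \<in> I \<or> 1/2 \<in> I \<or> 2 \<in> I" using I by auto
    then show "complex_of_real ` I \<noteq> {}" by auto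
    show "complex_of_real ` I \<subseteq> ?S" using I by auto
    show "connected (complex_of_real ` I)" using I by (auto intro!: con)
    show "d = complex_of_real ` I" if "d \<noteq> {} \<and> complex_of_real ` I \<subseteq> d \<and> d \<subseteq> ?S \<and> connected d" for d
      using max[OF I] that by blast
  qed
  have A: "A \<in> components ?S" if "A \<in> {A0, A1, A2}" for A
    using that comp by (auto simp: A0_def A1_def A2_def)
  show ?thesis
    unfolding boundary_arcs_def
  proof
    show "components ?S \<subseteq> {A0, A1, A2}"
    proof
      fix C assume C: "C \<in> components ?S"
      then obtain x where "x \<in> C" using in_components_nonempty by blast
      then have "x \<in> A0 \<union> A1 \<union> A2" using in_components_subset[OF C] S by blast
      then obtain B where "B \<in> {A0, A1, A2}" "x \<in> B" by blast
      then show "C \<in> {A0, A1, A2}" using components_nonoverlap[OF C A[of B]] \<open>x \<in> C\<close> by blast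
    qed
    show "{A0, A1, A2} \<subseteq> components ?S" using A by blast
  qed
qed

lemma piece: "minimal_piece Y {0} {0, 1}"
  unfolding minimal_piece_def arcs_eq
  using Y_conformal Y_continuous arc_symmetry_A0 arc_symmetry_A1 arc_symmetry_A2 by auto

lemma symmetries_eq: "{\<sigma>. \<exists>A\<in>boundary_arcs {0, 1}. arc_symmetry Y A \<sigma>} = {\<sigma>0, \<sigma>1, \<sigma>2}"
  unfolding arcs_eq using arc_symmetry_A0 arc_symmetry_A1 arc_symmetry_A2 by auto

end

section \<open>Convergence\<close>

(* From here on the multiplication sign denotes products of sets. *)
unbundle no cross3_syntax

text \<open>The sequence \<open>p\<close> together with its limit is compact, and \<open>f\<close> is uniformly continuous on
  its product with \<open>K\<close>.\<close>

lemma uniform_limit_parameter: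
  fixes f :: "'a::heine_borel \<times> complex \<Rightarrow> complex"
  assumes cont: "continuous_on (T \<times> K) f" and K: "compact K" and p: "\<And>n. p n \<in> T" "l \<in> T" "p \<longlonglongrightarrow> l"
  shows "uniform_limit K (\<lambda>n z. f (p n, z)) (\<lambda>z. f (l, z)) sequentially"
proof (rule uniform_limitI)
  fix e :: real assume e: "e > 0"
  let ?S = "insert l (range p) \<times> K"
  have "compact ?S" using compact_sequence_with_limit[OF p(3)] K by (rule compact_Times)
  moreover have "continuous_on ?S f" by (rule continuous_on_subset[OF cont]) (use p in auto)
  ultimately have "uniformly_continuous_on ?S f" by (intro compact_uniformly_continuous)
  then obtain d where d: "d > 0" "\<And>x y. x \<in> ?S \<Longrightarrow> y \<in> ?S \<Longrightarrow> dist y x < d \<Longrightarrow> dist (f y) (f x) < e"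
    using e unfolding uniformly_continuous_on_def by metis
  have "\<forall>\<^sub>F n in sequentially. dist (p n) l < d" using tendstoD[OF p(3) d(1)] .
  then show "\<forall>\<^sub>F n in sequentially. \<forall>z\<in>K. dist (f (p n, z)) (f (l, z)) < e"
  proof eventually_elim
    case (elim n)
    show ?case
    proof
      fix z assume z: "z \<in> K"
      then have "dist (p n, z) (l, z) < d" using elim by (simp add: dist_prod_def)
      then show "dist (f (p n, z)) (f (l, z)) < e" using z by (intro d(2)) auto
    qed
  qed
qed

text \<open>The forms in terms of the parameters \<open>s = \<rho> \<surd>(-a)\<close>, \<open>\<epsilon> = 1 / (-a)\<close> and \<open>b\<close>, in
  which they are continuous up to the limit \<open>(c, 0, 0)\<close>.\<close>

definition moving_form :: "3 \<Rightarrow> (real \<times> real \<times> real) \<times> complex \<Rightarrow> complex" where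
  "moving_form k = (\<lambda>((s, \<epsilon>, b), z). weierstrass_form
     (of_real s * e3 * ((1 + of_real \<epsilon> * z) powr of_real (1/2) * (z powr of_real (-3/4) * ((z - of_real b) powr of_real (-3/4) * (z - 1) powr of_real (-3/4)))))
     (of_real (1/s) * e1 * ((1 + of_real \<epsilon> * z) powr of_real (-1/2) * (z powr of_real (-1/4) * ((z - of_real b) powr of_real (-1/4) * (z - 1) powr of_real (-1/4)))))
     (\<i> * (z powr of_real (-1/2) * ((z - of_real b) powr of_real (-1/2) * (z - 1) powr of_real (-1/2)))) $ k)"

lemma moving_form_continuous:
  "continuous_on (({0<..} \<times> {0..} \<times> UNIV) \<times> upper_half_plane) (moving_form k)"
proof -
  let ?D = "({0<..} \<times> {0..} \<times> UNIV) \<times> upper_half_plane :: ((real \<times> real \<times> real) \<times> complex) set"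
  have p1: "continuous_on ?D (\<lambda>x. (1 + of_real (fst (snd (fst x))) * snd x) powr of_real e)" for e :: real
  proof (rule continuous_on_powr_closed_half_plane)
    fix x assume x: "x \<in> ?D"
    then have "fst (snd (fst x)) \<ge> 0" "Im (snd x) > 0" by (auto simp: upper_half_plane_def)
    then show "1 + of_real (fst (snd (fst x))) * snd x \<in> closed_half_plane - {0}"
      by (auto simp: closed_half_plane_def complex_eq_iff)
  qed (intro continuous_intros)
  have p2: "continuous_on ?D (\<lambda>x. (snd x) powr of_real e)" "continuous_on ?D (\<lambda>x. (snd x - of_real (snd (snd (fst x)))) powr of_real e)"
    "continuous_on ?D (\<lambda>x. (snd x - 1) powr of_real e)" for e :: real
    by (intro continuous_on_powr_closed_half_plane continuous_intros;
        auto simp: upper_half_plane_def closed_half_plane_def complex_eq_iff)+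
  have s: "continuous_on ?D (\<lambda>x. complex_of_real (1 / fst (fst x)))" by (intro continuous_intros) auto
  have s0: "continuous_on ?D (\<lambda>x. complex_of_real (fst (fst x)))" by (intro continuous_intros)
  have k: "continuous_on ?D (\<lambda>x. moving_form 1 x)" "continuous_on ?D (\<lambda>x. moving_form 2 x)" "continuous_on ?D (\<lambda>x. moving_form 3 x)"
    unfolding moving_form_def case_prod_beta weierstrass_form_components
    by (intro continuous_on_add continuous_on_diff continuous_on_divide continuous_on_mult continuous_on_const p1 p2 s s0; simp)+
  then show ?thesis using exhaust_3[of k] by auto
qed

lemma powr_scale:
  assumes "x > 0" "w \<noteq> 0" shows "(of_real x * w :: complex) powr of_real e = of_real (x powr e) * w powr of_real e"
proof -
  have "of_real x * w \<noteq> 0" "Ln (of_real x * w) = of_real (ln x) + Ln w" using assms by (simp_all add: Ln_times_of_real Ln_of_real)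
  then have "(of_real x * w) powr of_real e = exp (of_real (e * ln x) + of_real e * Ln w)"
    by (simp add: powr_def distrib_left)
  also have "\<dots> = exp (of_real (e * ln x)) * exp (of_real e * Ln w)" by (rule exp_add)
  also have "exp (complex_of_real (e * ln x)) = of_real (x powr e)" using assms(1) by (simp only: exp_of_real) (simp add: powr_def)
  finally show ?thesis using assms(2) by (simp add: powr_def)
qed

lemma moving_form_CS4:
  assumes "a < 0" "\<rho> > 0" "z \<in> upper_half_plane"
  shows "CS4_form a b \<rho> z $ k = moving_form k ((\<rho> * sqrt (- a), 1 / - a, b), z)"
proof -
  interpret sc_weierstrass "G_list a b" "K_list a b" "H_list b" \<rho> by (rule CS4_weierstrass) fact
  have A: "- a > 0" using assms by simp
  have w: "1 + of_real (1 / - a) * z \<noteq> 0" using assms by (auto simp: upper_half_plane_def complex_eq_iff)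
  have eq: "z - of_real a = of_real (- a) * (1 + of_real (1 / - a) * z)" using assms(1) by (simp add: field_simps)
  have p: "(z - of_real a) powr of_real e = of_real ((- a) powr e) * (1 + of_real (1 / - a) * z) powr of_real e" for e
    unfolding eq by (rule powr_scale[OF A w])
  have s: "sqrt (- a) = (- a) powr (1/2)" "1 / (\<rho> * sqrt (- a)) = 1 / \<rho> * (- a) powr (-1/2)"
    using A assms(2) by (simp_all add: powr_half_sqrt powr_minus_divide)
  have G: "sc_form (G_list a b) z = (z - of_real a) powr of_real (1/2) * (z powr of_real (-3/4) * ((z - of_real b) powr of_real (-3/4) * (z - 1) powr of_real (-3/4)))"
    and K: "sc_form (K_list a b) z = (z - of_real a) powr of_real (-1/2) * (z powr of_real (-1/4) * ((z - of_real b) powr of_real (-1/4) * (z - 1) powr of_real (-1/4)))"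
    unfolding G_list_def K_list_def sc_form_def by simp_all
  have 1: "of_real \<rho> * e3 * sc_form (G_list a b) z = of_real (\<rho> * sqrt (- a)) * e3 *
      ((1 + of_real (1 / - a) * z) powr of_real (1/2) * (z powr of_real (-3/4) * ((z - of_real b) powr of_real (-3/4) * (z - 1) powr of_real (-3/4))))"
    unfolding G p s(1) of_real_mult by (simp only: mult_ac)
  have 2: "of_real (1/\<rho>) * e1 * sc_form (K_list a b) z = of_real (1 / (\<rho> * sqrt (- a))) * e1 *
      ((1 + of_real (1 / - a) * z) powr of_real (-1/2) * (z powr of_real (-1/4) * ((z - of_real b) powr of_real (-1/4) * (z - 1) powr of_real (-1/4))))"
    unfolding K p s(2) of_real_mult by (simp only: mult_ac)
  have 3: "sc_form (H_list b) z = z powr of_real (-1/2) * ((z - of_real b) powr of_real (-1/2) * (z - 1) powr of_real (-1/2))"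
    unfolding H_list_def sc_form_def by simp
  show ?thesis
    unfolding CS4_form_eq[OF assms(2,3)] form_def 1 2 3 moving_form_def by simp
qed

context costa_piece
begin

lemma moving_form_limit:
  assumes "z \<in> upper_half_plane" shows "moving_form j ((c, 0, 0), z) = form z $ j"
proof -
  have *: "z powr of_real e * (z powr of_real f * w) = z powr of_real (e + f) * w" for e f w
    by (simp add: powr_add)
  have 1: "sc_form G_lim z = z powr of_real (-3/2) * (z - 1) powr of_real (-3/4)"
    "sc_form K_lim z = z powr of_real (-1/2) * (z - 1) powr of_real (-1/4)"
    "sc_form H_lim z = z powr of_real (-1) * (z - 1) powr of_real (-1/2)"
    unfolding sc_list_defs sc_form_def by simp_all
  show ?thesis unfolding form_def 1 moving_form_def
    by (simp only: prod.case of_real_0 mult_zero_left add_0_right powr_one_eq_one mult_1_left diff_zero *) simp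
qed

lemma CS4_converges:
  assumes deg: "CS4_degeneration a b" and rho: "\<And>n. \<rho> n > 0" "(\<lambda>n. \<rho> n * sqrt (- a n)) \<longlonglongrightarrow> c"
    and K: "compact K" "K \<subseteq> upper_half_plane"
  shows "uniform_limit K (\<lambda>n z. CS4_map (a n) (b n) (\<rho> n) z) (\<lambda>z. X (Some z)) sequentially"
proof (rule uniform_limitI)
  interpret CS4_degeneration a b by (rule deg)
  fix e :: real assume e: "e > 0"
  have i: "\<i> \<in> upper_half_plane" by (simp add: upper_half_plane_def)
  \<comment> \<open>The paths of integration from the base point stay in this compact set.\<close>
  define K' where "K' = convex hull (insert \<i> K)"
  have K': "compact K'" "K' \<subseteq> upper_half_plane"
    unfolding K'_def using K i by (blast intro: compact_convex_hull compact_insert, metis hull_minimal convex_upper_half_plane insert_subset)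
  obtain B where B: "B > 0" "\<And>z. z \<in> K \<Longrightarrow> norm (z - \<i>) \<le> B"
  proof -
    have "bounded ((\<lambda>z. z - \<i>) ` K)" using K by (intro compact_imp_bounded compact_continuous_image continuous_intros)
    then show ?thesis using that by (auto simp: bounded_pos)
  qed
  define p where "p n = (\<rho> n * sqrt (- a n), 1 / - a n, b n)" for n
  have "(\<lambda>n. 1 / - a n) \<longlonglongrightarrow> 0"
    by (rule tendsto_divide_0[OF tendsto_const]) (rule filterlim_at_top_imp_at_infinity[OF neg_a_lim])
  then have pl: "p \<longlonglongrightarrow> (c, 0, 0)" unfolding p_def by (intro tendsto_Pair rho b_lim)
  have pT: "p n \<in> {0<..} \<times> {0..} \<times> UNIV" for n using ab[of n] rho(1)[of n] by (auto simp: p_def divide_nonneg_neg)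
  have ul: "uniform_limit K' (\<lambda>n z. moving_form j (p n, z)) (\<lambda>z. moving_form j ((c, 0, 0), z)) sequentially" for j
    by (rule uniform_limit_parameter[OF continuous_on_subset[OF moving_form_continuous] K'(1) pT _ pl])
       (use K' c in auto)
  define d where "d = e / (4 * B)"
  have d: "d > 0" using e B by (simp add: d_def)
  have "\<forall>\<^sub>F n in sequentially. \<forall>j. \<forall>z\<in>K'. dist (moving_form j (p n, z)) (moving_form j ((c, 0, 0), z)) < d"
    unfolding forall_3 by (intro eventually_conj uniform_limitD[OF ul d])
  then show "\<forall>\<^sub>F n in sequentially. \<forall>z\<in>K. dist (CS4_map (a n) (b n) (\<rho> n) z) (X (Some z)) < e"
  proof eventually_elim
    case (elim n)
    show ?case
    proof
      fix z assume z: "z \<in> K"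
      then have zH: "z \<in> upper_half_plane" using K by auto
      have seg: "closed_segment \<i> z \<subseteq> K'"
        unfolding K'_def by (intro closed_segment_subset convex_convex_hull) (use z in \<open>auto intro: hull_inc\<close>)
      have comp: "\<bar>CS4_map (a n) (b n) (\<rho> n) z $ j - X (Some z) $ j\<bar> \<le> d * B" for j
      proof -
        let ?f = "\<lambda>z. CS4_form (a n) (b n) (\<rho> n) z $ j" and ?g = "\<lambda>z. form z $ j"
        have ci: "?g contour_integrable_on linepath \<i> z"
          by (intro contour_integrable_continuous_linepath
              continuous_on_subset[OF holomorphic_on_imp_continuous_on[OF form_holomorphic]] order_trans[OF seg K'(2)])
        have hf: "(\<lambda>z. ?f z) holomorphic_on upper_half_plane"
          by (rule holomorphic_transform[OF sc_weierstrass.form_holomorphic[OF CS4_weierstrass[OF rho(1)], where k = j]])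
             (simp add: CS4_form_eq[OF rho(1)])
        have cf: "?f contour_integrable_on linepath \<i> z"
          by (intro contour_integrable_continuous_linepath
              continuous_on_subset[OF holomorphic_on_imp_continuous_on[OF hf]] order_trans[OF seg K'(2)])
        have "norm (contour_integral (linepath \<i> z) (\<lambda>z. ?f z - ?g z)) \<le> d * norm (z - \<i>)"
        proof (rule contour_integral_bound_linepath)
          show "(\<lambda>z. ?f z - ?g z) contour_integrable_on linepath \<i> z" by (rule contour_integrable_diff[OF cf ci])
          fix x assume "x \<in> closed_segment \<i> z"
          then have x: "x \<in> K'" "x \<in> upper_half_plane" using seg K' by auto
          have "norm (moving_form j (p n, x) - moving_form j ((c, 0, 0), x)) < d"
            using elim x by (auto simp: dist_norm)
          then show "norm (?f x - ?g x) \<le> d"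
            unfolding moving_form_CS4[OF ab(1) rho(1) x(2)] moving_form_limit[OF x(2)] p_def by simp
        qed (use d in simp)
        also have "\<dots> \<le> d * B" using d B(2)[OF z] by simp
        finally have "norm (contour_integral (linepath \<i> z) ?f - contour_integral (linepath \<i> z) ?g) \<le> d * B"
          by (simp add: contour_integral_diff[OF cf ci])
        moreover have "contour_integral (linepath \<i> z) ?g = \<Phi> (Some z) $ j"
          by (rule \<Phi>_contour_integral[OF _ zH]) simp
        ultimately have "norm (contour_integral (linepath \<i> z) ?f - \<Phi> (Some z) $ j) \<le> d * B" by simp
        then have "\<bar>Re (contour_integral (linepath \<i> z) ?f - \<Phi> (Some z) $ j)\<bar> \<le> d * B"
          by (rule order_trans[OF abs_Re_le_cmod])
        then show ?thesis by (simp add: CS4_map_def X_def)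
      qed
      have "dist (CS4_map (a n) (b n) (\<rho> n) z) (X (Some z)) \<le> (\<Sum>j\<in>UNIV. \<bar>(CS4_map (a n) (b n) (\<rho> n) z - X (Some z)) $ j\<bar>)"
        unfolding dist_norm by (rule norm_le_l1_cart)
      also have "\<dots> \<le> (\<Sum>j\<in>(UNIV :: 3 set). d * B)" using comp by (intro sum_mono) simp
      also have "\<dots> = 3 / 4 * e" using B by (simp add: d_def)
      also have "\<dots> < e" using e by simp
      finally show "dist (CS4_map (a n) (b n) (\<rho> n) z) (X (Some z)) < e" .
    qed
  qed
qed

end

section \<open>Gluing the limit piece to a surface\<close>

text \<open>The half turn about the vertical axis, and the product of a quarter turn about it with
  the reflection at the horizontal plane; the second one generates a cyclic group of order
  four that contains the first.\<close>

definition vertical_turn :: "real^3 \<Rightarrow> real^3" where "vertical_turn x = vector [- x$1, - x$2, x$3]"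
definition rotary :: "real^3 \<Rightarrow> real^3" where "rotary x = vector [- x$2, x$1, - x$3]"

lemma vertical_turn_nth [simp]: "vertical_turn x $ 1 = - x $ 1" "vertical_turn x $ 2 = - x $ 2" "vertical_turn x $ 3 = x $ 3"
  and rotary_nth [simp]: "rotary x $ 1 = - x $ 2" "rotary x $ 2 = x $ 1" "rotary x $ 3 = - x $ 3"
  by (simp_all add: vertical_turn_def rotary_def)

lemma bounded_linear_vertical_turn: "bounded_linear vertical_turn"
  and bounded_linear_rotary: "bounded_linear rotary"
  unfolding linear_conv_bounded_linear[symmetric]
  by (rule linearI; simp add: vec_eq_iff forall_3)+

context costa_piece
begin

lemma \<sigma>_nth [simp]: "\<sigma>0 x $ 1 = - x $ 1" "\<sigma>0 x $ 2 = x $ 2" "\<sigma>0 x $ 3 = x $ 3"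
  "\<sigma>1 x $ 1 = x $ 1" "\<sigma>1 x $ 2 = - x $ 2" "\<sigma>1 x $ 3 = x $ 3"
  "\<sigma>2 x $ 1 = - x $ 2" "\<sigma>2 x $ 2 = - x $ 1" "\<sigma>2 x $ 3 = - x $ 3"
  by (simp_all add: \<sigma>0_def \<sigma>1_def \<sigma>2_def)

lemma bounded_linear_\<sigma>1: "bounded_linear \<sigma>1"
  unfolding linear_conv_bounded_linear[symmetric] by (rule linearI; simp add: vec_eq_iff forall_3)

text \<open>The map is first defined over a quarter of the \<open>u\<close>-plane, where \<open>1 - u\<^sup>2\<close> runs through
  the closed half plane, and then extended by the symmetries \<open>(u, w) \<mapsto> (cnj u, cnj w)\<close>
  and \<open>(u, w) \<mapsto> (- u, - \<i> w)\<close>. Over the quarter plane one of the two values of \<open>w\<close> has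
  an argument between \<open>- pi / 4\<close> and \<open>pi / 2\<close>, so it is singled out by
  \<open>2 Re w + Im w \<ge> 0\<close>; the other one is related to it by \<open>(u, w) \<mapsto> (u, - w)\<close>. The
  factor \<open>1/2\<close> compensates the derivative of \<open>u\<^sup>2\<close>.\<close>

definition wedge_map :: "complex \<times> complex \<Rightarrow> real^3" where
  "wedge_map = (\<lambda>(u, w). if - (2 * Re w + Im w) \<le> 0 then (1/2) *\<^sub>R Y (1 - u\<^sup>2)
     else vertical_turn ((1/2) *\<^sub>R Y (1 - u\<^sup>2)))"

definition half_map :: "complex \<times> complex \<Rightarrow> real^3" where
  "half_map = (\<lambda>(u, w). if Im u \<le> 0 then wedge_map (u, w) else \<sigma>1 (wedge_map (cnj u, cnj w)))"

definition costa_map :: "complex \<times> complex \<Rightarrow> real^3" where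
  "costa_map = (\<lambda>(u, w). if - Re u \<le> 0 then half_map (u, w) else rotary (half_map (- u, - (\<i> * w))))"

definition wedge where "wedge = {(u, w) \<in> costa_curve. 0 \<le> Re u \<and> Im u \<le> 0}"
definition half where "half = {(u, w) \<in> costa_curve. 0 \<le> Re u}"

lemma curve_iff: "(u, w) \<in> costa_curve \<longleftrightarrow> w\<^sup>2 = u * (1 - u\<^sup>2) \<and> u \<noteq> 1 \<and> u \<noteq> -1"
  by (auto simp: costa_curve_def)

lemma curve_cnj: "(u, w) \<in> costa_curve \<Longrightarrow> (cnj u, cnj w) \<in> costa_curve"
proof -
  assume "(u, w) \<in> costa_curve"
  then have w: "w\<^sup>2 = u * (1 - u\<^sup>2)" "u \<noteq> 1" "u \<noteq> -1" by (auto simp: curve_iff)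
  have "(cnj w)\<^sup>2 = cnj u * (1 - (cnj u)\<^sup>2)" using arg_cong[OF w(1), of cnj] by simp
  then show ?thesis using w(2,3) by (auto simp: curve_iff complex_eq_iff)
qed

lemma curve_rotate:
  assumes "(u, w) \<in> costa_curve" "j\<^sup>2 = -1" shows "(- u, j * w) \<in> costa_curve"
proof -
  have w: "w\<^sup>2 = u * (1 - u\<^sup>2)" "u \<noteq> 1" "u \<noteq> -1" using assms(1) by (auto simp: curve_iff)
  have "(j * w)\<^sup>2 = - u * (1 - (- u)\<^sup>2)" unfolding power_mult_distrib assms(2) w(1) by simp
  then show ?thesis using w(2,3) by (auto simp: curve_iff equation_minus_iff)
qed

lemma curve_minus: "(u, w) \<in> costa_curve \<Longrightarrow> (u, - w) \<in> costa_curve"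
  by (auto simp: curve_iff)

lemma curve_nonzero: "(u, w) \<in> costa_curve \<Longrightarrow> 1 - u\<^sup>2 \<noteq> 0"
  by (auto simp: curve_iff power2_eq_1_iff)

lemma wedge_half_plane:
  assumes "(u, w) \<in> wedge" shows "1 - u\<^sup>2 \<in> closed_half_plane - {0}"
proof -
  have "Im (1 - u\<^sup>2) = - 2 * (Re u * Im u)" by (simp add: power2_eq_square)
  moreover have "Re u * Im u \<le> 0" using assms by (auto simp: wedge_def mult_nonneg_nonpos)
  ultimately have "Im (1 - u\<^sup>2) \<ge> 0" by linarith
  then show ?thesis using assms curve_nonzero[of u w] by (auto simp: wedge_def closed_half_plane_def simp del: minus_complex.simps Im_power2)
qed

lemma square_real: "w\<^sup>2 = of_real m \<Longrightarrow> m \<ge> 0 \<Longrightarrow> cnj w = w"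
  and square_negative: "w\<^sup>2 = of_real m \<Longrightarrow> m \<le> 0 \<Longrightarrow> cnj w = - w"
proof -
  have *: "Re w * Im w = 0 \<and> (Re w)\<^sup>2 - (Im w)\<^sup>2 = m" if "w\<^sup>2 = of_real m"
    using that by (auto simp: complex_eq_iff power2_eq_square)
  show "cnj w = w" if "w\<^sup>2 = of_real m" "m \<ge> 0"
  proof -
    have "Im w = 0"
    proof (rule ccontr)
      assume "Im w \<noteq> 0"
      then have "(Im w)\<^sup>2 > 0" "(Re w)\<^sup>2 = 0" using *[OF that(1)] by auto
      then show False using *[OF that(1)] that(2) by linarith
    qed
    then show ?thesis by (simp add: complex_eq_iff)
  qed
  show "cnj w = - w" if "w\<^sup>2 = of_real m" "m \<le> 0"
  proof -
    have "Re w = 0"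
    proof (rule ccontr)
      assume "Re w \<noteq> 0"
      then have "(Re w)\<^sup>2 > 0" "(Im w)\<^sup>2 = 0" using *[OF that(1)] by auto
      then show False using *[OF that(1)] that(2) by linarith
    qed
    then show ?thesis by (simp add: complex_eq_iff)
  qed
qed

lemma square_imaginary: "w\<^sup>2 = \<i> * of_real m \<Longrightarrow> m > 0 \<Longrightarrow> \<i> * cnj w = w"
proof -
  assume w: "w\<^sup>2 = \<i> * of_real m" and m: "m > 0"
  have e: "(Re w - Im w) * (Re w + Im w) = 0" "2 * Re w * Im w = m"
    using w by (auto simp: complex_eq_iff power2_eq_square algebra_simps)
  have "Re w + Im w \<noteq> 0"
  proof
    assume "Re w + Im w = 0"
    then have "Re w = - Im w" by simp
    then have "2 * Re w * Im w = - 2 * (Im w)\<^sup>2" by (simp add: power2_eq_square)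
    then show False using e(2) m by (smt (verit) zero_le_power2)
  qed
  then show ?thesis using e(1) by (simp add: complex_eq_iff)
qed

text \<open>The two sheets over the quarter plane meet only in the branch point, which goes to the
  common point \<open>Y 1 = 0\<close> of all symmetries.\<close>

lemma wedge_sign_zero:
  assumes "(u, w) \<in> wedge" "2 * Re w + Im w = 0" shows "u = 0 \<and> w = 0"
proof -
  define x y t where "x = Re u" and "y = - Im u" and "t = Re w"
  have xy: "x \<ge> 0" "y \<ge> 0" using assms(1) by (auto simp: wedge_def x_def y_def)
  have u: "u = Complex x (- y)" and w: "w = Complex t (- 2 * t)"
    using assms(2) by (simp_all add: complex_eq_iff x_def y_def t_def)
  have "w\<^sup>2 = u * (1 - u\<^sup>2)" using assms(1) by (auto simp: wedge_def curve_iff)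
  then have e: "- 3 * t\<^sup>2 = x * (1 - x\<^sup>2 + 3 * y\<^sup>2)" "- 4 * t\<^sup>2 = y * (3 * x\<^sup>2 - 1 - y\<^sup>2)"
    unfolding u w by (simp_all add: complex_eq_iff power2_eq_square algebra_simps)
  have t: "t = 0"
  proof (rule ccontr)
    assume "t \<noteq> 0"
    then have t2: "t\<^sup>2 > 0" by simp
    have "x * (1 - x\<^sup>2 + 3 * y\<^sup>2) < 0" "y * (3 * x\<^sup>2 - 1 - y\<^sup>2) < 0" using e t2 by linarith+
    then have "1 - x\<^sup>2 + 3 * y\<^sup>2 < 0" "3 * x\<^sup>2 - 1 - y\<^sup>2 < 0" using xy by (simp_all add: mult_less_0_iff not_less)
    then show False using zero_le_power2[of x] zero_le_power2[of y] by linarith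
  qed
  then have "w = 0" by (simp add: w complex_eq_iff)
  moreover have "u = 0"
    using assms(1) \<open>w = 0\<close> curve_nonzero[of u w] by (auto simp: wedge_def curve_iff)
  ultimately show ?thesis by simp
qed

lemma wedge_map_minus:
  assumes "(u, w) \<in> wedge" shows "wedge_map (u, - w) = vertical_turn (wedge_map (u, w))"
proof (cases "2 * Re w + Im w = 0")
  case True
  then have "u = 0" "w = 0" using wedge_sign_zero[OF assms] by auto
  then show ?thesis by (simp add: wedge_map_def Y_1 vertical_turn_def vec_eq_iff forall_3)
next
  case False
  then show ?thesis by (auto simp: wedge_map_def vec_eq_iff forall_3)
qed

lemma wedge_map_continuous: "continuous_on wedge wedge_map"
proof -
  have Yc: "continuous_on S (\<lambda>p. (1/2) *\<^sub>R Y (1 - (fst p)\<^sup>2))" if "S \<subseteq> wedge" for S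
  proof (intro continuous_intros continuous_on_compose2[OF Y_continuous])
    show "(\<lambda>p. 1 - (fst p)\<^sup>2) ` S \<subseteq> closed_half_plane - {0}" using wedge_half_plane that by fastforce
  qed
  have "continuous_on wedge (\<lambda>p. if - (2 * Re (snd p) + Im (snd p)) \<le> 0 then (1/2) *\<^sub>R Y (1 - (fst p)\<^sup>2)
     else vertical_turn ((1/2) *\<^sub>R Y (1 - (fst p)\<^sup>2)))"
  proof (rule continuous_on_cases_le)
    show "continuous_on {t \<in> wedge. 0 \<le> - (2 * Re (snd t) + Im (snd t))} (\<lambda>p. vertical_turn ((1/2) *\<^sub>R Y (1 - (fst p)\<^sup>2)))"
      by (rule bounded_linear.continuous_on[OF bounded_linear_vertical_turn Yc]) auto
    fix t assume "t \<in> wedge" "- (2 * Re (snd t) + Im (snd t)) = 0"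
    then have "fst t = 0" using wedge_sign_zero[of "fst t" "snd t"] by simp
    then show "(1/2) *\<^sub>R Y (1 - (fst t)\<^sup>2) = vertical_turn ((1/2) *\<^sub>R Y (1 - (fst t)\<^sup>2))"
      by (simp add: Y_1 vec_eq_iff forall_3)
  qed (intro continuous_intros Yc; auto)+
  then show ?thesis by (simp add: wedge_map_def case_prod_unfold)
qed

text \<open>For \<open>0 \<le> u < 1\<close> the value \<open>w\<close> is real and the arc over \<open>(0, 1)\<close> lies in the plane
  of \<open>\<sigma>1\<close>. For \<open>u > 1\<close> it is imaginary, conjugation interchanges the sheets, and the arc
  over the negative axis lies in the plane of \<open>\<sigma>0\<close>, which is the composition of \<open>\<sigma>1\<close> with the
  half turn.\<close>

lemma half_map_seam:
  assumes "(u, w) \<in> half" "Im u = 0" shows "\<sigma>1 (wedge_map (cnj u, cnj w)) = wedge_map (u, w)"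
proof -
  define x where "x = Re u"
  have u: "u = of_real x" using assms(2) by (simp add: complex_eq_iff x_def)
  have x: "x \<ge> 0" "x \<noteq> 1" and w: "w\<^sup>2 = of_real (x * (1 - x\<^sup>2))"
    using assms(1) unfolding u by (auto simp: half_def curve_iff)
  have wd: "(u, w) \<in> wedge" using assms by (auto simp: half_def wedge_def)
  have z: "1 - u\<^sup>2 = of_real (1 - x\<^sup>2)" by (simp add: u)
  show ?thesis
  proof (cases "x < 1")
    case True
    then have "0 < 1 - x\<^sup>2" "1 - x\<^sup>2 \<le> 1" using x by (simp_all add: power_less_one_iff)
    then have "Y (1 - u\<^sup>2) $ 2 = 0" "cnj w = w" unfolding z using x by (intro Y_plane2 square_real[OF w]; simp)+
    then show ?thesis by (auto simp: u wedge_map_def vec_eq_iff forall_3)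
  next
    case False
    then have "1 - x\<^sup>2 < 0" using x by (simp add: one_less_power)
    then have "Y (1 - u\<^sup>2) $ 1 = 0" "cnj w = - w"
      unfolding z using x by (intro Y_plane1 square_negative[OF w]; simp add: mult_nonneg_nonpos)+
    moreover have "cnj u = u" by (simp add: u)
    ultimately show ?thesis using wedge_map_minus[OF wd] by (auto simp: wedge_map_def vec_eq_iff forall_3)
  qed
qed

lemma half_map_continuous: "continuous_on half half_map"
proof -
  have "continuous_on half (\<lambda>p. if Im (fst p) \<le> 0 then wedge_map p else \<sigma>1 (wedge_map (cnj (fst p), cnj (snd p))))"
  proof (rule continuous_on_cases_le)
    show "continuous_on {t \<in> half. Im (fst t) \<le> 0} wedge_map"
      by (rule continuous_on_subset[OF wedge_map_continuous]) (auto simp: half_def wedge_def)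
    show "continuous_on {t \<in> half. 0 \<le> Im (fst t)} (\<lambda>p. \<sigma>1 (wedge_map (cnj (fst p), cnj (snd p))))"
      by (rule bounded_linear.continuous_on[OF bounded_linear_\<sigma>1], rule continuous_on_compose2[OF wedge_map_continuous])
         (auto simp: half_def wedge_def curve_cnj intro!: continuous_intros)
    show "wedge_map t = \<sigma>1 (wedge_map (cnj (fst t), cnj (snd t)))" if "t \<in> half" "Im (fst t) = 0" for t
      using half_map_seam[of "fst t" "snd t"] that by simp
  qed (intro continuous_intros)
  then show ?thesis by (simp only: half_map_def case_prod_unfold prod.collapse)
qed

lemma half_map_minus:
  assumes "(u, w) \<in> half" shows "half_map (u, - w) = vertical_turn (half_map (u, w))"
proof (cases "Im u \<le> 0")
  case True
  then show ?thesis using wedge_map_minus[of u w] assms by (auto simp: half_map_def half_def wedge_def)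
next
  case False
  then have "(cnj u, cnj w) \<in> wedge" using assms by (auto simp: half_def wedge_def curve_cnj)
  then show ?thesis using wedge_map_minus[of "cnj u" "cnj w"] False by (auto simp: half_map_def vec_eq_iff forall_3)
qed

lemma half_map_cnj:
  assumes "(u, w) \<in> half" shows "half_map (cnj u, cnj w) = \<sigma>1 (half_map (u, w))"
proof -
  consider "Im u < 0" | "Im u > 0" | "Im u = 0" by linarith
  then show ?thesis
    by cases (use half_map_seam[OF assms] in \<open>auto simp: half_map_def vec_eq_iff forall_3\<close>)
qed

text \<open>On the imaginary \<open>u\<close>-axis \<open>1 - u\<^sup>2 \<ge> 1\<close>, so the values lie in the line that contains
  the arc beyond \<open>1\<close>.\<close>

lemma costa_map_seam:
  assumes "(u, w) \<in> costa_curve" "Re u = 0"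
  shows "rotary (half_map (- u, - (\<i> * w))) = half_map (u, w)"
proof -
  define v where "v = Im u"
  have u: "u = \<i> * of_real v" using assms(2) by (simp add: complex_eq_iff v_def)
  have z: "1 - u\<^sup>2 = of_real (1 + v\<^sup>2)" by (simp add: u power_mult_distrib)
  have w: "w\<^sup>2 = \<i> * of_real (v * (1 + v\<^sup>2))" using assms(1) by (simp add: curve_iff z) (simp add: u)
  have Yl: "Y (1 - u\<^sup>2) $ 2 = - Y (1 - u\<^sup>2) $ 1" "Y (1 - u\<^sup>2) $ 3 = 0" unfolding z by (intro Y_line; simp)+
  consider "v = 0" | "v < 0" | "v > 0" by linarith
  then show ?thesis
  proof cases
    case 1
    then have "u = 0" "w = 0" using w by (simp_all add: u)
    then show ?thesis by (simp add: half_map_def wedge_map_def Y_1 vec_eq_iff forall_3)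
  next
    case 2
    then have wd: "(u, w) \<in> wedge" using assms by (auto simp: wedge_def v_def)
    have "(- cnj w)\<^sup>2 = cnj (w\<^sup>2)" by simp
    also have "\<dots> = \<i> * of_real (- (v * (1 + v\<^sup>2)))" unfolding w by simp
    finally have "\<i> * cnj (- cnj w) = - cnj w"
      by (rule square_imaginary) (use 2 in \<open>simp add: mult_neg_pos add_pos_nonneg\<close>)
    then have "\<i> * w = cnj w" by simp
    then have j: "cnj (- (\<i> * w)) = - w" by simp
    have "half_map (- u, - (\<i> * w)) = \<sigma>1 (wedge_map (cnj (- u), cnj (- (\<i> * w))))"
      using 2 by (simp add: half_map_def v_def)
    also have "\<dots> = \<sigma>1 (vertical_turn (wedge_map (u, w)))"
      unfolding j using wedge_map_minus[OF wd] by (simp add: u)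
    finally show ?thesis using 2 Yl by (auto simp: half_map_def v_def wedge_map_def vec_eq_iff forall_3)
  next
    case 3
    have "\<i> * cnj w = w" by (rule square_imaginary[OF w]) (use 3 in \<open>simp add: add_pos_nonneg\<close>)
    then have "cnj w = - \<i> * w" by (metis complex_i_mult_minus mult_minus_left minus_minus)
    then have e: "(cnj u, cnj w) = (- u, - (\<i> * w))" by (simp add: u)
    have "half_map (u, w) = \<sigma>1 (wedge_map (- u, - (\<i> * w)))" "half_map (- u, - (\<i> * w)) = wedge_map (- u, - (\<i> * w))"
      unfolding e[symmetric] using 3 by (simp_all add: half_map_def v_def)
    moreover have "wedge_map (- u, - (\<i> * w)) $ 2 = - wedge_map (- u, - (\<i> * w)) $ 1" "wedge_map (- u, - (\<i> * w)) $ 3 = 0"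
      using Yl by (simp_all add: wedge_map_def)
    ultimately show ?thesis by (simp add: vec_eq_iff forall_3)
  qed
qed

lemma costa_map_continuous: "continuous_on costa_curve costa_map"
proof -
  have "continuous_on costa_curve (\<lambda>p. if - Re (fst p) \<le> 0 then half_map p else rotary (half_map (- fst p, - (\<i> * snd p))))"
  proof (rule continuous_on_cases_le)
    show "continuous_on {t \<in> costa_curve. - Re (fst t) \<le> 0} half_map"
      by (rule continuous_on_subset[OF half_map_continuous]) (auto simp: half_def)
    show "continuous_on {t \<in> costa_curve. 0 \<le> - Re (fst t)} (\<lambda>p. rotary (half_map (- fst p, - (\<i> * snd p))))"
      by (rule bounded_linear.continuous_on[OF bounded_linear_rotary], rule continuous_on_compose2[OF half_map_continuous])
         (auto simp: half_def curve_rotate[of _ _ "-\<i>", simplified] intro!: continuous_intros)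
    show "half_map t = rotary (half_map (- fst t, - (\<i> * snd t)))" if "t \<in> costa_curve" "- Re (fst t) = 0" for t
      using costa_map_seam[of "fst t" "snd t"] that by simp
  qed (intro continuous_intros)
  then show ?thesis by (simp only: costa_map_def case_prod_unfold prod.collapse)
qed

lemma costa_map_minus:
  assumes "(u, w) \<in> costa_curve" shows "costa_map (u, - w) = vertical_turn (costa_map (u, w))"
proof (cases "0 \<le> Re u")
  case True
  then show ?thesis using half_map_minus[of u w] assms by (auto simp: costa_map_def half_def)
next
  case False
  then have "(- u, - (\<i> * w)) \<in> half" using assms curve_rotate[OF assms, of "-\<i>"] by (auto simp: half_def)
  then show ?thesis using half_map_minus[of "-u" "- (\<i> * w)"] False by (simp add: costa_map_def vec_eq_iff forall_3)
qed

lemma costa_map_cnj: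
  assumes "(u, w) \<in> costa_curve" shows "costa_map (cnj u, cnj w) = \<sigma>1 (costa_map (u, w))"
proof (cases "0 \<le> Re u")
  case True
  then show ?thesis using half_map_cnj[of u w] assms by (auto simp: costa_map_def half_def)
next
  case False
  then have *: "(- u, - (\<i> * w)) \<in> half" using assms curve_rotate[OF assms, of "-\<i>"] by (auto simp: half_def)
  have **: "(cnj (- u), cnj (- (\<i> * w))) \<in> half"
    using * curve_cnj[of "-u" "- (\<i> * w)"] by (auto simp: half_def)
  have e: "(- cnj u, - (\<i> * cnj w)) = (cnj (- u), - cnj (- (\<i> * w)))" by simp
  have "half_map (- cnj u, - (\<i> * cnj w)) = vertical_turn (\<sigma>1 (half_map (- u, - (\<i> * w))))"
    unfolding e half_map_minus[OF **] half_map_cnj[OF *] ..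
  then show ?thesis using False by (simp add: costa_map_def vec_eq_iff forall_3)
qed

lemma costa_map_rotate:
  assumes "(u, w) \<in> costa_curve" shows "costa_map (- u, \<i> * w) = rotary (costa_map (u, w))"
proof (cases "Re u > 0")
  case True
  then show ?thesis by (simp add: costa_map_def)
next
  case False
  then have "(- u, - (\<i> * w)) \<in> half" using assms curve_rotate[OF assms, of "-\<i>"] by (auto simp: half_def)
  then have "half_map (- u, \<i> * w) = vertical_turn (half_map (- u, - (\<i> * w)))"
    using half_map_minus[of "-u" "- (\<i> * w)"] by simp
  then have "half_map (- u, \<i> * w) = rotary (rotary (half_map (- u, - (\<i> * w))))" by (simp add: vec_eq_iff forall_3)
  moreover have "costa_map (u, w) = rotary (half_map (- u, - (\<i> * w)))"
    using False costa_map_seam[OF assms] by (cases "Re u = 0") (auto simp: costa_map_def)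
  ultimately show ?thesis using False by (simp add: costa_map_def)
qed

end

section \<open>The Weierstrass data of the glued surface\<close>

text \<open>A segment that starts off the line meets it at most once, so \<open>f\<close> is constant along the
  segment.\<close>

lemma constant_off_line:
  fixes f :: "complex \<Rightarrow> real" and L :: "complex \<Rightarrow> real"
  assumes B: "convex B" "continuous_on B f" and L: "linear L"
    and zero: "\<And>v. v \<in> B \<Longrightarrow> L v \<noteq> 0 \<Longrightarrow> (f has_derivative (\<lambda>_. 0)) (at v)"
    and p: "p \<in> B" "L p \<noteq> 0" and v: "v \<in> B"
  shows "f v = f p"
proof -
  let ?s = "\<lambda>t::real. p + t *\<^sub>R (v - p)"
  define T where "T = {L p / (L p - L v)}"
  have sB: "?s t \<in> B" if "t \<in> {0..1}" for t
  proof -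
    have "?s t = (1 - t) *\<^sub>R p + t *\<^sub>R v" by (simp add: algebra_simps)
    then show ?thesis using convexD_alt[OF B(1) p(1) v, of t] that by simp
  qed
  have Ls: "L (?s t) = L p + t * (L v - L p)" for t
    using L by (simp add: linear_add linear_scale linear_diff)
  have "(f \<circ> ?s) 1 = f p"
  proof (rule has_derivative_zero_unique_strong_interval[where k = T and a = 0 and b = 1 and f = "f \<circ> ?s"])
    show "continuous_on {0..1} (f \<circ> ?s)"
      by (intro continuous_on_compose continuous_intros continuous_on_subset[OF B(2)]) (use sB in auto)
    fix t assume t: "t \<in> {0..1} - T"
    have "L (?s t) \<noteq> 0"
    proof
      assume "L (?s t) = 0"
      then have e: "t * (L p - L v) = L p" unfolding Ls by (simp add: algebra_simps)
      then have "L p - L v \<noteq> 0" using p(2) by auto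
      then have "t = L p / (L p - L v)" using e by (simp add: field_simps)
      then show False using t by (simp add: T_def)
    qed
    then have "(f has_derivative (\<lambda>_. 0)) (at (?s t))" using sB t by (intro zero) auto
    moreover have "(?s has_derivative (\<lambda>t. t *\<^sub>R (v - p))) (at t)" by (auto intro!: derivative_eq_intros)
    ultimately have "(f \<circ> ?s has_derivative (\<lambda>_. 0) \<circ> (\<lambda>t. t *\<^sub>R (v - p))) (at t)" by (intro diff_chain_at)
    then show "((f \<circ> ?s) has_derivative (\<lambda>_. 0)) (at t within {0..1})"
      by (simp add: o_def has_derivative_at_withinI)
  qed (auto simp: T_def)
  then show ?thesis by simp
qed

lemma weierstrass_form_scale:
  "weierstrass_form \<alpha> \<beta> \<gamma> $ j * m = weierstrass_form (\<alpha> * m) (\<beta> * m) (\<gamma> * m) $ j"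
  using exhaust_3[of j] by (auto simp: algebra_simps diff_divide_distrib)

context costa_piece
begin

definition costa_form :: "complex \<Rightarrow> complex \<Rightarrow> complex^3" where
  "costa_form u w = weierstrass_form (of_real c / w * (1 / (u\<^sup>2 - 1))) (w / of_real c * (1 / (u\<^sup>2 - 1))) (1 / (u\<^sup>2 - 1))"

definition branch :: "complex set \<Rightarrow> (complex \<Rightarrow> complex) \<Rightarrow> bool" where
  "branch U s \<longleftrightarrow> open U \<and> s holomorphic_on U \<and> (\<forall>u\<in>U. s u \<noteq> 0 \<and> (s u)\<^sup>2 = u * (1 - u\<^sup>2))"

text \<open>The condition is imposed for all branches of \<open>w\<close> at once, so that it is invariant under
  the symmetries of the curve.\<close>

definition costa_derivative_at :: "complex \<Rightarrow> bool" where
  "costa_derivative_at u \<longleftrightarrow> (\<forall>U s. branch U s \<longrightarrow> u \<in> U \<longrightarrow>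
     ((\<lambda>u. costa_map (u, s u)) has_derivative (\<lambda>\<delta>. \<chi> j. Re (costa_form u (s u) $ j * \<delta>))) (at u))"

lemma branch_curve: "branch U s \<Longrightarrow> u \<in> U \<Longrightarrow> (u, s u) \<in> costa_curve"
proof -
  assume "branch U s" "u \<in> U"
  then have w: "(s u)\<^sup>2 = u * (1 - u\<^sup>2)" "s u \<noteq> 0" by (simp_all add: branch_def)
  have "u \<noteq> 1" "u \<noteq> -1" using w by (rule_tac notI, simp)+
  then show ?thesis using w(1) by (simp add: curve_iff)
qed

lemma costa_form_turn: "vertical_turn (\<chi> j. Re (costa_form u w $ j * \<delta>)) = (\<chi> j. Re (costa_form u (- w) $ j * \<delta>))"
proof -
  have "costa_form u (- w) $ 1 = - costa_form u w $ 1" "costa_form u (- w) $ 2 = - costa_form u w $ 2"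
    "costa_form u (- w) $ 3 = costa_form u w $ 3"
    unfolding costa_form_def by (simp_all add: algebra_simps diff_divide_distrib add_divide_distrib)
  then show ?thesis by (simp add: vec_eq_iff forall_3)
qed

lemma costa_form_cnj: "\<sigma>1 (\<chi> j. Re (costa_form u w $ j * \<delta>)) = (\<chi> j. Re (costa_form (cnj u) (cnj w) $ j * cnj \<delta>))"
proof -
  have "costa_form (cnj u) (cnj w) $ 1 = cnj (costa_form u w $ 1)"
    "costa_form (cnj u) (cnj w) $ 2 = - cnj (costa_form u w $ 2)"
    "costa_form (cnj u) (cnj w) $ 3 = cnj (costa_form u w $ 3)"
    by (simp_all add: costa_form_def)
  then show ?thesis by (simp add: vec_eq_iff forall_3)
qed

lemma costa_form_rotate:
  assumes "w \<noteq> 0"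
  shows "rotary (\<chi> j. Re (costa_form u w $ j * \<delta>)) = (\<chi> j. Re (costa_form (- u) (\<i> * w) $ j * (- \<delta>)))"
proof -
  have 1: "of_real c / (\<i> * w) = - \<i> * (of_real c / w)" using assms by (simp add: field_simps)
  have "costa_form (- u) (\<i> * w) $ 1 = costa_form u w $ 2"
    "costa_form (- u) (\<i> * w) $ 2 = - costa_form u w $ 1"
    "costa_form (- u) (\<i> * w) $ 3 = costa_form u w $ 3"
    unfolding costa_form_def 1 by (simp_all add: algebra_simps diff_divide_distrib add_divide_distrib)
  then show ?thesis by (simp add: vec_eq_iff forall_3)
qed

lemma costa_derivative_cnj:
  assumes "costa_derivative_at u" shows "costa_derivative_at (cnj u)"
  unfolding costa_derivative_at_def
proof (intro allI impI)
  fix U s assume s: "branch U s" and u: "cnj u \<in> U"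
  define s' where "s' v = cnj (s (cnj v))" for v
  have "branch (cnj -` U) s'"
    unfolding branch_def
  proof (intro conjI ballI)
    show o: "open (cnj -` U)" using s by (intro open_vimage continuous_intros) (simp add: branch_def)
    have "cnj ` (cnj -` U) \<subseteq> U" by auto
    then have "s holomorphic_on cnj ` (cnj -` U)" using s by (auto simp: branch_def intro: holomorphic_on_subset)
    then have "(cnj \<circ> s \<circ> cnj) holomorphic_on cnj -` U" using o by (rule holomorphic_on_compose_cnj_cnj)
    then show "s' holomorphic_on cnj -` U" by (simp add: s'_def[abs_def] o_def)
    fix v assume "v \<in> cnj -` U"
    then have *: "s (cnj v) \<noteq> 0" "(s (cnj v))\<^sup>2 = cnj v * (1 - (cnj v)\<^sup>2)" using s by (auto simp: branch_def)
    show "s' v \<noteq> 0" using * by (simp add: s'_def)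
    show "(s' v)\<^sup>2 = v * (1 - v\<^sup>2)" using arg_cong[OF *(2), of cnj] by (simp add: s'_def)
  qed
  then have "((\<lambda>v. costa_map (v, s' v)) has_derivative (\<lambda>\<delta>. \<chi> j. Re (costa_form u (s' u) $ j * \<delta>))) (at (cnj (cnj u)))"
    using assms u by (simp add: costa_derivative_at_def)
  from diff_chain_at[OF bounded_linear.has_derivative[OF bounded_linear_cnj has_derivative_ident] this]
  have "((\<lambda>v. \<sigma>1 (costa_map (cnj v, s' (cnj v)))) has_derivative (\<lambda>\<delta>. \<sigma>1 (\<chi> j. Re (costa_form u (s' u) $ j * cnj \<delta>)))) (at (cnj u))"
    unfolding o_def by (rule bounded_linear.has_derivative[OF bounded_linear_\<sigma>1])
  moreover have "s' u = cnj (s (cnj u))" by (simp add: s'_def)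
  ultimately have "((\<lambda>v. \<sigma>1 (costa_map (cnj v, s' (cnj v)))) has_derivative (\<lambda>\<delta>. \<chi> j. Re (costa_form (cnj u) (s (cnj u)) $ j * \<delta>))) (at (cnj u))"
    unfolding costa_form_cnj by simp
  then show "((\<lambda>v. costa_map (v, s v)) has_derivative (\<lambda>\<delta>. \<chi> j. Re (costa_form (cnj u) (s (cnj u)) $ j * \<delta>))) (at (cnj u))"
  proof (rule has_derivative_transform_within_open)
    show "open U" using s by (simp add: branch_def)
    show "\<sigma>1 (costa_map (cnj v, s' (cnj v))) = costa_map (v, s v)" if "v \<in> U" for v
      using costa_map_cnj[OF branch_curve[OF s that]] by (simp add: s'_def vec_eq_iff forall_3)
  qed (rule u)
qed

lemma costa_derivative_minus:
  assumes "costa_derivative_at u" shows "costa_derivative_at (- u)"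
  unfolding costa_derivative_at_def
proof (intro allI impI)
  fix U s assume s: "branch U s" and u: "- u \<in> U"
  define s' where "s' v = - (\<i> * s (- v))" for v
  have sU: "s holomorphic_on U" "open U" "\<And>v. v \<in> U \<Longrightarrow> s v \<noteq> 0 \<and> (s v)\<^sup>2 = v * (1 - v\<^sup>2)" using s by (auto simp: branch_def)
  have "branch (uminus -` U) s'"
    unfolding branch_def
  proof (intro conjI ballI)
    show "open (uminus -` U)" using sU by (intro open_vimage continuous_intros)
    have "(s \<circ> uminus) holomorphic_on uminus -` U"
      by (rule holomorphic_on_compose_gen[OF _ sU(1)]) (auto intro!: holomorphic_intros)
    then show "s' holomorphic_on uminus -` U" unfolding s'_def[abs_def] o_def by (intro holomorphic_intros)
    fix v assume "v \<in> uminus -` U"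
    then have *: "s (- v) \<noteq> 0" "(s (- v))\<^sup>2 = - v * (1 - (- v)\<^sup>2)" using sU(3) by auto
    show "s' v \<noteq> 0" using * by (simp add: s'_def)
    show "(s' v)\<^sup>2 = v * (1 - v\<^sup>2)" using *(2) by (simp add: s'_def power_mult_distrib)
  qed
  then have "((\<lambda>v. costa_map (v, s' v)) has_derivative (\<lambda>\<delta>. \<chi> j. Re (costa_form u (s' u) $ j * \<delta>))) (at (- (- u)))"
    using assms u by (simp add: costa_derivative_at_def)
  from diff_chain_at[OF has_derivative_minus[OF has_derivative_ident] this]
  have "((\<lambda>v. rotary (costa_map (- v, s' (- v)))) has_derivative (\<lambda>\<delta>. rotary (\<chi> j. Re (costa_form u (s' u) $ j * - \<delta>)))) (at (- u))"
    unfolding o_def by (rule bounded_linear.has_derivative[OF bounded_linear_rotary])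
  moreover have s'u: "s' u \<noteq> 0" "\<i> * s' u = s (- u)" using sU(3)[OF u] by (auto simp: s'_def algebra_simps)
  have "rotary (\<chi> j. Re (costa_form u (s' u) $ j * - \<delta>)) = (\<chi> j. Re (costa_form (- u) (s (- u)) $ j * \<delta>))" for \<delta>
    using costa_form_rotate[OF s'u(1), of u "- \<delta>"] unfolding s'u(2) minus_minus .
  ultimately have "((\<lambda>v. rotary (costa_map (- v, s' (- v)))) has_derivative (\<lambda>\<delta>. \<chi> j. Re (costa_form (- u) (s (- u)) $ j * \<delta>))) (at (- u))"
    by (simp only:)
  then show "((\<lambda>v. costa_map (v, s v)) has_derivative (\<lambda>\<delta>. \<chi> j. Re (costa_form (- u) (s (- u)) $ j * \<delta>))) (at (- u))"
  proof (rule has_derivative_transform_within_open)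
    show "rotary (costa_map (- v, s' (- v))) = costa_map (v, s v)" if "v \<in> U" for v
    proof -
      have "(- v, s' (- v)) \<in> costa_curve"
        using curve_rotate[OF branch_curve[OF s that], of "- \<i>"] by (simp add: s'_def)
      from costa_map_rotate[OF this] show ?thesis by (simp add: s'_def)
    qed
  qed (use u sU in auto)
qed

text \<open>The change of variables \<open>z = 1 - u\<^sup>2\<close>: up to a constant phase, which cancels those
  in the form, \<open>(z - 1)\<^sup>e\<close> is \<open>u\<^sup>2\<^sup>e\<close>, and the square roots of \<open>z\<close> and \<open>u\<close> multiply to the
  square root of \<open>u (1 - u\<^sup>2)\<close> on the sheet that \<open>wedge_map\<close> singles out.\<close>

lemma wedge_form:
  assumes u: "Re u > 0" "Im u < 0"
  defines "w \<equiv> csqrt (1 - u\<^sup>2) * csqrt u"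
  shows "form (1 - u\<^sup>2) $ j * (- u) = costa_form u w $ j" "w\<^sup>2 = u * (1 - u\<^sup>2)" "2 * Re w + Im w > 0"
proof -
  define z where "z = 1 - u\<^sup>2"
  have "Im u * Re u < 0" using u by (simp add: mult_neg_pos)
  then have Imz: "Im z > 0" by (simp add: z_def power2_eq_square)
  then have z: "z \<in> upper_half_plane" "z \<noteq> 0" by (auto simp: upper_half_plane_def)
  have u0: "u \<noteq> 0" using u by auto
  define p where "p = csqrt z"
  define q where "q = csqrt u"
  have pq: "p\<^sup>2 = z" "q\<^sup>2 = u" by (simp_all add: p_def q_def)
  then have nz: "p \<noteq> 0" "q \<noteq> 0" using z u0 by auto
  have w: "w = p * q" by (simp add: w_def p_def q_def z_def)
  show "w\<^sup>2 = u * (1 - u\<^sup>2)" unfolding w power_mult_distrib pq by (simp add: z_def)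
  have P: "Re p > 0" "Im p > 0"
  proof -
    have "2 * Re p * Im p > 0" using Imz by (simp only: pq(1)[symmetric] Im_power2)
    moreover have "Re p \<ge> 0" unfolding p_def by (rule Re_csqrt)
    ultimately show "Re p > 0" "Im p > 0" by (auto simp: zero_less_mult_iff)
  qed
  have Q: "Re q > 0" "- Im q > 0" "Re q > - Im q"
  proof -
    have e: "2 * Re q * Im q < 0" "(Re q)\<^sup>2 - (Im q)\<^sup>2 > 0" using u by (simp_all only: pq(2)[symmetric] Im_power2 Re_power2 diff_gt_0_iff_gt)
    have "Re q \<ge> 0" unfolding q_def by (rule Re_csqrt)
    then show "Re q > 0" "- Im q > 0" using e(1) by (auto simp: mult_less_0_iff)
    then show "Re q > - Im q" using e(2) by (intro power_less_imp_less_base[of "- Im q" 2 "Re q"]) auto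
  qed
  have "2 * Re w + Im w = Re p * (2 * Re q - - Im q) + Im p * (2 * - Im q + Re q)"
    unfolding w by (simp add: algebra_simps)
  also have "\<dots> > 0" using P Q by (intro add_pos_pos mult_pos_pos) linarith+
  finally show "2 * Re w + Im w > 0" .
  have half: "x powr of_real (-1/2) = 1 / csqrt x" "x powr of_real (-3/2) = 1 / (x * csqrt x)" if "x \<noteq> 0" for x
  proof -
    have c: "csqrt x = x powr (1/2)" by (simp add: csqrt_conv_powr that)
    show "x powr of_real (-1/2) = 1 / csqrt x" unfolding c using that by (simp add: powr_minus_divide)
    have "x powr of_real (-3/2) = x powr (-1) * x powr (-(1/2))" by (simp flip: powr_add)
    then show "x powr of_real (-3/2) = 1 / (x * csqrt x)" unfolding c powr_minus using that by (simp add: divide_simps)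
  qed
  have uu: "(u\<^sup>2) powr of_real e = u powr of_real (2 * e)" for e
  proof -
    have "Ln (u\<^sup>2) = of_nat 2 * Ln u"
    proof (rule Ln_unique)
      show "exp (of_nat 2 * Ln u) = u\<^sup>2" unfolding exp_of_nat_mult using u0 by simp
      have "\<bar>Im (Ln u)\<bar> < pi / 2" using Re_Ln_pos_lt[OF u0] u by simp
      then show "- pi < Im (of_nat 2 * Ln u)" "Im (of_nat 2 * Ln u) \<le> pi" by auto
    qed
    then show ?thesis using u0 by (simp add: powr_def mult_ac)
  qed
  have z1: "(z - 1) powr of_real e = cis (pi * e) * u powr of_real f" if "f = 2 * e" for e f
  proof -
    have "(1 - z) powr of_real e = cis (- (pi * e)) * (z - 1) powr of_real e" by (rule powr_one_minus[OF z(1)])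
    then have "cis (pi * e) * (u\<^sup>2) powr of_real e = (cis (pi * e) * cis (- (pi * e))) * (z - 1) powr of_real e"
      by (simp add: z_def)
    then show ?thesis unfolding uu that by (simp add: cis_mult)
  qed
  have G: "of_real c * e3 * sc_form G_lim z = of_real c / (z * p * (u * q))"
  proof -
    have S: "sc_form G_lim z = z powr of_real (-3/2) * (z - 1) powr of_real (-3/4)" unfolding sc_form_def G_lim_def by simp
    have S1: "(z - 1) powr of_real (-3/4) = cis (pi * (-3/4)) * u powr of_real (-3/2)" by (rule z1) simp
    have "of_real c * e3 * sc_form G_lim z = of_real c * (e3 * cis (pi * (-3/4))) * (z powr of_real (-3/2) * u powr of_real (-3/2))"
      unfolding S S1 by (simp only: mult_ac)
    then show ?thesis unfolding phases half[OF z(2)] half[OF u0] p_def[symmetric] q_def[symmetric] by simp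
  qed
  have K: "of_real (1/c) * e1 * sc_form K_lim z = 1 / (of_real c * p * q)"
  proof -
    have S: "sc_form K_lim z = z powr of_real (-1/2) * (z - 1) powr of_real (-1/4)" unfolding sc_form_def K_lim_def by simp
    have S1: "(z - 1) powr of_real (-1/4) = cis (pi * (-1/4)) * u powr of_real (-1/2)" by (rule z1) simp
    have "of_real (1/c) * e1 * sc_form K_lim z = of_real (1/c) * (e1 * cis (pi * (-1/4))) * (z powr of_real (-1/2) * u powr of_real (-1/2))"
      unfolding S S1 by (simp only: mult_ac)
    then show ?thesis unfolding phases half[OF z(2)] half[OF u0] p_def[symmetric] q_def[symmetric] by simp
  qed
  have H: "\<i> * sc_form H_lim z = 1 / (z * u)"
  proof -
    have S: "sc_form H_lim z = z powr of_real (-1) * (z - 1) powr of_real (-1/2)" unfolding sc_form_def H_lim_def by simp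
    have S1: "(z - 1) powr of_real (-1/2) = cis (pi * (-1/2)) * u powr of_real (-1)" by (rule z1) simp
    have "\<i> * sc_form H_lim z = (\<i> * cis (pi * (-1/2))) * (z powr of_real (-1) * u powr of_real (-1))"
      unfolding S S1 by (simp only: mult_ac)
    then show ?thesis unfolding phases using z(2) u0 by (simp add: powr_minus divide_simps)
  qed
  have u21: "u\<^sup>2 - 1 = - z" by (simp add: z_def)
  have c0: "complex_of_real c \<noteq> 0" using c by simp
  have "of_real c / (z * p * (u * q)) * (- u) = of_real c / w * (1 / (u\<^sup>2 - 1))"
    "1 / (z * u) * (- u) = 1 / (u\<^sup>2 - 1)"
    unfolding w u21 using nz z(2) u0 by (simp_all add: field_simps)
  moreover have "1 / (of_real c * p * q) * (- u) = w / of_real c * (1 / (u\<^sup>2 - 1))"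
    unfolding w u21 pq(1)[symmetric] using nz c0 pq(2) by (simp add: field_simps power2_eq_square)
  ultimately have "form z $ j * (- u) = costa_form u w $ j"
    unfolding form_def G K H costa_form_def weierstrass_form_scale by simp
  then show "form (1 - u\<^sup>2) $ j * (- u) = costa_form u w $ j" by (simp add: z_def)
qed

lemma wedge_derivative:
  assumes s: "branch U s" and u: "u \<in> U" "Re u > 0" "Im u < 0" and pos: "2 * Re (s u) + Im (s u) > 0"
  shows "((\<lambda>u. costa_map (u, s u)) has_derivative (\<lambda>\<delta>. \<chi> j. Re (costa_form u (s u) $ j * \<delta>))) (at u)"
proof -
  have sU: "s holomorphic_on U" "open U" "\<And>v. v \<in> U \<Longrightarrow> s v \<noteq> 0 \<and> (s v)\<^sup>2 = v * (1 - v\<^sup>2)" using s by (auto simp: branch_def)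
  have "(s u)\<^sup>2 = (csqrt (1 - u\<^sup>2) * csqrt u)\<^sup>2" using sU(3)[OF u(1)] wedge_form(2)[OF u(2,3)] by simp
  then have "s u = csqrt (1 - u\<^sup>2) * csqrt u"
    using pos wedge_form(3)[OF u(2,3)] by (auto simp: power2_eq_iff)
  then have f: "form (1 - u\<^sup>2) $ j * (- u) = costa_form u (s u) $ j" for j using wedge_form(1)[OF u(2,3)] by simp
  have "Im u * Re u < 0" using u by (simp add: mult_neg_pos)
  then have "1 - u\<^sup>2 \<in> upper_half_plane" by (simp add: upper_half_plane_def power2_eq_square)
  then have "(Y has_derivative (\<lambda>\<delta>. \<chi> j. Re (form (1 - u\<^sup>2) $ j * \<delta>))) (at (1 - u\<^sup>2))"
    using Y_rep by (simp add: weierstrass_rep_def)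
  moreover have "((\<lambda>u. 1 - u\<^sup>2) has_derivative (\<lambda>\<delta>. - (2 * u * \<delta>))) (at u)"
    by (auto intro!: derivative_eq_intros simp: algebra_simps)
  ultimately have "(Y \<circ> (\<lambda>u. 1 - u\<^sup>2) has_derivative (\<lambda>\<delta>. \<chi> j. Re (form (1 - u\<^sup>2) $ j * \<delta>)) \<circ> (\<lambda>\<delta>. - (2 * u * \<delta>))) (at u)"
    by (intro diff_chain_at)
  then have "((\<lambda>u. (1/2) *\<^sub>R Y (1 - u\<^sup>2)) has_derivative (\<lambda>\<delta>. (1/2) *\<^sub>R (\<chi> j. Re (form (1 - u\<^sup>2) $ j * - (2 * u * \<delta>))))) (at u)"
    unfolding o_def by (intro has_derivative_scaleR_right)
  moreover have "(1/2) *\<^sub>R (\<chi> j. Re (form (1 - u\<^sup>2) $ j * - (2 * u * \<delta>))) = (\<chi> j. Re (costa_form u (s u) $ j * \<delta>))" for \<delta>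
  proof -
    have "form (1 - u\<^sup>2) $ j * - (2 * u * \<delta>) = of_real 2 * (form (1 - u\<^sup>2) $ j * (- u) * \<delta>)" for j by simp
    moreover have "Re (of_real 2 * x) = 2 * Re x" for x by simp
    ultimately have "Re (form (1 - u\<^sup>2) $ j * - (2 * u * \<delta>)) = 2 * Re (costa_form u (s u) $ j * \<delta>)" for j by (simp only: f)
    then show ?thesis unfolding vec_eq_iff vector_scaleR_component vec_lambda_beta by (simp only:) simp
  qed
  ultimately have d: "((\<lambda>u. (1/2) *\<^sub>R Y (1 - u\<^sup>2)) has_derivative (\<lambda>\<delta>. \<chi> j. Re (costa_form u (s u) $ j * \<delta>))) (at u)" by (simp only:)
  let ?m = "\<lambda>v. min (min (Re v) (- Im v)) (2 * Re (s v) + Im (s v))"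
  have "continuous_on U s" using sU(1) by (rule holomorphic_on_imp_continuous_on)
  then have "open (U \<inter> ?m -` {0<..})" by (intro continuous_open_preimage continuous_intros sU) auto
  from has_derivative_transform_within_open[OF d this] show ?thesis
    using u pos by (auto simp: costa_map_def half_map_def wedge_map_def)
qed

lemma costa_derivative_quadrant:
  assumes u: "Re u > 0" "Im u < 0" shows "costa_derivative_at u"
  unfolding costa_derivative_at_def
proof (intro allI impI)
  fix U s assume s: "branch U s" and uU: "u \<in> U"
  have sU: "s holomorphic_on U" "open U" "\<And>v. v \<in> U \<Longrightarrow> s v \<noteq> 0 \<and> (s v)\<^sup>2 = v * (1 - v\<^sup>2)" using s by (auto simp: branch_def)
  have "(u, s u) \<in> wedge" using branch_curve[OF s uU] u by (simp add: wedge_def)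
  then have "2 * Re (s u) + Im (s u) \<noteq> 0" using wedge_sign_zero u by fastforce
  then consider "2 * Re (s u) + Im (s u) > 0" | "2 * Re (s u) + Im (s u) < 0" by linarith
  then show "((\<lambda>u. costa_map (u, s u)) has_derivative (\<lambda>\<delta>. \<chi> j. Re (costa_form u (s u) $ j * \<delta>))) (at u)"
  proof cases
    case 1
    then show ?thesis by (rule wedge_derivative[OF s uU u])
  next
    case 2
    have "branch U (\<lambda>v. - s v)" using sU by (auto simp: branch_def intro!: holomorphic_intros)
    then have "((\<lambda>u. costa_map (u, - s u)) has_derivative (\<lambda>\<delta>. \<chi> j. Re (costa_form u (- s u) $ j * \<delta>))) (at u)"
      by (rule wedge_derivative[OF _ uU u]) (use 2 in simp)
    from bounded_linear.has_derivative[OF bounded_linear_vertical_turn this]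
    have "((\<lambda>u. vertical_turn (costa_map (u, - s u))) has_derivative (\<lambda>\<delta>. \<chi> j. Re (costa_form u (s u) $ j * \<delta>))) (at u)"
      unfolding costa_form_turn by simp
    then show ?thesis
    proof (rule has_derivative_transform_within_open[OF _ sU(2) uU])
      show "vertical_turn (costa_map (v, - s v)) = costa_map (v, s v)" if "v \<in> U" for v
        using costa_map_minus[OF branch_curve[OF s that]] by (simp add: vec_eq_iff forall_3)
    qed
  qed
qed

lemma costa_derivative_off_axes:
  assumes "Re u \<noteq> 0" "Im u \<noteq> 0" shows "costa_derivative_at u"
proof -
  have "costa_derivative_at (Complex \<bar>Re u\<bar> (- \<bar>Im u\<bar>))" (is "costa_derivative_at ?v")
    by (rule costa_derivative_quadrant) (use assms in auto)
  then have "costa_derivative_at v" if "v \<in> {?v, cnj ?v, - ?v, - cnj ?v}" for v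
    using that costa_derivative_cnj costa_derivative_minus by blast
  moreover have "u \<in> {?v, cnj ?v, - ?v, - cnj ?v}"
  proof -
    consider "Re u > 0" "Im u < 0" | "Re u > 0" "Im u > 0" | "Re u < 0" "Im u > 0" | "Re u < 0" "Im u < 0"
      using assms by linarith
    then show ?thesis by cases (simp_all add: complex_eq_iff)
  qed
  ultimately show ?thesis by blast
qed

text \<open>Near a point of an axis other than \<open>0\<close> the difference between the map and the real part
  of a primitive of the form is continuous and, off the axis, locally constant. The point
  \<open>u = 0\<close> does not occur, since \<open>w\<close> vanishes there.\<close>

lemma costa_derivative: "costa_derivative_at u"
proof (cases "Re u \<noteq> 0 \<and> Im u \<noteq> 0")
  case True
  then show ?thesis by (intro costa_derivative_off_axes) auto
next
  case axis: False
  show ?thesis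
    unfolding costa_derivative_at_def
  proof (intro allI impI)
    fix U s assume s: "branch U s" and uU: "u \<in> U"
    have sU: "s holomorphic_on U" "open U" "\<And>v. v \<in> U \<Longrightarrow> s v \<noteq> 0 \<and> (s v)\<^sup>2 = v * (1 - v\<^sup>2)" using s by (auto simp: branch_def)
    have sc: "continuous_on U s" using sU(1) by (rule holomorphic_on_imp_continuous_on)
    have u0: "u \<noteq> 0" using sU(3)[OF uU] by auto
    obtain r0 where r0: "r0 > 0" "ball u r0 \<subseteq> U" using sU(2) uU open_contains_ball by blast
    define r where "r = min r0 (norm u)"
    define B where "B = ball u r"
    have r: "r > 0" "r \<le> norm u" and BU: "B \<subseteq> U" and B: "convex B" "open B" "u \<in> B"
      using r0 u0 by (auto simp: r_def B_def)
    have near: "norm (u - v) < norm u" if "v \<in> B" for v using that r by (simp add: B_def dist_norm)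
    obtain L d where L: "linear L" "L u = 0" "L d = (1::real)" "norm d = 1"
      and off: "\<And>v. v \<in> B \<Longrightarrow> L v \<noteq> 0 \<Longrightarrow> Re v \<noteq> 0 \<and> Im v \<noteq> 0"
    proof (cases "Im u = 0")
      case True
      have "Re v \<noteq> 0" if "v \<in> B" for v
      proof -
        have "norm u = \<bar>Re u\<bar>" using True by (simp add: norm_complex_def)
        then show ?thesis using near[OF that] abs_Re_le_cmod[of "u - v"] by auto
      qed
      then show ?thesis using that[of Im \<i>] True by (auto simp: linear_conv_bounded_linear bounded_linear_Im)
    next
      case False
      then have "Re u = 0" using axis by simp
      have "Im v \<noteq> 0" if "v \<in> B" for v
      proof -
        have "norm u = \<bar>Im u\<bar>" using \<open>Re u = 0\<close> by (simp add: norm_complex_def)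
        then show ?thesis using near[OF that] abs_Im_le_cmod[of "u - v"] by auto
      qed
      then show ?thesis using that[of Re 1] \<open>Re u = 0\<close> by (auto simp: linear_conv_bounded_linear bounded_linear_Re)
    qed
    define p where "p = u + (r/2) *\<^sub>R d"
    have "L p = r / 2" by (simp only: p_def linear_add[OF L(1)] linear_scale[OF L(1)] L(2,3)) simp
    then have p: "p \<in> B" "L p \<noteq> 0" using r L(4) by (auto simp: p_def B_def dist_norm)
    have comp: "((\<lambda>u. costa_map (u, s u) $ j) has_derivative (\<lambda>\<delta>. Re (costa_form u (s u) $ j * \<delta>))) (at u)" for j
    proof -
      have "(\<lambda>v. costa_form v (s v) $ 1) holomorphic_on B" "(\<lambda>v. costa_form v (s v) $ 2) holomorphic_on B" "(\<lambda>v. costa_form v (s v) $ 3) holomorphic_on B"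
      proof -
        have "s holomorphic_on B" by (rule holomorphic_on_subset[OF sU(1) BU])
        moreover have "v\<^sup>2 - 1 \<noteq> 0" "s v \<noteq> 0" if "v \<in> B" for v using sU(3)[of v] BU that by (auto simp: eq_diff_eq)
        ultimately show "(\<lambda>v. costa_form v (s v) $ 1) holomorphic_on B" "(\<lambda>v. costa_form v (s v) $ 2) holomorphic_on B" "(\<lambda>v. costa_form v (s v) $ 3) holomorphic_on B"
          unfolding costa_form_def weierstrass_form_components using c by (intro holomorphic_intros; simp)+
      qed
      then have "(\<lambda>v. costa_form v (s v) $ j) holomorphic_on B" using exhaust_3[of j] by auto
      then obtain P where Pw: "\<And>v. v \<in> B \<Longrightarrow> (P has_field_derivative costa_form v (s v) $ j) (at v within B)"
        using holomorphic_convex_primitive'[OF B(1,2)] by blast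
      have P: "(P has_field_derivative costa_form v (s v) $ j) (at v)" if "v \<in> B" for v
        using Pw[OF that] unfolding at_within_open[OF that B(2)] .
      let ?d = "\<lambda>v. costa_map (v, s v) $ j - Re (P v)"
      have dR: "((\<lambda>v. Re (P v)) has_derivative (\<lambda>\<delta>. Re (costa_form v (s v) $ j * \<delta>))) (at v)" if "v \<in> B" for v
        by (rule has_derivative_Re_mult[OF P[OF that]])
      have "continuous_on B (\<lambda>v. costa_map (v, s v))"
        by (rule continuous_on_compose2[OF costa_map_continuous])
           (use BU branch_curve[OF s] in \<open>auto intro!: continuous_intros continuous_on_subset[OF sc]\<close>)
      moreover have "continuous_on B P" using P by (intro continuous_at_imp_continuous_on) (auto dest: DERIV_isCont)
      ultimately have cont: "continuous_on B ?d" by (intro continuous_intros)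
      have zero: "(?d has_derivative (\<lambda>_. 0)) (at v)" if v: "v \<in> B" "L v \<noteq> 0" for v
      proof -
        have "costa_derivative_at v" using off[OF v] by (intro costa_derivative_off_axes) auto
        then have "((\<lambda>u. costa_map (u, s u)) has_derivative (\<lambda>\<delta>. \<chi> j. Re (costa_form v (s v) $ j * \<delta>))) (at v)"
          using s v BU by (auto simp: costa_derivative_at_def)
        from has_derivative_diff[OF bounded_linear.has_derivative[OF bounded_linear_vec_nth[of j] this] dR[OF v(1)]]
        show ?thesis by (simp only: vec_lambda_beta diff_self)
      qed
      have const: "?d v = ?d p" if "v \<in> B" for v
        by (rule constant_off_line[OF B(1) cont L(1) zero p that])
      have "((\<lambda>v. Re (P v) + ?d p) has_derivative (\<lambda>\<delta>. Re (costa_form u (s u) $ j * \<delta>) + 0)) (at u)"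
        by (intro has_derivative_add dR B has_derivative_const)
      then have "((\<lambda>v. Re (P v) + ?d p) has_derivative (\<lambda>\<delta>. Re (costa_form u (s u) $ j * \<delta>))) (at u)" by (simp only: add_0_right)
      then show ?thesis
      proof (rule has_derivative_transform_within_open[OF _ B(2,3)])
        show "Re (P v) + ?d p = costa_map (v, s v) $ j" if "v \<in> B" for v using const[OF that] by linarith
      qed
    qed
    have "((\<lambda>u. \<chi> j. costa_map (u, s u) $ j) has_derivative (\<lambda>\<delta>. \<chi> j. Re (costa_form u (s u) $ j * \<delta>))) (at u)"
      by (rule has_derivative_vec_lambda[OF comp])
    then show "((\<lambda>u. costa_map (u, s u)) has_derivative (\<lambda>\<delta>. \<chi> j. Re (costa_form u (s u) $ j * \<delta>))) (at u)"
      by (simp only: vec_lambda_eta)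
  qed
qed

lemma costa_immersion: "costa_immersion c costa_map"
  unfolding costa_immersion_def
proof (intro conjI allI impI ballI)
  fix U s u assume "open U \<and> s holomorphic_on U \<and> (\<forall>u\<in>U. s u \<noteq> 0 \<and> (s u)\<^sup>2 = u * (1 - u\<^sup>2))" "u \<in> U"
  then have "branch U s" "u \<in> U" by (auto simp: branch_def)
  then show "((\<lambda>u. costa_map (u, s u)) has_derivative (\<lambda>\<delta>. \<chi> j. Re (weierstrass_form (of_real c / s u * (1 / (u\<^sup>2 - 1)))
      (s u / of_real c * (1 / (u\<^sup>2 - 1))) (1 / (u\<^sup>2 - 1)) $ j * \<delta>))) (at u)"
    using costa_derivative[of u] unfolding costa_derivative_at_def costa_form_def by blast
qed (rule c costa_map_continuous)+

end

section \<open>The Costa surface\<close>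

context costa_piece
begin

lemma double_linear: "2 *\<^sub>R rotary x = rotary (2 *\<^sub>R x)" "2 *\<^sub>R \<sigma>1 x = \<sigma>1 (2 *\<^sub>R x)" "2 *\<^sub>R \<sigma>2 x = \<sigma>2 (2 *\<^sub>R x)"
  "2 *\<^sub>R vertical_turn x = vertical_turn (2 *\<^sub>R x)"
  by (simp_all add: vec_eq_iff forall_3)

text \<open>Both sets contain the piece. The image of the curve is invariant under the symmetries of
  the arcs because these generate the same group as the isometries used in the gluing;
  conversely the image is made of the piece by these isometries.\<close>

lemma symmetric_extension_eq: "symmetric_extension Y {0} {0, 1} = (\<lambda>x. 2 *\<^sub>R x) ` costa_map ` costa_curve"
proof -
  let ?M = "Y ` (closed_half_plane - {0})"
  define E where "E = extension_by {\<sigma>0, \<sigma>1, \<sigma>2} ?M"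
  define C where "C = (\<lambda>x. 2 *\<^sub>R x) ` costa_map ` costa_curve"
  have MC: "Y z \<in> C" if z: "z \<in> closed_half_plane - {0}" for z
  proof -
    define u where "u = (if Im (csqrt (1 - z)) \<le> 0 then csqrt (1 - z) else - csqrt (1 - z))"
    have u2: "u\<^sup>2 = 1 - z" by (simp add: u_def)
    have "Im (u\<^sup>2) \<le> 0" unfolding u2 using z by (simp add: closed_half_plane_def)
    then have s: "Re u * Im u \<le> 0" by (simp only: Im_power2 mult.assoc)
    have q: "Re u \<ge> 0 \<and> Im u \<le> 0"
    proof (cases "Im (csqrt (1 - z)) \<le> 0")
      case True
      then show ?thesis using Re_csqrt[of "1 - z"] by (simp add: u_def del: csqrt.simps)
    next
      case False
      then have "Re u \<le> 0" "Im u < 0" using Re_csqrt[of "1 - z"] by (simp_all add: u_def del: csqrt.simps)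
      then show ?thesis using s by (auto simp: mult_le_0_iff)
    qed
    define w0 where "w0 = csqrt (u * (1 - u\<^sup>2))"
    \<comment> \<open>The sheet on which \<open>wedge_map\<close> is given by \<open>Y\<close> itself.\<close>
    define w where "w = (if 2 * Re w0 + Im w0 \<ge> 0 then w0 else - w0)"
    have w: "w\<^sup>2 = u * (1 - u\<^sup>2)" "2 * Re w + Im w \<ge> 0" by (simp_all add: w_def w0_def del: csqrt.simps)
    have "u \<noteq> 1 \<and> u \<noteq> -1"
    proof -
      have "u\<^sup>2 \<noteq> 1" unfolding u2 using z by simp
      then show ?thesis by auto
    qed
    then have "(u, w) \<in> costa_curve" using w(1) unfolding curve_iff by blast
    moreover have "Y z = 2 *\<^sub>R costa_map (u, w)"
      using q w(2) u2 by (simp add: costa_map_def half_map_def wedge_map_def)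
    ultimately show ?thesis unfolding C_def by blast
  qed
  have rotC: "rotary x \<in> C" and turnC: "vertical_turn x \<in> C" and refC: "\<sigma>1 x \<in> C" if "x \<in> C" for x
  proof -
    obtain u w where uw: "(u, w) \<in> costa_curve" "x = 2 *\<^sub>R costa_map (u, w)" using \<open>x \<in> C\<close> by (auto simp: C_def)
    have "rotary x = 2 *\<^sub>R costa_map (- u, \<i> * w)" "(- u, \<i> * w) \<in> costa_curve"
      "vertical_turn x = 2 *\<^sub>R costa_map (u, - w)" "(u, - w) \<in> costa_curve"
      "\<sigma>1 x = 2 *\<^sub>R costa_map (cnj u, cnj w)" "(cnj u, cnj w) \<in> costa_curve"
      using uw by (simp_all add: double_linear costa_map_rotate costa_map_minus costa_map_cnj curve_cnj curve_minus
          curve_rotate[of u w \<i>])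
    then show "rotary x \<in> C" "vertical_turn x \<in> C" "\<sigma>1 x \<in> C" unfolding C_def by blast+
  qed
  have \<sigma>C: "\<sigma> x \<in> C" if "\<sigma> \<in> {\<sigma>0, \<sigma>1, \<sigma>2}" "x \<in> C" for \<sigma> x
  proof -
    have "\<sigma>0 x = vertical_turn (\<sigma>1 x)" "\<sigma>2 x = \<sigma>1 (rotary x)" by (simp_all add: vec_eq_iff forall_3)
    then show ?thesis using that rotC turnC refC by auto
  qed
  have "\<tau> ` ?M \<subseteq> C" if "\<tau> \<in> generated_maps {\<sigma>0, \<sigma>1, \<sigma>2}" for \<tau>
    using that
  proof induction
    case id
    then show ?case using MC by auto
  next
    case (comp \<sigma> \<tau>)
    then show ?case using \<sigma>C by fastforce
  qed
  then have EC: "E \<subseteq> C" by (auto simp: E_def extension_by_def)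
  have \<sigma>E: "\<sigma> x \<in> E" if \<sigma>: "\<sigma> \<in> {\<sigma>0, \<sigma>1, \<sigma>2}" and x: "x \<in> E" for \<sigma> x
  proof -
    obtain \<tau> y where "\<tau> \<in> generated_maps {\<sigma>0, \<sigma>1, \<sigma>2}" "y \<in> ?M" "x = \<tau> y" using x by (auto simp: E_def extension_by_def)
    then have "\<sigma> \<circ> \<tau> \<in> generated_maps {\<sigma>0, \<sigma>1, \<sigma>2}" "\<sigma> x = (\<sigma> \<circ> \<tau>) y" using generated_maps.comp[OF \<sigma>] by auto
    then show ?thesis using \<open>y \<in> ?M\<close> unfolding E_def extension_by_def by blast
  qed
  have ME: "Y z \<in> E" if "z \<in> closed_half_plane - {0}" for z
    unfolding E_def extension_by_def using that generated_maps.id[of "{\<sigma>0, \<sigma>1, \<sigma>2}"] by (intro UN_I[of id]) auto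
  have wedgeE: "2 *\<^sub>R wedge_map (u, w) \<in> E" if "(u, w) \<in> wedge" for u w
  proof -
    have "Y (1 - u\<^sup>2) \<in> E" by (rule ME[OF wedge_half_plane[OF that]])
    moreover have "vertical_turn x = \<sigma>0 (\<sigma>1 x)" for x by (simp add: vec_eq_iff forall_3)
    ultimately have "vertical_turn (Y (1 - u\<^sup>2)) \<in> E" using \<sigma>E by simp
    then show ?thesis using \<open>Y (1 - u\<^sup>2) \<in> E\<close> by (simp add: wedge_map_def double_linear)
  qed
  have halfE: "2 *\<^sub>R half_map (u, w) \<in> E" if uw: "(u, w) \<in> half" for u w
  proof (cases "Im u \<le> 0")
    case True
    then show ?thesis using wedgeE[of u w] uw by (simp add: half_map_def half_def wedge_def)
  next
    case False
    then have "(cnj u, cnj w) \<in> wedge" using uw by (simp add: half_def wedge_def curve_cnj)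
    then show ?thesis using wedgeE \<sigma>E False by (simp add: half_map_def double_linear)
  qed
  have "2 *\<^sub>R costa_map (u, w) \<in> E" if uw: "(u, w) \<in> costa_curve" for u w
  proof (cases "Re u \<ge> 0")
    case True
    then show ?thesis using halfE[of u w] uw by (simp add: costa_map_def half_def)
  next
    case False
    then have "(- u, - (\<i> * w)) \<in> half" using curve_rotate[OF uw, of "- \<i>"] by (simp add: half_def)
    moreover have "rotary x = \<sigma>1 (\<sigma>2 x)" for x by (simp add: vec_eq_iff forall_3)
    ultimately show ?thesis using halfE \<sigma>E False by (simp add: costa_map_def double_linear)
  qed
  then have "C \<subseteq> E" by (auto simp: C_def)
  then have "E = C" using EC by blast
  then show ?thesis unfolding symmetric_extension_def symmetries_eq E_def C_def by simp
qed

lemma extension_costa: "costa_surface (symmetric_extension Y {0} {0, 1})"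
  unfolding costa_surface_def symmetric_extension_eq
proof (intro exI conjI)
  show "costa_immersion c costa_map" by (rule costa_immersion)
  show "(0 :: real) < 2" by simp
  show "orthogonal_transformation (\<lambda>x :: real^3. x)" by (rule orthogonal_transformation_id)
  show "(\<lambda>x. 2 *\<^sub>R x) ` costa_map ` costa_curve = (\<lambda>x. 2 *\<^sub>R x + 0) ` costa_map ` costa_curve" by simp
qed

end

theorem theorem1p4:
  shows "\<exists>(a :: nat \<Rightarrow> real) (b :: nat \<Rightarrow> real) (\<rho> :: nat \<Rightarrow> real) (S :: nat \<Rightarrow> (real^3) set).
           (\<forall>n. CS4_surface (a n) (b n) (\<rho> n) (S n)) \<and>
           converges_to_costa (\<lambda>n. CS4_map (a n) (b n) (\<rho> n))"
proof -
  obtain a b \<rho> c where deg: "CS4_degeneration a b" and pos: "\<And>n. \<rho> n > 0"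
    and per: "\<And>n. CS4_period (a n) (b n) (\<rho> n)" "\<And>n. 1/2 \<le> (\<rho> n)\<^sup>2 * (- a n)" "\<And>n. (\<rho> n)\<^sup>2 \<le> 1"
    and lim: "(\<lambda>n. \<rho> n * sqrt (- a n)) \<longlonglongrightarrow> c" and c: "c > 0"
    "c\<^sup>2 * side3 G_lim = sqrt 2 * (LBINT x:{0<..<1}. sc_abs K_lim x)"
    by (rule CS4_parameters; rule that; assumption)
  interpret CS4_degeneration a b by (rule deg)
  have "\<exists>S. CS4_surface (a n) (b n) (\<rho> n) S" for n
  proof -
    interpret CS4_pentagon "a n" "b n" "\<rho> n"
      using a[of n] ab[of n] per pos by unfold_locales auto
    show ?thesis by (rule surface)
  qed
  then obtain S where S: "\<And>n. CS4_surface (a n) (b n) (\<rho> n) (S n)" by metis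
  interpret costa_piece c by unfold_locales (rule c)+
  have "converges_to_costa (\<lambda>n. CS4_map (a n) (b n) (\<rho> n))"
    unfolding converges_to_costa_def
  proof (intro exI conjI allI impI)
    show "(0 :: real) < 1" by simp
    show "uniform_limit K (\<lambda>n z. 1 *\<^sub>R CS4_map (a n) (b n) (\<rho> n) z + - X (Some 1)) Y sequentially"
      if "compact K \<and> K \<subseteq> upper_half_plane" for K
    proof -
      have "uniform_limit K (\<lambda>n z. CS4_map (a n) (b n) (\<rho> n) z + - X (Some 1)) (\<lambda>z. X (Some z) + - X (Some 1)) sequentially"
        using that by (intro uniform_limit_add CS4_converges[OF deg pos lim] uniform_limit_const) auto
      then show ?thesis by (simp add: Y_def[abs_def])
    qed
    show "minimal_piece Y {0} {0, 1}" by (rule piece)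
    show "costa_surface (symmetric_extension Y {0} {0, 1})" by (rule extension_costa)
  qed
  then show ?thesis using S by blast
qed

end
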